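(* Let $A$ be an $R$-algebra that is $p$-torsion free, $p$-adically complete, with $A/pA$ reduced, equipped with a Frobenius lift $\phi$. Let $\mathcal A=A\otimes_R\mathbb K^\circ$, let $\Phi$ be the unique endomorphism of $\mathcal A$ compatible with $\phi$ on $A$ and with the canonical relative Frobenius lift on $\mathbb K^\circ$, and also denote by $\Phi$ its extension to $\widehat{\mathcal A}$. Let $\mathcal B=\varinjlim_\Phi\widehat{\mathcal A}$, $\mathcal B'=\varinjlim_\Phi\mathcal A$, $P^\circ(A,\phi)=\widehat{\mathcal B}=\widehat{\mathcal B'}$ and $P(A,\phi)=\widehat{\mathcal B}[1/p]$. Then: (1) the $\mathbb K$-algebra $P(A,\phi)$ with its natural Banach structure is perfectoid; (2) $P(A,\phi)^\circ=P^\circ(A,\phi)$; (3) the endomorphism $\Phi$ of $P(A,\phi)$ induced by $\Phi$ is an invertible relative Frobenius lift; (4) $\widehat{\mathcal B}/\mathbb K^{\circ\circ}\widehat{\mathcal B}\simeq (A/pA)_{\mathrm{perf}}$; (5) $(A,\phi)\mapsto(P(A,\phi),\Phi)$ defines a functor from the category of $p$-torsion free, $p$-adically complete $R$-algebras with reduced reduction mod $p$ equipped with a Frobenius lift, to the category of perfectoid $\mathbb K$-algebras equipped with a relative Frobenius lift; (6) this functor sends surjections to surjections.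
   Context: $p$ is an odd prime; $R$ is a complete discrete valuation ring with maximal ideal $pR$ and algebraically closed residue field $k$; $\phi$ denotes Frobenius lifts (ring endomorphisms reducing mod $p$ to $x\mapsto x^p$). $\widehat{\ }$ is $p$-adic completion. With fixed compatible roots $p^{1/p^m}$, $\mathbb K^\circ$ is the $p$-adic completion of $\bigcup_m R[p^{1/p^m}]$, $\mathbb K^{\circ\circ}$ its maximal ideal, $\mathbb K=\mathbb K^\circ[1/p]$; the canonical relative Frobenius lift $\Phi$ of $\mathbb K^\circ$ is the unique ring automorphism extending the Frobenius lift of $R$ and fixing all $p^{1/p^m}$. A relative Frobenius lift on a $\mathbb K^\circ$-algebra $\mathcal B$ is a ring endomorphism extending $\Phi$ on $\mathbb K^\circ$ and inducing the $p$-power Frobenius on $\mathcal B/\mathbb K^{\circ\circ}\mathcal B$; invertible means bijective. A perfectoid $\mathbb K$-algebra is a Banach $\mathbb K$-algebra $B$ whose ring $B^\circ$ of power-bounded elements is bounded and with Frobenius surjective on $B^\circ/pB^\circ$; a relative Frobenius lift on $B$ is an endomorphism preserving $B^\circ$ whose restriction to $B^\circ$ is a relative Frobenius lift (invertible if that restriction is bijective). For a ring endomorphism $\Phi$ of $A$, $\varinjlim_\Phi A$ is the direct limit of $A\xrightarrow{\Phi}A\xrightarrow{\Phi}\cdots$. For a ring $A$ of characteristic $p$, $A_{\mathrm{perf}}=\varinjlim_{x\mapsto x^p}A$. *)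

theory Defs
  imports Complex_Main "HOL-Algebra.Algebra"
begin

section \<open>Algebras over a ring\<close>

text \<open>The algebra over the domain of \<open>h\<close> given by a ring \<open>B\<close> and a structure map \<open>h\<close> into \<open>B\<close>.\<close>

definition algebra_of :: "('r \<Rightarrow> 'b) \<Rightarrow> ('b, 'm) ring_scheme \<Rightarrow> ('r, 'b) module" where
  "algebra_of h B = \<lparr>carrier = carrier B, monoid.mult = monoid.mult B, one = one B, ring.zero = ring.zero B,
     ring.add = ring.add B, smult = (\<lambda>r x. h r \<otimes>\<^bsub>B\<^esub> x)\<rparr>"

section \<open>The \<open>p\<close>-adic topology\<close>

definition p_elem :: "nat \<Rightarrow> ('a, 'm) ring_scheme \<Rightarrow> 'a" where
  "p_elem p A = [p] \<cdot>\<^bsub>A\<^esub> \<one>\<^bsub>A\<^esub>"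

definition p_ideal :: "nat \<Rightarrow> nat \<Rightarrow> ('a, 'm) ring_scheme \<Rightarrow> 'a set" where
  "p_ideal p n A = PIdl\<^bsub>A\<^esub> (p_elem p A [^]\<^bsub>A\<^esub> n)"

definition mod_p :: "nat \<Rightarrow> ('a, 'm) ring_scheme \<Rightarrow> 'a set ring" where
  "mod_p p A = A Quot (p_ideal p 1 A)"

definition p_torsion_free :: "nat \<Rightarrow> ('a, 'm) ring_scheme \<Rightarrow> bool" where
  "p_torsion_free p A \<longleftrightarrow> (\<forall>x\<in>carrier A. [p] \<cdot>\<^bsub>A\<^esub> x = \<zero>\<^bsub>A\<^esub> \<longrightarrow> x = \<zero>\<^bsub>A\<^esub>)"

definition reduced_ring :: "('a, 'm) ring_scheme \<Rightarrow> bool" where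
  "reduced_ring A \<longleftrightarrow> (\<forall>x\<in>carrier A. \<forall>n::nat. x [^]\<^bsub>A\<^esub> n = \<zero>\<^bsub>A\<^esub> \<longrightarrow> x = \<zero>\<^bsub>A\<^esub>)"

text \<open>The inverse limit of the rings \<open>A/p\<^sup>nA\<close>. For a coset \<open>s (n+1)\<close> of \<open>p\<^sup>n\<^sup>+\<^sup>1A\<close> and a coset
  \<open>s n\<close> of \<open>p\<^sup>nA\<close>, the first is mapped to the second iff it is contained in it.\<close>

definition padic_completion :: "nat \<Rightarrow> ('a, 'm) ring_scheme \<Rightarrow> (nat \<Rightarrow> 'a set) ring" where
  "padic_completion p A =
    \<lparr>carrier = {s. (\<forall>n. s n \<in> carrier (A Quot (p_ideal p n A))) \<and> (\<forall>n. s (Suc n) \<subseteq> s n)},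
     monoid.mult = (\<lambda>s t n. s n \<otimes>\<^bsub>A Quot (p_ideal p n A)\<^esub> t n),
     one = (\<lambda>n. \<one>\<^bsub>A Quot (p_ideal p n A)\<^esub>),
     ring.zero = (\<lambda>n. \<zero>\<^bsub>A Quot (p_ideal p n A)\<^esub>),
     ring.add = (\<lambda>s t n. s n \<oplus>\<^bsub>A Quot (p_ideal p n A)\<^esub> t n)\<rparr>"

definition padic_in :: "nat \<Rightarrow> ('a, 'm) ring_scheme \<Rightarrow> 'a \<Rightarrow> nat \<Rightarrow> 'a set" where
  "padic_in p A a = (\<lambda>n. p_ideal p n A +>\<^bsub>A\<^esub> a)"

definition padically_complete :: "nat \<Rightarrow> ('a, 'm) ring_scheme \<Rightarrow> bool" where
  "padically_complete p A \<longleftrightarrow>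
     bij_betw (padic_in p A) (carrier A) (carrier (padic_completion p A))"

text \<open>The map into the completion of \<open>B\<close> induced by a ring homomorphism \<open>f\<close> into \<open>B\<close>; all cosets
  in the union below coincide. The same device is used for the other induced maps.\<close>

definition padic_map ::
  "nat \<Rightarrow> ('b, 'm) ring_scheme \<Rightarrow> ('a \<Rightarrow> 'b) \<Rightarrow> (nat \<Rightarrow> 'a set) \<Rightarrow> nat \<Rightarrow> 'b set" where
  "padic_map p B f s = (\<lambda>n. \<Union>a\<in>s n. p_ideal p n B +>\<^bsub>B\<^esub> f a)"

definition frobenius_lift :: "nat \<Rightarrow> ('a, 'm) ring_scheme \<Rightarrow> ('a \<Rightarrow> 'a) \<Rightarrow> bool" where
  "frobenius_lift p A \<phi> \<longleftrightarrow> \<phi> \<in> ring_hom A A \<and>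
     (\<forall>x\<in>carrier A. \<phi> x \<ominus>\<^bsub>A\<^esub> x [^]\<^bsub>A\<^esub> p \<in> p_ideal p 1 A)"

section \<open>Direct limit along an endomorphism\<close>

text \<open>A pair \<open>(m, a)\<close> stands for the element \<open>a\<close> of the \<open>m\<close>-th copy of \<open>A\<close> in
  \<open>A \<rightarrow> A \<rightarrow> A \<rightarrow> \<dots>\<close>.\<close>

definition dirlim_rel ::
  "('a, 'm) ring_scheme \<Rightarrow> ('a \<Rightarrow> 'a) \<Rightarrow> ((nat \<times> 'a) \<times> (nat \<times> 'a)) set" where
  "dirlim_rel A \<Phi> = {((m, a), (n, b)). a \<in> carrier A \<and> b \<in> carrier A \<and>
     (\<exists>k. (\<Phi> ^^ (n + k)) a = (\<Phi> ^^ (m + k)) b)}"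

definition dirlim_in ::
  "('a, 'm) ring_scheme \<Rightarrow> ('a \<Rightarrow> 'a) \<Rightarrow> nat \<Rightarrow> 'a \<Rightarrow> (nat \<times> 'a) set" where
  "dirlim_in A \<Phi> m a = dirlim_rel A \<Phi> `` {(m, a)}"

definition dirlim :: "('a, 'm) ring_scheme \<Rightarrow> ('a \<Rightarrow> 'a) \<Rightarrow> (nat \<times> 'a) set ring" where
  "dirlim A \<Phi> =
    \<lparr>carrier = (UNIV \<times> carrier A) // dirlim_rel A \<Phi>,
     monoid.mult = (\<lambda>U V. \<Union>(m, a)\<in>U. \<Union>(n, b)\<in>V.
        dirlim_in A \<Phi> (m + n) ((\<Phi> ^^ n) a \<otimes>\<^bsub>A\<^esub> (\<Phi> ^^ m) b)),
     one = dirlim_in A \<Phi> 0 \<one>\<^bsub>A\<^esub>,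
     ring.zero = dirlim_in A \<Phi> 0 \<zero>\<^bsub>A\<^esub>,
     ring.add = (\<lambda>U V. \<Union>(m, a)\<in>U. \<Union>(n, b)\<in>V.
        dirlim_in A \<Phi> (m + n) ((\<Phi> ^^ n) a \<oplus>\<^bsub>A\<^esub> (\<Phi> ^^ m) b))\<rparr>"

definition dirlim_map :: "('b, 'm) ring_scheme \<Rightarrow> ('b \<Rightarrow> 'b) \<Rightarrow> ('a \<Rightarrow> 'b) \<Rightarrow>
    (nat \<times> 'a) set \<Rightarrow> (nat \<times> 'b) set" where
  "dirlim_map B \<Psi> f U = (\<Union>(m, a)\<in>U. dirlim_in B \<Psi> m (f a))"

definition perfection :: "nat \<Rightarrow> ('a, 'm) ring_scheme \<Rightarrow> (nat \<times> 'a) set ring" where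
  "perfection p A = dirlim A (\<lambda>x. x [^]\<^bsub>A\<^esub> p)"

section \<open>Localization at one element\<close>

text \<open>A pair \<open>(a, m)\<close> stands for the fraction \<open>a/s\<^sup>m\<close>.\<close>

definition loc_rel :: "('a, 'm) ring_scheme \<Rightarrow> 'a \<Rightarrow> (('a \<times> nat) \<times> ('a \<times> nat)) set" where
  "loc_rel A s = {((a, m), (b, n)). a \<in> carrier A \<and> b \<in> carrier A \<and>
     (\<exists>k. s [^]\<^bsub>A\<^esub> (n + k) \<otimes>\<^bsub>A\<^esub> a = s [^]\<^bsub>A\<^esub> (m + k) \<otimes>\<^bsub>A\<^esub> b)}"

definition loc_frac :: "('a, 'm) ring_scheme \<Rightarrow> 'a \<Rightarrow> 'a \<Rightarrow> nat \<Rightarrow> ('a \<times> nat) set" where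
  "loc_frac A s a m = loc_rel A s `` {(a, m)}"

definition loc :: "('a, 'm) ring_scheme \<Rightarrow> 'a \<Rightarrow> ('a \<times> nat) set ring" where
  "loc A s =
    \<lparr>carrier = (carrier A \<times> UNIV) // loc_rel A s,
     monoid.mult = (\<lambda>U V. \<Union>(a, m)\<in>U. \<Union>(b, n)\<in>V. loc_frac A s (a \<otimes>\<^bsub>A\<^esub> b) (m + n)),
     one = loc_frac A s \<one>\<^bsub>A\<^esub> 0,
     ring.zero = loc_frac A s \<zero>\<^bsub>A\<^esub> 0,
     ring.add = (\<lambda>U V. \<Union>(a, m)\<in>U. \<Union>(b, n)\<in>V.
        loc_frac A s (s [^]\<^bsub>A\<^esub> n \<otimes>\<^bsub>A\<^esub> a \<oplus>\<^bsub>A\<^esub> s [^]\<^bsub>A\<^esub> m \<otimes>\<^bsub>A\<^esub> b) (m + n))\<rparr>"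

definition loc_map ::
  "('b, 'm) ring_scheme \<Rightarrow> 'b \<Rightarrow> ('a \<Rightarrow> 'b) \<Rightarrow> ('a \<times> nat) set \<Rightarrow> ('b \<times> nat) set" where
  "loc_map B t f U = (\<Union>(a, m)\<in>U. loc_frac B t (f a) m)"

definition invert_p :: "nat \<Rightarrow> ('a, 'm) ring_scheme \<Rightarrow> ('a \<times> nat) set ring" where
  "invert_p p A = loc A (p_elem p A)"

definition invert_p_in :: "nat \<Rightarrow> ('a, 'm) ring_scheme \<Rightarrow> 'a \<Rightarrow> ('a \<times> nat) set" where
  "invert_p_in p A a = loc_frac A (p_elem p A) a 0"

definition invert_p_map :: "nat \<Rightarrow> ('b, 'm) ring_scheme \<Rightarrow> ('a \<Rightarrow> 'b) \<Rightarrow>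
    ('a \<times> nat) set \<Rightarrow> ('b \<times> nat) set" where
  "invert_p_map p B f = loc_map B (p_elem p B) f"

section \<open>Tensor product of two algebras\<close>

text \<open>The free abelian group on \<open>A \<times> B\<close> (see \<^const>\<open>free_Abelian_group\<close>) with the bilinear
  extension of \<open>(a, b)(a', b') = (aa', bb')\<close>, i.e. the integral monoid ring of the multiplicative
  monoid \<open>A \<times> B\<close>. The subgroup generated by the usual relators of \<open>A \<otimes>\<^sub>R B\<close> is an ideal of this
  ring, since multiplication by \<open>(a', b')\<close> maps relators to relators; so dividing by the ideal they
  generate yields the tensor product together with its multiplication.\<close>

definition tensor_free ::
  "('a, 'm) ring_scheme \<Rightarrow> ('b, 'n) ring_scheme \<Rightarrow> (('a \<times> 'b) \<Rightarrow>\<^sub>0 int) ring" where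
  "tensor_free A B =
    \<lparr>carrier = carrier (free_Abelian_group (carrier A \<times> carrier B)),
     monoid.mult = (\<lambda>u v. frag_extend (\<lambda>(a, b). frag_extend (\<lambda>(a', b').
        frag_of (a \<otimes>\<^bsub>A\<^esub> a', b \<otimes>\<^bsub>B\<^esub> b')) v) u),
     one = frag_of (\<one>\<^bsub>A\<^esub>, \<one>\<^bsub>B\<^esub>), ring.zero = 0, ring.add = (+)\<rparr>"

definition tensor_relators :: "('r, 'k) ring_scheme \<Rightarrow> ('r, 'a, 'm) module_scheme \<Rightarrow>
    ('r, 'b, 'n) module_scheme \<Rightarrow> (('a \<times> 'b) \<Rightarrow>\<^sub>0 int) set" where
  "tensor_relators R A B =
     {frag_of (a \<oplus>\<^bsub>A\<^esub> a', b) - frag_of (a, b) - frag_of (a', b) |a a' b.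
        a \<in> carrier A \<and> a' \<in> carrier A \<and> b \<in> carrier B} \<union>
     {frag_of (a, b \<oplus>\<^bsub>B\<^esub> b') - frag_of (a, b) - frag_of (a, b') |a b b'.
        a \<in> carrier A \<and> b \<in> carrier B \<and> b' \<in> carrier B} \<union>
     {frag_of (r \<odot>\<^bsub>A\<^esub> a, b) - frag_of (a, r \<odot>\<^bsub>B\<^esub> b) |r a b.
        r \<in> carrier R \<and> a \<in> carrier A \<and> b \<in> carrier B}"

definition tensor_ideal :: "('r, 'k) ring_scheme \<Rightarrow> ('r, 'a, 'm) module_scheme \<Rightarrow>
    ('r, 'b, 'n) module_scheme \<Rightarrow> (('a \<times> 'b) \<Rightarrow>\<^sub>0 int) set" where
  "tensor_ideal R A B = Idl\<^bsub>tensor_free A B\<^esub> (tensor_relators R A B)"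

definition tensor :: "('r, 'k) ring_scheme \<Rightarrow> ('r, 'a, 'm) module_scheme \<Rightarrow>
    ('r, 'b, 'n) module_scheme \<Rightarrow> (('a \<times> 'b) \<Rightarrow>\<^sub>0 int) set ring" where
  "tensor R A B = tensor_free A B Quot (tensor_ideal R A B)"

definition tensor_in :: "('r, 'k) ring_scheme \<Rightarrow> ('r, 'a, 'm) module_scheme \<Rightarrow>
    ('r, 'b, 'n) module_scheme \<Rightarrow> 'a \<Rightarrow> 'b \<Rightarrow> (('a \<times> 'b) \<Rightarrow>\<^sub>0 int) set" where
  "tensor_in R A B a b = tensor_ideal R A B +>\<^bsub>tensor_free A B\<^esub> frag_of (a, b)"

text \<open>The map \<open>f \<otimes> g\<close> into the tensor product of \<open>C\<close> and \<open>D\<close>.\<close>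

definition tensor_map :: "('r, 'k) ring_scheme \<Rightarrow> ('r, 'c, 'm) module_scheme \<Rightarrow>
    ('r, 'd, 'n) module_scheme \<Rightarrow> ('a \<Rightarrow> 'c) \<Rightarrow> ('b \<Rightarrow> 'd) \<Rightarrow>
    (('a \<times> 'b) \<Rightarrow>\<^sub>0 int) set \<Rightarrow> (('c \<times> 'd) \<Rightarrow>\<^sub>0 int) set" where
  "tensor_map R C D f g U = (\<Union>u\<in>U. tensor_ideal R C D +>\<^bsub>tensor_free C D\<^esub>
     frag_extend (\<lambda>(a, b). frag_of (f a, g b)) u)"

section \<open>The base ring and field\<close>

text \<open>\<open>R\<close> is a subring of a field \<open>L\<close> (for instance an algebraic closure of its fraction field),
  and \<open>w m \<in> L\<close> is the chosen root \<open>p\<^bsup>1/p^m\<^esup>\<close>.\<close>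

definition root_tower :: "('l, 'm) ring_scheme \<Rightarrow> 'l set \<Rightarrow> (nat \<Rightarrow> 'l) \<Rightarrow> ('l, 'm) ring_scheme" where
  "root_tower L R w = L\<lparr>carrier := (\<Union>m. generate_ring L (insert (w m) R))\<rparr>"

definition Kcirc :: "nat \<Rightarrow> ('l, 'm) ring_scheme \<Rightarrow> 'l set \<Rightarrow> (nat \<Rightarrow> 'l) \<Rightarrow>
    ('l, nat \<Rightarrow> 'l set) module" where
  "Kcirc p L R w = algebra_of (padic_in p (root_tower L R w))
     (padic_completion p (root_tower L R w))"

definition Kcirc_root :: "nat \<Rightarrow> ('l, 'm) ring_scheme \<Rightarrow> 'l set \<Rightarrow> (nat \<Rightarrow> 'l) \<Rightarrow>
    nat \<Rightarrow> nat \<Rightarrow> 'l set" where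
  "Kcirc_root p L R w m = padic_in p (root_tower L R w) (w m)"

definition max_ideal :: "('a, 'm) ring_scheme \<Rightarrow> 'a set" where
  "max_ideal A = (THE I. maximalideal I A)"

definition dvr :: "('a, 'm) ring_scheme \<Rightarrow> bool" where
  "dvr A \<longleftrightarrow> principal_domain A \<and> \<not> field A \<and> (\<exists>!I. maximalideal I A)"

text \<open>\<open>\<Phi>K\<close> is the canonical relative Frobenius lift; it and \<open>\<phi>R\<close> are
  determined, as functions on the carriers, by the conditions below.\<close>

locale base_data =
  fixes p :: nat and L :: "('l, 'm) ring_scheme" and R :: "'l set" and w :: "nat \<Rightarrow> 'l"
    and \<phi>R :: "'l \<Rightarrow> 'l" and \<Phi>K :: "(nat \<Rightarrow> 'l set) \<Rightarrow> (nat \<Rightarrow> 'l set)"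
  assumes prime: "Factorial_Ring.prime p" and odd: "odd p"
    and L_field: "field L" and R_subring: "subring R L"
    and R_dvr: "dvr (L\<lparr>carrier := R\<rparr>)"
    and R_max: "maximalideal (p_ideal p 1 (L\<lparr>carrier := R\<rparr>)) (L\<lparr>carrier := R\<rparr>)"
    and R_complete: "padically_complete p (L\<lparr>carrier := R\<rparr>)"
    and residue_field: "algebraically_closed (mod_p p (L\<lparr>carrier := R\<rparr>))"
    and roots_in: "\<And>m. w m \<in> carrier L"
    and root_0: "w 0 = p_elem p L"
    and root_Suc: "\<And>m. w (Suc m) [^]\<^bsub>L\<^esub> p = w m"
    and \<phi>R: "frobenius_lift p (L\<lparr>carrier := R\<rparr>) \<phi>R"
    and \<Phi>K_auto: "\<Phi>K \<in> ring_iso (Kcirc p L R w) (Kcirc p L R w)"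
    and \<Phi>K_extends: "\<And>r. r \<in> R \<Longrightarrow>
      \<Phi>K (padic_in p (root_tower L R w) r) = padic_in p (root_tower L R w) (\<phi>R r)"
    and \<Phi>K_roots: "\<And>m. \<Phi>K (Kcirc_root p L R w m) = Kcirc_root p L R w m"

text \<open>The norm on \<open>C[1/p]\<close> with unit ball the image of \<open>C\<close>, where \<open>t m \<in> C\<close> is
  \<open>p\<^bsup>1/p^m\<^esup>\<close>: the infimum of all \<open>|\<lambda>|\<close> such that \<open>x \<in> \<lambda>C\<close>, with \<open>\<lambda>\<close> ranging over the
  integral powers of the \<open>p\<^bsup>1/p^m\<^esup>\<close> and \<open>|p| = 1/p\<close>. For \<open>C = \<bbbK>\<degree>\<close> this is the absolute value
  of \<open>\<bbbK>\<close>. As every nonzero element of \<open>\<bbbK>\<close> is a unit of \<open>\<bbbK>\<degree>\<close> times such a power,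
  restricting to these \<open>\<lambda>\<close> is harmless.\<close>

definition gauge_norm :: "nat \<Rightarrow> ('c, 'm) ring_scheme \<Rightarrow> (nat \<Rightarrow> 'c) \<Rightarrow> ('c \<times> nat) set \<Rightarrow> real" where
  "gauge_norm p C t x = Inf {real p powr (- (real_of_int a / real p ^ m)) |(a::int) (m::nat).
     x \<in> (\<lambda>c. (invert_p_in p C (t m) [^]\<^bsub>invert_p p C\<^esub> a) \<otimes>\<^bsub>invert_p p C\<^esub> invert_p_in p C c) ` carrier C}"

section \<open>Perfectoid algebras\<close>

definition norm_complete :: "('b, 'm) ring_scheme \<Rightarrow> ('b \<Rightarrow> real) \<Rightarrow> bool" where
  "norm_complete B nB \<longleftrightarrow> (\<forall>s. (\<forall>i::nat. s i \<in> carrier B) \<longrightarrow>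
     (\<forall>e>0. \<exists>N. \<forall>i\<ge>N. \<forall>j\<ge>N. nB (s i \<ominus>\<^bsub>B\<^esub> s j) < e) \<longrightarrow>
     (\<exists>l\<in>carrier B. (\<lambda>i. nB (s i \<ominus>\<^bsub>B\<^esub> l)) \<longlonglongrightarrow> 0))"

definition nonarch_field :: "('k, 'm) ring_scheme \<Rightarrow> ('k \<Rightarrow> real) \<Rightarrow> bool" where
  "nonarch_field K nK \<longleftrightarrow> field K \<and>
     (\<forall>x\<in>carrier K. 0 \<le> nK x \<and> (nK x = 0 \<longleftrightarrow> x = \<zero>\<^bsub>K\<^esub>)) \<and>
     (\<forall>x\<in>carrier K. \<forall>y\<in>carrier K. nK (x \<otimes>\<^bsub>K\<^esub> y) = nK x * nK y) \<and>
     (\<forall>x\<in>carrier K. \<forall>y\<in>carrier K. nK (x \<oplus>\<^bsub>K\<^esub> y) \<le> max (nK x) (nK y)) \<and>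
     (\<exists>x\<in>carrier K. 0 < nK x \<and> nK x < 1) \<and>
     norm_complete K nK"

definition banach_algebra :: "('k, 'm) ring_scheme \<Rightarrow> ('k \<Rightarrow> real) \<Rightarrow>
    ('k, 'b, 'n) module_scheme \<Rightarrow> ('b \<Rightarrow> real) \<Rightarrow> bool" where
  "banach_algebra K nK B nB \<longleftrightarrow> nonarch_field K nK \<and> algebra K B \<and>
     (\<forall>x\<in>carrier B. 0 \<le> nB x \<and> (nB x = 0 \<longleftrightarrow> x = \<zero>\<^bsub>B\<^esub>)) \<and>
     (\<forall>c\<in>carrier K. \<forall>x\<in>carrier B. nB (c \<odot>\<^bsub>B\<^esub> x) = nK c * nB x) \<and>
     (\<forall>x\<in>carrier B. \<forall>y\<in>carrier B. nB (x \<oplus>\<^bsub>B\<^esub> y) \<le> max (nB x) (nB y)) \<and>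
     (\<forall>x\<in>carrier B. \<forall>y\<in>carrier B. nB (x \<otimes>\<^bsub>B\<^esub> y) \<le> nB x * nB y) \<and>
     norm_complete B nB"

definition power_bounded :: "('b, 'm) ring_scheme \<Rightarrow> ('b \<Rightarrow> real) \<Rightarrow> 'b set" where
  "power_bounded B nB = {x \<in> carrier B. \<exists>M. \<forall>n::nat. nB (x [^]\<^bsub>B\<^esub> n) \<le> M}"

abbreviation power_bounded_ring :: "('b, 'm) ring_scheme \<Rightarrow> ('b \<Rightarrow> real) \<Rightarrow> ('b, 'm) ring_scheme" where
  "power_bounded_ring B nB \<equiv> B\<lparr>carrier := power_bounded B nB\<rparr>"

definition frobenius_surj :: "('a, 'm) ring_scheme \<Rightarrow> nat \<Rightarrow> bool" where
  "frobenius_surj A p \<longleftrightarrow> (\<lambda>x. x [^]\<^bsub>A\<^esub> p) ` carrier A = carrier A"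

definition perfectoid_algebra :: "nat \<Rightarrow> ('k, 'm) ring_scheme \<Rightarrow> ('k \<Rightarrow> real) \<Rightarrow>
    ('k, 'b, 'n) module_scheme \<Rightarrow> ('b \<Rightarrow> real) \<Rightarrow> bool" where
  "perfectoid_algebra p K nK B nB \<longleftrightarrow> banach_algebra K nK B nB \<and>
     (\<exists>M. \<forall>x\<in>power_bounded B nB. nB x \<le> M) \<and>
     frobenius_surj (mod_p p (power_bounded_ring B nB)) p"

section \<open>Relative Frobenius lifts\<close>

definition max_extended :: "('c, 'm) ring_scheme \<Rightarrow> ('c, 'b, 'n) module_scheme \<Rightarrow> 'b set" where
  "max_extended Kc B = Idl\<^bsub>B\<^esub> ((\<lambda>c. c \<odot>\<^bsub>B\<^esub> \<one>\<^bsub>B\<^esub>) ` max_ideal Kc)"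

definition rel_frobenius_lift :: "nat \<Rightarrow> ('c, 'm) ring_scheme \<Rightarrow> ('c \<Rightarrow> 'c) \<Rightarrow>
    ('c, 'b, 'n) module_scheme \<Rightarrow> ('b \<Rightarrow> 'b) \<Rightarrow> bool" where
  "rel_frobenius_lift p Kc \<Phi>K B F \<longleftrightarrow> F \<in> ring_hom B B \<and>
     (\<forall>c\<in>carrier Kc. F (c \<odot>\<^bsub>B\<^esub> \<one>\<^bsub>B\<^esub>) = \<Phi>K c \<odot>\<^bsub>B\<^esub> \<one>\<^bsub>B\<^esub>) \<and>
     (\<forall>x\<in>carrier B. F x \<ominus>\<^bsub>B\<^esub> x [^]\<^bsub>B\<^esub> p \<in> max_extended Kc B)"

text \<open>Here \<open>B\<close> is an algebra over \<open>\<bbbK> = \<bbbK>\<degree>[1/p]\<close>.\<close>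

definition power_bounded_algebra :: "nat \<Rightarrow> ('c, 'm) ring_scheme \<Rightarrow>
    (('c \<times> nat) set, 'b, 'n) module_scheme \<Rightarrow> ('b \<Rightarrow> real) \<Rightarrow> ('c, 'b) module" where
  "power_bounded_algebra p Kc B nB =
     algebra_of (\<lambda>c. invert_p_in p Kc c \<odot>\<^bsub>B\<^esub> \<one>\<^bsub>B\<^esub>) (power_bounded_ring B nB)"

definition perfectoid_frobenius_lift :: "nat \<Rightarrow> ('c, 'm) ring_scheme \<Rightarrow> ('c \<Rightarrow> 'c) \<Rightarrow>
    (('c \<times> nat) set, 'b, 'n) module_scheme \<Rightarrow> ('b \<Rightarrow> real) \<Rightarrow> ('b \<Rightarrow> 'b) \<Rightarrow> bool" where
  "perfectoid_frobenius_lift p Kc \<Phi>K B nB F \<longleftrightarrow> F \<in> ring_hom B B \<and>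
     F ` power_bounded B nB \<subseteq> power_bounded B nB \<and>
     rel_frobenius_lift p Kc \<Phi>K (power_bounded_algebra p Kc B nB) F"

definition invertible_perfectoid_frobenius_lift :: "nat \<Rightarrow> ('c, 'm) ring_scheme \<Rightarrow> ('c \<Rightarrow> 'c) \<Rightarrow>
    (('c \<times> nat) set, 'b, 'n) module_scheme \<Rightarrow> ('b \<Rightarrow> real) \<Rightarrow> ('b \<Rightarrow> 'b) \<Rightarrow> bool" where
  "invertible_perfectoid_frobenius_lift p Kc \<Phi>K B nB F \<longleftrightarrow>
     perfectoid_frobenius_lift p Kc \<Phi>K B nB F \<and>
     bij_betw F (power_bounded B nB) (power_bounded B nB)"

section \<open>The two categories\<close>

text \<open>Morphisms are functions on carriers (extensional outside), so that equality of morphisms is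
  equality in the logic; identities and composition are \<open>\<lambda>x\<in>carrier A. x\<close> and \<^const>\<open>compose\<close>.\<close>

definition frob_alg :: "nat \<Rightarrow> ('r, 'm) ring_scheme \<Rightarrow> ('r, 'a, 'n) module_scheme \<Rightarrow>
    ('a \<Rightarrow> 'a) \<Rightarrow> bool" where
  "frob_alg p R A \<phi> \<longleftrightarrow> algebra R A \<and> p_torsion_free p A \<and> padically_complete p A \<and>
     reduced_ring (mod_p p A) \<and> frobenius_lift p A \<phi>"

definition frob_alg_hom :: "('r, 'm) ring_scheme \<Rightarrow> ('r, 'a, 'n) module_scheme \<Rightarrow> ('a \<Rightarrow> 'a) \<Rightarrow>
    ('r, 'b, 'o) module_scheme \<Rightarrow> ('b \<Rightarrow> 'b) \<Rightarrow> ('a \<Rightarrow> 'b) set" where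
  "frob_alg_hom R A \<phi> B \<psi> = {f \<in> ring_hom A B \<inter> extensional (carrier A).
     (\<forall>r\<in>carrier R. \<forall>a\<in>carrier A. f (r \<odot>\<^bsub>A\<^esub> a) = r \<odot>\<^bsub>B\<^esub> f a) \<and>
     (\<forall>a\<in>carrier A. f (\<phi> a) = \<psi> (f a))}"

definition perf_alg_hom :: "('k, 'm) ring_scheme \<Rightarrow>
    ('k, 'a, 'n) module_scheme \<Rightarrow> ('a \<Rightarrow> real) \<Rightarrow> ('a \<Rightarrow> 'a) \<Rightarrow>
    ('k, 'b, 'o) module_scheme \<Rightarrow> ('b \<Rightarrow> real) \<Rightarrow> ('b \<Rightarrow> 'b) \<Rightarrow> ('a \<Rightarrow> 'b) set" where
  "perf_alg_hom K B nB F C nC G = {f \<in> ring_hom B C \<inter> extensional (carrier B).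
     (\<forall>c\<in>carrier K. \<forall>x\<in>carrier B. f (c \<odot>\<^bsub>B\<^esub> x) = c \<odot>\<^bsub>C\<^esub> f x) \<and>
     (\<exists>M. \<forall>x\<in>carrier B. nC (f x) \<le> M * nB x) \<and>
     (\<forall>x\<in>carrier B. f (F x) = G (f x))}"

section \<open>The perfectoid algebra attached to an algebra with Frobenius lift\<close>

text \<open>Throughout, \<open>Kc\<close> is an \<open>R\<close>-algebra (meant to be \<open>\<bbbK>\<degree>\<close>) with endomorphism \<open>\<Phi>K\<close>.\<close>

abbreviation Phi :: "('r, 'm) ring_scheme \<Rightarrow> ('r, 'c, 'n) module_scheme \<Rightarrow> ('c \<Rightarrow> 'c) \<Rightarrow>
    ('r, 'a, 'o) module_scheme \<Rightarrow> ('a \<Rightarrow> 'a) \<Rightarrow>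
    (('a \<times> 'c) \<Rightarrow>\<^sub>0 int) set \<Rightarrow> (('a \<times> 'c) \<Rightarrow>\<^sub>0 int) set" where
  "Phi R Kc \<Phi>K A \<phi> \<equiv> tensor_map R A Kc \<phi> \<Phi>K"

abbreviation Ahat :: "nat \<Rightarrow> ('r, 'm) ring_scheme \<Rightarrow> ('r, 'c, 'n) module_scheme \<Rightarrow>
    ('r, 'a, 'o) module_scheme \<Rightarrow> (nat \<Rightarrow> (('a \<times> 'c) \<Rightarrow>\<^sub>0 int) set set) ring" where
  "Ahat p R Kc A \<equiv> padic_completion p (tensor R A Kc)"

abbreviation Phi_hat :: "nat \<Rightarrow> ('r, 'm) ring_scheme \<Rightarrow> ('r, 'c, 'n) module_scheme \<Rightarrow> ('c \<Rightarrow> 'c) \<Rightarrow>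
    ('r, 'a, 'o) module_scheme \<Rightarrow> ('a \<Rightarrow> 'a) \<Rightarrow>
    (nat \<Rightarrow> (('a \<times> 'c) \<Rightarrow>\<^sub>0 int) set set) \<Rightarrow> (nat \<Rightarrow> (('a \<times> 'c) \<Rightarrow>\<^sub>0 int) set set)" where
  "Phi_hat p R Kc \<Phi>K A \<phi> \<equiv> padic_map p (tensor R A Kc) (Phi R Kc \<Phi>K A \<phi>)"

definition Blim :: "nat \<Rightarrow> ('r, 'm) ring_scheme \<Rightarrow> ('r, 'c, 'n) module_scheme \<Rightarrow> ('c \<Rightarrow> 'c) \<Rightarrow>
    ('r, 'a, 'o) module_scheme \<Rightarrow> ('a \<Rightarrow> 'a) \<Rightarrow>
    (nat \<times> (nat \<Rightarrow> (('a \<times> 'c) \<Rightarrow>\<^sub>0 int) set set)) set ring" where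
  "Blim p R Kc \<Phi>K A \<phi> = dirlim (Ahat p R Kc A) (Phi_hat p R Kc \<Phi>K A \<phi>)"

definition Blim' :: "('r, 'm) ring_scheme \<Rightarrow> ('r, 'c, 'n) module_scheme \<Rightarrow> ('c \<Rightarrow> 'c) \<Rightarrow>
    ('r, 'a, 'o) module_scheme \<Rightarrow> ('a \<Rightarrow> 'a) \<Rightarrow> (nat \<times> (('a \<times> 'c) \<Rightarrow>\<^sub>0 int) set) set ring" where
  "Blim' R Kc \<Phi>K A \<phi> = dirlim (tensor R A Kc) (Phi R Kc \<Phi>K A \<phi>)"

text \<open>The image in \<open>P\<degree>\<close> of \<open>a \<otimes> c\<close>, placed in the \<open>m\<close>-th copy of the completed tensor product.\<close>

definition Pcirc_in :: "nat \<Rightarrow> ('r, 'm) ring_scheme \<Rightarrow> ('r, 'c, 'n) module_scheme \<Rightarrow> ('c \<Rightarrow> 'c) \<Rightarrow>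
    ('r, 'a, 'o) module_scheme \<Rightarrow> ('a \<Rightarrow> 'a) \<Rightarrow> nat \<Rightarrow> 'a \<Rightarrow> 'c \<Rightarrow>
    nat \<Rightarrow> (nat \<times> (nat \<Rightarrow> (('a \<times> 'c) \<Rightarrow>\<^sub>0 int) set set)) set set" where
  "Pcirc_in p R Kc \<Phi>K A \<phi> m a c = padic_in p (Blim p R Kc \<Phi>K A \<phi>)
     (dirlim_in (Ahat p R Kc A) (Phi_hat p R Kc \<Phi>K A \<phi>) m
       (padic_in p (tensor R A Kc) (tensor_in R A Kc a c)))"

text \<open>The transition maps of the direct limit are \<open>\<Phi>K\<close>-semilinear; the \<open>\<bbbK>\<degree>\<close>-algebra structure
  on the limit is the one coming from the first term of the system.\<close>

definition Pcirc :: "nat \<Rightarrow> ('r, 'm) ring_scheme \<Rightarrow> ('r, 'c, 'n) module_scheme \<Rightarrow> ('c \<Rightarrow> 'c) \<Rightarrow>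
    ('r, 'a, 'o) module_scheme \<Rightarrow> ('a \<Rightarrow> 'a) \<Rightarrow>
    ('c, nat \<Rightarrow> (nat \<times> (nat \<Rightarrow> (('a \<times> 'c) \<Rightarrow>\<^sub>0 int) set set)) set set) module" where
  "Pcirc p R Kc \<Phi>K A \<phi> = algebra_of (\<lambda>c. Pcirc_in p R Kc \<Phi>K A \<phi> 0 \<one>\<^bsub>A\<^esub> c)
     (padic_completion p (Blim p R Kc \<Phi>K A \<phi>))"

definition Palg :: "nat \<Rightarrow> ('r, 'm) ring_scheme \<Rightarrow> ('r, 'c, 'n) module_scheme \<Rightarrow> ('c \<Rightarrow> 'c) \<Rightarrow>
    ('r, 'a, 'o) module_scheme \<Rightarrow> ('a \<Rightarrow> 'a) \<Rightarrow>
    (('c \<times> nat) set, ((nat \<Rightarrow> (nat \<times> (nat \<Rightarrow> (('a \<times> 'c) \<Rightarrow>\<^sub>0 int) set set)) set set) \<times> nat) set) module" where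
  "Palg p R Kc \<Phi>K A \<phi> = algebra_of
     (invert_p_map p (Pcirc p R Kc \<Phi>K A \<phi>)
        (\<lambda>c. c \<odot>\<^bsub>Pcirc p R Kc \<Phi>K A \<phi>\<^esub> \<one>\<^bsub>Pcirc p R Kc \<Phi>K A \<phi>\<^esub>))
     (invert_p p (Pcirc p R Kc \<Phi>K A \<phi>))"

definition Pnorm :: "nat \<Rightarrow> ('r, 'm) ring_scheme \<Rightarrow> ('r, 'c, 'n) module_scheme \<Rightarrow> ('c \<Rightarrow> 'c) \<Rightarrow>
    (nat \<Rightarrow> 'c) \<Rightarrow> ('r, 'a, 'o) module_scheme \<Rightarrow> ('a \<Rightarrow> 'a) \<Rightarrow>
    ((nat \<Rightarrow> (nat \<times> (nat \<Rightarrow> (('a \<times> 'c) \<Rightarrow>\<^sub>0 int) set set)) set set) \<times> nat) set \<Rightarrow> real" where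
  "Pnorm p R Kc \<Phi>K t A \<phi> = gauge_norm p (Pcirc p R Kc \<Phi>K A \<phi>)
     (\<lambda>m. t m \<odot>\<^bsub>Pcirc p R Kc \<Phi>K A \<phi>\<^esub> \<one>\<^bsub>Pcirc p R Kc \<Phi>K A \<phi>\<^esub>)"

text \<open>The map \<open>P(A,\<phi>) \<rightarrow> P(B,\<psi>)\<close> induced by a pair of compatible maps \<open>f : A \<rightarrow> B\<close> and
  \<open>g : Kc \<rightarrow> Kc\<close>.\<close>

definition Pinduced :: "nat \<Rightarrow> ('r, 'm) ring_scheme \<Rightarrow> ('r, 'c, 'n) module_scheme \<Rightarrow> ('c \<Rightarrow> 'c) \<Rightarrow>
    ('r, 'b, 'o) module_scheme \<Rightarrow> ('b \<Rightarrow> 'b) \<Rightarrow> ('a \<Rightarrow> 'b) \<Rightarrow> ('c \<Rightarrow> 'c) \<Rightarrow>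
    ((nat \<Rightarrow> (nat \<times> (nat \<Rightarrow> (('a \<times> 'c) \<Rightarrow>\<^sub>0 int) set set)) set set) \<times> nat) set \<Rightarrow>
    ((nat \<Rightarrow> (nat \<times> (nat \<Rightarrow> (('b \<times> 'c) \<Rightarrow>\<^sub>0 int) set set)) set set) \<times> nat) set" where
  "Pinduced p R Kc \<Phi>K B \<psi> f g =
     invert_p_map p (Pcirc p R Kc \<Phi>K B \<psi>)
       (padic_map p (Blim p R Kc \<Phi>K B \<psi>)
         (dirlim_map (Ahat p R Kc B) (Phi_hat p R Kc \<Phi>K B \<psi>)
           (padic_map p (tensor R B Kc) (tensor_map R B Kc f g))))"

definition Pfrob :: "nat \<Rightarrow> ('r, 'm) ring_scheme \<Rightarrow> ('r, 'c, 'n) module_scheme \<Rightarrow> ('c \<Rightarrow> 'c) \<Rightarrow>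
    ('r, 'a, 'o) module_scheme \<Rightarrow> ('a \<Rightarrow> 'a) \<Rightarrow>
    ((nat \<Rightarrow> (nat \<times> (nat \<Rightarrow> (('a \<times> 'c) \<Rightarrow>\<^sub>0 int) set set)) set set) \<times> nat) set \<Rightarrow>
    ((nat \<Rightarrow> (nat \<times> (nat \<Rightarrow> (('a \<times> 'c) \<Rightarrow>\<^sub>0 int) set set)) set set) \<times> nat) set" where
  "Pfrob p R Kc \<Phi>K A \<phi> = Pinduced p R Kc \<Phi>K A \<phi> \<phi> \<Phi>K"

definition Pmap :: "nat \<Rightarrow> ('r, 'm) ring_scheme \<Rightarrow> ('r, 'c, 'n) module_scheme \<Rightarrow> ('c \<Rightarrow> 'c) \<Rightarrow>
    ('r, 'a, 'o) module_scheme \<Rightarrow> ('a \<Rightarrow> 'a) \<Rightarrow> ('r, 'b, 'q) module_scheme \<Rightarrow> ('b \<Rightarrow> 'b) \<Rightarrow> ('a \<Rightarrow> 'b) \<Rightarrow>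
    ((nat \<Rightarrow> (nat \<times> (nat \<Rightarrow> (('a \<times> 'c) \<Rightarrow>\<^sub>0 int) set set)) set set) \<times> nat) set \<Rightarrow>
    ((nat \<Rightarrow> (nat \<times> (nat \<Rightarrow> (('b \<times> 'c) \<Rightarrow>\<^sub>0 int) set set)) set set) \<times> nat) set" where
  "Pmap p R Kc \<Phi>K A \<phi> B \<psi> f =
     restrict (Pinduced p R Kc \<Phi>K B \<psi> f id) (carrier (Palg p R Kc \<Phi>K A \<phi>))"

end

(* Write t_m for p^(1/p^m). Modulo p, every element of the tensor product of A and K^o is a polynomial
   in some t_m of degree less than p^m with coefficients in A. These coefficients are well defined
   modulo p: the rings R[t_m] are free over R on the powers of t_m, and taking the coefficient of t_m^0
   is an R-linear functional on their union that extends to the tensor product modulo each p^n. As Phi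
   fixes every t_m and is injective modulo p on A (A/pA is reduced), this passes to the limit. With J the
   ideal of P^o generated by all t_m, it follows that P^o is p-torsion free, that P^o/J is the perfection
   of A/pA, hence reduced, and that every element of P^o not in pP^o is t_m^j y with y not in J. So
   each nonzero x in P^o[1/p] has norm |t_m^a| with x = t_m^a y and y not in J, and x is power bounded
   iff it lies in P^o: a power of y is never in J.

   An element placed in one copy of the tensor product equals its image under Phi in the next copy.
   Hence Phi is bijective in the limit, and Frobenius is surjective modulo p because
   a (x) c in copy m equals phi(a) (x) Phi(c) in copy m+1, which is a p-th power modulo p. Maps out of
   the completed limit are determined by, and surjective if they are so on, the tensor products; this
   gives functoriality and the statement on surjections. *)
theory Submission
  imports Defs
begin

section \<open>Congruences modulo powers of \<open>p\<close>\<close>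

text \<open>Freeness of \<open>R[t_m]\<close> comes down to \<open>p\<close> not being invertible in
  the union \<open>S\<close> of these rings. The powers of \<open>t_m\<close> below
  \<open>p^m\<close> span because \<open>t_m^(p^m) = p\<close>, and by Nakayama's lemma no finite
  nonzero \<open>R\<close>-module inside the field equals \<open>p\<close> times itself. This gives
  \<open>t_m S \<inter> R = pR\<close>, which forces the coefficients of an element of
  \<open>pS\<close> into \<open>pR\<close>. Instead of flatness, elements of the tensor product are
  tested by functionals. Only the coefficient of \<open>t_m^0\<close> is seen directly; that of
  \<open>t_m^j\<close> becomes visible after multiplication by \<open>t_m^(p^m - j)\<close>, at the
  price of an extra factor \<open>p\<close>. Cancelling \<open>p\<close> therefore loses powers of
  \<open>p\<close>, which is harmless in a separated ring since the argument runs for all exponents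
  at once. \<open>Phi\<close> exists on the tensor product over \<open>R\<close> only because
  \<open>phi\<close> is semilinear over the Frobenius lift of \<open>R\<close>. This is derived:
  every element of \<open>R\<close> is a \<open>p\<close>-th power modulo \<open>p\<close>, and
  \<open>p\<close>-th powers improve congruences. Comparisons of completed limits use only density
  of the copies, completeness, and a criterion for divisibility by \<open>p^n\<close> stated in a
  single copy (\<open>lim_ring\<close>).\<close>

definition pcong :: "nat \<Rightarrow> nat \<Rightarrow> ('a, 'm) ring_scheme \<Rightarrow> 'a \<Rightarrow> 'a \<Rightarrow> bool" where
  "pcong p n A x y \<longleftrightarrow> x \<in> carrier A \<and> y \<in> carrier A \<and> x \<ominus>\<^bsub>A\<^esub> y \<in> p_ideal p n A"

context cring
begin

lemma p_elem_closed [simp, intro]: "p_elem p R \<in> carrier R"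
  by (simp add: p_elem_def)

lemma p_ideal_iff: "x \<in> p_ideal p n R \<longleftrightarrow> (\<exists>y\<in>carrier R. x = p_elem p R [^] n \<otimes> y)"
  unfolding p_ideal_def cgenideal_def by (auto simp: m_comm)

lemma p_idealI: "y \<in> carrier R \<Longrightarrow> p_elem p R [^] n \<otimes> y \<in> p_ideal p n R"
  by (auto simp: p_ideal_iff)

lemma p_idealE:
  assumes "x \<in> p_ideal p n R"
  obtains y where "y \<in> carrier R" "x = p_elem p R [^] n \<otimes> y"
  using assms by (auto simp: p_ideal_iff)

lemma p_ideal_ideal: "ideal (p_ideal p n R) R"
  unfolding p_ideal_def by (rule cgenideal_ideal) simp

lemma p_ideal_carrier: "x \<in> p_ideal p n R \<Longrightarrow> x \<in> carrier R"
  by (auto simp: p_ideal_iff)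

lemma p_ideal_zero [simp]: "\<zero> \<in> p_ideal p n R"
  by (simp add: p_ideal_ideal additive_subgroup.zero_closed ideal.axioms(1))

lemma p_ideal_add: "x \<in> p_ideal p n R \<Longrightarrow> y \<in> p_ideal p n R \<Longrightarrow> x \<oplus> y \<in> p_ideal p n R"
  by (simp add: p_ideal_ideal additive_subgroup.a_closed ideal.axioms(1))

lemma p_ideal_neg: "x \<in> p_ideal p n R \<Longrightarrow> \<ominus> x \<in> p_ideal p n R"
  by (simp add: p_ideal_ideal additive_subgroup.a_inv_closed ideal.axioms(1))

lemma p_ideal_mult: "x \<in> p_ideal p n R \<Longrightarrow> y \<in> carrier R \<Longrightarrow> y \<otimes> x \<in> p_ideal p n R"
  by (simp add: p_ideal_ideal ideal.I_l_closed)

lemma p_ideal_mono: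
  assumes "x \<in> p_ideal p m R" "n \<le> m" shows "x \<in> p_ideal p n R"
proof -
  obtain y where y: "y \<in> carrier R" "x = p_elem p R [^] m \<otimes> y" using assms(1) by (rule p_idealE)
  have "p_elem p R [^] m = p_elem p R [^] n \<otimes> p_elem p R [^] (m - n)"
    using assms(2) by (simp add: nat_pow_mult)
  then show ?thesis using y by (auto simp: p_ideal_iff m_assoc intro!: bexI[of _ "p_elem p R [^] (m - n) \<otimes> y"])
qed

lemma p_ideal_0 [simp]: "x \<in> p_ideal p 0 R \<longleftrightarrow> x \<in> carrier R"
  by (auto simp: p_ideal_iff)

lemma p_ideal_mult2:
  assumes "x \<in> p_ideal p m R" "y \<in> p_ideal p n R" shows "x \<otimes> y \<in> p_ideal p (m + n) R"
proof -
  obtain x' where x: "x' \<in> carrier R" "x = p_elem p R [^] m \<otimes> x'" using assms(1) by (rule p_idealE)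
  obtain y' where y: "y' \<in> carrier R" "y = p_elem p R [^] n \<otimes> y'" using assms(2) by (rule p_idealE)
  have "x \<otimes> y = p_elem p R [^] (m + n) \<otimes> (x' \<otimes> y')"
    unfolding x y nat_pow_mult[symmetric, OF p_elem_closed] using x(1) y(1) by (simp add: m_ac)
  then show ?thesis using x(1) y(1) by (simp add: p_idealI)
qed

lemma pcong_closed: "pcong p n R x y \<Longrightarrow> x \<in> carrier R \<and> y \<in> carrier R"
  by (simp add: pcong_def)

lemma pcong_refl [simp]: "x \<in> carrier R \<Longrightarrow> pcong p n R x x"
  by (simp add: pcong_def r_neg a_minus_def)

lemma pcong_sym:
  assumes "pcong p n R x y" shows "pcong p n R y x"
proof -
  have c: "x \<in> carrier R" "y \<in> carrier R" using assms by (auto simp: pcong_def)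
  have "y \<ominus> x = \<ominus> (x \<ominus> y)" using c by algebra
  with assms c show ?thesis by (simp add: pcong_def p_ideal_neg)
qed

lemma pcong_trans:
  assumes "pcong p n R x y" "pcong p n R y z" shows "pcong p n R x z"
proof -
  have c: "x \<in> carrier R" "y \<in> carrier R" "z \<in> carrier R" using assms by (auto simp: pcong_def)
  have "x \<ominus> z = (x \<ominus> y) \<oplus> (y \<ominus> z)" using c by algebra
  with assms c show ?thesis by (simp add: pcong_def p_ideal_add)
qed

lemma pcong_add:
  assumes "pcong p n R x y" "pcong p n R z w" shows "pcong p n R (x \<oplus> z) (y \<oplus> w)"
proof -
  have c: "x \<in> carrier R" "y \<in> carrier R" "z \<in> carrier R" "w \<in> carrier R" using assms by (auto simp: pcong_def)
  have "(x \<oplus> z) \<ominus> (y \<oplus> w) = (x \<ominus> y) \<oplus> (z \<ominus> w)" using c by algebra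
  with assms c show ?thesis by (simp add: pcong_def p_ideal_add)
qed

lemma pcong_neg:
  assumes "pcong p n R x y" shows "pcong p n R (\<ominus> x) (\<ominus> y)"
proof -
  have c: "x \<in> carrier R" "y \<in> carrier R" using assms by (auto simp: pcong_def)
  have "(\<ominus> x) \<ominus> (\<ominus> y) = \<ominus> (x \<ominus> y)" using c by algebra
  with assms c show ?thesis by (simp add: pcong_def p_ideal_neg)
qed

lemma pcong_mult:
  assumes "pcong p n R x y" "pcong p n R z w" shows "pcong p n R (x \<otimes> z) (y \<otimes> w)"
proof -
  have c: "x \<in> carrier R" "y \<in> carrier R" "z \<in> carrier R" "w \<in> carrier R" using assms by (auto simp: pcong_def)
  have "(x \<otimes> z) \<ominus> (y \<otimes> w) = z \<otimes> (x \<ominus> y) \<oplus> y \<otimes> (z \<ominus> w)" using c by algebra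
  with assms c show ?thesis by (simp add: pcong_def p_ideal_add p_ideal_mult)
qed

lemma pcong_mono: "pcong p m R x y \<Longrightarrow> n \<le> m \<Longrightarrow> pcong p n R x y"
  by (auto simp: pcong_def intro: p_ideal_mono)

lemma pcong_zero: "pcong p n R x \<zero> \<longleftrightarrow> x \<in> p_ideal p n R"
  by (auto simp: pcong_def a_minus_def p_ideal_carrier)

lemma pcong_p_ideal: "pcong p n R x y \<Longrightarrow> y \<in> p_ideal p n R \<longleftrightarrow> x \<in> p_ideal p n R"
  by (meson pcong_sym pcong_trans pcong_zero)

lemma pcong_iff:
  "pcong p n R x y \<longleftrightarrow> y \<in> carrier R \<and> (\<exists>z\<in>carrier R. x = y \<oplus> p_elem p R [^] n \<otimes> z)"
proof
  assume "pcong p n R x y"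
  then have c: "x \<in> carrier R" "y \<in> carrier R" and "x \<ominus> y \<in> p_ideal p n R" by (auto simp: pcong_def)
  then obtain z where z: "z \<in> carrier R" "x \<ominus> y = p_elem p R [^] n \<otimes> z" by (auto elim: p_idealE)
  have "x = y \<oplus> (x \<ominus> y)" using c by algebra
  then show "y \<in> carrier R \<and> (\<exists>z\<in>carrier R. x = y \<oplus> p_elem p R [^] n \<otimes> z)" using c z by auto
next
  assume "y \<in> carrier R \<and> (\<exists>z\<in>carrier R. x = y \<oplus> p_elem p R [^] n \<otimes> z)"
  then obtain z where z: "y \<in> carrier R" "z \<in> carrier R" "x = y \<oplus> p_elem p R [^] n \<otimes> z" by auto
  define q where "q = p_elem p R [^] n"
  have q: "q \<in> carrier R" by (simp add: q_def)
  have "(y \<oplus> q \<otimes> z) \<ominus> y = q \<otimes> z" using z q by algebra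
  then show "pcong p n R x y" using z by (simp add: pcong_def p_idealI q_def)
qed

section \<open>Cosets and quotient rings\<close>

lemma ideal_coset_eq_iff:
  assumes "ideal I R" "x \<in> carrier R" "y \<in> carrier R"
  shows "I +> x = I +> y \<longleftrightarrow> x \<ominus> y \<in> I"
proof -
  interpret I: ideal I R by fact
  show ?thesis using quotient_eq_iff_same_a_r_cos[OF assms] by simp
qed

lemma ideal_coset_mem_iff:
  assumes "ideal I R" "x \<in> carrier R"
  shows "y \<in> I +> x \<longleftrightarrow> y \<in> carrier R \<and> y \<ominus> x \<in> I"
proof -
  interpret I: ideal I R by fact
  have "y \<in> I +> x \<longleftrightarrow> y \<in> carrier R \<and> I +> x = I +> y"
    using assms I.a_rcos_self a_r_coset_subset_G[OF I.a_subset assms(2)]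
      a_repr_independence[OF _ assms(2) I.a_subgroup] by blast
  then show ?thesis using ideal_coset_eq_iff[OF assms(1) _ assms(2)] by metis
qed

lemma p_coset_eq_iff:
  "x \<in> carrier R \<Longrightarrow> y \<in> carrier R \<Longrightarrow>
    p_ideal p n R +> x = p_ideal p n R +> y \<longleftrightarrow> pcong p n R x y"
  by (simp add: ideal_coset_eq_iff[OF p_ideal_ideal] pcong_def)

lemma p_coset_mem_iff:
  "x \<in> carrier R \<Longrightarrow> y \<in> p_ideal p n R +> x \<longleftrightarrow> pcong p n R y x"
  by (auto simp: ideal_coset_mem_iff[OF p_ideal_ideal] pcong_def)

lemma quot_carrier:
  "c \<in> carrier (R Quot I) \<longleftrightarrow> (\<exists>x\<in>carrier R. c = I +> x)"
  by (auto simp: FactRing_def A_RCOSETS_def')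

lemma quot_mult: "ideal I R \<Longrightarrow> x \<in> carrier R \<Longrightarrow> y \<in> carrier R \<Longrightarrow>
    (I +> x) \<otimes>\<^bsub>R Quot I\<^esub> (I +> y) = I +> (x \<otimes> y)"
  by (simp add: FactRing_def ideal.rcoset_mult_add)

lemma quot_add:
  assumes "ideal I R" "x \<in> carrier R" "y \<in> carrier R"
  shows "(I +> x) \<oplus>\<^bsub>R Quot I\<^esub> (I +> y) = I +> (x \<oplus> y)"
proof -
  interpret I: ideal I R by fact
  show ?thesis using assms by (simp add: FactRing_def I.a_rcos_sum)
qed

lemma quot_zero: "ideal I R \<Longrightarrow> \<zero>\<^bsub>R Quot I\<^esub> = I +> \<zero>"
  by (metis FactRing_def a_coset_add_zero additive_subgroup.a_subset ideal.axioms(1) ring.simps(1))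

lemma quot_one: "\<one>\<^bsub>R Quot I\<^esub> = I +> \<one>"
  by (simp add: FactRing_def)

lemma quot_pow:
  assumes "ideal I R" "x \<in> carrier R"
  shows "(I +> x) [^]\<^bsub>R Quot I\<^esub> (n::nat) = I +> (x [^] n)"
  by (induction n) (simp_all add: quot_one quot_mult assms)

end

section \<open>Ring homomorphisms and divisibility by powers of p\<close>

lemma ring_hom_p_elem:
  assumes "cring A" "cring B" "f \<in> ring_hom A B"
  shows "f (p_elem p A) = p_elem p B"
proof -
  interpret A: cring A by fact
  interpret B: cring B by fact
  interpret ring_hom_cring A B f using assms by (simp add: ring_hom_cring_def ring_hom_cring_axioms_def)
  have "f ([p] \<cdot>\<^bsub>A\<^esub> \<one>\<^bsub>A\<^esub>) = [p] \<cdot>\<^bsub>B\<^esub> \<one>\<^bsub>B\<^esub>" by (induction p) auto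
  then show ?thesis by (simp add: p_elem_def)
qed

lemma ring_hom_pow:
  assumes "cring A" "cring B" "f \<in> ring_hom A B" "x \<in> carrier A"
  shows "f (x [^]\<^bsub>A\<^esub> (n::nat)) = f x [^]\<^bsub>B\<^esub> n"
proof -
  interpret ring_hom_cring A B f using assms by (simp add: ring_hom_cring_def ring_hom_cring_axioms_def)
  show ?thesis using assms(4) by simp
qed

lemma ring_hom_minus:
  assumes "cring A" "cring B" "f \<in> ring_hom A B" "x \<in> carrier A" "y \<in> carrier A"
  shows "f (x \<ominus>\<^bsub>A\<^esub> y) = f x \<ominus>\<^bsub>B\<^esub> f y"
proof -
  interpret ring_hom_cring A B f using assms by (simp add: ring_hom_cring_def ring_hom_cring_axioms_def)
  show ?thesis using assms(4,5) by (simp add: a_minus_def)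
qed

lemma ring_hom_zero':
  assumes "cring A" "cring B" "f \<in> ring_hom A B" shows "f \<zero>\<^bsub>A\<^esub> = \<zero>\<^bsub>B\<^esub>"
proof -
  interpret ring_hom_cring A B f using assms by (simp add: ring_hom_cring_def ring_hom_cring_axioms_def)
  show ?thesis by simp
qed

lemma ring_hom_p_ideal:
  assumes "cring A" "cring B" "f \<in> ring_hom A B" "x \<in> p_ideal p n A"
  shows "f x \<in> p_ideal p n B"
proof -
  interpret A: cring A by fact
  interpret B: cring B by fact
  obtain y where "y \<in> carrier A" "x = p_elem p A [^]\<^bsub>A\<^esub> n \<otimes>\<^bsub>A\<^esub> y"
    using assms(4) by (rule A.p_idealE)
  then show ?thesis using assms
    by (simp add: ring_hom_mult[OF assms(3)] ring_hom_pow ring_hom_p_elem B.p_idealI ring_hom_closed[OF assms(3)])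
qed

lemma ring_hom_pcong:
  assumes "cring A" "cring B" "f \<in> ring_hom A B" "pcong p n A x y"
  shows "pcong p n B (f x) (f y)"
  using assms unfolding pcong_def
  by (metis ring_hom_p_ideal ring_hom_minus ring_hom_closed)

section \<open>The completion\<close>

text \<open>Points of the inverse limit are handled through sequences of representatives. The
  coherence condition \<open>pcoh\<close> compares the terms \<open>n + 1\<close> and
  \<open>n\<close> modulo \<open>p^n\<close> only, which is what the inclusion of cosets in
  \<open>padic_completion\<close> demands.\<close>

definition pseq :: "nat \<Rightarrow> ('a, 'm) ring_scheme \<Rightarrow> (nat \<Rightarrow> 'a) \<Rightarrow> nat \<Rightarrow> 'a set" where
  "pseq p A a = (\<lambda>n. p_ideal p n A +>\<^bsub>A\<^esub> a n)"

definition pcoh :: "nat \<Rightarrow> ('a, 'm) ring_scheme \<Rightarrow> (nat \<Rightarrow> 'a) \<Rightarrow> bool" where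
  "pcoh p A a \<longleftrightarrow> (\<forall>n. a n \<in> carrier A) \<and> (\<forall>n. pcong p n A (a (Suc n)) (a n))"

context cring
begin

lemma pcoh_closed: "pcoh p R a \<Longrightarrow> a n \<in> carrier R"
  by (simp add: pcoh_def)

lemma pcoh_le: 
  assumes "pcoh p R a" "n \<le> m" shows "pcong p n R (a m) (a n)"
  using assms(2)
proof (induction m)
  case (Suc m)
  show ?case
  proof (cases "n = Suc m")
    case False
    then have "n \<le> m" using Suc by simp
    have "pcong p m R (a (Suc m)) (a m)" using assms(1) by (simp add: pcoh_def)
    then show ?thesis using Suc.IH \<open>n \<le> m\<close> pcong_mono pcong_trans by blast
  qed (use assms(1) in \<open>auto simp: pcoh_def\<close>)
qed (use assms(1) in \<open>auto simp: pcoh_def\<close>)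

lemma pseq_eq_iff:
  "pcoh p R a \<Longrightarrow> pcoh p R b \<Longrightarrow> pseq p R a = pseq p R b \<longleftrightarrow> (\<forall>n. pcong p n R (a n) (b n))"
  by (auto simp: pseq_def fun_eq_iff p_coset_eq_iff pcoh_def)

lemma completion_carrier_iff:
  "s \<in> carrier (padic_completion p R) \<longleftrightarrow> (\<exists>a. pcoh p R a \<and> s = pseq p R a)" (is "?l = ?r")
proof
  assume ?l
  then have 1: "\<forall>n. \<exists>x\<in>carrier R. s n = p_ideal p n R +> x" and 2: "\<And>n. s (Suc n) \<subseteq> s n"
    by (auto simp: padic_completion_def quot_carrier)
  from 1 obtain a where a: "\<And>n. a n \<in> carrier R" "\<And>n. s n = p_ideal p n R +> a n" by metis
  have "pcong p n R (a (Suc n)) (a n)" for n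
  proof -
    have "a (Suc n) \<in> s (Suc n)" using a by (simp add: p_coset_mem_iff)
    then have "a (Suc n) \<in> s n" using 2 by blast
    then show ?thesis using a by (simp add: p_coset_mem_iff)
  qed
  then show ?r using a by (auto simp: pcoh_def pseq_def fun_eq_iff)
next
  assume ?r
  then obtain a where a: "pcoh p R a" "s = pseq p R a" by auto
  have "s (Suc n) \<subseteq> s n" for n
  proof
    fix x assume "x \<in> s (Suc n)"
    then have "pcong p (Suc n) R x (a (Suc n))" using a by (simp add: pseq_def pcoh_def p_coset_mem_iff)
    moreover have "pcong p n R (a (Suc n)) (a n)" using a by (simp add: pcoh_def)
    ultimately have "pcong p n R x (a n)" using pcong_mono[of p "Suc n" x] pcong_trans by (meson le_SucI order_refl)
    then show "x \<in> s n" using a by (simp add: pseq_def pcoh_def p_coset_mem_iff)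
  qed
  then show ?l using a by (auto simp: padic_completion_def quot_carrier pseq_def pcoh_def)
qed

lemma completionE:
  assumes "s \<in> carrier (padic_completion p R)"
  obtains a where "pcoh p R a" "s = pseq p R a"
  using assms completion_carrier_iff by blast

lemma pcoh_add: "pcoh p R a \<Longrightarrow> pcoh p R b \<Longrightarrow> pcoh p R (\<lambda>n. a n \<oplus> b n)"
  by (auto simp: pcoh_def pcong_add)
lemma pcoh_mult: "pcoh p R a \<Longrightarrow> pcoh p R b \<Longrightarrow> pcoh p R (\<lambda>n. a n \<otimes> b n)"
  by (auto simp: pcoh_def pcong_mult)
lemma pcoh_neg: "pcoh p R a \<Longrightarrow> pcoh p R (\<lambda>n. \<ominus> a n)"
  by (auto simp: pcoh_def pcong_neg)
lemma pcoh_const: "x \<in> carrier R \<Longrightarrow> pcoh p R (\<lambda>n. x)"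
  by (auto simp: pcoh_def)

lemma pseq_closed: "pcoh p R a \<Longrightarrow> pseq p R a \<in> carrier (padic_completion p R)"
  using completion_carrier_iff by blast

lemma pseq_add: "pcoh p R a \<Longrightarrow> pcoh p R b \<Longrightarrow>
    pseq p R a \<oplus>\<^bsub>padic_completion p R\<^esub> pseq p R b = pseq p R (\<lambda>n. a n \<oplus> b n)"
  by (simp add: padic_completion_def pseq_def pcoh_def quot_add p_ideal_ideal)
lemma pseq_mult: "pcoh p R a \<Longrightarrow> pcoh p R b \<Longrightarrow>
    pseq p R a \<otimes>\<^bsub>padic_completion p R\<^esub> pseq p R b = pseq p R (\<lambda>n. a n \<otimes> b n)"
  by (simp add: padic_completion_def pseq_def pcoh_def quot_mult p_ideal_ideal)
lemma pseq_zero: "\<zero>\<^bsub>padic_completion p R\<^esub> = pseq p R (\<lambda>n. \<zero>)"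
  by (simp add: padic_completion_def pseq_def quot_zero p_ideal_ideal)
lemma pseq_one: "\<one>\<^bsub>padic_completion p R\<^esub> = pseq p R (\<lambda>n. \<one>)"
  by (simp add: padic_completion_def pseq_def quot_one)

lemmas pseq_simps = pseq_add pseq_mult pseq_zero pseq_one pcoh_add pcoh_mult pcoh_neg pcoh_const pseq_closed

lemma completion_cring: "cring (padic_completion p R)"
proof (rule cringI)
  show "abelian_group (padic_completion p R)"
  proof (rule abelian_groupI)
    fix x assume "x \<in> carrier (padic_completion p R)"
    then obtain a where a: "pcoh p R a" "x = pseq p R a" by (rule completionE)
    have "pseq p R (\<lambda>n. \<ominus> a n) \<oplus>\<^bsub>padic_completion p R\<^esub> x = \<zero>\<^bsub>padic_completion p R\<^esub>"
      using a by (simp add: pseq_simps l_neg pcoh_closed)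
    then show "\<exists>y\<in>carrier (padic_completion p R). y \<oplus>\<^bsub>padic_completion p R\<^esub> x = \<zero>\<^bsub>padic_completion p R\<^esub>"
      using pseq_closed[OF pcoh_neg[OF a(1)]] by blast
  qed (auto elim!: completionE simp: pseq_simps a_ac pcoh_closed)
  show "comm_monoid (padic_completion p R)"
    by (rule comm_monoidI) (auto elim!: completionE simp: pseq_simps m_ac pcoh_closed)
qed (auto elim!: completionE simp: pseq_simps l_distr pcoh_closed)

lemma padic_in_eq: "padic_in p R x = pseq p R (\<lambda>n. x)"
  by (simp add: padic_in_def pseq_def)

lemma padic_in_hom: "padic_in p R \<in> ring_hom R (padic_completion p R)"
  by (rule ring_hom_memI) (simp_all add: padic_in_eq pseq_simps)

lemma completion_p_pow: "p_elem p (padic_completion p R) [^]\<^bsub>padic_completion p R\<^esub> (n::nat) =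
    padic_in p R (p_elem p R [^] n)"
  using ring_hom_p_elem[OF cring_axioms completion_cring padic_in_hom]
    ring_hom_pow[OF cring_axioms completion_cring padic_in_hom, of "p_elem p R"]
  by simp

text \<open>The completion of a ring along a principal ideal is again separated and complete because an element
  with trivial image in \<open>R/p\<^sup>n\<close> is a multiple of \<open>p\<^sup>n\<close>.\<close>

lemma completion_p_ideal_iff:
  assumes a: "pcoh p R a"
  shows "pseq p R a \<in> p_ideal p n (padic_completion p R) \<longleftrightarrow> a n \<in> p_ideal p n R"
proof
  interpret c: cring "padic_completion p R" by (rule completion_cring)
  assume "pseq p R a \<in> p_ideal p n (padic_completion p R)"
  then obtain y where y: "y \<in> carrier (padic_completion p R)"
    "pseq p R a = padic_in p R (p_elem p R [^] n) \<otimes>\<^bsub>padic_completion p R\<^esub> y"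
    unfolding c.p_ideal_iff completion_p_pow by auto
  then obtain b where b: "pcoh p R b" "y = pseq p R b" by (auto elim: completionE)
  then have "pcong p n R (a n) (p_elem p R [^] n \<otimes> b n)"
    using y(2) a by (simp add: padic_in_eq pseq_simps pseq_eq_iff)
  then show "a n \<in> p_ideal p n R"
    using b by (metis p_idealI pcoh_closed pcong_p_ideal)
next
  interpret c: cring "padic_completion p R" by (rule completion_cring)
  assume an: "a n \<in> p_ideal p n R"
  then obtain b where b: "b \<in> carrier R" "a n = p_elem p R [^] n \<otimes> b" by (rule p_idealE)
  have "\<forall>i. \<exists>d\<in>carrier R. a (Suc (n + i)) = a (n + i) \<oplus> p_elem p R [^] (n + i) \<otimes> d"
    using a unfolding pcoh_def pcong_iff by auto
  then obtain d where d: "\<And>i. d i \<in> carrier R"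
    "\<And>i. a (Suc (n + i)) = a (n + i) \<oplus> p_elem p R [^] (n + i) \<otimes> d i" by metis
  \<comment> \<open>\<open>p\<close> may be a zero divisor, so quotients by \<open>p^n\<close>
    cannot be taken term by term. The chosen increments \<open>d i\<close> of \<open>a\<close> above
    level \<open>n\<close> are summed again with the factor \<open>p^n\<close> left out:
    \<open>y i\<close> is \<open>b\<close> plus all \<open>p^k * d k\<close> with
    \<open>k < i\<close>. This forces both coherence of \<open>y\<close> and
    \<open>a (n + i) = p^n * y i\<close>.\<close>
  define y where "y = rec_nat b (\<lambda>i z. z \<oplus> p_elem p R [^] i \<otimes> d i)"
  have y0: "y 0 = b" and yS: "\<And>i. y (Suc i) = y i \<oplus> p_elem p R [^] i \<otimes> d i" by (simp_all add: y_def)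
  have yc: "y i \<in> carrier R" for i by (induction i) (simp_all add: y0 yS b d)
  have coh: "pcoh p R y" unfolding pcoh_def using yc d by (auto simp: pcong_iff yS)
  have e: "a (n + i) = p_elem p R [^] n \<otimes> y i" for i
  proof (induction i)
    case (Suc i)
    have "p_elem p R [^] (n + i) = p_elem p R [^] n \<otimes> p_elem p R [^] i" by (simp add: nat_pow_mult)
    then show ?case using Suc yc d by (simp add: yS r_distr m_assoc)
  qed (use b y0 in simp)
  have "pcong p i R (a i) (p_elem p R [^] n \<otimes> y i)" for i
    using pcoh_le[OF a, of i "n + i"] by (simp add: e pcong_sym)
  then have "pseq p R a = padic_in p R (p_elem p R [^] n) \<otimes>\<^bsub>padic_completion p R\<^esub> pseq p R y"
    using a coh by (simp add: padic_in_eq pseq_simps pseq_eq_iff)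
  then show "pseq p R a \<in> p_ideal p n (padic_completion p R)"
    unfolding c.p_ideal_iff completion_p_pow using coh by (auto simp: pseq_closed)
qed

lemma padic_in_p_ideal_iff:
  "x \<in> carrier R \<Longrightarrow> padic_in p R x \<in> p_ideal p n (padic_completion p R) \<longleftrightarrow> x \<in> p_ideal p n R"
  by (simp add: padic_in_eq completion_p_ideal_iff pcoh_const)

lemma completion_pcong_iff:
  assumes "pcoh p R a" "pcoh p R b"
  shows "pcong p n (padic_completion p R) (pseq p R a) (pseq p R b) \<longleftrightarrow> pcong p n R (a n) (b n)"
proof -
  interpret c: cring "padic_completion p R" by (rule completion_cring)
  have "\<ominus>\<^bsub>padic_completion p R\<^esub> pseq p R b = pseq p R (\<lambda>n. \<ominus> b n)"
    using assms by (intro c.minus_equality) (simp_all add: pseq_simps l_neg pcoh_closed)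
  then have "pseq p R a \<ominus>\<^bsub>padic_completion p R\<^esub> pseq p R b = pseq p R (\<lambda>n. a n \<ominus> b n)"
    using assms by (simp add: a_minus_def pseq_simps)
  moreover have "pcoh p R (\<lambda>n. a n \<ominus> b n)" using assms by (simp add: a_minus_def pseq_simps)
  ultimately show ?thesis using assms by (simp add: pcong_def pseq_closed completion_p_ideal_iff pcoh_closed)
qed

lemma completion_dense:
  assumes "x \<in> carrier (padic_completion p R)"
  shows "\<exists>a\<in>carrier R. pcong p n (padic_completion p R) x (padic_in p R a)"
proof -
  obtain a where a: "pcoh p R a" "x = pseq p R a" using assms by (rule completionE)
  then have "pcong p n (padic_completion p R) x (padic_in p R (a n))"
    by (simp add: padic_in_eq completion_pcong_iff pcoh_const pcoh_closed)
  then show ?thesis using a(1) by (auto simp: pcoh_closed)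
qed

end

text \<open>Injectivity and surjectivity of the map to the completion in elementwise form, so that
  the same arguments serve \<open>R\<close>, \<open>K^o\<close> and \<open>P^o\<close>.\<close>

locale complete_ring = cring +
  fixes p :: nat
  assumes sep: "x \<in> carrier R \<Longrightarrow> (\<And>n. x \<in> p_ideal p n R) \<Longrightarrow> x = \<zero>"
    and lim: "pcoh p R s \<Longrightarrow> \<exists>l\<in>carrier R. \<forall>n. pcong p n R l (s n)"
begin

lemma sep_eq:
  assumes "x \<in> carrier R" "y \<in> carrier R" "\<And>n. pcong p n R x y" shows "x = y"
proof -
  have "x \<ominus> y = \<zero>" using assms by (intro sep) (auto simp: pcong_def)
  then show ?thesis using assms by (simp add: r_right_minus_eq)
qed

end

text \<open>The limit of a coherent sequence of points of the completion is its diagonal. If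
  \<open>a n\<close> represents the \<open>n\<close>-th point, then \<open>a n n\<close> is
  coherent, because the points \<open>n\<close> and \<open>n + 1\<close> agree modulo
  \<open>p^n\<close> and each \<open>a n\<close> is itself coherent.\<close>

lemma (in cring) completion_complete: "complete_ring (padic_completion p R) p"
proof -
  interpret c: cring "padic_completion p R" by (rule completion_cring)
  show ?thesis
  proof unfold_locales
    fix x assume "x \<in> carrier (padic_completion p R)" and x: "\<And>n. x \<in> p_ideal p n (padic_completion p R)"
    then obtain a where a: "pcoh p R a" "x = pseq p R a" by (auto elim: completionE)
    then have "a n \<in> p_ideal p n R" for n using x completion_p_ideal_iff by auto
    then show "x = \<zero>\<^bsub>padic_completion p R\<^esub>" using a by (simp add: pseq_zero pseq_eq_iff pcoh_const pcong_zero)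
  next
    fix s assume s: "pcoh p (padic_completion p R) s"
    then have "\<forall>n. \<exists>a. pcoh p R a \<and> s n = pseq p R a" by (meson c.pcoh_closed completionE)
    then obtain a where a: "\<And>n. pcoh p R (a n)" "\<And>n. s n = pseq p R (a n)" by metis
    have st: "pcong p n R (a (Suc n) n) (a n n)" for n
      using s a unfolding pcoh_def by (metis completion_pcong_iff a)
    have "pcong p n R (a (Suc n) (Suc n)) (a n n)" for n
      using st[of n] a(1)[of "Suc n"] unfolding pcoh_def by (metis pcong_trans)
    then have coh: "pcoh p R (\<lambda>n. a n n)" using a(1) by (auto simp: pcoh_def)
    have "pcong p n (padic_completion p R) (pseq p R (\<lambda>n. a n n)) (s n)" for n
      using a coh pcoh_closed[OF coh] by (simp add: completion_pcong_iff)
    then show "\<exists>l\<in>carrier (padic_completion p R). \<forall>n. pcong p n (padic_completion p R) l (s n)"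
      using coh pseq_closed by blast
  qed
qed

lemma (in cring) padically_complete_imp_sep:
  assumes "padically_complete p R" "x \<in> carrier R" "\<And>n. x \<in> p_ideal p n R"
  shows "x = \<zero>"
proof -
  have "padic_in p R x = padic_in p R \<zero>"
    using assms(2,3) by (simp add: padic_in_eq pseq_eq_iff pcoh_const pcong_zero)
  then show ?thesis using assms(1,2) by (auto simp: padically_complete_def bij_betw_def inj_on_def)
qed

section \<open>Functoriality of the completion\<close>

lemma padic_map_pseq:
  assumes "cring A" "cring B" "f \<in> ring_hom A B" "pcoh p A a"
  shows "padic_map p B f (pseq p A a) = pseq p B (\<lambda>n. f (a n))" "pcoh p B (\<lambda>n. f (a n))"
proof -
  interpret A: cring A by fact
  interpret B: cring B by fact
  have "(\<Union>x\<in>p_ideal p n A +>\<^bsub>A\<^esub> a n. p_ideal p n B +>\<^bsub>B\<^esub> f x) = p_ideal p n B +>\<^bsub>B\<^esub> f (a n)" for n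
  proof -
    have an: "a n \<in> carrier A" using assms(4) by (simp add: A.pcoh_closed)
    have "p_ideal p n B +>\<^bsub>B\<^esub> f x = p_ideal p n B +>\<^bsub>B\<^esub> f (a n)" if "x \<in> p_ideal p n A +>\<^bsub>A\<^esub> a n" for x
      using that an ring_hom_pcong[OF assms(1-3)] ring_hom_closed[OF assms(3)]
      by (metis A.p_coset_mem_iff A.pcong_closed B.p_coset_eq_iff)
    moreover have "a n \<in> p_ideal p n A +>\<^bsub>A\<^esub> a n" using an by (simp add: A.p_coset_mem_iff)
    ultimately show ?thesis by blast
  qed
  then show "padic_map p B f (pseq p A a) = pseq p B (\<lambda>n. f (a n))"
    by (simp add: padic_map_def pseq_def)
  show "pcoh p B (\<lambda>n. f (a n))"
    using assms(4) ring_hom_pcong[OF assms(1-3)] ring_hom_closed[OF assms(3)] by (auto simp: pcoh_def)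
qed

lemma padic_map_hom:
  assumes "cring A" "cring B" "f \<in> ring_hom A B"
  shows "padic_map p B f \<in> ring_hom (padic_completion p A) (padic_completion p B)"
proof -
  interpret A: cring A by fact
  interpret B: cring B by fact
  note m = padic_map_pseq[OF assms]
  show ?thesis
    by (rule ring_hom_memI)
      (auto elim!: A.completionE simp: m A.pseq_simps B.pseq_simps A.pcoh_closed
        ring_hom_add[OF assms(3)] ring_hom_mult[OF assms(3)] ring_hom_one[OF assms(3)])
qed

lemma padic_map_in:
  assumes "cring A" "cring B" "f \<in> ring_hom A B" "x \<in> carrier A"
  shows "padic_map p B f (padic_in p A x) = padic_in p B (f x)"
proof -
  interpret A: cring A by fact
  interpret B: cring B by fact
  show ?thesis using assms by (simp add: A.padic_in_eq B.padic_in_eq padic_map_pseq A.pcoh_const)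
qed

section \<open>Direct limits along an endomorphism\<close>

locale ring_endo = cring +
  fixes \<Phi> :: "'a \<Rightarrow> 'a"
  assumes endo: "\<Phi> \<in> ring_hom R R"
begin

abbreviation "dl \<equiv> dirlim_in R \<Phi>"

lemma endo_closed [simp]: "a \<in> carrier R \<Longrightarrow> \<Phi> a \<in> carrier R"
  using endo by (rule ring_hom_closed)

lemma endo_pow_closed [simp]: "a \<in> carrier R \<Longrightarrow> (\<Phi> ^^ k) a \<in> carrier R"
  by (induction k) auto

lemma endo_pow_hom: "(\<Phi> ^^ k) \<in> ring_hom R R"
proof (induction k)
  case (Suc k)
  then show ?case using ring_hom_trans[OF Suc endo] by (simp add: comp_def)
qed (simp add: ring_hom_def)

lemma endo_pow_pow: "(\<Phi> ^^ k) ((\<Phi> ^^ l) a) = (\<Phi> ^^ (k + l)) a"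
  by (simp add: funpow_add)

lemma dirlim_equiv: "equiv (UNIV \<times> carrier R) (dirlim_rel R \<Phi>)"
proof (rule equivI)
  show "refl_on (UNIV \<times> carrier R) (dirlim_rel R \<Phi>)" by (auto simp: refl_on_def dirlim_rel_def)
  show "sym (dirlim_rel R \<Phi>)" by (auto simp: sym_def dirlim_rel_def) metis
  show "trans (dirlim_rel R \<Phi>)"
  proof (rule transI, clarify)
    fix m a n b l c assume "((m, a), (n, b)) \<in> dirlim_rel R \<Phi>" "((n, b), (l, c)) \<in> dirlim_rel R \<Phi>"
    then obtain k j where c: "a \<in> carrier R" "c \<in> carrier R"
      and 1: "(\<Phi> ^^ (n + k)) a = (\<Phi> ^^ (m + k)) b" and 2: "(\<Phi> ^^ (l + j)) b = (\<Phi> ^^ (n + j)) c"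
      by (auto simp: dirlim_rel_def)
    have "(\<Phi> ^^ (l + (j + n + k))) a = (\<Phi> ^^ (l + j)) ((\<Phi> ^^ (n + k)) a)" by (simp add: endo_pow_pow add_ac)
    also have "\<dots> = (\<Phi> ^^ (m + k)) ((\<Phi> ^^ (l + j)) b)" unfolding 1 by (simp add: endo_pow_pow add_ac)
    also have "\<dots> = (\<Phi> ^^ (m + (j + n + k))) c" unfolding 2 by (simp add: endo_pow_pow add_ac)
    finally show "((m, a), (l, c)) \<in> dirlim_rel R \<Phi>" using c by (auto simp: dirlim_rel_def)
  qed
qed (auto simp: dirlim_rel_def)

lemma dl_eq_iff: "a \<in> carrier R \<Longrightarrow> b \<in> carrier R \<Longrightarrow>
    dl m a = dl n b \<longleftrightarrow> (\<exists>k. (\<Phi> ^^ (n + k)) a = (\<Phi> ^^ (m + k)) b)"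
  using eq_equiv_class_iff[OF dirlim_equiv, of "(m, a)" "(n, b)"]
  by (simp add: dirlim_in_def) (simp add: dirlim_rel_def)

lemma dl_mem: "(n, b) \<in> dl m a \<Longrightarrow> a \<in> carrier R \<Longrightarrow> b \<in> carrier R \<and> dl n b = dl m a"
  using equiv_class_eq[OF dirlim_equiv, of "(m, a)" "(n, b)"] by (simp add: dirlim_in_def) (simp add: dirlim_rel_def)

lemma dl_self: "a \<in> carrier R \<Longrightarrow> (m, a) \<in> dl m a"
  by (auto simp: dirlim_in_def dirlim_rel_def)

lemma dirlim_carrier_iff: "x \<in> carrier (dirlim R \<Phi>) \<longleftrightarrow> (\<exists>m. \<exists>a\<in>carrier R. x = dl m a)"
  by (auto simp: dirlim_def quotient_def dirlim_in_def)

lemma dl_closed [simp]: "a \<in> carrier R \<Longrightarrow> dl m a \<in> carrier (dirlim R \<Phi>)"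
  by (auto simp: dirlim_carrier_iff)

lemma dl_step: "a \<in> carrier R \<Longrightarrow> dl (m + k) ((\<Phi> ^^ k) a) = dl m a"
  by (subst dl_eq_iff) (auto simp: endo_pow_pow intro!: exI[of _ 0])

lemma dl_common:
  assumes "x \<in> carrier (dirlim R \<Phi>)" "y \<in> carrier (dirlim R \<Phi>)"
  obtains m a b where "a \<in> carrier R" "b \<in> carrier R" "x = dl m a" "y = dl m b"
proof -
  obtain m a n b where *: "a \<in> carrier R" "b \<in> carrier R" "x = dl m a" "y = dl n b"
    using assms by (auto simp: dirlim_carrier_iff)
  have "x = dl (m + n) ((\<Phi> ^^ n) a)" "y = dl (m + n) ((\<Phi> ^^ m) b)"
    using * dl_step[of a m n] dl_step[of b n m] by (simp_all add: add.commute)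
  from that[OF _ _ this] show ?thesis using * by simp
qed

text \<open>Sum and product of the limit are treated at once through an operation \<open>f\<close>
  that commutes with \<open>\<Phi>\<close>. Two representatives of a class agree after enough
  applications of \<open>\<Phi>\<close>, so all classes in the double union coincide.\<close>

lemma dl_op_same:
  assumes cl: "\<And>a b. a \<in> carrier R \<Longrightarrow> b \<in> carrier R \<Longrightarrow> f a b \<in> carrier R"
    and hom: "\<And>a b. a \<in> carrier R \<Longrightarrow> b \<in> carrier R \<Longrightarrow> \<Phi> (f a b) = f (\<Phi> a) (\<Phi> b)"
    and ab: "a \<in> carrier R" "b \<in> carrier R"
  shows "(\<Union>(m', a')\<in>dl m a. \<Union>(n', b')\<in>dl m b.
      dl (m' + n') (f ((\<Phi> ^^ n') a') ((\<Phi> ^^ m') b'))) = dl m (f a b)"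
proof -
  have homk: "(\<Phi> ^^ k) (f a b) = f ((\<Phi> ^^ k) a) ((\<Phi> ^^ k) b)"
    if "a \<in> carrier R" "b \<in> carrier R" for a b k
    using that by (induction k) (auto simp: hom)
  have "dl (m' + n') (f ((\<Phi> ^^ n') a') ((\<Phi> ^^ m') b')) = dl m (f a b)"
    if "(m', a') \<in> dl m a" "(n', b') \<in> dl m b" for m' a' n' b'
  proof -
    have 1: "a' \<in> carrier R" "b' \<in> carrier R" "dl m' a' = dl m a" "dl n' b' = dl m b"
      using dl_mem[OF that(1) ab(1)] dl_mem[OF that(2) ab(2)] by auto
    then obtain k j where kj: "(\<Phi> ^^ (m + k)) a' = (\<Phi> ^^ (m' + k)) a" "(\<Phi> ^^ (m + j)) b' = (\<Phi> ^^ (n' + j)) b"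
      using ab by (auto simp: dl_eq_iff)
    have "(\<Phi> ^^ (m + (k + j))) (f ((\<Phi> ^^ n') a') ((\<Phi> ^^ m') b')) =
        f ((\<Phi> ^^ (n' + j)) ((\<Phi> ^^ (m + k)) a')) ((\<Phi> ^^ (m' + k)) ((\<Phi> ^^ (m + j)) b'))"
      using 1 by (simp add: homk endo_pow_pow add_ac)
    also have "\<dots> = (\<Phi> ^^ (m' + n' + (k + j))) (f a b)"
      unfolding kj using ab by (simp add: homk endo_pow_pow add_ac)
    finally show ?thesis using 1 ab by (subst dl_eq_iff) (auto simp: cl)
  qed
  then have "(\<Union>(m', a')\<in>dl m a. \<Union>(n', b')\<in>dl m b.
      dl (m' + n') (f ((\<Phi> ^^ n') a') ((\<Phi> ^^ m') b'))) = (\<Union>(m', a')\<in>dl m a. \<Union>(n', b')\<in>dl m b. dl m (f a b))"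
    by (intro SUP_cong) auto
  also have "\<dots> = dl m (f a b)" using dl_self[OF ab(1), of m] dl_self[OF ab(2), of m] by auto
  finally show ?thesis .
qed

lemma dl_mult: "a \<in> carrier R \<Longrightarrow> b \<in> carrier R \<Longrightarrow>
    dl m a \<otimes>\<^bsub>dirlim R \<Phi>\<^esub> dl m b = dl m (a \<otimes> b)"
  using dl_op_same[of "(\<otimes>)" a b m] ring_hom_mult[OF endo] by (simp add: dirlim_def)
lemma dl_add: "a \<in> carrier R \<Longrightarrow> b \<in> carrier R \<Longrightarrow>
    dl m a \<oplus>\<^bsub>dirlim R \<Phi>\<^esub> dl m b = dl m (a \<oplus> b)"
  using dl_op_same[of "(\<oplus>)" a b m] ring_hom_add[OF endo] by (simp add: dirlim_def)
lemma dl_one: "\<one>\<^bsub>dirlim R \<Phi>\<^esub> = dl m \<one>"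
  using dl_step[of \<one> 0 m] ring_hom_one[OF endo_pow_hom] by (simp add: dirlim_def)
lemma dl_zero: "\<zero>\<^bsub>dirlim R \<Phi>\<^esub> = dl m \<zero>"
proof -
  have "dl (0 + m) ((\<Phi> ^^ m) \<zero>) = dl 0 \<zero>" by (rule dl_step) simp
  moreover have "(\<Phi> ^^ m) \<zero> = \<zero>" by (rule ring_hom_zero'[OF cring_axioms cring_axioms endo_pow_hom])
  ultimately show ?thesis by (simp add: dirlim_def)
qed

lemma dl_common3:
  assumes "x \<in> carrier (dirlim R \<Phi>)" "y \<in> carrier (dirlim R \<Phi>)" "z \<in> carrier (dirlim R \<Phi>)"
  obtains m a b c where "a \<in> carrier R" "b \<in> carrier R" "c \<in> carrier R" "x = dl m a" "y = dl m b" "z = dl m c"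
proof -
  obtain m a b where 1: "a \<in> carrier R" "b \<in> carrier R" "x = dl m a" "y = dl m b"
    using dl_common[OF assms(1,2)] .
  obtain n c where 2: "c \<in> carrier R" "z = dl n c" using assms(3) by (auto simp: dirlim_carrier_iff)
  have "x = dl (m + n) ((\<Phi> ^^ n) a)" "y = dl (m + n) ((\<Phi> ^^ n) b)" "z = dl (m + n) ((\<Phi> ^^ m) c)"
    using 1 2 dl_step[of a m n] dl_step[of b m n] dl_step[of c n m] by (simp_all add: add.commute)
  from that[OF _ _ _ this] show ?thesis using 1 2 by simp
qed

lemma dirlim_cring: "cring (dirlim R \<Phi>)"
proof (rule cringI)
  show "abelian_group (dirlim R \<Phi>)"
  proof (rule abelian_groupI)
    fix x y z assume *: "x \<in> carrier (dirlim R \<Phi>)" "y \<in> carrier (dirlim R \<Phi>)" "z \<in> carrier (dirlim R \<Phi>)"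
    show "x \<oplus>\<^bsub>dirlim R \<Phi>\<^esub> y \<oplus>\<^bsub>dirlim R \<Phi>\<^esub> z = x \<oplus>\<^bsub>dirlim R \<Phi>\<^esub> (y \<oplus>\<^bsub>dirlim R \<Phi>\<^esub> z)"
      by (rule dl_common3[OF *]) (simp add: dl_add a_assoc)
  next
    fix x assume "x \<in> carrier (dirlim R \<Phi>)"
    then obtain m a where a: "a \<in> carrier R" "x = dl m a" by (auto simp: dirlim_carrier_iff)
    show "\<zero>\<^bsub>dirlim R \<Phi>\<^esub> \<oplus>\<^bsub>dirlim R \<Phi>\<^esub> x = x" using a by (simp add: dl_add dl_zero[of m])
    show "\<exists>y\<in>carrier (dirlim R \<Phi>). y \<oplus>\<^bsub>dirlim R \<Phi>\<^esub> x = \<zero>\<^bsub>dirlim R \<Phi>\<^esub>"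
      using a by (intro bexI[of _ "dl m (\<ominus> a)"]) (simp_all add: dl_add dl_zero[of m] l_neg)
  next
    fix x y assume *: "x \<in> carrier (dirlim R \<Phi>)" "y \<in> carrier (dirlim R \<Phi>)"
    show "x \<oplus>\<^bsub>dirlim R \<Phi>\<^esub> y \<in> carrier (dirlim R \<Phi>)"
      "x \<oplus>\<^bsub>dirlim R \<Phi>\<^esub> y = y \<oplus>\<^bsub>dirlim R \<Phi>\<^esub> x"
      by (rule dl_common[OF *], simp add: dl_add a_comm)+
  qed (simp add: dl_zero[of 0])
  show "comm_monoid (dirlim R \<Phi>)"
  proof (rule comm_monoidI)
    fix x y z assume *: "x \<in> carrier (dirlim R \<Phi>)" "y \<in> carrier (dirlim R \<Phi>)" "z \<in> carrier (dirlim R \<Phi>)"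
    show "x \<otimes>\<^bsub>dirlim R \<Phi>\<^esub> y \<otimes>\<^bsub>dirlim R \<Phi>\<^esub> z = x \<otimes>\<^bsub>dirlim R \<Phi>\<^esub> (y \<otimes>\<^bsub>dirlim R \<Phi>\<^esub> z)"
      by (rule dl_common3[OF *]) (simp add: dl_mult m_assoc)
  next
    fix x assume "x \<in> carrier (dirlim R \<Phi>)"
    then obtain m a where a: "a \<in> carrier R" "x = dl m a" by (auto simp: dirlim_carrier_iff)
    show "\<one>\<^bsub>dirlim R \<Phi>\<^esub> \<otimes>\<^bsub>dirlim R \<Phi>\<^esub> x = x" using a by (simp add: dl_mult dl_one[of m])
  next
    fix x y assume *: "x \<in> carrier (dirlim R \<Phi>)" "y \<in> carrier (dirlim R \<Phi>)"
    show "x \<otimes>\<^bsub>dirlim R \<Phi>\<^esub> y \<in> carrier (dirlim R \<Phi>)"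
      "x \<otimes>\<^bsub>dirlim R \<Phi>\<^esub> y = y \<otimes>\<^bsub>dirlim R \<Phi>\<^esub> x"
      by (rule dl_common[OF *], simp add: dl_mult m_comm)+
  qed (simp add: dl_one[of 0])
next
  fix x y z assume *: "x \<in> carrier (dirlim R \<Phi>)" "y \<in> carrier (dirlim R \<Phi>)" "z \<in> carrier (dirlim R \<Phi>)"
  show "(x \<oplus>\<^bsub>dirlim R \<Phi>\<^esub> y) \<otimes>\<^bsub>dirlim R \<Phi>\<^esub> z =
      x \<otimes>\<^bsub>dirlim R \<Phi>\<^esub> z \<oplus>\<^bsub>dirlim R \<Phi>\<^esub> y \<otimes>\<^bsub>dirlim R \<Phi>\<^esub> z"
    by (rule dl_common3[OF *]) (simp add: dl_mult dl_add l_distr)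
qed

lemma dl_hom: "dl m \<in> ring_hom R (dirlim R \<Phi>)"
  by (rule ring_hom_memI) (simp_all add: dl_mult dl_add dl_one[of m])

text \<open>A quotient by \<open>p^n\<close> in the limit comes from some copy, and the equation
  that it satisfies already holds after finitely many applications of \<open>\<Phi>\<close>.
  Divisibility in the limit is thus a statement about a finite stage.\<close>

lemma dl_p_ideal_iff:
  assumes "a \<in> carrier R"
  shows "dl m a \<in> p_ideal p n (dirlim R \<Phi>) \<longleftrightarrow> (\<exists>k. (\<Phi> ^^ k) a \<in> p_ideal p n R)"
proof
  interpret D: cring "dirlim R \<Phi>" by (rule dirlim_cring)
  assume "dl m a \<in> p_ideal p n (dirlim R \<Phi>)"
  then obtain y where y: "y \<in> carrier (dirlim R \<Phi>)"
    "dl m a = p_elem p (dirlim R \<Phi>) [^]\<^bsub>dirlim R \<Phi>\<^esub> n \<otimes>\<^bsub>dirlim R \<Phi>\<^esub> y" by (rule D.p_idealE)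
  then obtain l b where b: "b \<in> carrier R" "y = dl l b" by (auto simp: dirlim_carrier_iff)
  have "p_elem p (dirlim R \<Phi>) [^]\<^bsub>dirlim R \<Phi>\<^esub> n = dl l (p_elem p R [^] n)"
    using ring_hom_p_elem[OF cring_axioms dirlim_cring dl_hom[of l], of p]
      ring_hom_pow[OF cring_axioms dirlim_cring dl_hom, of "p_elem p R" l n] by simp
  then have "dl m a = dl l (p_elem p R [^] n \<otimes> b)" using y b by (simp add: dl_mult)
  then obtain k where "(\<Phi> ^^ (l + k)) a = (\<Phi> ^^ (m + k)) (p_elem p R [^] n \<otimes> b)"
    using assms b by (auto simp: dl_eq_iff)
  then show "\<exists>k. (\<Phi> ^^ k) a \<in> p_ideal p n R"
    using b ring_hom_p_ideal[OF cring_axioms cring_axioms endo_pow_hom] p_idealI by metis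
next
  assume "\<exists>k. (\<Phi> ^^ k) a \<in> p_ideal p n R"
  then obtain k where "(\<Phi> ^^ k) a \<in> p_ideal p n R" by auto
  then have "dl (m + k) ((\<Phi> ^^ k) a) \<in> p_ideal p n (dirlim R \<Phi>)"
    by (rule ring_hom_p_ideal[OF cring_axioms dirlim_cring dl_hom])
  then show "dl m a \<in> p_ideal p n (dirlim R \<Phi>)" using assms by (simp add: dl_step)
qed

end

section \<open>Maps between direct limits\<close>

lemma dirlim_map_in:
  assumes "ring_endo A \<Phi>" "ring_endo B \<Psi>" "f \<in> ring_hom A B"
    "\<And>x. x \<in> carrier A \<Longrightarrow> f (\<Phi> x) = \<Psi> (f x)" "a \<in> carrier A"
  shows "dirlim_map B \<Psi> f (dirlim_in A \<Phi> m a) = dirlim_in B \<Psi> m (f a)"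
proof -
  interpret A: ring_endo A \<Phi> by fact
  interpret B: ring_endo B \<Psi> by fact
  have fk: "f ((\<Phi> ^^ k) x) = (\<Psi> ^^ k) (f x)" if "x \<in> carrier A" for k x
    using that by (induction k) (simp_all add: assms(4))
  have "B.dl n (f b) = B.dl m (f a)" if "(n, b) \<in> A.dl m a" for n b
  proof -
    have b: "b \<in> carrier A" "A.dl n b = A.dl m a" using A.dl_mem[OF that assms(5)] by auto
    then obtain k where "(\<Phi> ^^ (m + k)) b = (\<Phi> ^^ (n + k)) a" using assms(5) by (auto simp: A.dl_eq_iff)
    then have "(\<Psi> ^^ (m + k)) (f b) = (\<Psi> ^^ (n + k)) (f a)" using fk b assms(5) by metis
    then show ?thesis using b assms(5) ring_hom_closed[OF assms(3)] by (auto simp: B.dl_eq_iff)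
  qed
  then show ?thesis using A.dl_self[OF assms(5), of m] unfolding dirlim_map_def by blast
qed

lemma dirlim_map_hom:
  assumes "ring_endo A \<Phi>" "ring_endo B \<Psi>" "f \<in> ring_hom A B"
    "\<And>x. x \<in> carrier A \<Longrightarrow> f (\<Phi> x) = \<Psi> (f x)"
  shows "dirlim_map B \<Psi> f \<in> ring_hom (dirlim A \<Phi>) (dirlim B \<Psi>)"
proof -
  interpret A: ring_endo A \<Phi> by fact
  interpret B: ring_endo B \<Psi> by fact
  note d = dirlim_map_in[OF assms] and fc = ring_hom_closed[OF assms(3)]
  show ?thesis
  proof (rule ring_hom_memI)
    fix x assume "x \<in> carrier (dirlim A \<Phi>)"
    then show "dirlim_map B \<Psi> f x \<in> carrier (dirlim B \<Psi>)" by (auto simp: A.dirlim_carrier_iff d fc)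
  next
    fix x y assume "x \<in> carrier (dirlim A \<Phi>)" "y \<in> carrier (dirlim A \<Phi>)"
    then obtain m a b where "a \<in> carrier A" "b \<in> carrier A" "x = A.dl m a" "y = A.dl m b"
      by (rule A.dl_common)
    then show "dirlim_map B \<Psi> f (x \<otimes>\<^bsub>dirlim A \<Phi>\<^esub> y) = dirlim_map B \<Psi> f x \<otimes>\<^bsub>dirlim B \<Psi>\<^esub> dirlim_map B \<Psi> f y"
      "dirlim_map B \<Psi> f (x \<oplus>\<^bsub>dirlim A \<Phi>\<^esub> y) = dirlim_map B \<Psi> f x \<oplus>\<^bsub>dirlim B \<Psi>\<^esub> dirlim_map B \<Psi> f y"
      by (simp_all add: A.dl_mult A.dl_add B.dl_mult B.dl_add d fc ring_hom_mult[OF assms(3)] ring_hom_add[OF assms(3)])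
  qed (simp add: A.dl_one[of 0] B.dl_one[of 0] d ring_hom_one[OF assms(3)])
qed

section \<open>Localization at a non-zero-divisor\<close>

locale nzd_loc = cring +
  fixes s
  assumes s_closed [simp]: "s \<in> carrier R"
    and s_nzd: "x \<in> carrier R \<Longrightarrow> s \<otimes> x = \<zero> \<Longrightarrow> x = \<zero>"
begin

abbreviation "fr \<equiv> loc_frac R s"

lemma s_cancel:
  assumes "x \<in> carrier R" "y \<in> carrier R" "s [^] (n::nat) \<otimes> x = s [^] n \<otimes> y" shows "x = y"
  using assms
proof (induction n)
  case (Suc n)
  have c: "s [^] n \<otimes> x \<in> carrier R" "s [^] n \<otimes> y \<in> carrier R" using Suc.prems by auto
  have "s \<otimes> (s [^] n \<otimes> x) = s \<otimes> (s [^] n \<otimes> y)"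
    using Suc.prems(3) by (simp only: nat_pow_Suc2[OF s_closed] m_assoc[OF s_closed nat_pow_closed[OF s_closed]] Suc.prems(1,2))
  then have "s \<otimes> (s [^] n \<otimes> x \<ominus> s [^] n \<otimes> y) = \<zero>"
    using c by (simp add: a_minus_def r_distr r_minus r_neg)
  then have "s [^] n \<otimes> x \<ominus> s [^] n \<otimes> y = \<zero>" by (rule s_nzd[rotated]) (use c in simp)
  then have "s [^] n \<otimes> x = s [^] n \<otimes> y" using c by (simp add: r_right_minus_eq)
  then show ?case using Suc by blast
qed auto

lemma loc_rel_eq: "((a, m), (b, n)) \<in> loc_rel R s \<longleftrightarrow>
    a \<in> carrier R \<and> b \<in> carrier R \<and> s [^] n \<otimes> a = s [^] m \<otimes> b"
proof -
  have "s [^] n \<otimes> a = s [^] m \<otimes> b"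
    if "a \<in> carrier R" "b \<in> carrier R" "s [^] (n + k) \<otimes> a = s [^] (m + k) \<otimes> b" for k
  proof (rule s_cancel)
    show "s [^] k \<otimes> (s [^] n \<otimes> a) = s [^] k \<otimes> (s [^] m \<otimes> b)"
      using that by (simp add: m_assoc[symmetric] nat_pow_mult add.commute)
  qed (use that in auto)
  moreover have "s [^] (n + 0) \<otimes> a = s [^] (m + 0) \<otimes> b" if "s [^] n \<otimes> a = s [^] m \<otimes> b" using that by simp
  ultimately show ?thesis unfolding loc_rel_def by blast
qed

lemma loc_equiv: "equiv (carrier R \<times> UNIV) (loc_rel R s)"
proof (rule equivI)
  show "trans (loc_rel R s)"
  proof (rule transI, clarify)
    fix m a n b l c assume "((a, m), (b, n)) \<in> loc_rel R s" "((b, n), (c, l)) \<in> loc_rel R s"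
    then have c: "a \<in> carrier R" "b \<in> carrier R" "c \<in> carrier R"
      and 1: "s [^] n \<otimes> a = s [^] m \<otimes> b" and 2: "s [^] l \<otimes> b = s [^] n \<otimes> c"
      by (auto simp: loc_rel_eq)
    have "s [^] n \<otimes> (s [^] l \<otimes> a) = s [^] l \<otimes> (s [^] n \<otimes> a)" using c by (simp add: m_lcomm)
    also have "\<dots> = s [^] m \<otimes> (s [^] l \<otimes> b)" unfolding 1 using c by (simp add: m_lcomm)
    also have "\<dots> = s [^] n \<otimes> (s [^] m \<otimes> c)" unfolding 2 using c by (simp add: m_lcomm)
    finally have "s [^] l \<otimes> a = s [^] m \<otimes> c" using c s_cancel by (meson m_closed nat_pow_closed s_closed)
    then show "((a, m), (c, l)) \<in> loc_rel R s" using c by (auto simp: loc_rel_eq)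
  qed
  show "refl_on (carrier R \<times> UNIV) (loc_rel R s)" by (auto simp: refl_on_def loc_rel_eq)
  show "sym (loc_rel R s)" by (auto simp: sym_def loc_rel_eq)
qed (auto simp: loc_rel_eq loc_rel_def)

lemma fr_eq_iff: "a \<in> carrier R \<Longrightarrow> b \<in> carrier R \<Longrightarrow>
    fr a m = fr b n \<longleftrightarrow> s [^] n \<otimes> a = s [^] m \<otimes> b"
  using eq_equiv_class_iff[OF loc_equiv, of "(a, m)" "(b, n)"]
  by (simp add: loc_frac_def) (simp add: loc_rel_eq)

lemma fr_mem: "(b, n) \<in> fr a m \<Longrightarrow> a \<in> carrier R \<Longrightarrow> b \<in> carrier R \<and> fr b n = fr a m"
  using fr_eq_iff[of b a n m] by (auto simp: loc_frac_def loc_rel_eq)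

lemma fr_self: "a \<in> carrier R \<Longrightarrow> (a, m) \<in> fr a m"
  by (auto simp: loc_frac_def loc_rel_eq)

lemma loc_carrier_iff: "x \<in> carrier (loc R s) \<longleftrightarrow> (\<exists>a\<in>carrier R. \<exists>m. x = fr a m)"
  by (auto simp: loc_def quotient_def loc_frac_def)

lemma fr_closed [simp]: "a \<in> carrier R \<Longrightarrow> fr a m \<in> carrier (loc R s)"
  by (auto simp: loc_carrier_iff)

lemma fr_step: "a \<in> carrier R \<Longrightarrow> fr (s [^] k \<otimes> a) (m + k) = fr a m"
  by (simp add: fr_eq_iff nat_pow_mult[symmetric] m_assoc)

lemma fr_common:
  assumes "x \<in> carrier (loc R s)" "y \<in> carrier (loc R s)"
  obtains m a b where "a \<in> carrier R" "b \<in> carrier R" "x = fr a m" "y = fr b m"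
proof -
  obtain m a n b where *: "a \<in> carrier R" "b \<in> carrier R" "x = fr a m" "y = fr b n"
    using assms by (auto simp: loc_carrier_iff)
  have "x = fr (s [^] n \<otimes> a) (m + n)" "y = fr (s [^] m \<otimes> b) (m + n)"
    using * fr_step[of a n m] fr_step[of b m n] by (simp_all add: add.commute)
  from that[OF _ _ this] show ?thesis using * by simp
qed

lemma fr_mult:
  assumes "a \<in> carrier R" "b \<in> carrier R"
  shows "fr a m \<otimes>\<^bsub>loc R s\<^esub> fr b n = fr (a \<otimes> b) (m + n)"
proof -
  have "fr (a' \<otimes> b') (m' + n') = fr (a \<otimes> b) (m + n)" if "(a', m') \<in> fr a m" "(b', n') \<in> fr b n" for a' m' b' n'
  proof -
    have 1: "a' \<in> carrier R" "b' \<in> carrier R" and 2: "s [^] m \<otimes> a' = s [^] m' \<otimes> a" "s [^] n \<otimes> b' = s [^] n' \<otimes> b"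
      using fr_mem[OF that(1) assms(1)] fr_mem[OF that(2) assms(2)] assms by (auto simp: fr_eq_iff)
    have "s [^] (m + n) \<otimes> (a' \<otimes> b') = (s [^] m \<otimes> a') \<otimes> (s [^] n \<otimes> b')"
      using 1 by (simp add: nat_pow_mult[symmetric] m_ac)
    also have "\<dots> = s [^] (m' + n') \<otimes> (a \<otimes> b)"
      unfolding 2 using assms by (simp add: nat_pow_mult[symmetric] m_ac)
    finally show ?thesis using 1 assms by (simp add: fr_eq_iff)
  qed
  then have "fr a m \<otimes>\<^bsub>loc R s\<^esub> fr b n = (\<Union>(a', m')\<in>fr a m. \<Union>(b', n')\<in>fr b n. fr (a \<otimes> b) (m + n))"
    unfolding loc_def by (simp del: UN_constant UN_simps, intro SUP_cong refl) (auto simp del: UN_constant)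
  also have "\<dots> = fr (a \<otimes> b) (m + n)" using fr_self[OF assms(1), of m] fr_self[OF assms(2), of n] by auto
  finally show ?thesis .
qed

lemma fr_add_gen:
  assumes "a \<in> carrier R" "b \<in> carrier R"
  shows "fr a m \<oplus>\<^bsub>loc R s\<^esub> fr b n = fr (s [^] n \<otimes> a \<oplus> s [^] m \<otimes> b) (m + n)"
proof -
  have "fr (s [^] n' \<otimes> a' \<oplus> s [^] m' \<otimes> b') (m' + n') = fr (s [^] n \<otimes> a \<oplus> s [^] m \<otimes> b) (m + n)"
    if "(a', m') \<in> fr a m" "(b', n') \<in> fr b n" for a' m' b' n'
  proof -
    have 1: "a' \<in> carrier R" "b' \<in> carrier R" and 2: "s [^] m \<otimes> a' = s [^] m' \<otimes> a" "s [^] n \<otimes> b' = s [^] n' \<otimes> b"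
      using fr_mem[OF that(1) assms(1)] fr_mem[OF that(2) assms(2)] assms by (auto simp: fr_eq_iff)
    have "s [^] (m + n) \<otimes> (s [^] n' \<otimes> a' \<oplus> s [^] m' \<otimes> b') =
        s [^] n \<otimes> s [^] n' \<otimes> (s [^] m \<otimes> a') \<oplus> s [^] m \<otimes> s [^] m' \<otimes> (s [^] n \<otimes> b')"
      using 1 by (simp add: nat_pow_mult[symmetric] m_ac r_distr)
    also have "\<dots> = s [^] (m' + n') \<otimes> (s [^] n \<otimes> a \<oplus> s [^] m \<otimes> b)"
      unfolding 2 using assms by (simp add: nat_pow_mult[symmetric] m_ac r_distr)
    finally show ?thesis using 1 assms by (simp add: fr_eq_iff)
  qed
  then have "fr a m \<oplus>\<^bsub>loc R s\<^esub> fr b n = (\<Union>(a', m')\<in>fr a m. \<Union>(b', n')\<in>fr b n. fr (s [^] n \<otimes> a \<oplus> s [^] m \<otimes> b) (m + n))"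
    unfolding loc_def by (simp del: UN_constant UN_simps, intro SUP_cong refl) (auto simp del: UN_constant)
  also have "\<dots> = fr (s [^] n \<otimes> a \<oplus> s [^] m \<otimes> b) (m + n)"
    using fr_self[OF assms(1), of m] fr_self[OF assms(2), of n] by auto
  finally show ?thesis .
qed

lemma fr_add:
  assumes "a \<in> carrier R" "b \<in> carrier R"
  shows "fr a m \<oplus>\<^bsub>loc R s\<^esub> fr b m = fr (a \<oplus> b) m"
  using assms fr_step[of "a \<oplus> b" m m] by (simp add: fr_add_gen r_distr)

lemma fr_one: "\<one>\<^bsub>loc R s\<^esub> = fr \<one> 0" by (simp add: loc_def)

lemma fr_zero: "\<zero>\<^bsub>loc R s\<^esub> = fr \<zero> m"
  using fr_step[of \<zero> m 0] by (simp add: loc_def)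

lemma fr_common3:
  assumes "x \<in> carrier (loc R s)" "y \<in> carrier (loc R s)" "z \<in> carrier (loc R s)"
  obtains m a b c where "a \<in> carrier R" "b \<in> carrier R" "c \<in> carrier R" "x = fr a m" "y = fr b m" "z = fr c m"
proof -
  obtain m a b where 1: "a \<in> carrier R" "b \<in> carrier R" "x = fr a m" "y = fr b m"
    using fr_common[OF assms(1,2)] .
  obtain n c where 2: "c \<in> carrier R" "z = fr c n" using assms(3) by (auto simp: loc_carrier_iff)
  have "x = fr (s [^] n \<otimes> a) (m + n)" "y = fr (s [^] n \<otimes> b) (m + n)" "z = fr (s [^] m \<otimes> c) (m + n)"
    using 1 2 fr_step[of a n m] fr_step[of b n m] fr_step[of c m n] by (simp_all add: add.commute)
  from that[OF _ _ _ this] show ?thesis using 1 2 by simp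
qed

lemma loc_cring: "cring (loc R s)"
proof (rule cringI)
  show "abelian_group (loc R s)"
  proof (rule abelian_groupI)
    fix x y z assume *: "x \<in> carrier (loc R s)" "y \<in> carrier (loc R s)" "z \<in> carrier (loc R s)"
    show "x \<oplus>\<^bsub>loc R s\<^esub> y \<oplus>\<^bsub>loc R s\<^esub> z = x \<oplus>\<^bsub>loc R s\<^esub> (y \<oplus>\<^bsub>loc R s\<^esub> z)"
      by (rule fr_common3[OF *]) (simp add: fr_add a_assoc)
  next
    fix x assume "x \<in> carrier (loc R s)"
    then obtain m a where a: "a \<in> carrier R" "x = fr a m" by (auto simp: loc_carrier_iff)
    show "\<zero>\<^bsub>loc R s\<^esub> \<oplus>\<^bsub>loc R s\<^esub> x = x" using a by (simp add: fr_add fr_zero[of m])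
    show "\<exists>y\<in>carrier (loc R s). y \<oplus>\<^bsub>loc R s\<^esub> x = \<zero>\<^bsub>loc R s\<^esub>"
      using a by (intro bexI[of _ "fr (\<ominus> a) m"]) (simp_all add: fr_add fr_zero[of m] l_neg)
  next
    fix x y assume *: "x \<in> carrier (loc R s)" "y \<in> carrier (loc R s)"
    show "x \<oplus>\<^bsub>loc R s\<^esub> y \<in> carrier (loc R s)"
      "x \<oplus>\<^bsub>loc R s\<^esub> y = y \<oplus>\<^bsub>loc R s\<^esub> x"
      by (rule fr_common[OF *], simp add: fr_add a_comm)+
  qed (simp add: fr_zero[of 0])
  show "comm_monoid (loc R s)"
  proof (rule comm_monoidI)
    fix x y z assume *: "x \<in> carrier (loc R s)" "y \<in> carrier (loc R s)" "z \<in> carrier (loc R s)"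
    show "x \<otimes>\<^bsub>loc R s\<^esub> y \<otimes>\<^bsub>loc R s\<^esub> z = x \<otimes>\<^bsub>loc R s\<^esub> (y \<otimes>\<^bsub>loc R s\<^esub> z)"
      by (rule fr_common3[OF *]) (simp add: fr_mult m_assoc add_ac)
  next
    fix x assume "x \<in> carrier (loc R s)"
    then obtain m a where a: "a \<in> carrier R" "x = fr a m" by (auto simp: loc_carrier_iff)
    show "\<one>\<^bsub>loc R s\<^esub> \<otimes>\<^bsub>loc R s\<^esub> x = x" using a by (simp add: fr_mult fr_one)
  next
    fix x y assume *: "x \<in> carrier (loc R s)" "y \<in> carrier (loc R s)"
    show "x \<otimes>\<^bsub>loc R s\<^esub> y \<in> carrier (loc R s)"
      "x \<otimes>\<^bsub>loc R s\<^esub> y = y \<otimes>\<^bsub>loc R s\<^esub> x"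
      by (rule fr_common[OF *], simp add: fr_mult m_comm)+
  qed (simp add: fr_one)
next
  fix x y z assume *: "x \<in> carrier (loc R s)" "y \<in> carrier (loc R s)" "z \<in> carrier (loc R s)"
  show "(x \<oplus>\<^bsub>loc R s\<^esub> y) \<otimes>\<^bsub>loc R s\<^esub> z =
      x \<otimes>\<^bsub>loc R s\<^esub> z \<oplus>\<^bsub>loc R s\<^esub> y \<otimes>\<^bsub>loc R s\<^esub> z"
    by (rule fr_common3[OF *]) (simp add: fr_mult fr_add l_distr)
qed

lemma fr_hom: "(\<lambda>a. fr a 0) \<in> ring_hom R (loc R s)"
  by (rule ring_hom_memI) (simp_all add: fr_mult fr_add fr_one)

end

section \<open>Maps between localizations\<close>

lemma loc_map_frac:
  assumes "nzd_loc A s" "nzd_loc B t" "f \<in> ring_hom A B" "f s = t" "a \<in> carrier A"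
  shows "loc_map B t f (loc_frac A s a m) = loc_frac B t (f a) m"
proof -
  interpret A: nzd_loc A s by fact
  interpret B: nzd_loc B t by fact
  note fc = ring_hom_closed[OF assms(3)]
  have "B.fr (f b) n = B.fr (f a) m" if "(b, n) \<in> A.fr a m" for n b
  proof -
    have b: "b \<in> carrier A" "s [^]\<^bsub>A\<^esub> m \<otimes>\<^bsub>A\<^esub> b = s [^]\<^bsub>A\<^esub> n \<otimes>\<^bsub>A\<^esub> a"
      using A.fr_mem[OF that assms(5)] assms(5) by (auto simp: A.fr_eq_iff)
    then have "f (s [^]\<^bsub>A\<^esub> m \<otimes>\<^bsub>A\<^esub> b) = f (s [^]\<^bsub>A\<^esub> n \<otimes>\<^bsub>A\<^esub> a)" by simp
    then have "t [^]\<^bsub>B\<^esub> m \<otimes>\<^bsub>B\<^esub> f b = t [^]\<^bsub>B\<^esub> n \<otimes>\<^bsub>B\<^esub> f a"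
      using b(1) assms(5) by (simp add: ring_hom_mult[OF assms(3)] ring_hom_pow[OF A.cring_axioms B.cring_axioms assms(3)] assms(4))
    then show ?thesis using b assms(5) fc by (auto simp: B.fr_eq_iff)
  qed
  then show ?thesis using A.fr_self[OF assms(5), of m] unfolding loc_map_def by blast
qed

lemma loc_map_hom:
  assumes "nzd_loc A s" "nzd_loc B t" "f \<in> ring_hom A B" "f s = t"
  shows "loc_map B t f \<in> ring_hom (loc A s) (loc B t)"
proof -
  interpret A: nzd_loc A s by fact
  interpret B: nzd_loc B t by fact
  note d = loc_map_frac[OF assms] and fc = ring_hom_closed[OF assms(3)]
  show ?thesis
  proof (rule ring_hom_memI)
    fix x assume "x \<in> carrier (loc A s)"
    then show "loc_map B t f x \<in> carrier (loc B t)" by (auto simp: A.loc_carrier_iff d fc)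
  next
    fix x y assume "x \<in> carrier (loc A s)" "y \<in> carrier (loc A s)"
    then obtain m a b where "a \<in> carrier A" "b \<in> carrier A" "x = A.fr a m" "y = A.fr b m"
      by (rule A.fr_common)
    then show "loc_map B t f (x \<otimes>\<^bsub>loc A s\<^esub> y) = loc_map B t f x \<otimes>\<^bsub>loc B t\<^esub> loc_map B t f y"
      "loc_map B t f (x \<oplus>\<^bsub>loc A s\<^esub> y) = loc_map B t f x \<oplus>\<^bsub>loc B t\<^esub> loc_map B t f y"
      by (simp_all add: A.fr_mult A.fr_add B.fr_mult B.fr_add d fc ring_hom_mult[OF assms(3)] ring_hom_add[OF assms(3)])
  qed (simp add: A.fr_one B.fr_one d ring_hom_one[OF assms(3)])
qed

section \<open>Tensor products\<close>

lemma frag_extend_fun_add: "frag_extend (\<lambda>x. f x + g x) u = frag_extend f u + frag_extend g u"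
  by (simp add: frag_extend_def frag_cmul_distrib2 sum.distrib)

lemma frag_extend_fun_diff: "frag_extend (\<lambda>x. f x - g x) u = frag_extend f u - frag_extend g u"
  using frag_extend_fun_add[of "\<lambda>x. f x - g x" g u] by (simp add: eq_diff_eq)

lemma frag_extend_fun_zero [simp]: "frag_extend (\<lambda>x. 0) u = 0"
  by (simp add: frag_extend_def)

locale tensor_pair = A: algebra R A + B: algebra R B for R :: "('r, 'k) ring_scheme"
  and A :: "('r, 'a, 'm) module_scheme" and B :: "('r, 'b, 'n) module_scheme"
begin

text \<open>The product of the integral monoid ring of \<open>A \<times> B\<close> as a plain
  function on the free group. Additivity in each argument turns the ring laws into checks on
  generators, carried out with \<open>FC_induct\<close>.\<close>

definition "tmul u v = frag_extend (\<lambda>x. frag_extend (\<lambda>y. frag_of (fst x \<otimes>\<^bsub>A\<^esub> fst y, snd x \<otimes>\<^bsub>B\<^esub> snd y)) v) u"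

abbreviation "F \<equiv> tensor_free A B"
abbreviation "I \<equiv> tensor_ideal R A B"
abbreviation "T \<equiv> tensor R A B"
abbreviation "tin \<equiv> tensor_in R A B"
definition "FC = {u. Poly_Mapping.keys u \<subseteq> carrier A \<times> carrier B}"

lemma F_simps: "carrier F = FC" "u \<otimes>\<^bsub>F\<^esub> v = tmul u v" "\<one>\<^bsub>F\<^esub> = frag_of (\<one>\<^bsub>A\<^esub>, \<one>\<^bsub>B\<^esub>)"
  "\<zero>\<^bsub>F\<^esub> = 0" "u \<oplus>\<^bsub>F\<^esub> v = u + v"
  by (auto simp: tensor_free_def tmul_def case_prod_unfold FC_def)

lemma tmul_diff1: "tmul (u - u') v = tmul u v - tmul u' v"
  by (simp add: tmul_def frag_extend_diff)
lemma tmul_diff2: "tmul u (v - v') = tmul u v - tmul u v'"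
  by (simp add: tmul_def frag_extend_diff frag_extend_fun_diff)
lemma tmul_add1: "tmul (u + u') v = tmul u v + tmul u' v"
  by (simp add: tmul_def frag_extend_add)
lemma tmul_zero [simp]: "tmul 0 v = 0" "tmul u 0 = 0"
  by (simp_all add: tmul_def)
lemma tmul_neg1: "tmul (- u) v = - tmul u v"
  using tmul_diff1[of 0 u v] by simp
lemma tmul_of: "tmul (frag_of (a, b)) (frag_of (a', b')) = frag_of (a \<otimes>\<^bsub>A\<^esub> a', b \<otimes>\<^bsub>B\<^esub> b')"
  by (simp add: tmul_def)

lemma FC_of: "a \<in> carrier A \<Longrightarrow> b \<in> carrier B \<Longrightarrow> frag_of (a, b) \<in> FC"
  by (simp add: keys_frag_of FC_def)
lemma FC_diff: "u \<in> FC \<Longrightarrow> v \<in> FC \<Longrightarrow> u - v \<in> FC"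
  using keys_diff[of u v] by (auto simp: FC_def)
lemma FC_add: "u \<in> FC \<Longrightarrow> v \<in> FC \<Longrightarrow> u + v \<in> FC"
  using Poly_Mapping.keys_add[of u v] by (auto simp: FC_def)
lemma FC_zero: "0 \<in> FC"
  by (simp add: FC_def)
lemma FC_neg: "u \<in> FC \<Longrightarrow> - u \<in> FC"
  by (simp add: FC_def)

lemma FC_induct [consumes 1, case_names zero one diff]:
  assumes "u \<in> FC" "P 0" "\<And>a b. a \<in> carrier A \<Longrightarrow> b \<in> carrier B \<Longrightarrow> P (frag_of (a, b))"
    "\<And>u v. u \<in> FC \<Longrightarrow> v \<in> FC \<Longrightarrow> P u \<Longrightarrow> P v \<Longrightarrow> P (u - v)"
  shows "P u"
proof -
  have "Poly_Mapping.keys u \<subseteq> carrier A \<times> carrier B" using assms(1) by (simp add: FC_def)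
  then have "u \<in> FC \<and> P u"
  proof (induction u rule: frag_induction)
    case (diff a b)
    then show ?case using FC_diff[of a b] assms(4) by blast
  qed (use assms FC_zero in \<open>auto intro: FC_of\<close>)
  then show ?thesis by blast
qed

lemma tmul_closed:
  assumes "u \<in> FC" "v \<in> FC" shows "tmul u v \<in> FC"
  using assms(1)
proof (induction u rule: FC_induct)
  case (one a b)
  show ?case using assms(2)
    by (induction v rule: FC_induct) (auto simp: tmul_of tmul_diff2 one FC_zero intro: FC_diff FC_of)
qed (auto simp: tmul_diff1 FC_zero intro: FC_diff)

lemma tmul_comm: "u \<in> FC \<Longrightarrow> v \<in> FC \<Longrightarrow> tmul u v = tmul v u"
proof (induction u rule: FC_induct)
  case (one a b)
  show ?case using one(3)
    by (induction v rule: FC_induct) (auto simp: tmul_of tmul_diff1 tmul_diff2 one A.m_comm B.m_comm)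
qed (auto simp: tmul_diff1 tmul_diff2)

lemma tmul_assoc: "u \<in> FC \<Longrightarrow> v \<in> FC \<Longrightarrow> w \<in> FC \<Longrightarrow> tmul (tmul u v) w = tmul u (tmul v w)"
proof (induction u rule: FC_induct)
  case (one a b)
  note ab = one(1,2) and w = one(4)
  show ?case using one(3)
  proof (induction v rule: FC_induct)
    case (one a' b')
    show ?case using w
      by (induction w rule: FC_induct) (auto simp: tmul_of tmul_diff2 one ab A.m_assoc B.m_assoc)
  qed (auto simp: tmul_diff1 tmul_diff2)
qed (auto simp: tmul_diff1)

lemma tmul_one: "u \<in> FC \<Longrightarrow> tmul (frag_of (\<one>\<^bsub>A\<^esub>, \<one>\<^bsub>B\<^esub>)) u = u"
  by (induction u rule: FC_induct) (auto simp: tmul_of tmul_diff2)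

lemma F_cring: "cring F"
proof (rule cringI)
  show "abelian_group F"
  proof (rule abelian_groupI)
    fix x assume "x \<in> carrier F"
    then show "\<exists>y\<in>carrier F. y \<oplus>\<^bsub>F\<^esub> x = \<zero>\<^bsub>F\<^esub>"
      by (intro bexI[of _ "- x"]) (auto simp: F_simps FC_neg)
  qed (auto simp: F_simps add_ac FC_zero FC_add)
  show "comm_monoid F"
    by (rule comm_monoidI) (use tmul_closed tmul_assoc tmul_one tmul_comm in \<open>auto simp: F_simps FC_of\<close>)
qed (auto simp: F_simps tmul_add1)

sublocale F: cring F by (rule F_cring)

lemma F_minus: "u \<in> FC \<Longrightarrow> \<ominus>\<^bsub>F\<^esub> u = - u"
  by (rule F.minus_equality) (auto simp: F_simps FC_neg)

lemma F_diff: "u \<in> FC \<Longrightarrow> v \<in> FC \<Longrightarrow> u \<ominus>\<^bsub>F\<^esub> v = u - v"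
  by (simp add: a_minus_def F_minus) (simp add: F_simps)

lemma relators_FC: "tensor_relators R A B \<subseteq> FC"
  unfolding tensor_relators_def by (auto intro!: FC_diff FC_of)

lemma I_ideal: "ideal I F"
  unfolding tensor_ideal_def using relators_FC by (intro F.genideal_ideal) (simp add: F_simps)

lemma relators_I: "tensor_relators R A B \<subseteq> I"
  unfolding tensor_ideal_def using relators_FC by (intro F.genideal_self) (simp add: F_simps)

lemma I_minimal: "ideal J F \<Longrightarrow> tensor_relators R A B \<subseteq> J \<Longrightarrow> I \<subseteq> J"
  unfolding tensor_ideal_def by (rule F.genideal_minimal)

lemma I_FC: "I \<subseteq> FC"
  using ideal.Icarr[OF I_ideal] by (auto simp: F_simps)

lemma T_cring: "cring T"
  unfolding tensor_def by (rule ideal.quotient_is_cring[OF I_ideal F_cring])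

sublocale T: cring T by (rule T_cring)

lemma T_carrier_iff: "x \<in> carrier T \<longleftrightarrow> (\<exists>u\<in>FC. x = I +>\<^bsub>F\<^esub> u)"
  unfolding tensor_def F.quot_carrier by (auto simp: F_simps)

lemma T_coset_eq_iff: "u \<in> FC \<Longrightarrow> v \<in> FC \<Longrightarrow> I +>\<^bsub>F\<^esub> u = I +>\<^bsub>F\<^esub> v \<longleftrightarrow> u - v \<in> I"
  using F.ideal_coset_eq_iff[OF I_ideal, of u v] by (simp add: F_simps F_diff)

lemma T_coset_mem_iff: "u \<in> FC \<Longrightarrow> v \<in> I +>\<^bsub>F\<^esub> u \<longleftrightarrow> v \<in> FC \<and> v - u \<in> I"
  using F.ideal_coset_mem_iff[OF I_ideal, of u v] by (auto simp: F_simps F_diff)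

lemma T_add: "u \<in> FC \<Longrightarrow> v \<in> FC \<Longrightarrow> (I +>\<^bsub>F\<^esub> u) \<oplus>\<^bsub>T\<^esub> (I +>\<^bsub>F\<^esub> v) = I +>\<^bsub>F\<^esub> (u + v)"
  using F.quot_add[OF I_ideal, of u v] by (simp add: F_simps tensor_def)
lemma T_mult: "u \<in> FC \<Longrightarrow> v \<in> FC \<Longrightarrow> (I +>\<^bsub>F\<^esub> u) \<otimes>\<^bsub>T\<^esub> (I +>\<^bsub>F\<^esub> v) = I +>\<^bsub>F\<^esub> (tmul u v)"
  using F.quot_mult[OF I_ideal, of u v] by (simp add: F_simps tensor_def)
lemma T_zero: "\<zero>\<^bsub>T\<^esub> = I +>\<^bsub>F\<^esub> 0"
  using F.quot_zero[OF I_ideal] by (simp add: F_simps tensor_def)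
lemma T_one: "\<one>\<^bsub>T\<^esub> = I +>\<^bsub>F\<^esub> frag_of (\<one>\<^bsub>A\<^esub>, \<one>\<^bsub>B\<^esub>)"
  using F.quot_one[of I] by (simp add: F_simps tensor_def)

lemma tin_def: "tin a b = I +>\<^bsub>F\<^esub> frag_of (a, b)"
  by (simp add: tensor_in_def)

lemma tin_closed [simp, intro]: "a \<in> carrier A \<Longrightarrow> b \<in> carrier B \<Longrightarrow> tin a b \<in> carrier T"
  using FC_of by (auto simp: T_carrier_iff tin_def)

lemma tin_mult: "a \<in> carrier A \<Longrightarrow> b \<in> carrier B \<Longrightarrow> a' \<in> carrier A \<Longrightarrow> b' \<in> carrier B \<Longrightarrow>
    tin a b \<otimes>\<^bsub>T\<^esub> tin a' b' = tin (a \<otimes>\<^bsub>A\<^esub> a') (b \<otimes>\<^bsub>B\<^esub> b')"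
  using FC_of by (simp add: tin_def T_mult tmul_of)

lemma tin_one: "tin \<one>\<^bsub>A\<^esub> \<one>\<^bsub>B\<^esub> = \<one>\<^bsub>T\<^esub>"
  by (simp add: T_one tin_def)

lemma tin_add1:
  assumes "a \<in> carrier A" "a' \<in> carrier A" "b \<in> carrier B"
  shows "tin (a \<oplus>\<^bsub>A\<^esub> a') b = tin a b \<oplus>\<^bsub>T\<^esub> tin a' b"
proof -
  have "frag_of (a \<oplus>\<^bsub>A\<^esub> a', b) - frag_of (a, b) - frag_of (a', b) \<in> I"
    using relators_I assms unfolding tensor_relators_def by blast
  moreover have "frag_of (a, b) \<in> FC" "frag_of (a', b) \<in> FC" "frag_of (a \<oplus>\<^bsub>A\<^esub> a', b) \<in> FC"
    using assms by (auto intro: FC_of)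
  ultimately show ?thesis by (simp add: tin_def T_add T_coset_eq_iff FC_add diff_diff_eq)
qed

lemma tin_add2:
  assumes "a \<in> carrier A" "b' \<in> carrier B" "b \<in> carrier B"
  shows "tin a (b \<oplus>\<^bsub>B\<^esub> b') = tin a b \<oplus>\<^bsub>T\<^esub> tin a b'"
proof -
  have "frag_of (a, b \<oplus>\<^bsub>B\<^esub> b') - frag_of (a, b) - frag_of (a, b') \<in> I"
    using relators_I assms unfolding tensor_relators_def by blast
  moreover have "frag_of (a, b) \<in> FC" "frag_of (a, b') \<in> FC" "frag_of (a, b \<oplus>\<^bsub>B\<^esub> b') \<in> FC"
    using assms by (auto intro: FC_of)
  ultimately show ?thesis by (simp add: tin_def T_add T_coset_eq_iff FC_add diff_diff_eq)
qed

lemma tin_smult: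
  assumes "r \<in> carrier R" "a \<in> carrier A" "b \<in> carrier B"
  shows "tin (r \<odot>\<^bsub>A\<^esub> a) b = tin a (r \<odot>\<^bsub>B\<^esub> b)"
proof -
  have "frag_of (r \<odot>\<^bsub>A\<^esub> a, b) - frag_of (a, r \<odot>\<^bsub>B\<^esub> b) \<in> I"
    using relators_I assms unfolding tensor_relators_def by blast
  then show ?thesis using assms FC_of by (simp add: tin_def T_coset_eq_iff)
qed

lemma tin_hom1: "(\<lambda>a. tin a \<one>\<^bsub>B\<^esub>) \<in> ring_hom A T"
  by (rule ring_hom_memI) (simp_all add: tin_mult tin_add1 tin_one)

lemma tin_hom2: "tin \<one>\<^bsub>A\<^esub> \<in> ring_hom B T"
  by (rule ring_hom_memI) (simp_all add: tin_mult tin_add2 tin_one)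

lemma tin_split: "a \<in> carrier A \<Longrightarrow> b \<in> carrier B \<Longrightarrow> tin a b = tin a \<one>\<^bsub>B\<^esub> \<otimes>\<^bsub>T\<^esub> tin \<one>\<^bsub>A\<^esub> b"
  by (simp add: tin_mult)

lemma tin_neg: "a \<in> carrier A \<Longrightarrow> b \<in> carrier B \<Longrightarrow> tin (\<ominus>\<^bsub>A\<^esub> a) b = \<ominus>\<^bsub>T\<^esub> tin a b"
proof -
  assume *: "a \<in> carrier A" "b \<in> carrier B"
  have "tin \<zero>\<^bsub>A\<^esub> b \<oplus>\<^bsub>T\<^esub> tin \<zero>\<^bsub>A\<^esub> b = tin \<zero>\<^bsub>A\<^esub> b"
    using tin_add1[of "\<zero>\<^bsub>A\<^esub>" "\<zero>\<^bsub>A\<^esub>" b] * by simp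
  then have "tin \<zero>\<^bsub>A\<^esub> b = \<zero>\<^bsub>T\<^esub>" using * by (simp add: T.add.l_cancel_one)
  moreover have "tin (\<ominus>\<^bsub>A\<^esub> a) b \<oplus>\<^bsub>T\<^esub> tin a b = tin \<zero>\<^bsub>A\<^esub> b"
    using tin_add1[of "\<ominus>\<^bsub>A\<^esub> a" a b] * by (simp add: A.l_neg)
  ultimately show ?thesis using * by (simp add: T.minus_equality)
qed

text \<open>Minus a pure tensor is a pure tensor, so sums of pure tensors exhaust the tensor
  product. Since induction in the free group passes to differences, the property is carried along
  for a class and for its negative together.\<close>

lemma T_induct [consumes 1, case_names gen add]:
  assumes "x \<in> carrier T"
    and gen: "\<And>a b. a \<in> carrier A \<Longrightarrow> b \<in> carrier B \<Longrightarrow> P (tin a b)"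
    and add: "\<And>x y. x \<in> carrier T \<Longrightarrow> y \<in> carrier T \<Longrightarrow> P x \<Longrightarrow> P y \<Longrightarrow> P (x \<oplus>\<^bsub>T\<^esub> y)"
  shows "P x"
proof -
  obtain u where u: "u \<in> FC" "x = I +>\<^bsub>F\<^esub> u" using assms(1) by (auto simp: T_carrier_iff)
  have neg: "\<ominus>\<^bsub>T\<^esub> (I +>\<^bsub>F\<^esub> u) = I +>\<^bsub>F\<^esub> (- u)" if "u \<in> FC" for u
    using that FC_neg[OF that] by (intro T.minus_equality) (auto simp: T_carrier_iff T_add T_zero)
  \<comment> \<open>Zero is reached as the sum of the pure tensors \<open>1 \<otimes> 1\<close> and
    \<open>(-1) \<otimes> 1\<close>.\<close>
  have P0: "P \<zero>\<^bsub>T\<^esub>"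
    using add[OF _ _ gen[of "\<one>\<^bsub>A\<^esub>" "\<one>\<^bsub>B\<^esub>"] gen[of "\<ominus>\<^bsub>A\<^esub> \<one>\<^bsub>A\<^esub>" "\<one>\<^bsub>B\<^esub>"]]
    by (simp add: tin_neg T.r_neg)
  from u(1) have "u \<in> FC \<and> P (I +>\<^bsub>F\<^esub> u) \<and> P (\<ominus>\<^bsub>T\<^esub> (I +>\<^bsub>F\<^esub> u))"
  proof (induction u rule: FC_induct)
    case zero
    then show ?case using P0 FC_zero by (simp add: T_zero[symmetric])
  next
    case (one a b)
    then show ?case using gen[of a b] gen[of "\<ominus>\<^bsub>A\<^esub> a" b] FC_of by (simp add: tin_neg tin_def[symmetric])
  next
    case (diff u v)
    have *: "- v \<in> FC" "- u \<in> FC" "u - v \<in> FC" using diff FC_diff FC_neg by auto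
    then have 1: "I +>\<^bsub>F\<^esub> (u - v) = (I +>\<^bsub>F\<^esub> u) \<oplus>\<^bsub>T\<^esub> \<ominus>\<^bsub>T\<^esub> (I +>\<^bsub>F\<^esub> v)"
      using diff by (simp add: neg T_add)
    have 2: "\<ominus>\<^bsub>T\<^esub> (I +>\<^bsub>F\<^esub> (u - v)) = \<ominus>\<^bsub>T\<^esub> (I +>\<^bsub>F\<^esub> u) \<oplus>\<^bsub>T\<^esub> (I +>\<^bsub>F\<^esub> v)"
      using diff * by (simp add: neg T_add)
    have c: "I +>\<^bsub>F\<^esub> u \<in> carrier T" "I +>\<^bsub>F\<^esub> v \<in> carrier T" using diff by (auto simp: T_carrier_iff)
    have "P (I +>\<^bsub>F\<^esub> (u - v))" unfolding 1 using diff c by (intro add) auto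
    moreover have "P (\<ominus>\<^bsub>T\<^esub> (I +>\<^bsub>F\<^esub> (u - v)))" unfolding 2 using diff c by (intro add) auto
    ultimately show ?case using *(3) by blast
  qed
  then show ?thesis using u by simp
qed

text \<open>An additive map kills the ideal generated by the relators as soon as it kills the relators, since
  the largest ideal inside its kernel contains them.\<close>

lemma T_universal:
  assumes G: "abelian_group G"
    and cl: "\<And>a b. a \<in> carrier A \<Longrightarrow> b \<in> carrier B \<Longrightarrow> \<beta> a b \<in> carrier G"
    and add1: "\<And>a a' b. a \<in> carrier A \<Longrightarrow> a' \<in> carrier A \<Longrightarrow> b \<in> carrier B \<Longrightarrow> \<beta> (a \<oplus>\<^bsub>A\<^esub> a') b = \<beta> a b \<oplus>\<^bsub>G\<^esub> \<beta> a' b"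
    and add2: "\<And>a b b'. a \<in> carrier A \<Longrightarrow> b \<in> carrier B \<Longrightarrow> b' \<in> carrier B \<Longrightarrow> \<beta> a (b \<oplus>\<^bsub>B\<^esub> b') = \<beta> a b \<oplus>\<^bsub>G\<^esub> \<beta> a b'"
    and bal: "\<And>r a b. r \<in> carrier R \<Longrightarrow> a \<in> carrier A \<Longrightarrow> b \<in> carrier B \<Longrightarrow> \<beta> (r \<odot>\<^bsub>A\<^esub> a) b = \<beta> a (r \<odot>\<^bsub>B\<^esub> b)"
  obtains h where "\<And>x. x \<in> carrier T \<Longrightarrow> h x \<in> carrier G"
    "\<And>x y. x \<in> carrier T \<Longrightarrow> y \<in> carrier T \<Longrightarrow> h (x \<oplus>\<^bsub>T\<^esub> y) = h x \<oplus>\<^bsub>G\<^esub> h y"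
    "\<And>a b. a \<in> carrier A \<Longrightarrow> b \<in> carrier B \<Longrightarrow> h (tin a b) = \<beta> a b"
proof -
  interpret G: abelian_group G by fact
  have im: "(\<lambda>(a, b). \<beta> a b) ` (carrier A \<times> carrier B) \<subseteq> carrier (add_monoid G)" using cl by auto
  obtain g where g: "g \<in> hom (free_Abelian_group (carrier A \<times> carrier B)) (add_monoid G)"
    and gof: "\<And>x. x \<in> carrier A \<times> carrier B \<Longrightarrow> g (frag_of x) = (\<lambda>(a, b). \<beta> a b) x"
    by (rule comm_group.free_Abelian_group_universal[OF G.a_comm_group im]) (erule that, blast)
  have gc: "g u \<in> carrier G" if "u \<in> FC" for u using g that by (auto simp: hom_def FC_def)
  have gadd: "g (u + v) = g u \<oplus>\<^bsub>G\<^esub> g v" if "u \<in> FC" "v \<in> FC" for u v using g that by (auto simp: hom_def FC_def)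
  have g0: "g 0 = \<zero>\<^bsub>G\<^esub>" using gadd[of 0 0] gc[of 0] FC_zero by (simp add: G.add.l_cancel_one)
  have gdiff: "g (u - v) = g u \<ominus>\<^bsub>G\<^esub> g v" if "u \<in> FC" "v \<in> FC" for u v
  proof -
    have uv: "u - v \<in> FC" using that by (rule FC_diff)
    have "g u = g (u - v) \<oplus>\<^bsub>G\<^esub> g v" using gadd[OF uv that(2)] by simp
    then show ?thesis using gc[OF uv] gc[OF that(2)] by (simp add: a_minus_def G.a_assoc G.r_neg)
  qed
  have G4: "x \<oplus>\<^bsub>G\<^esub> y \<ominus>\<^bsub>G\<^esub> x \<ominus>\<^bsub>G\<^esub> y = \<zero>\<^bsub>G\<^esub>" if "x \<in> carrier G" "y \<in> carrier G" for x y
  proof -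
    have "x \<oplus>\<^bsub>G\<^esub> y \<ominus>\<^bsub>G\<^esub> x \<ominus>\<^bsub>G\<^esub> y = (x \<oplus>\<^bsub>G\<^esub> \<ominus>\<^bsub>G\<^esub> x) \<oplus>\<^bsub>G\<^esub> (y \<oplus>\<^bsub>G\<^esub> \<ominus>\<^bsub>G\<^esub> y)"
      unfolding a_minus_def using that by (simp add: G.a_ac del: G.r_neg)
    then show ?thesis using that by (simp add: G.r_neg)
  qed
  define J where "J = {u \<in> FC. \<forall>v\<in>FC. g (tmul u v) = \<zero>\<^bsub>G\<^esub>}"
  have JF: "ideal J F"
  proof (rule idealI)
    show "subgroup J (add_monoid F)"
    proof
      show "J \<subseteq> carrier (add_monoid F)" by (auto simp: J_def F_simps)
      show "\<one>\<^bsub>add_monoid F\<^esub> \<in> J" using g0 FC_zero by (simp add: J_def F_simps)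
    next
      fix x y assume "x \<in> J" "y \<in> J"
      then show "x \<otimes>\<^bsub>add_monoid F\<^esub> y \<in> J"
        unfolding J_def using FC_add gadd tmul_closed by (auto simp: F_simps tmul_add1)
    next
      fix x assume "x \<in> J"
      then have *: "x \<in> FC" "\<And>v. v \<in> FC \<Longrightarrow> g (tmul x v) = \<zero>\<^bsub>G\<^esub>" by (auto simp: J_def)
      have "g (tmul (- x) v) = \<zero>\<^bsub>G\<^esub>" if "v \<in> FC" for v
      proof -
        have "g (0 - tmul x v) = g 0 \<ominus>\<^bsub>G\<^esub> g (tmul x v)" by (rule gdiff[OF FC_zero tmul_closed[OF *(1) that]])
        then show ?thesis using *(2)[OF that] g0 by (simp add: tmul_neg1 a_minus_def)
      qed
      then show "inv\<^bsub>add_monoid F\<^esub> x \<in> J" using F_minus[of x] * FC_neg[of x] by (simp add: J_def a_inv_def)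
    qed
  next
    fix a x assume ax: "a \<in> J" "x \<in> carrier F"
    have "g (tmul (tmul a x) v) = \<zero>\<^bsub>G\<^esub>" if "v \<in> FC" for v
      using ax that tmul_closed tmul_assoc by (auto simp: J_def F_simps)
    then show "a \<otimes>\<^bsub>F\<^esub> x \<in> J" "x \<otimes>\<^bsub>F\<^esub> a \<in> J"
      using ax tmul_closed tmul_comm by (auto simp: J_def F_simps)
  qed (rule F.ring_axioms)
  have "tensor_relators R A B \<subseteq> J"
  proof
    fix u assume u: "u \<in> tensor_relators R A B"
    have "g (tmul u v) = \<zero>\<^bsub>G\<^esub>" if v: "v \<in> FC" for v using v
    proof (induction v rule: FC_induct)
      case zero
      show ?case by (simp add: g0)
    next
      case (diff v v')
      moreover have "u \<in> FC" using u relators_FC by blast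
      ultimately show ?case using gdiff[of "tmul u v" "tmul u v'"] tmul_closed[of u]
        by (simp add: tmul_diff2 a_minus_def)
    next
      case (one a' b')
      from u consider
        (1) x y b where "u = frag_of (x \<oplus>\<^bsub>A\<^esub> y, b) - frag_of (x, b) - frag_of (y, b)" "x \<in> carrier A" "y \<in> carrier A" "b \<in> carrier B"
      | (2) a x y where "u = frag_of (a, x \<oplus>\<^bsub>B\<^esub> y) - frag_of (a, x) - frag_of (a, y)" "a \<in> carrier A" "x \<in> carrier B" "y \<in> carrier B"
      | (3) r a b where "u = frag_of (r \<odot>\<^bsub>A\<^esub> a, b) - frag_of (a, r \<odot>\<^bsub>B\<^esub> b)" "r \<in> carrier R" "a \<in> carrier A" "b \<in> carrier B"
        unfolding tensor_relators_def by blast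
      then show ?case
      proof cases
        case 1
        then show ?thesis using one
          by (simp add: gdiff FC_of FC_diff cl tmul_diff1 tmul_of gof A.l_distr add1 G4)
      next
        case 2
        then show ?thesis using one
          by (simp add: gdiff FC_of FC_diff cl tmul_diff1 tmul_of gof B.l_distr add2 G4)
      next
        case 3
        then show ?thesis using one
          by (simp add: gdiff FC_of FC_diff cl tmul_diff1 tmul_of gof A.smult_assoc2 B.smult_assoc2 bal a_minus_def G.r_neg)
      qed
    qed
    then show "u \<in> J" using u relators_FC by (auto simp: J_def)
  qed
  then have IJ: "I \<subseteq> J" by (rule I_minimal[OF JF])
  have gI: "g u = \<zero>\<^bsub>G\<^esub>" if "u \<in> I" for u
  proof -
    have u: "u \<in> J" "u \<in> FC" using that IJ I_FC by auto
    then have "g (tmul u (frag_of (\<one>\<^bsub>A\<^esub>, \<one>\<^bsub>B\<^esub>))) = \<zero>\<^bsub>G\<^esub>" using FC_of by (auto simp: J_def)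
    then show ?thesis using u tmul_one tmul_comm[of u "frag_of (\<one>\<^bsub>A\<^esub>, \<one>\<^bsub>B\<^esub>)"] FC_of by simp
  qed
  define h where "h U = g (SOME u. u \<in> FC \<and> U = I +>\<^bsub>F\<^esub> u)" for U
  have h: "h (I +>\<^bsub>F\<^esub> u) = g u" if u: "u \<in> FC" for u
  proof -
    define v where "v = (SOME v. v \<in> FC \<and> I +>\<^bsub>F\<^esub> u = I +>\<^bsub>F\<^esub> v)"
    have v: "v \<in> FC \<and> I +>\<^bsub>F\<^esub> u = I +>\<^bsub>F\<^esub> v" unfolding v_def by (rule someI[of _ u]) (use u in simp)
    then have "u - v \<in> I" using T_coset_eq_iff u by blast
    then have "g u \<ominus>\<^bsub>G\<^esub> g v = \<zero>\<^bsub>G\<^esub>" using gI[of "u - v"] gdiff[of u v] u v by simp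
    moreover have "g u = (g u \<ominus>\<^bsub>G\<^esub> g v) \<oplus>\<^bsub>G\<^esub> g v"
      using gc[of u] gc[of v] u v by (simp add: a_minus_def G.a_assoc G.l_neg)
    ultimately have "g u = g v" using gc[of v] v by simp
    then show ?thesis by (simp add: h_def v_def)
  qed
  show ?thesis
  proof (rule that)
    show "h x \<in> carrier G" if "x \<in> carrier T" for x using that h gc by (auto simp: T_carrier_iff)
    show "h (x \<oplus>\<^bsub>T\<^esub> y) = h x \<oplus>\<^bsub>G\<^esub> h y" if "x \<in> carrier T" "y \<in> carrier T" for x y
      using that by (auto simp: T_carrier_iff h gadd FC_add T_add)
    show "h (tin a b) = \<beta> a b" if "a \<in> carrier A" "b \<in> carrier B" for a b
      using h[OF FC_of[OF that]] gof that by (simp add: tin_def)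
  qed
qed

end

text \<open>The two maps may be semilinear over one and the same self-map \<open>\<sigma>\<close> of
  \<open>R\<close>: the relator for \<open>r\<close> then goes to the relator for
  \<open>\<sigma> r\<close>. This generality serves \<open>\<phi>\<close> and
  \<open>\<Phi>K\<close>, which are semilinear over \<open>\<phi>R\<close> rather than
  linear.\<close>

lemma tensor_map_tin_aux:
  assumes "tensor_pair R A B" "tensor_pair R C D"
    and f: "f \<in> ring_hom A C" and g: "g \<in> ring_hom B D"
    and \<sigma>: "\<And>r. r \<in> carrier R \<Longrightarrow> \<sigma> r \<in> carrier R"
    and fs: "\<And>r a. r \<in> carrier R \<Longrightarrow> a \<in> carrier A \<Longrightarrow> f (r \<odot>\<^bsub>A\<^esub> a) = \<sigma> r \<odot>\<^bsub>C\<^esub> f a"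
    and gs: "\<And>r b. r \<in> carrier R \<Longrightarrow> b \<in> carrier B \<Longrightarrow> g (r \<odot>\<^bsub>B\<^esub> b) = \<sigma> r \<odot>\<^bsub>D\<^esub> g b"
  shows "tensor_map R C D f g \<in> ring_hom (tensor R A B) (tensor R C D)"
    and "\<And>a b. a \<in> carrier A \<Longrightarrow> b \<in> carrier B \<Longrightarrow>
      tensor_map R C D f g (tensor_in R A B a b) = tensor_in R C D (f a) (g b)"
proof -
  interpret X: tensor_pair R A B by fact
  interpret Y: tensor_pair R C D by fact
  define e where "e u = frag_extend (\<lambda>(a, b). frag_of (f a, g b)) u" for u
  have e_of: "e (frag_of (a, b)) = frag_of (f a, g b)" for a b by (simp add: e_def)
  have e_diff: "e (u - v) = e u - e v" for u v by (simp add: e_def frag_extend_diff)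
  have e_add: "e (u + v) = e u + e v" for u v by (simp add: e_def frag_extend_add)
  have e0: "e 0 = 0" by (simp add: e_def)
  note fc = ring_hom_closed[OF f] and gc = ring_hom_closed[OF g]
  have ec: "e u \<in> Y.FC" if "u \<in> X.FC" for u using that
  proof (induction u rule: X.FC_induct)
    case (diff u v) then show ?case by (simp add: e_diff Y.FC_diff)
  qed (auto simp: e0 e_of fc gc Y.FC_zero intro: Y.FC_of)
  have em: "e (X.tmul u v) = Y.tmul (e u) (e v)" if "u \<in> X.FC" "v \<in> X.FC" for u v using that
  proof (induction u rule: X.FC_induct)
    case (one a b)
    show ?case using one(3)
      by (induction v rule: X.FC_induct)
        (auto simp: e0 X.tmul_of Y.tmul_of X.tmul_diff2 Y.tmul_diff2 e_of e_diff one
          ring_hom_mult[OF f] ring_hom_mult[OF g])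
  qed (auto simp: e0 X.tmul_diff1 Y.tmul_diff1 e_diff)
  have eh: "e \<in> ring_hom X.F Y.F"
    by (rule ring_hom_memI) (use ec em e_add e_of in \<open>auto simp: X.F_simps Y.F_simps ring_hom_one[OF f] ring_hom_one[OF g]\<close>)
  interpret e: ring_hom_ring X.F Y.F e
    using eh by (intro ring_hom_ringI2) (auto intro: X.F.ring_axioms Y.F.ring_axioms)
  have id: "ideal {u \<in> carrier X.F. e u \<in> Y.I} X.F" by (rule e.ideal_vimage[OF Y.I_ideal])
  have "tensor_relators R A B \<subseteq> {u \<in> carrier X.F. e u \<in> Y.I}"
  proof
    fix u assume u: "u \<in> tensor_relators R A B"
    then have "e u \<in> tensor_relators R C D"
      unfolding tensor_relators_def
      apply (elim UnE CollectE exE conjE)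
      subgoal for x y b
        by (rule UnI1, rule UnI1, rule CollectI, rule exI[of _ "f x"], rule exI[of _ "f y"], rule exI[of _ "g b"])
          (simp add: e_diff e_of ring_hom_add[OF f] ring_hom_add[OF g] fs gs \<sigma> fc gc)
      subgoal for a x y
        by (rule UnI1, rule UnI2, rule CollectI, rule exI[of _ "f a"], rule exI[of _ "g x"], rule exI[of _ "g y"])
          (simp add: e_diff e_of ring_hom_add[OF f] ring_hom_add[OF g] fs gs \<sigma> fc gc)
      subgoal for r a b
        by (rule UnI2, rule CollectI, rule exI[of _ "\<sigma> r"], rule exI[of _ "f a"], rule exI[of _ "g b"])
          (simp add: e_diff e_of ring_hom_add[OF f] ring_hom_add[OF g] fs gs \<sigma> fc gc)
      done
    then show "u \<in> {u \<in> carrier X.F. e u \<in> Y.I}" using u X.relators_FC Y.relators_I by (auto simp: X.F_simps)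
  qed
  from X.I_minimal[OF id this] have eI: "e u \<in> Y.I" if "u \<in> X.I" for u using that by blast
  have tm: "tensor_map R C D f g (X.I +>\<^bsub>X.F\<^esub> u) = Y.I +>\<^bsub>Y.F\<^esub> e u" if u: "u \<in> X.FC" for u
  proof -
    have "Y.I +>\<^bsub>Y.F\<^esub> e v = Y.I +>\<^bsub>Y.F\<^esub> e u" if "v \<in> X.I +>\<^bsub>X.F\<^esub> u" for v
    proof -
      have "v \<in> X.FC" "v - u \<in> X.I" using that X.T_coset_mem_iff[OF u] by blast+
      then show ?thesis using eI[of "v - u"] ec[of v] ec[of u] u by (simp add: Y.T_coset_eq_iff e_diff)
    qed
    moreover have "u \<in> X.I +>\<^bsub>X.F\<^esub> u" using X.T_coset_mem_iff[OF u] u additive_subgroup.zero_closed[OF ideal.axioms(1)[OF X.I_ideal]]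
      by (simp add: X.F_simps)
    ultimately show ?thesis unfolding tensor_map_def e_def[symmetric] by blast
  qed
  show "tensor_map R C D f g \<in> ring_hom X.T Y.T"
    by (rule ring_hom_memI)
      (use X.FC_of[of "\<one>\<^bsub>A\<^esub>" "\<one>\<^bsub>B\<^esub>"] in \<open>auto simp: ec em X.FC_add X.tmul_closed X.T_carrier_iff Y.T_carrier_iff tm X.T_add X.T_mult Y.T_add Y.T_mult
        X.T_one Y.T_one e_add e_of ring_hom_one[OF f] ring_hom_one[OF g] simp del: mem_Collect_eq\<close>)
  show "\<And>a b. a \<in> carrier A \<Longrightarrow> b \<in> carrier B \<Longrightarrow> tensor_map R C D f g (X.tin a b) = Y.tin (f a) (g b)"
    using X.FC_of by (simp add: X.tin_def Y.tin_def tm e_of)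
qed

lemmas tensor_map_hom = tensor_map_tin_aux(1)
lemmas tensor_map_in = tensor_map_tin_aux(2)

section \<open>Frobenius modulo \<open>p\<close>\<close>

context cring
begin

lemma p_elem_mult: "x \<in> carrier R \<Longrightarrow> p_elem p R \<otimes> x = [p] \<cdot>\<^bsub>R\<^esub> x"
  by (simp add: p_elem_def add_pow_ldistr)

text \<open>The binomial expansion of \<open>(x + y)^n\<close> cut off before the exponent
  \<open>j\<close> of \<open>x\<close>, so that an induction on \<open>j\<close> deals with one term
  at a time.\<close>

primrec binom_sum :: "'a \<Rightarrow> 'a \<Rightarrow> nat \<Rightarrow> nat \<Rightarrow> 'a" where
  "binom_sum x y n 0 = \<zero>"
| "binom_sum x y n (Suc j) = binom_sum x y n j \<oplus> [(n choose j)] \<cdot>\<^bsub>R\<^esub> (x [^] j \<otimes> y [^] (n - j))"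

lemma binom_sum_closed [simp]: "x \<in> carrier R \<Longrightarrow> y \<in> carrier R \<Longrightarrow> binom_sum x y n j \<in> carrier R"
  by (induction j) auto

text \<open>Pascal's rule for truncated sums: multiplication by \<open>x\<close> raises the cut-off
  by one, multiplication by \<open>y\<close> leaves it where it is.\<close>

lemma binom_sum_Suc:
  assumes "x \<in> carrier R" "y \<in> carrier R"
  shows "j \<le> Suc n \<Longrightarrow> binom_sum x y (Suc n) (Suc j) = x \<otimes> binom_sum x y n j \<oplus> y \<otimes> binom_sum x y n (Suc j)"
proof (induction j)
  case 0
  then show ?case using assms by (simp add: m_comm)
next
  case (Suc j)
  have j: "j \<le> n" using Suc.prems by simp
  define T where "T = x [^] Suc j \<otimes> y [^] (n - j)"
  have T: "T \<in> carrier R" using assms by (simp add: T_def)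
  have 1: "x \<otimes> ([(n choose j)] \<cdot>\<^bsub>R\<^esub> (x [^] j \<otimes> y [^] (n - j))) = [(n choose j)] \<cdot>\<^bsub>R\<^esub> T"
    using assms by (simp add: T_def add_pow_rdistr m_ac)
  have 2: "y \<otimes> ([(n choose Suc j)] \<cdot>\<^bsub>R\<^esub> (x [^] Suc j \<otimes> y [^] (n - Suc j))) = [(n choose Suc j)] \<cdot>\<^bsub>R\<^esub> T"
  \<comment> \<open>For \<open>j = n\<close> the subtraction \<open>n - Suc j\<close> is truncated,
    but the binomial coefficient of that term is zero.\<close>
  proof (cases "j = n")
    case False
    then have "n - j = Suc (n - Suc j)" using j by simp
    then have "T = y \<otimes> (x [^] Suc j \<otimes> y [^] (n - Suc j))" unfolding T_def using assms by (simp add: m_ac)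
    then show ?thesis using assms by (simp add: add_pow_rdistr)
  qed (use assms in \<open>simp add: binomial_eq_0\<close>)
  have "[(Suc n choose Suc j)] \<cdot>\<^bsub>R\<^esub> (x [^] Suc j \<otimes> y [^] (Suc n - Suc j)) = [(n choose j)] \<cdot>\<^bsub>R\<^esub> T \<oplus> [(n choose Suc j)] \<cdot>\<^bsub>R\<^esub> T"
    using T by (simp add: T_def add.nat_pow_mult)
  then have "binom_sum x y (Suc n) (Suc (Suc j)) =
      (x \<otimes> binom_sum x y n j \<oplus> y \<otimes> binom_sum x y n (Suc j)) \<oplus> ([(n choose j)] \<cdot>\<^bsub>R\<^esub> T \<oplus> [(n choose Suc j)] \<cdot>\<^bsub>R\<^esub> T)"
    using Suc.IH j by (simp only: binom_sum.simps(2)[of x y "Suc n" "Suc j"])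
  also have "\<dots> = (x \<otimes> binom_sum x y n j \<oplus> [(n choose j)] \<cdot>\<^bsub>R\<^esub> T) \<oplus> (y \<otimes> binom_sum x y n (Suc j) \<oplus> [(n choose Suc j)] \<cdot>\<^bsub>R\<^esub> T)"
    using T assms by (simp add: a_ac del: binom_sum.simps)
  also have "\<dots> = x \<otimes> binom_sum x y n (Suc j) \<oplus> y \<otimes> binom_sum x y n (Suc (Suc j))"
    unfolding binom_sum.simps(2)[of x y n j] binom_sum.simps(2)[of x y n "Suc j"] 1[symmetric] 2[symmetric]
    using assms by (simp add: r_distr del: binom_sum.simps)
  finally show ?case .
qed

lemma binomial:
  assumes "x \<in> carrier R" "y \<in> carrier R"
  shows "(x \<oplus> y) [^] n = binom_sum x y n (Suc n)"
proof (induction n)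
  case (Suc n)
  have "binom_sum x y n (Suc (Suc n)) = binom_sum x y n (Suc n)" using assms by (simp add: binomial_eq_0)
  then have "binom_sum x y (Suc n) (Suc (Suc n)) = x \<otimes> binom_sum x y n (Suc n) \<oplus> y \<otimes> binom_sum x y n (Suc n)"
    using binom_sum_Suc[OF assms, of "Suc n" n] by simp
  also have "\<dots> = (x \<oplus> y) [^] Suc n" using assms Suc by (simp add: l_distr m_comm del: binom_sum.simps)
  finally show ?case ..
qed (use assms in simp)

lemma binom_sum_pcong:
  assumes p: "Factorial_Ring.prime p" and d: "d \<in> p_ideal p m R" and y: "y \<in> carrier R"
  shows "0 < j \<Longrightarrow> j \<le> p \<Longrightarrow> pcong p (Suc m) R (binom_sum d y p j) (y [^] p)"
proof (induction j)
  case (Suc j)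
  have dc: "d \<in> carrier R" using d by (rule p_ideal_carrier)
  show ?case
  proof (cases j)
    case (Suc i)
    then have "p dvd (p choose j)" using p Suc.prems by (intro dvd_choose_prime) auto
    then obtain c where c: "p choose j = p * c" by (auto elim: dvdE)
    define e where "e = [c] \<cdot>\<^bsub>R\<^esub> (d [^] i \<otimes> y [^] (p - j))"
    have e: "e \<in> carrier R" using dc y by (simp add: e_def)
    have dj: "d [^] j = d \<otimes> d [^] i" using dc Suc by (simp add: m_comm)
    have "[(p * c)] \<cdot>\<^bsub>R\<^esub> (d [^] j \<otimes> y [^] (p - j)) = p_elem p R \<otimes> (e \<otimes> d)"
      unfolding dj e_def using dc y
      by (simp add: p_elem_mult add.nat_pow_pow mult.commute add_pow_ldistr add_pow_rdistr m_ac)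
    moreover have "p_elem p R \<otimes> (e \<otimes> d) \<in> p_ideal p (1 + m) R"
    proof (rule p_ideal_mult2)
      show "p_elem p R \<in> p_ideal p 1 R" using p_idealI[of \<one> p 1] by simp
    qed (use p_ideal_mult[OF d e] in simp)
    ultimately have "[(p choose j)] \<cdot>\<^bsub>R\<^esub> (d [^] j \<otimes> y [^] (p - j)) \<in> p_ideal p (1 + m) R"
      by (simp add: c)
    moreover have "pcong p (Suc m) R (binom_sum d y p j) (y [^] p)" using Suc.IH Suc.prems Suc by simp
    ultimately show ?thesis
      using pcong_add[of p "Suc m" "binom_sum d y p j" "y [^] p" "[(p choose j)] \<cdot>\<^bsub>R\<^esub> (d [^] j \<otimes> y [^] (p - j))" \<zero>] y
      by (simp add: pcong_zero)
  qed (use dc y in simp)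
qed simp

lemma binom_pcong:
  assumes p: "Factorial_Ring.prime p" and d: "d \<in> p_ideal p m R" and y: "y \<in> carrier R"
  shows "pcong p (Suc m) R ((d \<oplus> y) [^] p) (d [^] p \<oplus> y [^] p)"
proof -
  have dc: "d \<in> carrier R" using d by (rule p_ideal_carrier)
  have "pcong p (Suc m) R (binom_sum d y p p \<oplus> d [^] p) (y [^] p \<oplus> d [^] p)"
    using binom_sum_pcong[OF assms, of p] prime_gt_0_nat[OF p] dc by (intro pcong_add) auto
  then show ?thesis using dc y by (simp add: binomial a_comm)
qed

lemma freshman:
  assumes "Factorial_Ring.prime p" "x \<in> carrier R" "y \<in> carrier R"
  shows "pcong p 1 R ((x \<oplus> y) [^] p) (x [^] p \<oplus> y [^] p)"
  using binom_pcong[of p x 0 y] assms by simp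

text \<open>With \<open>d = x - y\<close> the mixed binomial terms gain a factor \<open>p\<close>,
  and \<open>d^p\<close> is a multiple of \<open>d^2\<close>, hence divisible by
  \<open>p^(2n+2)\<close>. The latter gains nothing for a congruence modulo \<open>p^0\<close>,
  which is why the exponent starts at \<open>Suc n\<close>.\<close>

lemma pcong_frob:
  assumes p: "Factorial_Ring.prime p" and xy: "pcong p (Suc n) R x y"
  shows "pcong p (Suc (Suc n)) R (x [^] p) (y [^] p)"
proof -
  have c: "x \<in> carrier R" "y \<in> carrier R" and d: "x \<ominus> y \<in> p_ideal p (Suc n) R" using xy by (auto simp: pcong_def)
  have dc: "x \<ominus> y \<in> carrier R" using c by simp
  have "(x \<ominus> y) \<oplus> y = x" using c by algebra
  then have 1: "pcong p (Suc (Suc n)) R (x [^] p) ((x \<ominus> y) [^] p \<oplus> y [^] p)"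
    using binom_pcong[OF p d c(2)] by simp
  obtain k where k: "p = Suc (Suc k)" using prime_ge_2_nat[OF p] by (metis add_2_eq_Suc le_Suc_ex)
  have "(x \<ominus> y) [^] k \<otimes> ((x \<ominus> y) \<otimes> (x \<ominus> y)) \<in> p_ideal p (Suc n + Suc n) R"
    using p_ideal_mult[OF p_ideal_mult2[OF d d]] dc by simp
  then have "(x \<ominus> y) [^] p \<in> p_ideal p (Suc (Suc n)) R"
    using p_ideal_mono[of _ p "Suc n + Suc n" "Suc (Suc n)"] dc by (simp add: k m_assoc)
  then have "pcong p (Suc (Suc n)) R ((x \<ominus> y) [^] p \<oplus> y [^] p) (\<zero> \<oplus> y [^] p)"
    using c by (intro pcong_add) (auto simp: pcong_zero)
  then show ?thesis using pcong_trans[OF 1] c by simp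
qed

end

section \<open>Units of complete rings\<close>

context complete_ring
begin

text \<open>The geometric series of \<open>x\<close> converges, its \<open>n\<close>-th term being
  divisible by \<open>p^n\<close>; the limit of the partial sums \<open>s\<close> is the
  inverse.\<close>

lemma one_minus_unit:
  assumes "x \<in> p_ideal p 1 R" shows "\<one> \<ominus> x \<in> Units R"
proof -
  have x: "x \<in> carrier R" using assms by (rule p_ideal_carrier)
  have xn: "x [^] n \<in> p_ideal p n R" for n
  proof (induction n)
    case (Suc n)
    then show ?case using p_ideal_mult2[OF Suc assms] by simp
  qed simp
  define s where "s = rec_nat \<zero> (\<lambda>n z. z \<oplus> x [^] n)"
  have s0: "s 0 = \<zero>" and sS: "\<And>n. s (Suc n) = s n \<oplus> x [^] n" by (simp_all add: s_def)
  have sc: "s n \<in> carrier R" for n by (induction n) (simp_all add: s0 sS x)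
  have "pcong p n R (s (Suc n)) (s n)" for n
    using pcong_add[of p n "s n" "s n" "x [^] n" \<zero>] sc x xn by (simp add: sS pcong_zero)
  then have "pcoh p R s" using sc by (simp add: pcoh_def)
  then obtain l where l: "l \<in> carrier R" "\<And>n. pcong p n R l (s n)" using lim by blast
  have e: "(\<one> \<ominus> x) \<otimes> s n = \<one> \<ominus> x [^] n" for n
  proof (induction n)
    case (Suc n)
    have "(\<one> \<ominus> x) \<otimes> s (Suc n) = (\<one> \<ominus> x) \<otimes> s n \<oplus> (\<one> \<ominus> x) \<otimes> x [^] n"
      using sc x by (simp add: sS r_distr)
    also have "\<dots> = (\<one> \<ominus> x [^] n) \<oplus> (x [^] n \<ominus> x [^] n \<otimes> x)"
      using x Suc by (simp add: a_minus_def l_distr l_minus r_distr r_minus m_comm)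
    also have "\<dots> = \<one> \<ominus> x [^] n \<otimes> x"
    proof -
      have "x [^] n \<in> carrier R" "x [^] n \<otimes> x \<in> carrier R" using x by auto
      then show ?thesis by algebra
    qed
    finally show ?case by simp
  qed (use x in \<open>simp add: s0 a_minus_def r_neg\<close>)
  have "pcong p n R ((\<one> \<ominus> x) \<otimes> l) \<one>" for n
  proof -
    have "pcong p n R ((\<one> \<ominus> x) \<otimes> l) (\<one> \<ominus> x [^] n)"
      unfolding e[symmetric] using l x by (intro pcong_mult) auto
    moreover have "pcong p n R (\<one> \<ominus> x [^] n) (\<one> \<oplus> \<ominus> \<zero>)"
      unfolding a_minus_def using x xn by (intro pcong_add pcong_neg) (auto simp: pcong_zero)
    ultimately show ?thesis using pcong_trans by fastforce
  qed
  then have "(\<one> \<ominus> x) \<otimes> l = \<one>" using l x by (intro sep_eq) auto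
  then show ?thesis using l x m_comm[of "\<one> \<ominus> x" l] unfolding Units_def by auto
qed

text \<open>A product congruent to \<open>1\<close> is a unit by the geometric series, and factors
  of units are units.\<close>

lemma unit_mod_p:
  assumes "x \<in> carrier R" "y \<in> carrier R" "pcong p 1 R (x \<otimes> y) \<one>" shows "x \<in> Units R"
proof -
  have "\<one> \<ominus> x \<otimes> y \<in> p_ideal p 1 R" using pcong_sym[OF assms(3)] by (simp add: pcong_def)
  moreover have "\<one> \<ominus> (\<one> \<ominus> x \<otimes> y) = x \<otimes> y"
  proof -
    have "x \<otimes> y \<in> carrier R" using assms by simp
    then show ?thesis by algebra
  qed
  ultimately have "x \<otimes> y \<in> Units R" using one_minus_unit by metis
  then show ?thesis using assms(1,2) unit_factor by blast
qed

end

lemma (in cring) padically_complete_imp_complete: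
  assumes "padically_complete p R" shows "complete_ring R p"
proof unfold_locales
  fix s assume s: "pcoh p R s"
  then have "pseq p R s \<in> padic_in p R ` carrier R"
    using assms pseq_closed[OF s] by (simp add: padically_complete_def bij_betw_def)
  then obtain x where x: "x \<in> carrier R" "pseq p R s = padic_in p R x" by auto
  then show "\<exists>l\<in>carrier R. \<forall>n. pcong p n R l (s n)"
    using s by (auto simp: padic_in_eq pseq_eq_iff pcoh_const intro: pcong_sym)
qed (rule padically_complete_imp_sep[OF assms])

section \<open>Polynomial expressions\<close>

text \<open>Value at \<open>t\<close> of the polynomial with coefficients
  \<open>u 0, ..., u (k - 1)\<close>. It is mostly used with \<open>t\<close> a
  \<open>p^m\<close>-th root of \<open>p\<close> and \<open>k = p^m\<close>, the number of powers
  below \<open>p\<close> itself.\<close>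

primrec hs :: "('a, 'm) ring_scheme \<Rightarrow> 'a \<Rightarrow> (nat \<Rightarrow> 'a) \<Rightarrow> nat \<Rightarrow> 'a" where
  "hs A t u 0 = \<zero>\<^bsub>A\<^esub>"
| "hs A t u (Suc k) = hs A t u k \<oplus>\<^bsub>A\<^esub> u k \<otimes>\<^bsub>A\<^esub> t [^]\<^bsub>A\<^esub> k"

context cring
begin

lemma hs_closed [simp]: "t \<in> carrier R \<Longrightarrow> (\<And>i. u i \<in> carrier R) \<Longrightarrow> hs R t u k \<in> carrier R"
  by (induction k) auto

lemma pow_split:
  assumes "t \<in> carrier R" "k < n"
  shows "t [^] n = t [^] k \<otimes> (t \<otimes> t [^] (n - Suc k))"
proof -
  have "t [^] k \<otimes> (t \<otimes> t [^] (n - Suc k)) = t [^] k \<otimes> t [^] Suc (n - Suc k)"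
    using assms by (simp only: nat_pow_Suc2)
  also have "\<dots> = t [^] (k + Suc (n - Suc k))" using assms by (simp only: nat_pow_mult)
  finally show ?thesis using assms by simp
qed

lemma hs_add:
  assumes "t \<in> carrier R" "\<And>i. u i \<in> carrier R" "\<And>i. v i \<in> carrier R"
  shows "hs R t (\<lambda>i. u i \<oplus> v i) k = hs R t u k \<oplus> hs R t v k"
proof (induction k)
  case (Suc k)
  then show ?case using assms by (simp add: l_distr a_ac)
qed simp

lemma hs_smult:
  assumes "t \<in> carrier R" "\<And>i. u i \<in> carrier R" "c \<in> carrier R"
  shows "hs R t (\<lambda>i. c \<otimes> u i) k = c \<otimes> hs R t u k"
  by (induction k) (use assms in \<open>auto simp: r_distr m_assoc\<close>)

lemma hs_zero:
  assumes "t \<in> carrier R" shows "hs R t (\<lambda>i. \<zero>) k = \<zero>"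
  by (induction k) (use assms in auto)

lemma hs_cong: "(\<And>i. i < k \<Longrightarrow> u i = v i) \<Longrightarrow> hs R t u k = hs R t v k"
  by (induction k) auto

lemma hs_single:
  assumes "t \<in> carrier R" "c \<in> carrier R"
  shows "hs R t (\<lambda>i. if i = j then c else \<zero>) k = (if j < k then c \<otimes> t [^] j else \<zero>)"
  by (induction k) (use assms in \<open>auto simp: less_Suc_eq\<close>)

lemma hs_update:
  assumes "t \<in> carrier R" "\<And>i. u i \<in> carrier R" "c \<in> carrier R" "j < k"
  shows "hs R t (u(j := u j \<oplus> c)) k = hs R t u k \<oplus> c \<otimes> t [^] j"
proof -
  have "u(j := u j \<oplus> c) = (\<lambda>i. u i \<oplus> (if i = j then c else \<zero>))" using assms by auto
  then show ?thesis using assms by (simp add: hs_add hs_single)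
qed

lemma hs_split:
  assumes t: "t \<in> carrier R" and u: "\<And>i. u i \<in> carrier R" and k: "k < n"
  shows "\<exists>z\<in>carrier R. hs R t u n = hs R t u k \<oplus> u k \<otimes> t [^] k \<oplus> t [^] Suc k \<otimes> z"
proof -
  have "\<exists>z\<in>carrier R. hs R t u (Suc k + d) = hs R t u k \<oplus> u k \<otimes> t [^] k \<oplus> t [^] Suc k \<otimes> z" for d
  proof (induction d)
    case 0
    then show ?case using t u by (intro bexI[of _ \<zero>]) auto
  next
    case (Suc d)
    then obtain z where z: "z \<in> carrier R" "hs R t u (Suc k + d) = hs R t u k \<oplus> u k \<otimes> t [^] k \<oplus> t [^] Suc k \<otimes> z" by auto
    have "hs R t u (Suc k + Suc d) = hs R t u k \<oplus> u k \<otimes> t [^] k \<oplus> t [^] Suc k \<otimes> z \<oplus> u (Suc k + d) \<otimes> t [^] (Suc k + d)"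
      using z by simp
    also have "\<dots> = hs R t u k \<oplus> u k \<otimes> t [^] k \<oplus> t [^] Suc k \<otimes> (z \<oplus> u (Suc k + d) \<otimes> t [^] d)"
      using t u z(1) by (simp add: nat_pow_mult[symmetric] r_distr m_ac a_assoc del: nat_pow_Suc)
    finally show ?case using t u z by blast
  qed
  from this[of "n - Suc k"] show ?thesis using k by simp
qed

end

lemma hs_hom:
  assumes "cring A" "cring B" "f \<in> ring_hom A B" "t \<in> carrier A" "\<And>i. u i \<in> carrier A"
  shows "f (hs A t u k) = hs B (f t) (\<lambda>i. f (u i)) k"
proof -
  interpret A: cring A by fact
  interpret B: cring B by fact
  show ?thesis
    by (induction k) (simp_all add: assms ring_hom_zero'[OF assms(1-3)] ring_hom_add[OF assms(3)]
      ring_hom_mult[OF assms(3)] ring_hom_pow[OF assms(1-3)])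
qed

text \<open>Let \<open>j\<close> be the first index whose coefficient is not divisible by
  \<open>q = t^n\<close>. The terms before it are multiples of \<open>q\<close>, hence of
  \<open>t^(j+1)\<close> as \<open>j < n\<close>, so \<open>t^j\<close> can be factored out with
  \<open>u j\<close> left over modulo \<open>t\<close>. In the applications \<open>n = p^m\<close>
  and \<open>q = p\<close>.\<close>

lemma (in cring) hs_leading:
  assumes t: "t \<in> carrier R" and u: "\<And>i. u i \<in> carrier R" and q: "t [^] n = q"
    and k: "k \<le> n"
  shows "(\<exists>z\<in>carrier R. hs R t u k = q \<otimes> z) \<or>
    (\<exists>j<k. \<exists>z\<in>carrier R. (\<nexists>y. y \<in> carrier R \<and> u j = q \<otimes> y) \<and> hs R t u k = t [^] j \<otimes> (u j \<oplus> t \<otimes> z))"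
  using k
proof (induction k)
  case 0
  have "q \<in> carrier R" using t q by auto
  then show ?case by (auto intro!: bexI[of _ \<zero>])
next
  case (Suc k)
  have qc: "q \<in> carrier R" using t q by auto
  consider (a) z where "z \<in> carrier R" "hs R t u k = q \<otimes> z"
    | (b) j z where "j < k" "z \<in> carrier R" "\<nexists>y. y \<in> carrier R \<and> u j = q \<otimes> y" "hs R t u k = t [^] j \<otimes> (u j \<oplus> t \<otimes> z)"
    using Suc by auto
  then show ?case
  proof cases
    case a
    show ?thesis
    proof (cases "\<exists>y. y \<in> carrier R \<and> u k = q \<otimes> y")
      case True
      then obtain y where y: "y \<in> carrier R" "u k = q \<otimes> y" by auto
      have "hs R t u (Suc k) = q \<otimes> (z \<oplus> y \<otimes> t [^] k)"
        using a y qc t by (simp add: r_distr m_assoc)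
      then show ?thesis using a y t by (intro disjI1 bexI[of _ "z \<oplus> y \<otimes> t [^] k"]) auto
    next
      case False
      have "q = t [^] k \<otimes> (t \<otimes> t [^] (n - Suc k))"
        using Suc.prems t q pow_split[of t k n] by simp
      then have "hs R t u (Suc k) = t [^] k \<otimes> (t \<otimes> t [^] (n - Suc k)) \<otimes> z \<oplus> u k \<otimes> t [^] k"
        using a by simp
      also have "\<dots> = t [^] k \<otimes> (u k \<oplus> t \<otimes> (t [^] (n - Suc k) \<otimes> z))"
        using t u[of k] a(1) by (simp add: r_distr m_ac a_comm)
      finally show ?thesis using False t a(1)
        by (intro disjI2 exI[of _ k]) auto
    qed
  next
    case b
    have "t [^] k = t [^] j \<otimes> (t \<otimes> t [^] (k - Suc j))"
      using b(1) t by (rule pow_split[rotated])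
    then have "hs R t u (Suc k) = t [^] j \<otimes> (u j \<oplus> t \<otimes> z) \<oplus> u k \<otimes> (t [^] j \<otimes> (t \<otimes> t [^] (k - Suc j)))"
      using b by simp
    also have "\<dots> = t [^] j \<otimes> (u j \<oplus> t \<otimes> (z \<oplus> u k \<otimes> t [^] (k - Suc j)))"
      using t u[of j] u[of k] b(2) by (simp add: r_distr m_ac a_assoc)
    finally show ?thesis using b t u[of k]
      by (intro disjI2 exI[of _ j]) (auto intro!: bexI[of _ "z \<oplus> u k \<otimes> t [^] (k - Suc j)"])
  qed
qed

section \<open>The tower of roots of \<open>p\<close>\<close>

text \<open>The \<open>R\<close>-submodule of \<open>L\<close> spanned by \<open>B\<close>. Adding
  one term \<open>r x\<close> at a time makes the finiteness of linear combinations
  implicit.\<close>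

inductive_set rspan :: "('l, 'm) ring_scheme \<Rightarrow> 'l set \<Rightarrow> 'l set \<Rightarrow> 'l set" for L R B where
  zero: "\<zero>\<^bsub>L\<^esub> \<in> rspan L R B"
| step: "r \<in> R \<Longrightarrow> x \<in> B \<Longrightarrow> y \<in> rspan L R B \<Longrightarrow> r \<otimes>\<^bsub>L\<^esub> x \<oplus>\<^bsub>L\<^esub> y \<in> rspan L R B"

lemma p_elem_sub: "p_elem p (L\<lparr>carrier := H\<rparr>) = p_elem p L"
  by (simp add: p_elem_def add_pow_def nat_pow_def)

lemma pow_sub: "x [^]\<^bsub>L\<lparr>carrier := H\<rparr>\<^esub> (n::nat) = x [^]\<^bsub>L\<^esub> n"
  by (simp add: nat_pow_def)

lemma hs_sub: "hs (L\<lparr>carrier := H\<rparr>) t u k = hs L t u k"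
  by (induction k) (simp_all add: pow_sub)

context base_data
begin

sublocale L: field L by (rule L_field)

abbreviation "RR \<equiv> L\<lparr>carrier := R\<rparr>"
abbreviation "S \<equiv> root_tower L R w"
abbreviation "\<pi> \<equiv> p_elem p L"

lemma R_sub: "r \<in> R \<Longrightarrow> r \<in> carrier L"
  using subringE(1)[OF R_subring] by blast

lemmas R_closed = subringE(2,3,5,6,7)[OF R_subring]

lemma RR_domain: "domain RR"
  by (rule L.subring_is_domain[OF R_subring])

sublocale RR: domain RR by (rule RR_domain)

lemma sub_minus:
  assumes "subring H L" "x \<in> H" "y \<in> H"
  shows "x \<ominus>\<^bsub>L\<lparr>carrier := H\<rparr>\<^esub> y = x \<ominus>\<^bsub>L\<^esub> y" and "\<ominus>\<^bsub>L\<lparr>carrier := H\<rparr>\<^esub> y = \<ominus>\<^bsub>L\<^esub> y"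
proof -
  interpret H: domain "L\<lparr>carrier := H\<rparr>" by (rule L.subring_is_domain[OF assms(1)])
  have yL: "y \<in> carrier L" using subringE(1)[OF assms(1)] assms by blast
  have "\<ominus>\<^bsub>L\<^esub> y \<in> H" using subringE(5)[OF assms(1)] assms by blast
  then show "\<ominus>\<^bsub>L\<lparr>carrier := H\<rparr>\<^esub> y = \<ominus>\<^bsub>L\<^esub> y"
    using assms yL by (intro H.minus_equality) (simp_all add: L.l_neg)
  then show "x \<ominus>\<^bsub>L\<lparr>carrier := H\<rparr>\<^esub> y = x \<ominus>\<^bsub>L\<^esub> y" by (simp add: a_minus_def)
qed

lemma sub_p_ideal_iff:
  assumes "subring H L"
  shows "x \<in> p_ideal p n (L\<lparr>carrier := H\<rparr>) \<longleftrightarrow> (\<exists>y\<in>H. x = \<pi> [^]\<^bsub>L\<^esub> n \<otimes>\<^bsub>L\<^esub> y)"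
proof -
  interpret H: domain "L\<lparr>carrier := H\<rparr>" by (rule L.subring_is_domain[OF assms(1)])
  show ?thesis by (simp add: H.p_ideal_iff pow_sub p_elem_sub)
qed

lemma \<pi>_R: "\<pi> \<in> R"
  using RR.p_elem_closed[of p] by (simp add: p_elem_sub)

text \<open>If \<open>p\<close> were zero, the zero ideal would be maximal and \<open>R\<close> a
  field, which \<open>dvr\<close> excludes.\<close>

lemma \<pi>_nz: "\<pi> \<noteq> \<zero>\<^bsub>L\<^esub>"
proof
  assume "\<pi> = \<zero>\<^bsub>L\<^esub>"
  then have "p_ideal p 1 RR = {\<zero>\<^bsub>L\<^esub>}"
    using R_closed(1) by (auto simp: sub_p_ideal_iff[OF R_subring] R_sub set_eq_iff)
  then have "field RR" using R_max RR.zeromaximalideal_fieldI by simp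
  then show False using R_dvr by (simp add: dvr_def)
qed

lemma R_complete_ring: "complete_ring RR p"
  by (rule RR.padically_complete_imp_complete[OF R_complete])

sublocale RC: complete_ring RR p by (rule R_complete_ring)

text \<open>Such an element is invertible in the residue field, that is, modulo \<open>p\<close>,
  and by completeness this makes it a unit.\<close>

lemma R_unit:
  assumes r: "r \<in> R" "r \<notin> p_ideal p 1 RR"
  shows "\<exists>u\<in>R. r \<otimes>\<^bsub>L\<^esub> u = \<one>\<^bsub>L\<^esub>"
proof -
  let ?I = "p_ideal p 1 RR"
  interpret Q: field "RR Quot ?I"
    by (rule maximalideal.quotient_is_field[OF R_max RR.is_cring])
  have c: "?I +>\<^bsub>RR\<^esub> r \<in> carrier (RR Quot ?I)" using r by (subst RR.quot_carrier) auto
  have "?I +>\<^bsub>RR\<^esub> r \<noteq> \<zero>\<^bsub>RR Quot ?I\<^esub>"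
    unfolding RR.quot_zero[OF RR.p_ideal_ideal] using r RR.p_coset_eq_iff[of r "\<zero>\<^bsub>RR\<^esub>" p 1] RR.pcong_zero[of p 1 r] RR.zero_closed by simp
  then have "?I +>\<^bsub>RR\<^esub> r \<in> Units (RR Quot ?I)" using c Q.field_Units by blast
  then obtain v where v: "v \<in> carrier (RR Quot ?I)" "(?I +>\<^bsub>RR\<^esub> r) \<otimes>\<^bsub>RR Quot ?I\<^esub> v = \<one>\<^bsub>RR Quot ?I\<^esub>"
    by (auto simp: Units_def)
  then obtain s where s: "s \<in> R" "v = ?I +>\<^bsub>RR\<^esub> s" using RR.quot_carrier by auto
  have "pcong p 1 RR (r \<otimes>\<^bsub>RR\<^esub> s) \<one>\<^bsub>RR\<^esub>"
    using v(2) r s RR.quot_mult[OF RR.p_ideal_ideal, of r s p 1] R_closed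
    by (simp add: RR.quot_one RR.p_coset_eq_iff RR.pcong_sym)
  then have "r \<in> Units RR" using RC.unit_mod_p r s by simp
  then show ?thesis by (auto simp: Units_def)
qed

lemma w_pow: "w (m + k) [^]\<^bsub>L\<^esub> (p ^ k) = w m"
proof (induction k)
  case (Suc k)
  have "w (m + Suc k) [^]\<^bsub>L\<^esub> (p ^ Suc k) = (w (Suc (m + k)) [^]\<^bsub>L\<^esub> p) [^]\<^bsub>L\<^esub> (p ^ k)"
    by (simp add: L.nat_pow_pow roots_in)
  then show ?case using Suc by (simp add: root_Suc)
qed (simp add: roots_in)

lemma w_pow_N: "w m [^]\<^bsub>L\<^esub> (p ^ m) = \<pi>"
  using w_pow[of 0 m] by (simp add: root_0)

lemma p0: "p > 0"
  using prime by (rule prime_gt_0_nat)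

lemma w_nz: "w m \<noteq> \<zero>\<^bsub>L\<^esub>"
  using w_pow_N[of m] \<pi>_nz p0 L.nat_pow_zero[of "p ^ m"] by auto

lemma w_pow_nz: "w m [^]\<^bsub>L\<^esub> (k::nat) \<noteq> \<zero>\<^bsub>L\<^esub>"
  by (induction k) (simp_all add: roots_in w_nz L.integral_iff)

lemma w_red: "w m [^]\<^bsub>L\<^esub> (j::nat) = \<pi> [^]\<^bsub>L\<^esub> (j div p ^ m) \<otimes>\<^bsub>L\<^esub> w m [^]\<^bsub>L\<^esub> (j mod p ^ m)"
  using L.nat_pow_mult[of "w m" "p ^ m * (j div p ^ m)" "j mod p ^ m"] L.nat_pow_pow[of "w m" "p ^ m" "j div p ^ m"]
  by (simp add: roots_in w_pow_N)

subsection \<open>Spans\<close>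

abbreviation "rsp \<equiv> rspan L R"

lemma span_carrier:
  assumes "B \<subseteq> carrier L" "y \<in> rsp B" shows "y \<in> carrier L"
  using assms(2) by (induction rule: rspan.induct) (use assms(1) R_sub in auto)

lemma span_add:
  assumes B: "B \<subseteq> carrier L" and "x \<in> rsp B" "y \<in> rsp B" shows "x \<oplus>\<^bsub>L\<^esub> y \<in> rsp B"
  using assms(2)
proof (induction rule: rspan.induct)
  case zero
  then show ?case using span_carrier[OF B assms(3)] assms(3) by simp
next
  case (step r x z)
  have "r \<otimes>\<^bsub>L\<^esub> x \<oplus>\<^bsub>L\<^esub> z \<oplus>\<^bsub>L\<^esub> y = r \<otimes>\<^bsub>L\<^esub> x \<oplus>\<^bsub>L\<^esub> (z \<oplus>\<^bsub>L\<^esub> y)"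
    using step B span_carrier[OF B] assms(3) by (intro L.a_assoc) (auto simp: R_sub)
  then show ?case using rspan.step[OF step(1,2,4)] by simp
qed

lemma span_smult:
  assumes B: "B \<subseteq> carrier L" and "c \<in> R" "y \<in> rsp B" shows "c \<otimes>\<^bsub>L\<^esub> y \<in> rsp B"
  using assms(3)
proof (induction rule: rspan.induct)
  case zero
  then show ?case using assms by (simp add: R_sub rspan.zero)
next
  case (step r x z)
  have "c \<otimes>\<^bsub>L\<^esub> (r \<otimes>\<^bsub>L\<^esub> x \<oplus>\<^bsub>L\<^esub> z) = (c \<otimes>\<^bsub>L\<^esub> r) \<otimes>\<^bsub>L\<^esub> x \<oplus>\<^bsub>L\<^esub> c \<otimes>\<^bsub>L\<^esub> z"
    using step B span_carrier[OF B] assms(2) by (simp add: L.r_distr L.m_assoc R_sub subset_iff)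
  then show ?case using rspan.step[OF R_closed(4)[OF assms(2) step(1)] step(2,4)] by simp
qed

lemma span_incl:
  assumes "B \<subseteq> carrier L" "x \<in> B" "r \<in> R" shows "r \<otimes>\<^bsub>L\<^esub> x \<in> rsp B"
proof -
  have "r \<otimes>\<^bsub>L\<^esub> x = r \<otimes>\<^bsub>L\<^esub> x \<oplus>\<^bsub>L\<^esub> \<zero>\<^bsub>L\<^esub>"
    using assms by (intro L.r_zero[symmetric]) (auto simp: R_sub)
  then show ?thesis using rspan.step[OF assms(3,2) rspan.zero] by metis
qed

lemma span_incl1: "B \<subseteq> carrier L \<Longrightarrow> x \<in> B \<Longrightarrow> x \<in> rsp B"
  using span_incl[of B x "\<one>\<^bsub>L\<^esub>"] R_closed(2) by (auto simp: subset_iff)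

lemma span_sub:
  assumes C: "C \<subseteq> carrier L" and "B \<subseteq> rsp C" and "y \<in> rsp B" shows "y \<in> rsp C"
  using assms(3)
proof (induction rule: rspan.induct)
  case (step r x z)
  then show ?case using assms by (intro span_add[OF C] span_smult[OF C]) auto
qed (rule rspan.zero)

lemma span_insert:
  assumes B: "insert b B \<subseteq> carrier L" and "y \<in> rsp (insert b B)"
  shows "\<exists>r\<in>R. \<exists>z\<in>rsp B. y = r \<otimes>\<^bsub>L\<^esub> b \<oplus>\<^bsub>L\<^esub> z"
  using assms(2)
proof (induction rule: rspan.induct)
  case zero
  then show ?case using B R_closed(1) rspan.zero by (intro bexI[of _ "\<zero>\<^bsub>L\<^esub>"] bexI[of _ "\<zero>\<^bsub>L\<^esub>"]) auto
next
  case (step r x y)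
  then obtain r' z where z: "r' \<in> R" "z \<in> rsp B" "y = r' \<otimes>\<^bsub>L\<^esub> b \<oplus>\<^bsub>L\<^esub> z" by auto
  have c: "b \<in> carrier L" "x \<in> carrier L" "z \<in> carrier L" using B step z span_carrier by auto
  show ?case
  proof (cases "x = b")
    case True
    have "r \<otimes>\<^bsub>L\<^esub> x \<oplus>\<^bsub>L\<^esub> y = (r \<oplus>\<^bsub>L\<^esub> r') \<otimes>\<^bsub>L\<^esub> b \<oplus>\<^bsub>L\<^esub> z"
      using c z(1) step(1) True by (simp add: z(3) R_sub L.l_distr L.a_assoc)
    then show ?thesis using z R_closed(5)[OF step(1) z(1)] by blast
  next
    case False
    then have "x \<in> B" using step by auto
    then have "r \<otimes>\<^bsub>L\<^esub> x \<oplus>\<^bsub>L\<^esub> z \<in> rsp B" using step z by (intro rspan.step)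
    moreover have "r \<otimes>\<^bsub>L\<^esub> x \<oplus>\<^bsub>L\<^esub> y = r' \<otimes>\<^bsub>L\<^esub> b \<oplus>\<^bsub>L\<^esub> (r \<otimes>\<^bsub>L\<^esub> x \<oplus>\<^bsub>L\<^esub> z)"
      using c z(1) step(1) by (simp add: z(3) R_sub L.a_lcomm)
    ultimately show ?thesis using z(1) by blast
  qed
qed

lemma span_mult:
  assumes B: "B \<subseteq> carrier L" and mult: "\<And>x y. x \<in> B \<Longrightarrow> y \<in> B \<Longrightarrow> x \<otimes>\<^bsub>L\<^esub> y \<in> B"
    and xy: "x \<in> rsp B" "y \<in> rsp B"
  shows "x \<otimes>\<^bsub>L\<^esub> y \<in> rsp B"
proof -
  note Bc = subsetD[OF B] and sc = span_carrier[OF B]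
  have 1: "b \<otimes>\<^bsub>L\<^esub> z \<in> rsp B" if b: "b \<in> B" and "z \<in> rsp B" for b z
    using that(2)
  proof (induction rule: rspan.induct)
    case zero
    then show ?case using Bc[OF b] by (simp add: rspan.zero)
  next
    case (step r x z)
    have "b \<otimes>\<^bsub>L\<^esub> (r \<otimes>\<^bsub>L\<^esub> x \<oplus>\<^bsub>L\<^esub> z) = r \<otimes>\<^bsub>L\<^esub> (b \<otimes>\<^bsub>L\<^esub> x) \<oplus>\<^bsub>L\<^esub> b \<otimes>\<^bsub>L\<^esub> z"
      using Bc[OF b] Bc[OF step(2)] R_sub[OF step(1)] sc[OF step(3)] by (simp add: L.r_distr L.m_lcomm)
    then show ?case using rspan.step[OF step(1) mult[OF b step(2)] step(4)] by simp
  qed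
  show ?thesis using xy(1)
  proof (induction rule: rspan.induct)
    case zero
    then show ?case using sc[OF xy(2)] by (simp add: rspan.zero)
  next
    case (step r x z)
    have "(r \<otimes>\<^bsub>L\<^esub> x \<oplus>\<^bsub>L\<^esub> z) \<otimes>\<^bsub>L\<^esub> y = r \<otimes>\<^bsub>L\<^esub> (x \<otimes>\<^bsub>L\<^esub> y) \<oplus>\<^bsub>L\<^esub> z \<otimes>\<^bsub>L\<^esub> y"
      using Bc[OF step(2)] R_sub[OF step(1)] sc[OF step(3)] sc[OF xy(2)] by (simp add: L.l_distr L.m_assoc)
    then show ?case using span_add[OF B span_smult[OF B step(1) 1[OF step(2) xy(2)]] step(4)] by simp
  qed
qed

text \<open>Nakayama's lemma: a finite spanning set of a nonzero module \<open>M = pM\<close> can be shrunk indefinitely.\<close>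

lemma nakayama:
  assumes "finite B" "B \<subseteq> carrier L" "B \<subseteq> M" "\<And>x. x \<in> M \<Longrightarrow> x \<in> rsp B" "\<one>\<^bsub>L\<^esub> \<in> M"
    and s: "s \<in> carrier L" "\<pi> \<otimes>\<^bsub>L\<^esub> s = \<one>\<^bsub>L\<^esub>" "\<And>x. x \<in> M \<Longrightarrow> s \<otimes>\<^bsub>L\<^esub> x \<in> M"
  shows False
  using assms(1-5)
proof (induction B)
  case empty
  have "y = \<zero>\<^bsub>L\<^esub>" if "y \<in> rsp {}" for y using that by (induction rule: rspan.induct) auto
  moreover have "\<one>\<^bsub>L\<^esub> \<in> rsp {}" using empty(3,4) by blast
  ultimately have "\<one>\<^bsub>L\<^esub> = \<zero>\<^bsub>L\<^esub>" by blast
  then show False by simp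
next
  case (insert b B)
  have b: "b \<in> carrier L" "B \<subseteq> carrier L" using insert by auto
  have "s \<otimes>\<^bsub>L\<^esub> b \<in> rsp (insert b B)" using insert s by auto
  then obtain r z where z: "r \<in> R" "z \<in> rsp B" "s \<otimes>\<^bsub>L\<^esub> b = r \<otimes>\<^bsub>L\<^esub> b \<oplus>\<^bsub>L\<^esub> z"
    using span_insert[OF insert.prems(1)] by blast
  have zc: "z \<in> carrier L" "r \<in> carrier L" "\<pi> \<in> carrier L" using span_carrier[OF b(2) z(2)] R_sub[OF z(1)] by auto
  define q where "q = \<one>\<^bsub>L\<^esub> \<ominus>\<^bsub>L\<^esub> \<pi> \<otimes>\<^bsub>L\<^esub> r"
  have "b = \<pi> \<otimes>\<^bsub>L\<^esub> (s \<otimes>\<^bsub>L\<^esub> b)" using b s zc by (simp add: L.m_assoc[symmetric])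
  then have "b = \<pi> \<otimes>\<^bsub>L\<^esub> r \<otimes>\<^bsub>L\<^esub> b \<oplus>\<^bsub>L\<^esub> \<pi> \<otimes>\<^bsub>L\<^esub> z" using b zc by (simp add: z(3) L.r_distr L.m_assoc)
  then have "b \<ominus>\<^bsub>L\<^esub> \<pi> \<otimes>\<^bsub>L\<^esub> r \<otimes>\<^bsub>L\<^esub> b = (\<pi> \<otimes>\<^bsub>L\<^esub> r \<otimes>\<^bsub>L\<^esub> b \<oplus>\<^bsub>L\<^esub> \<pi> \<otimes>\<^bsub>L\<^esub> z) \<ominus>\<^bsub>L\<^esub> \<pi> \<otimes>\<^bsub>L\<^esub> r \<otimes>\<^bsub>L\<^esub> b" by simp
  also have "\<dots> = \<pi> \<otimes>\<^bsub>L\<^esub> z"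
  proof -
    have "\<pi> \<otimes>\<^bsub>L\<^esub> r \<otimes>\<^bsub>L\<^esub> b \<in> carrier L" "\<pi> \<otimes>\<^bsub>L\<^esub> z \<in> carrier L" using b zc by auto
    then show ?thesis by algebra
  qed
  finally have qb: "q \<otimes>\<^bsub>L\<^esub> b = \<pi> \<otimes>\<^bsub>L\<^esub> z"
    unfolding q_def using b zc by (simp add: a_minus_def L.l_distr L.l_minus)
  have "\<pi> \<otimes>\<^bsub>L\<^esub> r \<in> p_ideal p 1 RR" using z(1) by (auto simp: sub_p_ideal_iff[OF R_subring])
  then have "\<one>\<^bsub>RR\<^esub> \<ominus>\<^bsub>RR\<^esub> \<pi> \<otimes>\<^bsub>L\<^esub> r \<in> Units RR" by (rule RC.one_minus_unit)
  then have "q \<in> Units RR"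
    using sub_minus(1)[OF R_subring, of "\<one>\<^bsub>L\<^esub>" "\<pi> \<otimes>\<^bsub>L\<^esub> r"] R_closed z(1) \<pi>_R by (simp add: q_def)
  then obtain u where u: "u \<in> R" "u \<otimes>\<^bsub>L\<^esub> q = \<one>\<^bsub>L\<^esub>" "q \<in> R" by (auto simp: Units_def)
  have "b = u \<otimes>\<^bsub>L\<^esub> (q \<otimes>\<^bsub>L\<^esub> b)" using u b R_sub by (simp add: L.m_assoc[symmetric])
  then have "b = u \<otimes>\<^bsub>L\<^esub> (\<pi> \<otimes>\<^bsub>L\<^esub> z)" by (simp add: qb)
  then have "b \<in> rsp B" using span_smult[OF b(2) u(1) span_smult[OF b(2) \<pi>_R z(2)]] by simp
  then have "insert b B \<subseteq> rsp B" using span_incl1[OF b(2)] by auto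
  then have "\<And>x. x \<in> M \<Longrightarrow> x \<in> rsp B" using insert.prems span_sub[OF b(2)] by blast
  then show False using insert b by blast
qed

subsection \<open>The ring of roots\<close>

abbreviation "gen m \<equiv> generate_ring L (insert (w m) R)"

lemma gen_sub: "subring (gen m) L"
  using R_sub roots_in by (intro L.generate_ring_is_subring) auto

lemma R_gen: "r \<in> R \<Longrightarrow> r \<in> gen m"
  by (rule generate_ring.incl) simp
lemma w_gen: "w m \<in> gen m"
  by (rule generate_ring.incl) simp

lemma gen_pow: "x \<in> gen m \<Longrightarrow> x [^]\<^bsub>L\<^esub> (k::nat) \<in> gen m"
  by (induction k) (auto intro: generate_ring.one generate_ring.eng_mult)

lemma gen_mono: "m \<le> n \<Longrightarrow> gen m \<subseteq> gen n"
proof (induction n)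
  case (Suc n)
  have "gen n \<subseteq> gen (Suc n)"
  proof (rule L.generate_ring_min_subring1)
    show "insert (w n) R \<subseteq> gen (Suc n)"
      using gen_pow[OF w_gen[of "Suc n"], of p] R_gen by (auto simp: root_Suc)
    show "subring (gen (Suc n)) L" by (rule gen_sub)
  qed (use R_sub roots_in in auto)
  then show ?case using Suc by (auto simp: le_Suc_eq)
qed simp

lemma S_carrier: "carrier S = (\<Union>m. gen m)"
  by (simp add: root_tower_def)

lemma S_sub: "subring (carrier S) L"
proof (rule L.subringI)
  show "carrier S \<subseteq> carrier L" unfolding S_carrier using subringE(1)[OF gen_sub] by blast
  show "\<one>\<^bsub>L\<^esub> \<in> carrier S" unfolding S_carrier using generate_ring.one by blast
  fix x y assume "x \<in> carrier S" "y \<in> carrier S"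
  then obtain m n where "x \<in> gen m" "y \<in> gen n" by (auto simp: S_carrier)
  then have xy: "x \<in> gen (max m n)" "y \<in> gen (max m n)"
    using gen_mono[of m "max m n"] gen_mono[of n "max m n"] by auto
  show "\<ominus>\<^bsub>L\<^esub> x \<in> carrier S" "x \<otimes>\<^bsub>L\<^esub> y \<in> carrier S" "x \<oplus>\<^bsub>L\<^esub> y \<in> carrier S"
    using generate_ring.a_inv[OF xy(1)] generate_ring.eng_mult[OF xy] generate_ring.eng_add[OF xy]
    by (auto simp only: S_carrier)
qed

lemma S_eq: "S = L\<lparr>carrier := carrier S\<rparr>"
  by (simp add: root_tower_def)

lemma S_domain: "domain S"
  using L.subring_is_domain[OF S_sub] S_eq by metis

sublocale S: domain S by (rule S_domain)

lemma S_ops [simp]: "x \<otimes>\<^bsub>S\<^esub> y = x \<otimes>\<^bsub>L\<^esub> y" "x \<oplus>\<^bsub>S\<^esub> y = x \<oplus>\<^bsub>L\<^esub> y" "\<one>\<^bsub>S\<^esub> = \<one>\<^bsub>L\<^esub>" "\<zero>\<^bsub>S\<^esub> = \<zero>\<^bsub>L\<^esub>"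
  "x [^]\<^bsub>S\<^esub> (n::nat) = x [^]\<^bsub>L\<^esub> n" "hs S t u k = hs L t u k" "p_elem p S = \<pi>"
  unfolding root_tower_def by (simp_all add: pow_sub hs_sub p_elem_sub)

lemma S_L: "x \<in> carrier S \<Longrightarrow> x \<in> carrier L"
  using subringE(1)[OF S_sub] by blast
lemma R_S: "r \<in> R \<Longrightarrow> r \<in> carrier S"
  unfolding S_carrier using R_gen by blast
lemma w_S: "w m \<in> carrier S"
  unfolding S_carrier using w_gen by blast
lemma w_pow_S: "w m [^]\<^bsub>L\<^esub> (k::nat) \<in> carrier S"
  using S.nat_pow_closed[OF w_S, of m k] by simp

lemma pows_L: "(\<lambda>j. w m [^]\<^bsub>L\<^esub> (j::nat)) ` J \<subseteq> carrier L"
  by (auto simp: roots_in)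

text \<open>Exponents can be reduced modulo \<open>p^m\<close>, since the \<open>p^m\<close>-th
  power of \<open>w m\<close> is \<open>\<pi>\<close> and lies in \<open>R\<close>. This is what
  makes \<open>R[w m]\<close> a finite \<open>R\<close>-module.\<close>

lemma pows_red: "rsp (range (\<lambda>j::nat. w m [^]\<^bsub>L\<^esub> j)) = rsp ((\<lambda>j. w m [^]\<^bsub>L\<^esub> j) ` {..<p ^ m})"
proof (intro equalityI subsetI)
  fix x assume "x \<in> rsp (range (\<lambda>j::nat. w m [^]\<^bsub>L\<^esub> j))"
  moreover have "range (\<lambda>j::nat. w m [^]\<^bsub>L\<^esub> j) \<subseteq> rsp ((\<lambda>j. w m [^]\<^bsub>L\<^esub> j) ` {..<p ^ m})"
  proof clarify
    fix j :: nat
    have "\<pi> [^]\<^bsub>L\<^esub> (j div p ^ m) \<in> R" using RR.nat_pow_closed[of \<pi> "j div p ^ m"] \<pi>_R by (simp add: pow_sub)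
    moreover have "w m [^]\<^bsub>L\<^esub> (j mod p ^ m) \<in> (\<lambda>j. w m [^]\<^bsub>L\<^esub> j) ` {..<p ^ m}" using p0 by auto
    ultimately show "w m [^]\<^bsub>L\<^esub> j \<in> rsp ((\<lambda>j. w m [^]\<^bsub>L\<^esub> j) ` {..<p ^ m})"
      unfolding w_red[of m j] by (intro span_incl pows_L)
  qed
  ultimately show "x \<in> rsp ((\<lambda>j. w m [^]\<^bsub>L\<^esub> j) ` {..<p ^ m})" by (rule span_sub[OF pows_L, rotated])
next
  fix x assume "x \<in> rsp ((\<lambda>j. w m [^]\<^bsub>L\<^esub> j) ` {..<p ^ m})"
  then show "x \<in> rsp (range (\<lambda>j::nat. w m [^]\<^bsub>L\<^esub> j))"
    by (rule span_sub[OF pows_L, rotated]) (auto intro!: span_incl1[OF pows_L])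
qed

lemma gen_span: "x \<in> gen m \<Longrightarrow> x \<in> rsp (range (\<lambda>j::nat. w m [^]\<^bsub>L\<^esub> j))"
proof (induction rule: generate_ring.induct)
  case one
  have "\<one>\<^bsub>L\<^esub> = w m [^]\<^bsub>L\<^esub> (0::nat)" by simp
  then show ?case by (intro span_incl1[OF pows_L]) blast
next
  case (incl h)
  show ?case
  proof (cases "h = w m")
    case True
    then have "h = w m [^]\<^bsub>L\<^esub> (1::nat)" by (simp add: roots_in)
    then show ?thesis by (intro span_incl1[OF pows_L]) blast
  next
    case False
    then have h: "h \<in> R" using incl by simp
    then have "h = h \<otimes>\<^bsub>L\<^esub> w m [^]\<^bsub>L\<^esub> (0::nat)" by (simp add: R_sub)
    moreover have "w m [^]\<^bsub>L\<^esub> (0::nat) \<in> range (\<lambda>j::nat. w m [^]\<^bsub>L\<^esub> j)" by blast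
    ultimately show ?thesis using span_incl[OF pows_L _ h] by metis
  qed
next
  case (a_inv h)
  have "\<ominus>\<^bsub>L\<^esub> h = (\<ominus>\<^bsub>L\<^esub> \<one>\<^bsub>L\<^esub>) \<otimes>\<^bsub>L\<^esub> h"
    using span_carrier[OF pows_L a_inv.IH] by (simp add: L.l_minus)
  then show ?case using span_smult[OF pows_L _ a_inv.IH] R_closed(2,3) by simp
next
  case (eng_add h1 h2)
  then show ?case by (intro span_add[OF pows_L])
next
  case (eng_mult h1 h2)
  then show ?case by (intro span_mult[OF pows_L]) (auto simp: L.nat_pow_mult roots_in)
qed

text \<open>An inverse of \<open>\<pi>\<close> would lie in one of the finite
  \<open>R\<close>-modules \<open>R[w m]\<close>. Multiplication by it maps that ring to itself,
  against \<open>nakayama\<close>.\<close>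

lemma p_not_unit_S:
  assumes "s \<in> carrier S" "\<pi> \<otimes>\<^bsub>L\<^esub> s = \<one>\<^bsub>L\<^esub>" shows False
proof -
  obtain m where s: "s \<in> gen m" using assms by (auto simp: S_carrier)
  let ?B = "(\<lambda>j. w m [^]\<^bsub>L\<^esub> j) ` {..<p ^ m}"
  show False
  proof (rule nakayama[of ?B "gen m" s])
    show "\<And>x. x \<in> gen m \<Longrightarrow> x \<in> rsp ?B" using gen_span pows_red by blast
    show "?B \<subseteq> gen m" using gen_pow[OF w_gen] by auto
  qed (use s assms S_L pows_L generate_ring.one generate_ring.eng_mult in auto)
qed

text \<open>Otherwise \<open>r\<close> is a unit of \<open>R\<close>, so \<open>w m\<close> is a
  unit of \<open>S\<close>, and so is its power \<open>\<pi>\<close>.\<close>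

lemma R_wS:
  assumes r: "r \<in> R" and s: "s \<in> carrier S" "r = w m \<otimes>\<^bsub>L\<^esub> s"
  shows "r \<in> p_ideal p 1 RR"
proof (rule ccontr)
  assume "r \<notin> p_ideal p 1 RR"
  then obtain u where u: "u \<in> R" "r \<otimes>\<^bsub>L\<^esub> u = \<one>\<^bsub>L\<^esub>" using R_unit r by blast
  define v where "v = s \<otimes>\<^bsub>L\<^esub> u"
  have v: "v \<in> carrier S" using S.m_closed[OF s(1) R_S[OF u(1)]] by (simp add: v_def)
  have "w m \<otimes>\<^bsub>L\<^esub> v = \<one>\<^bsub>L\<^esub>" using u s S_L[OF s(1)] R_sub[OF u(1)] by (simp add: v_def L.m_assoc roots_in)
  then have "(w m \<otimes>\<^bsub>L\<^esub> v) [^]\<^bsub>L\<^esub> (p ^ m) = \<one>\<^bsub>L\<^esub>" by simp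
  then have "\<pi> \<otimes>\<^bsub>L\<^esub> v [^]\<^bsub>L\<^esub> (p ^ m) = \<one>\<^bsub>L\<^esub>"
    using S_L[OF v] by (simp add: L.nat_pow_distrib roots_in w_pow_N)
  then show False using p_not_unit_S S.nat_pow_closed[OF v, of "p ^ m"] by simp
qed

lemma hs_R_S: "(\<And>i. u i \<in> R) \<Longrightarrow> hs L (w m) u k \<in> carrier S"
  using S.hs_closed[OF w_S, of u m k] R_S by simp

text \<open>Induction on the index \<open>k\<close>, writing \<open>w\<close> for
  \<open>w m\<close>. Once the coefficients below \<open>k\<close> are multiples of
  \<open>\<pi>\<close>, every term other than \<open>u k * w^k\<close> is divisible by
  \<open>w^(k+1)\<close>, because \<open>\<pi>\<close> is \<open>w^(p^m)\<close> and
  \<open>k < p^m\<close>. Cancelling \<open>w^k\<close> in the field leaves \<open>u k\<close> in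
  \<open>w S\<close>, and \<open>R_wS\<close> applies.\<close>

lemma coeff_div:
  assumes u: "\<And>i. u i \<in> R" and s: "s \<in> carrier S" "hs L (w m) u (p ^ m) = \<pi> \<otimes>\<^bsub>L\<^esub> s" and i: "i < p ^ m"
  shows "u i \<in> p_ideal p 1 RR"
proof -
  let ?t = "w m"
  have "k \<le> p ^ m \<Longrightarrow> \<forall>i<k. u i \<in> p_ideal p 1 RR" for k
  proof (induction k)
    case (Suc k)
    then have "\<forall>i. \<exists>y\<in>R. i < k \<longrightarrow> u i = \<pi> \<otimes>\<^bsub>L\<^esub> y"
      unfolding sub_p_ideal_iff[OF R_subring] using \<pi>_R R_sub by (metis L.nat_pow_one Suc_leD L.nat_pow_eone)
    then obtain v where v: "\<And>i. v i \<in> R" "\<And>i. i < k \<Longrightarrow> u i = \<pi> \<otimes>\<^bsub>L\<^esub> v i" by metis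
    have hk: "hs L ?t u k = \<pi> \<otimes>\<^bsub>L\<^esub> hs L ?t v k"
      using v by (simp add: L.hs_cong[of k u "\<lambda>i. \<pi> \<otimes>\<^bsub>L\<^esub> v i"] L.hs_smult roots_in R_sub \<pi>_R)
    obtain z where z: "z \<in> carrier S"
      "hs L ?t u (p ^ m) = hs L ?t u k \<oplus>\<^bsub>L\<^esub> u k \<otimes>\<^bsub>L\<^esub> ?t [^]\<^bsub>L\<^esub> k \<oplus>\<^bsub>L\<^esub> ?t [^]\<^bsub>L\<^esub> Suc k \<otimes>\<^bsub>L\<^esub> z"
      using S.hs_split[OF w_S, of u k "p ^ m" m] R_S u Suc.prems by (auto simp del: L.nat_pow_Suc)
    define d where "d = ?t [^]\<^bsub>L\<^esub> (p ^ m - Suc k)"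
    define h where "h = hs L ?t v k"
    define tk where "tk = ?t [^]\<^bsub>L\<^esub> k"
    have c: "d \<in> carrier L" "h \<in> carrier L" "tk \<in> carrier L" "s \<in> carrier L" "z \<in> carrier L" "u k \<in> carrier L" "w m \<in> carrier L"
      using s z S_L u R_sub roots_in hs_R_S v by (auto simp: d_def h_def tk_def)
    have \<pi>: "\<pi> = tk \<otimes>\<^bsub>L\<^esub> (?t \<otimes>\<^bsub>L\<^esub> d)"
      using L.pow_split[of ?t k "p ^ m"] Suc.prems by (simp add: w_pow_N roots_in tk_def d_def)
    have "tk \<otimes>\<^bsub>L\<^esub> u k = \<pi> \<otimes>\<^bsub>L\<^esub> s \<ominus>\<^bsub>L\<^esub> \<pi> \<otimes>\<^bsub>L\<^esub> h \<ominus>\<^bsub>L\<^esub> (?t \<otimes>\<^bsub>L\<^esub> tk) \<otimes>\<^bsub>L\<^esub> z"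
    proof -
      have "\<pi> \<otimes>\<^bsub>L\<^esub> s = \<pi> \<otimes>\<^bsub>L\<^esub> h \<oplus>\<^bsub>L\<^esub> u k \<otimes>\<^bsub>L\<^esub> tk \<oplus>\<^bsub>L\<^esub> (tk \<otimes>\<^bsub>L\<^esub> ?t) \<otimes>\<^bsub>L\<^esub> z"
        using z(2) s(2) hk by (simp add: tk_def h_def)
      then show ?thesis using c L.p_elem_closed[of p] by algebra
    qed
    also have "\<dots> = tk \<otimes>\<^bsub>L\<^esub> (?t \<otimes>\<^bsub>L\<^esub> (d \<otimes>\<^bsub>L\<^esub> s \<ominus>\<^bsub>L\<^esub> d \<otimes>\<^bsub>L\<^esub> h \<ominus>\<^bsub>L\<^esub> z))"
      unfolding \<pi> using c by algebra
    finally have "u k = ?t \<otimes>\<^bsub>L\<^esub> (d \<otimes>\<^bsub>L\<^esub> s \<ominus>\<^bsub>L\<^esub> d \<otimes>\<^bsub>L\<^esub> h \<ominus>\<^bsub>L\<^esub> z)"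
      using L.m_lcancel[of tk "u k" "?t \<otimes>\<^bsub>L\<^esub> (d \<otimes>\<^bsub>L\<^esub> s \<ominus>\<^bsub>L\<^esub> d \<otimes>\<^bsub>L\<^esub> h \<ominus>\<^bsub>L\<^esub> z)"] c w_pow_nz[of m k] by (simp add: tk_def)
    moreover have "d \<otimes>\<^bsub>L\<^esub> s \<ominus>\<^bsub>L\<^esub> d \<otimes>\<^bsub>L\<^esub> h \<ominus>\<^bsub>L\<^esub> z \<in> carrier S"
      using subringE(5,6,7)[OF S_sub] s z w_pow_S hs_R_S[of v, OF v(1)] unfolding a_minus_def d_def h_def by simp
    ultimately have "u k \<in> p_ideal p 1 RR" using R_wS u by blast
    then show ?case using Suc by (auto simp: less_Suc_eq)
  qed simp
  then show ?thesis using i by blast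
qed

end

context base_data
begin

subsection \<open>The coefficient of \<open>p\<^sup>0\<close>\<close>

abbreviation "Pm m \<equiv> rsp ((\<lambda>j. w m [^]\<^bsub>L\<^esub> (j::nat)) ` {0<..<p ^ m})"

lemma hs_upd0:
  assumes "\<And>i. u i \<in> R" "r \<in> R" "0 < j" "j < p ^ m"
  shows "hs L (w m) (u(j := u j \<oplus>\<^bsub>L\<^esub> r)) (p ^ m) = r \<otimes>\<^bsub>L\<^esub> w m [^]\<^bsub>L\<^esub> j \<oplus>\<^bsub>L\<^esub> hs L (w m) u (p ^ m)"
  using assms by (subst L.hs_update) (auto simp: R_sub roots_in intro!: L.a_comm)

lemma Pm_hs:
  assumes "y \<in> Pm m"
  shows "\<exists>u. (\<forall>i. u i \<in> R) \<and> u 0 = \<zero>\<^bsub>L\<^esub> \<and> y = hs L (w m) u (p ^ m)"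
  using assms
proof (induction rule: rspan.induct)
  case zero
  then show ?case using R_closed(1) by (intro exI[of _ "\<lambda>_. \<zero>\<^bsub>L\<^esub>"]) (auto simp: L.hs_zero roots_in)
next
  case (step r x y)
  then obtain u where u: "\<And>i. u i \<in> R" "u 0 = \<zero>\<^bsub>L\<^esub>" "y = hs L (w m) u (p ^ m)" by auto
  obtain j where j: "x = w m [^]\<^bsub>L\<^esub> j" "0 < j" "j < p ^ m" using step by auto
  have "r \<otimes>\<^bsub>L\<^esub> x \<oplus>\<^bsub>L\<^esub> y = hs L (w m) (u(j := u j \<oplus>\<^bsub>L\<^esub> r)) (p ^ m)"
    using hs_upd0[of u r j m, OF u(1) step(1) j(2,3)] by (simp add: j u(3))
  moreover have "\<forall>i. (u(j := u j \<oplus>\<^bsub>L\<^esub> r)) i \<in> R" using u(1) step(1) R_closed(5) by simp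
  moreover have "(u(j := u j \<oplus>\<^bsub>L\<^esub> r)) 0 = \<zero>\<^bsub>L\<^esub>" using u(2) j(2) by simp
  ultimately show ?case by metis
qed

lemma \<pi>_pow_R: "\<pi> [^]\<^bsub>L\<^esub> (k::nat) \<in> R"
  using RR.nat_pow_closed[of \<pi> k] \<pi>_R by (simp add: pow_sub)

text \<open>A relation can be divided by \<open>\<pi>\<close> repeatedly: by
  \<open>coeff_div\<close> all coefficients of a representation of \<open>\<pi>^(k+1)\<close> are
  multiples of \<open>\<pi>\<close>, and the quotients again have zeroth coefficient
  \<open>0\<close>. In the end \<open>1\<close> would be a multiple of \<open>w m\<close> in
  \<open>S\<close>, hence \<open>\<pi>\<close> a unit.\<close>

lemma pow_notin_Pm: "\<pi> [^]\<^bsub>L\<^esub> (k::nat) \<notin> Pm m"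
proof -
  have "\<pi> [^]\<^bsub>L\<^esub> k \<noteq> hs L (w m) u (p ^ m)" if "\<And>i. u i \<in> R" "u 0 = \<zero>\<^bsub>L\<^esub>" for u
    using that
  proof (induction k arbitrary: u)
    case 0
    have N: "0 < p ^ m" using p0 by simp
    then obtain z where z: "z \<in> carrier S" "hs L (w m) u (p ^ m) = u 0 \<oplus>\<^bsub>L\<^esub> w m \<otimes>\<^bsub>L\<^esub> z"
      using S.hs_split[OF w_S, of u 0 "p ^ m" m] R_S 0 R_sub by (auto simp: roots_in)
    show ?case
    proof
      assume "\<pi> [^]\<^bsub>L\<^esub> (0::nat) = hs L (w m) u (p ^ m)"
      then have 1: "\<one>\<^bsub>L\<^esub> = w m \<otimes>\<^bsub>L\<^esub> z" using z 0 S_L roots_in by simp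
      then have "\<one>\<^bsub>L\<^esub> \<in> p_ideal p 1 RR" using R_wS R_closed(2) z(1) by blast
      then obtain y where "y \<in> R" "\<one>\<^bsub>L\<^esub> = \<pi> \<otimes>\<^bsub>L\<^esub> y" by (auto simp: sub_p_ideal_iff[OF R_subring])
      then show False using p_not_unit_S R_S by metis
    qed
  next
    case (Suc k)
    show ?case
    proof
      assume a: "\<pi> [^]\<^bsub>L\<^esub> Suc k = hs L (w m) u (p ^ m)"
      have "hs L (w m) u (p ^ m) = \<pi> \<otimes>\<^bsub>L\<^esub> \<pi> [^]\<^bsub>L\<^esub> k" using a by (simp add: L.m_comm)
      then have "\<forall>i<p ^ m. u i \<in> p_ideal p 1 RR"
        using coeff_div[of u, OF Suc.prems(1) R_S[OF \<pi>_pow_R]] by blast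
      then have "\<forall>i. \<exists>y\<in>R. i < p ^ m \<longrightarrow> u i = \<pi> \<otimes>\<^bsub>L\<^esub> y"
        unfolding sub_p_ideal_iff[OF R_subring] using R_closed(1) by (metis L.nat_pow_eone L.p_elem_closed)
      then obtain v where v: "\<And>i. v i \<in> R" "\<And>i. i < p ^ m \<Longrightarrow> u i = \<pi> \<otimes>\<^bsub>L\<^esub> v i" by metis
      have "\<pi> \<otimes>\<^bsub>L\<^esub> v 0 = \<zero>\<^bsub>L\<^esub>" using v(2)[of 0] p0 Suc.prems(2) by simp
      then have v0: "v 0 = \<zero>\<^bsub>L\<^esub>" using \<pi>_nz v(1) by (simp add: L.integral_iff R_sub)
      have "hs L (w m) u (p ^ m) = \<pi> \<otimes>\<^bsub>L\<^esub> hs L (w m) v (p ^ m)"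
        using v by (simp add: L.hs_cong[of "p ^ m" u "\<lambda>i. \<pi> \<otimes>\<^bsub>L\<^esub> v i"] L.hs_smult roots_in R_sub)
      then have "\<pi> \<otimes>\<^bsub>L\<^esub> \<pi> [^]\<^bsub>L\<^esub> k = \<pi> \<otimes>\<^bsub>L\<^esub> hs L (w m) v (p ^ m)" using a by (simp add: L.m_comm)
      then have "\<pi> [^]\<^bsub>L\<^esub> k = hs L (w m) v (p ^ m)"
        using \<pi>_nz v(1) S_L[OF hs_R_S[of v]] by (simp add: L.m_lcancel)
      then show False using Suc.IH[of v, OF v(1) v0] by simp
    qed
  qed
  then show ?thesis using Pm_hs[of "\<pi> [^]\<^bsub>L\<^esub> k" m] by metis
qed

text \<open>A nonzero \<open>r\<close> is \<open>\<pi>^(k-1)\<close> times a unit, where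
  \<open>k\<close> is the least exponent with \<open>r\<close> outside \<open>p^k R\<close>. A unit
  multiple of \<open>r\<close> is then a power of \<open>\<pi>\<close> in the span, which
  \<open>pow_notin_Pm\<close> excludes.\<close>

lemma R_Pm_zero:
  assumes r: "r \<in> R" "r \<in> Pm m" shows "r = \<zero>\<^bsub>L\<^esub>"
proof (rule ccontr)
  assume "r \<noteq> \<zero>\<^bsub>L\<^esub>"
  then obtain n where n: "r \<notin> p_ideal p n RR" using RC.sep[of r] r by auto
  define k where "k = (LEAST n. r \<notin> p_ideal p n RR)"
  have k: "r \<notin> p_ideal p k RR" unfolding k_def using n by (rule LeastI)
  have k0: "k \<noteq> 0" using k r by (cases "k = 0") auto
  then have "r \<in> p_ideal p (k - 1) RR" using not_less_Least[of "k - 1" "\<lambda>n. r \<notin> p_ideal p n RR"] k_def by auto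
  then obtain s where s: "s \<in> R" "r = \<pi> [^]\<^bsub>L\<^esub> (k - 1) \<otimes>\<^bsub>L\<^esub> s" unfolding sub_p_ideal_iff[OF R_subring] by auto
  have "s \<notin> p_ideal p 1 RR"
  proof
    assume "s \<in> p_ideal p 1 RR"
    then obtain y where y: "y \<in> R" "s = \<pi> \<otimes>\<^bsub>L\<^esub> y" unfolding sub_p_ideal_iff[OF R_subring] by auto
    have "\<pi> [^]\<^bsub>L\<^esub> k = \<pi> [^]\<^bsub>L\<^esub> (k - 1) \<otimes>\<^bsub>L\<^esub> \<pi>" using k0 by (metis L.nat_pow_Suc Suc_pred' neq0_conv)
    then have "r = \<pi> [^]\<^bsub>L\<^esub> k \<otimes>\<^bsub>L\<^esub> y" using s y R_sub by (simp add: L.m_assoc)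
    then show False using k y unfolding sub_p_ideal_iff[OF R_subring] by blast
  qed
  then obtain u where u: "u \<in> R" "s \<otimes>\<^bsub>L\<^esub> u = \<one>\<^bsub>L\<^esub>" using R_unit s by blast
  have "u \<otimes>\<^bsub>L\<^esub> r = \<pi> [^]\<^bsub>L\<^esub> (k - 1) \<otimes>\<^bsub>L\<^esub> (s \<otimes>\<^bsub>L\<^esub> u)" using s u(1) R_sub by (simp add: L.m_ac)
  then have "u \<otimes>\<^bsub>L\<^esub> r = \<pi> [^]\<^bsub>L\<^esub> (k - 1)" using u by simp
  then show False using span_smult[OF pows_L u(1) r(2)] pow_notin_Pm by metis
qed

text \<open>An \<open>R\<close>-submodule complementary to \<open>R\<close> in \<open>S\<close>,
  spanned by the powers of roots with exponent strictly between \<open>0\<close> and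
  \<open>p^m\<close>, over all \<open>m\<close>. The levels are nested since \<open>w n\<close> is
  the \<open>p\<close>-th power of \<open>w (Suc n)\<close>.\<close>

definition "PS = (\<Union>m. Pm m)"

lemma Pm_mono: "m \<le> n \<Longrightarrow> Pm m \<subseteq> Pm n"
proof (induction n)
  case (Suc n)
  have "Pm n \<subseteq> Pm (Suc n)"
  proof
    fix y assume y: "y \<in> Pm n"
    show "y \<in> Pm (Suc n)"
    proof (rule span_sub[OF pows_L _ y], clarify)
      fix j :: nat assume j: "j \<in> {0<..<p ^ n}"
      have "w n [^]\<^bsub>L\<^esub> j = w (Suc n) [^]\<^bsub>L\<^esub> (p * j)"
        using L.nat_pow_pow[OF roots_in, of "Suc n" p j] by (simp add: root_Suc)
      moreover have "p * j \<in> {0<..<p ^ Suc n}" using j p0 by auto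
      ultimately have "w n [^]\<^bsub>L\<^esub> j \<in> (\<lambda>j. w (Suc n) [^]\<^bsub>L\<^esub> j) ` {0<..<p ^ Suc n}" by (rule image_eqI)
      then show "w n [^]\<^bsub>L\<^esub> j \<in> Pm (Suc n)" by (rule span_incl1[OF pows_L])
    qed
  qed
  then show ?case using Suc by (auto simp: le_Suc_eq)
qed simp

lemma PS_common:
  assumes "x \<in> PS" "y \<in> PS" shows "\<exists>m. x \<in> Pm m \<and> y \<in> Pm m"
proof -
  obtain m n where "x \<in> Pm m" "y \<in> Pm n" using assms by (auto simp: PS_def)
  then have "x \<in> Pm (max m n) \<and> y \<in> Pm (max m n)"
    using Pm_mono[of m "max m n"] Pm_mono[of n "max m n"] by auto
  then show ?thesis by blast
qed

lemma PS_add: "x \<in> PS \<Longrightarrow> y \<in> PS \<Longrightarrow> x \<oplus>\<^bsub>L\<^esub> y \<in> PS"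
  using PS_common[of x y] span_add[OF pows_L] unfolding PS_def by blast
lemma PS_smult: "c \<in> R \<Longrightarrow> y \<in> PS \<Longrightarrow> c \<otimes>\<^bsub>L\<^esub> y \<in> PS"
  using span_smult[OF pows_L] unfolding PS_def by blast
lemma PS_L: "y \<in> PS \<Longrightarrow> y \<in> carrier L"
  using span_carrier[OF pows_L] unfolding PS_def by blast
lemma PS_zero: "\<zero>\<^bsub>L\<^esub> \<in> PS"
  unfolding PS_def using rspan.zero by blast
lemma PS_neg: "y \<in> PS \<Longrightarrow> \<ominus>\<^bsub>L\<^esub> y \<in> PS"
  using PS_smult[of "\<ominus>\<^bsub>L\<^esub> \<one>\<^bsub>L\<^esub>" y] R_closed(2,3) PS_L by (simp add: L.l_minus)
lemma PS_pow: "0 < j \<Longrightarrow> j < p ^ m \<Longrightarrow> r \<in> R \<Longrightarrow> r \<otimes>\<^bsub>L\<^esub> w m [^]\<^bsub>L\<^esub> j \<in> PS"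
  unfolding PS_def using span_incl[OF pows_L, of "w m [^]\<^bsub>L\<^esub> j" m "{0<..<p ^ m}" r] by auto

text \<open>An expansion exists at every sufficiently high level, so that an element can be expanded
  in powers of a root of which a given root is itself a power.\<close>

lemma S_hs:
  assumes "s \<in> carrier S"
  shows "\<exists>M. \<forall>m\<ge>M. \<exists>u. (\<forall>i. u i \<in> R) \<and> s = hs L (w m) u (p ^ m)"
proof -
  obtain M where M: "s \<in> gen M" using assms by (auto simp: S_carrier)
  have "\<exists>u. (\<forall>i. u i \<in> R) \<and> s = hs L (w m) u (p ^ m)" if "M \<le> m" for m
  proof -
    have "s \<in> gen m" using M gen_mono[OF that] by blast
    then have "s \<in> rsp ((\<lambda>j. w m [^]\<^bsub>L\<^esub> j) ` {..<p ^ m})" using gen_span pows_red by blast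
    then show ?thesis
    proof (induction rule: rspan.induct)
      case zero
      then show ?case using R_closed(1) by (intro exI[of _ "\<lambda>_. \<zero>\<^bsub>L\<^esub>"]) (auto simp: L.hs_zero roots_in)
    next
      case (step r x y)
      then obtain u where u: "\<And>i. u i \<in> R" "y = hs L (w m) u (p ^ m)" by auto
      obtain j where j: "x = w m [^]\<^bsub>L\<^esub> j" "j < p ^ m" using step by auto
      have "hs L (w m) (u(j := u j \<oplus>\<^bsub>L\<^esub> r)) (p ^ m) = y \<oplus>\<^bsub>L\<^esub> r \<otimes>\<^bsub>L\<^esub> x"
        using u step(1) j by (subst L.hs_update) (auto simp: R_sub roots_in)
      moreover have "\<dots> = r \<otimes>\<^bsub>L\<^esub> x \<oplus>\<^bsub>L\<^esub> y"
        using S_L[OF hs_R_S[OF u(1)]] u(2) step(1) j by (intro L.a_comm) (auto simp: R_sub roots_in)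
      moreover have "\<forall>i. (u(j := u j \<oplus>\<^bsub>L\<^esub> r)) i \<in> R" using u(1) step(1) R_closed(5) by simp
      ultimately show ?case by metis
    qed
  qed
  then show ?thesis by blast
qed

lemma hs_decomp:
  assumes "\<And>i. u i \<in> R" "k \<le> p ^ m" "0 < k"
  shows "\<exists>y\<in>PS. hs L (w m) u k = u 0 \<oplus>\<^bsub>L\<^esub> y"
  using assms(3,2)
proof (induction k)
  case (Suc k)
  show ?case
  proof (cases "k = 0")
    case True
    then show ?thesis using R_sub[OF assms(1)] PS_zero by (intro bexI[of _ "\<zero>\<^bsub>L\<^esub>"]) auto
  next
    case False
    then obtain y where y: "y \<in> PS" "hs L (w m) u k = u 0 \<oplus>\<^bsub>L\<^esub> y" using Suc by auto
    have "u k \<otimes>\<^bsub>L\<^esub> w m [^]\<^bsub>L\<^esub> k \<in> PS" using PS_pow[of k m "u k"] assms(1) False Suc.prems by auto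
    then show ?thesis using y PS_add[OF y(1)] PS_L R_sub[OF assms(1)]
      by (intro bexI[of _ "y \<oplus>\<^bsub>L\<^esub> u k \<otimes>\<^bsub>L\<^esub> w m [^]\<^bsub>L\<^esub> k"]) (auto simp: L.a_assoc roots_in)
  qed
qed simp

text \<open>Projection of \<open>S\<close> onto \<open>R\<close> along \<open>PS\<close>. As it is
  defined by the decomposition and not by a chosen expansion, no level \<open>m\<close> enters;
  uniqueness of the decomposition is \<open>R_Pm_zero\<close>.\<close>

definition "e0 s = (THE r. r \<in> R \<and> (\<exists>y\<in>PS. s = r \<oplus>\<^bsub>L\<^esub> y))"

lemma e0_eqI:
  assumes "r \<in> R" "y \<in> PS" "s = r \<oplus>\<^bsub>L\<^esub> y" shows "e0 s = r"
  unfolding e0_def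
proof (rule the_equality)
  fix r' assume "r' \<in> R \<and> (\<exists>y\<in>PS. s = r' \<oplus>\<^bsub>L\<^esub> y)"
  then obtain y' where r': "r' \<in> R" "y' \<in> PS" "s = r' \<oplus>\<^bsub>L\<^esub> y'" by auto
  have c: "r \<in> carrier L" "r' \<in> carrier L" "y \<in> carrier L" "y' \<in> carrier L" using assms r' R_sub PS_L by auto
  have eq: "r' \<oplus>\<^bsub>L\<^esub> y' = r \<oplus>\<^bsub>L\<^esub> y" using assms r' by simp
  have "r' \<ominus>\<^bsub>L\<^esub> r = (r' \<oplus>\<^bsub>L\<^esub> y') \<ominus>\<^bsub>L\<^esub> r \<ominus>\<^bsub>L\<^esub> y'" using c by algebra
  also have "\<dots> = y \<ominus>\<^bsub>L\<^esub> y'" unfolding eq using c by algebra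
  finally have "r' \<ominus>\<^bsub>L\<^esub> r = y \<ominus>\<^bsub>L\<^esub> y'" .
  moreover have "y \<ominus>\<^bsub>L\<^esub> y' \<in> PS" unfolding a_minus_def using PS_add PS_neg assms r' by blast
  moreover have "r' \<ominus>\<^bsub>L\<^esub> r \<in> R" unfolding a_minus_def using R_closed(3,5) assms r' by blast
  ultimately have "r' \<ominus>\<^bsub>L\<^esub> r = \<zero>\<^bsub>L\<^esub>" using R_Pm_zero unfolding PS_def by auto
  then show "r' = r" using c by simp
qed (use assms in auto)

lemma e0_decomp:
  assumes "s \<in> carrier S"
  shows "e0 s \<in> R" "\<exists>y\<in>PS. s = e0 s \<oplus>\<^bsub>L\<^esub> y"
proof -
  obtain m u where u: "\<And>i. u i \<in> R" "s = hs L (w m) u (p ^ m)" using S_hs[OF assms] by blast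
  obtain y where y: "y \<in> PS" "s = u 0 \<oplus>\<^bsub>L\<^esub> y" using hs_decomp[of u "p ^ m" m] u p0 by auto
  then have "e0 s = u 0" using e0_eqI u(1) by blast
  then show "e0 s \<in> R" "\<exists>y\<in>PS. s = e0 s \<oplus>\<^bsub>L\<^esub> y" using u(1)[of 0] y by metis+
qed

lemma e0_add:
  assumes "s \<in> carrier S" "t \<in> carrier S"
  shows "e0 (s \<oplus>\<^bsub>L\<^esub> t) = e0 s \<oplus>\<^bsub>L\<^esub> e0 t"
proof -
  obtain y z where y: "y \<in> PS" "s = e0 s \<oplus>\<^bsub>L\<^esub> y" and z: "z \<in> PS" "t = e0 t \<oplus>\<^bsub>L\<^esub> z"
    using e0_decomp(2) assms by blast
  have r: "e0 s \<in> R" "e0 t \<in> R" using e0_decomp(1) assms by auto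
  have "s \<oplus>\<^bsub>L\<^esub> t = (e0 s \<oplus>\<^bsub>L\<^esub> y) \<oplus>\<^bsub>L\<^esub> (e0 t \<oplus>\<^bsub>L\<^esub> z)" using y(2) z(2) by simp
  also have "\<dots> = (e0 s \<oplus>\<^bsub>L\<^esub> e0 t) \<oplus>\<^bsub>L\<^esub> (y \<oplus>\<^bsub>L\<^esub> z)"
    using R_sub[OF r(1)] R_sub[OF r(2)] PS_L[OF y(1)] PS_L[OF z(1)] by (simp add: L.a_ac)
  finally show ?thesis using e0_eqI R_closed(5)[OF r] PS_add[OF y(1) z(1)] by blast
qed

lemma e0_smult:
  assumes "r \<in> R" "s \<in> carrier S"
  shows "e0 (r \<otimes>\<^bsub>L\<^esub> s) = r \<otimes>\<^bsub>L\<^esub> e0 s"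
proof -
  obtain y where y: "y \<in> PS" "s = e0 s \<oplus>\<^bsub>L\<^esub> y" using e0_decomp(2) assms by blast
  have e: "e0 s \<in> R" using e0_decomp(1) assms by auto
  have "r \<otimes>\<^bsub>L\<^esub> s = r \<otimes>\<^bsub>L\<^esub> (e0 s \<oplus>\<^bsub>L\<^esub> y)" using y(2) by simp
  also have "\<dots> = r \<otimes>\<^bsub>L\<^esub> e0 s \<oplus>\<^bsub>L\<^esub> r \<otimes>\<^bsub>L\<^esub> y" using R_sub e assms PS_L[OF y(1)] by (simp add: L.r_distr)
  finally show ?thesis using e0_eqI R_closed(4)[OF assms(1) e] PS_smult[OF assms(1) y(1)] by blast
qed

lemma e0_R: "r \<in> R \<Longrightarrow> e0 r = r"
  by (rule e0_eqI[OF _ PS_zero]) (auto simp: R_sub)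

lemma e0_PS: "y \<in> PS \<Longrightarrow> e0 y = \<zero>\<^bsub>L\<^esub>"
  by (rule e0_eqI[OF R_closed(1)]) (auto simp: PS_L)

lemma e0_pow: "0 < j \<Longrightarrow> j < p ^ m \<Longrightarrow> r \<in> R \<Longrightarrow> e0 (r \<otimes>\<^bsub>L\<^esub> w m [^]\<^bsub>L\<^esub> j) = \<zero>\<^bsub>L\<^esub>"
  by (intro e0_PS PS_pow)

text \<open>The total exponent is less than twice \<open>p^m\<close>. Strictly between
  \<open>0\<close> and \<open>p^m\<close> the power lies in \<open>PS\<close>, and likewise above
  \<open>p^m\<close> once \<open>\<pi>\<close> is split off; only the exponents \<open>0\<close> and
  \<open>p^m\<close> contribute. Multiplication by a power of the root thus singles out one
  coefficient.\<close>

lemma e0_pow_pair: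
  assumes "r \<in> R" "i \<le> p ^ m" "j < p ^ m"
  shows "e0 (w m [^]\<^bsub>L\<^esub> i \<otimes>\<^bsub>L\<^esub> (r \<otimes>\<^bsub>L\<^esub> w m [^]\<^bsub>L\<^esub> j)) =
    (if i + j = 0 then r else if i + j = p ^ m then \<pi> \<otimes>\<^bsub>L\<^esub> r else \<zero>\<^bsub>L\<^esub>)"
proof -
  have N: "p ^ m > 0" using p0 by simp
  have e: "w m [^]\<^bsub>L\<^esub> i \<otimes>\<^bsub>L\<^esub> (r \<otimes>\<^bsub>L\<^esub> w m [^]\<^bsub>L\<^esub> j) = r \<otimes>\<^bsub>L\<^esub> w m [^]\<^bsub>L\<^esub> (i + j)"
    using R_sub[OF assms(1)] by (simp add: L.nat_pow_mult[symmetric] roots_in L.m_lcomm)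
  consider "i + j = 0" | "0 < i + j" "i + j < p ^ m" | "i + j = p ^ m" | "p ^ m < i + j" by linarith
  then show ?thesis
  proof cases
    case 1
    then show ?thesis using assms N e0_R[OF assms(1)] unfolding e by (simp add: R_sub)
  next
    case 2
    then show ?thesis unfolding e using e0_pow assms by auto
  next
    case 3
    have "\<pi> \<otimes>\<^bsub>L\<^esub> r \<in> R" using \<pi>_R assms R_closed(4) by blast
    then show ?thesis unfolding e using 3 N assms p0 by (simp add: w_pow_N R_sub L.m_comm e0_R)
  next
    case 4
    define d where "d = i + j - p ^ m"
    have "w m [^]\<^bsub>L\<^esub> (i + j) = w m [^]\<^bsub>L\<^esub> (p ^ m) \<otimes>\<^bsub>L\<^esub> w m [^]\<^bsub>L\<^esub> d"
      using 4 by (simp add: L.nat_pow_mult roots_in d_def)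
    then have "r \<otimes>\<^bsub>L\<^esub> w m [^]\<^bsub>L\<^esub> (i + j) = (\<pi> \<otimes>\<^bsub>L\<^esub> r) \<otimes>\<^bsub>L\<^esub> w m [^]\<^bsub>L\<^esub> d"
      using R_sub[OF assms(1)] by (simp add: w_pow_N L.m_ac roots_in)
    moreover have "0 < d" "d < p ^ m" using 4 assms by (auto simp: d_def)
    moreover have "\<pi> \<otimes>\<^bsub>L\<^esub> r \<in> R" using \<pi>_R assms R_closed(4) by blast
    ultimately show ?thesis unfolding e using e0_pow[of d m "\<pi> \<otimes>\<^bsub>L\<^esub> r"] 4 by auto
  qed
qed

text \<open>At a level \<open>m\<close> above \<open>l\<close> the root \<open>w l\<close> is
  \<open>w m\<close> to the positive exponent \<open>i = p^(m-l)\<close>. The zeroth coefficient of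
  the product therefore only collects terms of total exponent \<open>p^m\<close>, each carrying a
  factor \<open>\<pi>\<close>.\<close>

lemma e0_w_mult:
  assumes s: "s \<in> carrier S" shows "e0 (w l \<otimes>\<^bsub>L\<^esub> s) \<in> p_ideal p 1 RR"
proof -
  obtain M where M: "\<And>m. m \<ge> M \<Longrightarrow> \<exists>u. (\<forall>i. u i \<in> R) \<and> s = hs L (w m) u (p ^ m)" using S_hs[OF s] by blast
  define m where "m = max l M"
  then obtain u where u: "\<And>i. u i \<in> R" "s = hs L (w m) u (p ^ m)" using M[of m] by auto
  define i where "i = p ^ (m - l)"
  have i: "w l = w m [^]\<^bsub>L\<^esub> i" "i > 0" "i \<le> p ^ m"
    using w_pow[of l "m - l"] p0 by (auto simp: i_def m_def intro!: power_increasing)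
  have "k \<le> p ^ m \<Longrightarrow> e0 (w l \<otimes>\<^bsub>L\<^esub> hs L (w m) u k) \<in> p_ideal p 1 RR" for k
  proof (induction k)
    case 0
    then show ?case using e0_R[OF R_closed(1)] RR.p_ideal_zero[of p 1] by (simp add: roots_in)
  next
    case (Suc k)
    have c: "u k \<otimes>\<^bsub>L\<^esub> w m [^]\<^bsub>L\<^esub> k \<in> carrier S" "w l \<in> carrier S" "hs L (w m) u k \<in> carrier S"
      using S.m_closed[OF R_S[OF u(1)] w_pow_S] w_S hs_R_S[OF u(1)] by auto
    have "w l \<otimes>\<^bsub>L\<^esub> hs L (w m) u (Suc k) = w l \<otimes>\<^bsub>L\<^esub> hs L (w m) u k \<oplus>\<^bsub>L\<^esub> w l \<otimes>\<^bsub>L\<^esub> (u k \<otimes>\<^bsub>L\<^esub> w m [^]\<^bsub>L\<^esub> k)"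
      using c S_L by (simp add: L.r_distr)
    then have "e0 (w l \<otimes>\<^bsub>L\<^esub> hs L (w m) u (Suc k)) = e0 (w l \<otimes>\<^bsub>L\<^esub> hs L (w m) u k) \<oplus>\<^bsub>L\<^esub> e0 (w l \<otimes>\<^bsub>L\<^esub> (u k \<otimes>\<^bsub>L\<^esub> w m [^]\<^bsub>L\<^esub> k))"
      using S.m_closed[OF c(2,1)] S.m_closed[OF c(2,3)] by (simp add: e0_add)
    moreover have "e0 (w l \<otimes>\<^bsub>L\<^esub> (u k \<otimes>\<^bsub>L\<^esub> w m [^]\<^bsub>L\<^esub> k)) \<in> p_ideal p 1 RR"
      unfolding i(1) using e0_pow_pair[OF u(1) i(3), of k k] Suc.prems i(2) RR.p_ideal_zero[of p 1] u(1)
      by (auto simp: sub_p_ideal_iff[OF R_subring])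
    ultimately show ?case using Suc RR.p_ideal_add[of _ p 1] by simp
  qed
  then show ?thesis using u(2) by simp
qed

end

section \<open>The norm defined by the roots of \<open>p\<close>\<close>

lemma (in monoid) int_pow_units_of:
  assumes "x \<in> Units G" shows "x [^]\<^bsub>units_of G\<^esub> (a::int) = x [^] a"
proof -
  have 1: "x [^] (n::nat) \<in> Units G" for n using assms by (rule Units_pow_closed)
  have 2: "x [^]\<^bsub>units_of G\<^esub> (n::nat) = x [^] n" for n
    by (simp add: nat_pow_def units_of_def)
  show ?thesis unfolding int_pow_def2 2 units_of_inv[OF 1] ..
qed

text \<open>The union of the principal ideals of the single roots; they increase with
  \<open>m\<close>, as \<open>t (m + k)\<close> divides \<open>t m\<close>. For \<open>K^o\<close>
  it turns out to be the maximal ideal, for \<open>P^o\<close> the ideal generated by it.\<close>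

definition tideal :: "('c, 'm) ring_scheme \<Rightarrow> (nat \<Rightarrow> 'c) \<Rightarrow> 'c set" where
  "tideal C t = {x. \<exists>m. \<exists>y\<in>carrier C. x = t m \<otimes>\<^bsub>C\<^esub> y}"

text \<open>Both \<open>K^o\<close> and \<open>P^o\<close> are instances, so that the theory of the
  norm is developed once.\<close>

locale root_ring = complete_ring C p for C :: "('c, 'm) ring_scheme" (structure) and p +
  fixes t :: "nat \<Rightarrow> 'c"
  assumes prime: "Factorial_Ring.prime p"
    and t_closed [simp]: "t m \<in> carrier C"
    and t_0: "t 0 = p_elem p C"
    and t_Suc: "t (Suc m) [^] p = t m"
begin

abbreviation "J \<equiv> tideal C t"

lemma p_gt_1: "p > 1" using prime by (rule prime_gt_1_nat)

lemma t_pow: "t (m + k) [^] (p ^ k) = t m"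
proof (induction k)
  case (Suc k)
  have "t (m + Suc k) [^] (p ^ Suc k) = (t (Suc (m + k)) [^] p) [^] (p ^ k)"
    by (simp add: nat_pow_pow)
  then show ?case using Suc by (simp add: t_Suc)
qed simp

lemma t_dvd: "\<exists>z\<in>carrier C. t m = t (m + k) \<otimes> z"
proof -
  obtain n where "p ^ k = Suc n" using p_gt_1 by (metis Suc_pred' less_trans zero_less_one zero_less_power)
  then have "t m = t (m + k) \<otimes> t (m + k) [^] n"
    using t_pow[of m k] by (metis nat_pow_Suc2 t_closed)
  then show ?thesis by (intro bexI[of _ "t (m + k) [^] n"]) simp_all
qed

lemma J_closed: "x \<in> J \<Longrightarrow> x \<in> carrier C"
  by (auto simp: tideal_def)

lemma J_E:
  assumes "x \<in> J" obtains m y where "y \<in> carrier C" "x = t m \<otimes> y"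
  using assms unfolding tideal_def by blast

lemma J_I: "y \<in> carrier C \<Longrightarrow> t m \<otimes> y \<in> J"
  unfolding tideal_def by blast

lemma J_level: "x \<in> J \<Longrightarrow> \<exists>M. \<forall>m\<ge>M. \<exists>y\<in>carrier C. x = t m \<otimes> y"
proof -
  assume "x \<in> J"
  then obtain l y where y: "y \<in> carrier C" "x = t l \<otimes> y" by (auto simp: tideal_def)
  have "\<exists>y\<in>carrier C. x = t m \<otimes> y" if m: "m \<ge> l" for m
  proof -
    obtain z where z: "z \<in> carrier C" "t l = t m \<otimes> z" using t_dvd[of l "m - l"] m by auto
    then have "x = t m \<otimes> (z \<otimes> y)" using y by (simp add: m_assoc)
    then show ?thesis using z(1) y(1) by blast
  qed
  then show ?thesis by blast
qed

lemma J_ideal: "ideal J C"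
proof (rule idealI)
  show "subgroup J (add_monoid C)"
  proof
    show "J \<subseteq> carrier (add_monoid C)" by (auto simp: tideal_def)
    show "\<one>\<^bsub>add_monoid C\<^esub> \<in> J" by (auto simp: tideal_def intro!: exI[of _ 0] bexI[of _ "\<zero>"])
  next
    fix x y assume xy: "x \<in> J" "y \<in> J"
    then obtain M M' where "\<forall>m\<ge>M. \<exists>z\<in>carrier C. x = t m \<otimes> z" "\<forall>m\<ge>M'. \<exists>z\<in>carrier C. y = t m \<otimes> z"
      using J_level by meson
    then obtain z z' where "z \<in> carrier C" "x = t (max M M') \<otimes> z" "z' \<in> carrier C" "y = t (max M M') \<otimes> z'"
      by (metis max.cobounded1 max.cobounded2)
    then have "z \<oplus> z' \<in> carrier C \<and> x \<oplus> y = t (max M M') \<otimes> (z \<oplus> z')" by (simp add: r_distr)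
    then show "x \<otimes>\<^bsub>add_monoid C\<^esub> y \<in> J" unfolding tideal_def by auto
  next
    fix x assume "x \<in> J"
    then obtain m y where y: "y \<in> carrier C" "x = t m \<otimes> y" by (auto simp: tideal_def)
    then have "\<ominus> x = t m \<otimes> (\<ominus> y)" by (simp add: r_minus)
    then have "\<ominus> x \<in> J" using y(1) unfolding tideal_def by (auto intro: a_inv_closed)
    then show "inv\<^bsub>add_monoid C\<^esub> x \<in> J" by (simp add: a_inv_def)
  qed
next
  fix a x assume "a \<in> J" "x \<in> carrier C"
  then obtain m y where y: "y \<in> carrier C" "a = t m \<otimes> y" by (auto simp: tideal_def)
  have "a \<otimes> x = t m \<otimes> (y \<otimes> x)" using y \<open>x \<in> carrier C\<close> by (simp add: m_assoc)
  then have "a \<otimes> x \<in> J" using y(1) \<open>x \<in> carrier C\<close> unfolding tideal_def by blast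
  then show "a \<otimes> x \<in> J" "x \<otimes> a \<in> J" using m_comm[of a x] y \<open>x \<in> carrier C\<close> by simp_all
qed (rule ring_axioms)

sublocale J: ideal J C by (rule J_ideal)

lemma p_ideal_J: "x \<in> p_ideal p 1 C \<Longrightarrow> x \<in> J"
  unfolding p_ideal_iff tideal_def using t_0 by (auto intro!: exI[of _ 0])

text \<open>The \<open>p^m\<close>-th power of \<open>t m * y\<close> is \<open>p\<close> times a
  power of \<open>y\<close>.\<close>

lemma J_nilpotent:
  assumes "x \<in> J" shows "\<exists>n::nat. x [^] n \<in> p_ideal p 1 C"
proof -
  obtain m y where y: "y \<in> carrier C" "x = t m \<otimes> y" using assms by (rule J_E)
  have "x [^] (p ^ m) = p_elem p C \<otimes> y [^] (p ^ m)"
    using y t_pow[of 0 m] by (simp add: nat_pow_distrib t_0)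
  then show ?thesis using y(1) p_idealI[of "y [^] (p ^ m)" p 1] by (metis nat_pow_closed nat_pow_eone p_elem_closed)
qed

text \<open>By \<open>hs_leading\<close> the first coefficient outside \<open>pC\<close> gives the
  exponent \<open>j\<close>. Everything besides \<open>u j\<close>, including the error
  \<open>p z\<close> of the congruence, keeps a factor \<open>t m\<close> after the
  \<open>j\<close>-th power of \<open>t m\<close> is taken out, since \<open>j < p^m\<close>; so it
  cannot move \<open>u j\<close> into \<open>J\<close>.\<close>

lemma leadingI:
  assumes u: "\<And>i. u i \<in> carrier C" and x: "pcong p 1 C x (hs C (t m) u (p ^ m))"
    and uJ: "\<And>i. u i \<in> J \<Longrightarrow> u i \<in> p_ideal p 1 C" and nx: "x \<notin> p_ideal p 1 C"
  shows "\<exists>j. \<exists>y\<in>carrier C. y \<notin> J \<and> x = t m [^] (j::nat) \<otimes> y"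
proof -
  have tN: "t m [^] (p ^ m) = p_elem p C" using t_pow[of 0 m] by (simp add: t_0)
  obtain z where z: "z \<in> carrier C" "x = hs C (t m) u (p ^ m) \<oplus> p_elem p C \<otimes> z" 
    using x by (auto simp: pcong_iff)
  have "\<not> (\<exists>z\<in>carrier C. hs C (t m) u (p ^ m) = p_elem p C \<otimes> z)"
    using nx pcong_p_ideal[OF x] p_idealI[of _ p 1] by auto
  then obtain j z' where j: "j < p ^ m" "z' \<in> carrier C" "\<nexists>y. y \<in> carrier C \<and> u j = p_elem p C \<otimes> y"
    "hs C (t m) u (p ^ m) = t m [^] j \<otimes> (u j \<oplus> t m \<otimes> z')"
    using hs_leading[of "t m" u, OF t_closed u tN order_refl] by blast
  define e where "e = t m [^] (p ^ m - Suc j)"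
  have e: "e \<in> carrier C" "p_elem p C = t m [^] j \<otimes> (t m \<otimes> e)"
    using pow_split[of "t m" j "p ^ m"] j(1) by (simp_all add: e_def tN)
  define v where "v = t m \<otimes> (z' \<oplus> e \<otimes> z)"
  have v: "v \<in> J" "v \<in> carrier C" unfolding v_def using j(2) e(1) z(1) by (auto intro: J_I)
  have uj: "u j \<notin> p_ideal p 1 C" using j(3) by (auto simp: p_ideal_iff)
  have "x = t m [^] j \<otimes> (u j \<oplus> v)"
    unfolding z(2) j(4) e(2) v_def using u[of j] j(2) e(1) z(1) by (simp add: r_distr m_assoc a_assoc)
  moreover have "u j \<oplus> v \<notin> J"
  proof
    assume "u j \<oplus> v \<in> J"
    then have "(u j \<oplus> v) \<oplus> \<ominus> v \<in> J" by (rule J.a_closed[OF _ J.a_inv_closed[OF v(1)]])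
    moreover have "(u j \<oplus> v) \<oplus> \<ominus> v = u j" using u[of j] v(2) by (simp add: a_assoc r_neg)
    ultimately show False using uJ uj by auto
  qed
  ultimately show ?thesis using u[of j] v(2) by blast
qed

end

text \<open>Conditions under which the gauge norm is understood. \<open>leading\<close> makes the
  infimum attained, the part outside \<open>J\<close> playing the role of an element of norm one.
  \<open>radical\<close> says that \<open>C/J\<close> is reduced and determines the power-bounded
  elements.\<close>

locale gauge_ring = root_ring +
  assumes ptf: "x \<in> carrier C \<Longrightarrow> p_elem p C \<otimes> x = \<zero> \<Longrightarrow> x = \<zero>"
    and leading: "x \<in> carrier C \<Longrightarrow> x \<notin> p_ideal p 1 C \<Longrightarrow>
      \<exists>m j. \<exists>y\<in>carrier C. y \<notin> J \<and> x = t m [^] (j::nat) \<otimes> y"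
    and radical: "x \<in> carrier C \<Longrightarrow> 0 < n \<Longrightarrow> x [^] (n::nat) \<in> J \<Longrightarrow> x \<in> J"
begin

sublocale nzd_loc C "p_elem p C"
  by unfold_locales (auto intro: ptf)

abbreviation "P \<equiv> invert_p p C"
abbreviation "\<iota> \<equiv> invert_p_in p C"
abbreviation "nrm \<equiv> gauge_norm p C t"

lemma P_eq: "P = loc C (p_elem p C)" by (simp add: invert_p_def)
lemma \<iota>_eq: "\<iota> x = fr x 0" by (simp add: invert_p_in_def)

sublocale P: cring P unfolding P_eq by (rule loc_cring)

lemma \<iota>_hom: "\<iota> \<in> ring_hom C P"
  using fr_hom by (simp add: P_eq \<iota>_eq[abs_def])

lemma \<iota>_closed [simp]: "x \<in> carrier C \<Longrightarrow> \<iota> x \<in> carrier P"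
  using \<iota>_hom by (rule ring_hom_closed)
lemma \<iota>_mult: "x \<in> carrier C \<Longrightarrow> y \<in> carrier C \<Longrightarrow> \<iota> (x \<otimes> y) = \<iota> x \<otimes>\<^bsub>P\<^esub> \<iota> y"
  using \<iota>_hom by (rule ring_hom_mult)
lemma \<iota>_add: "x \<in> carrier C \<Longrightarrow> y \<in> carrier C \<Longrightarrow> \<iota> (x \<oplus> y) = \<iota> x \<oplus>\<^bsub>P\<^esub> \<iota> y"
  using \<iota>_hom by (rule ring_hom_add)
lemma \<iota>_one: "\<iota> \<one> = \<one>\<^bsub>P\<^esub>"
  using \<iota>_hom by (rule ring_hom_one)
lemma \<iota>_zero: "\<iota> \<zero> = \<zero>\<^bsub>P\<^esub>"
  using \<iota>_hom by (rule ring_hom_zero'[OF is_cring P.is_cring])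
lemma \<iota>_pow: "x \<in> carrier C \<Longrightarrow> \<iota> (x [^] (n::nat)) = \<iota> x [^]\<^bsub>P\<^esub> n"
  using ring_hom_pow[OF is_cring P.is_cring \<iota>_hom] .
lemma \<iota>_minus: "x \<in> carrier C \<Longrightarrow> y \<in> carrier C \<Longrightarrow> \<iota> (x \<ominus> y) = \<iota> x \<ominus>\<^bsub>P\<^esub> \<iota> y"
  using ring_hom_minus[OF is_cring P.is_cring \<iota>_hom] .
lemma \<iota>_inj: "x \<in> carrier C \<Longrightarrow> y \<in> carrier C \<Longrightarrow> \<iota> x = \<iota> y \<longleftrightarrow> x = y"
  by (simp add: \<iota>_eq fr_eq_iff)

lemma \<iota>_p_unit: "\<iota> (p_elem p C) \<in> Units P"
proof -
  have "\<iota> (p_elem p C) \<otimes>\<^bsub>P\<^esub> fr \<one> 1 = \<one>\<^bsub>P\<^esub>"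
    by (simp add: P_eq \<iota>_eq fr_mult fr_one fr_eq_iff)
  then have "\<iota> (p_elem p C) \<otimes>\<^bsub>P\<^esub> fr \<one> 1 \<in> Units P" by simp
  then show ?thesis by (rule P.unit_factor) (simp_all, simp add: P_eq)
qed

lemma \<iota>_t_unit: "\<iota> (t m) \<in> Units P"
proof -
  obtain z where z: "z \<in> carrier C" "t 0 = t m \<otimes> z" using t_dvd[of 0 m] by auto
  then have "\<iota> (t m) \<otimes>\<^bsub>P\<^esub> \<iota> z \<in> Units P" using \<iota>_p_unit by (simp add: \<iota>_mult[symmetric] t_0)
  then show ?thesis using P.unit_factor[of "\<iota> (t m)" "\<iota> z"] z(1) by simp
qed

text \<open>The element \<open>p^(a/p^m)\<close> of \<open>C[1/p]\<close>; by
  \<open>tp_level\<close> it depends on the quotient \<open>a/p^m\<close> only. Its powers are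
  computed in the group of units, where the laws for integer exponents hold.\<close>

definition "tp m (a::int) = \<iota> (t m) [^]\<^bsub>P\<^esub> a"

interpretation U: comm_group "units_of P" by (rule P.units_comm_group)

lemma tU: "\<iota> (t m) \<in> carrier (units_of P)"
  using \<iota>_t_unit by (simp add: units_of_carrier)

lemma tp_U: "tp m a = \<iota> (t m) [^]\<^bsub>units_of P\<^esub> a"
  using P.int_pow_units_of[OF \<iota>_t_unit] by (simp add: tp_def)

lemma tp_unit: "tp m a \<in> Units P"
  using U.int_pow_closed[OF tU, of m a] by (simp add: tp_U units_of_carrier)

lemma tp_closed [simp]: "tp m a \<in> carrier P"
  using tp_unit by (rule P.Units_closed)

lemma tp_add: "tp m (a + b) = tp m a \<otimes>\<^bsub>P\<^esub> tp m b"
  using U.int_pow_mult[OF tU, of m a b] by (simp add: tp_U units_of_mult)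

lemma tp_nat: "tp m (int n) = \<iota> (t m [^] n)"
  by (simp add: tp_def int_pow_int \<iota>_pow)

lemma tp_0 [simp]: "tp m 0 = \<one>\<^bsub>P\<^esub>"
  by (simp add: tp_def)

lemma tp_level: "tp (m + k) (a * int (p ^ k)) = tp m a"
proof -
  have 1: "\<iota> (t (m + k)) [^]\<^bsub>units_of P\<^esub> (int (p ^ k)) = \<iota> (t m)"
    using tp_nat[of "m + k" "p ^ k"] unfolding tp_U t_pow .
  show ?thesis
    using U.int_pow_pow[OF tU[of "m + k"], of "int (p ^ k)" a] unfolding tp_U 1 by (simp only: mult.commute)
qed

lemma tp_level': "tp m a = tp (m + k) (a * int (p ^ k))"
  by (rule tp_level[symmetric])

lemma tp_inv: "tp m a \<otimes>\<^bsub>P\<^esub> tp m (- a) = \<one>\<^bsub>P\<^esub>"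
  by (simp add: tp_add[symmetric])

lemma tp_mult: "tp m a \<otimes>\<^bsub>P\<^esub> tp l b = tp (m + l) (a * int (p ^ l) + b * int (p ^ m))"
  using tp_level[of m l a] tp_level[of l m b] by (simp add: tp_add add.commute)

text \<open>The closed ball of radius \<open>p^(-a/p^m)\<close> around zero, as
  \<open>nrm_le_iff\<close> shows later. In this form inclusions and sums of balls become
  divisibility statements in \<open>C\<close>.\<close>

definition "ball m a = {x. \<exists>c\<in>carrier C. x = tp m a \<otimes>\<^bsub>P\<^esub> \<iota> c}"

abbreviation "val m (a::int) \<equiv> real_of_int a / real p ^ m"

lemma val_le_iff: "val l b \<le> val m a \<longleftrightarrow> b * int (p ^ m) \<le> a * int (p ^ l)"
proof -
  have "val l b \<le> val m a \<longleftrightarrow> real_of_int b * real p ^ m \<le> real_of_int a * real p ^ l"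
    using p_gt_1 by (simp add: field_simps)
  also have "\<dots> \<longleftrightarrow> real_of_int (b * int (p ^ m)) \<le> real_of_int (a * int (p ^ l))" by simp
  finally show ?thesis by linarith
qed

lemma nrm_eq: "nrm x = Inf {real p powr (- val m a) |(a::int) (m::nat). x \<in> ball m a}"
proof -
  have "x \<in> (\<lambda>c. \<iota> (t m) [^]\<^bsub>P\<^esub> a \<otimes>\<^bsub>P\<^esub> \<iota> c) ` carrier C \<longleftrightarrow> x \<in> ball m a" for m a
    by (auto simp: ball_def tp_def)
  then show ?thesis by (simp add: gauge_norm_def)
qed

lemma ball_closed: "x \<in> ball m a \<Longrightarrow> x \<in> carrier P"
  by (auto simp: ball_def)

lemma ball_mono:
  assumes "x \<in> ball m a" "val l b \<le> val m a" shows "x \<in> ball l b"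
proof -
  obtain c where c: "c \<in> carrier C" "x = tp m a \<otimes>\<^bsub>P\<^esub> \<iota> c" using assms(1) by (auto simp: ball_def)
  define d where "d = nat (a * int (p ^ l) - b * int (p ^ m))"
  have d: "a * int (p ^ l) = b * int (p ^ m) + int d" using assms(2) unfolding val_le_iff d_def by simp
  have "tp m a = tp (m + l) (a * int (p ^ l))" by (rule tp_level')
  also have "\<dots> = tp (m + l) (b * int (p ^ m)) \<otimes>\<^bsub>P\<^esub> \<iota> (t (m + l) [^] d)" unfolding d tp_add tp_nat ..
  also have "tp (m + l) (b * int (p ^ m)) = tp l b" using tp_level[of l m b] by (simp add: add.commute)
  finally have "x = tp l b \<otimes>\<^bsub>P\<^esub> \<iota> (t (m + l) [^] d \<otimes> c)" using c by (simp add: \<iota>_mult P.m_assoc)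
  then show ?thesis using c(1) by (auto simp: ball_def)
qed

text \<open>A larger exponent would make \<open>y\<close> a multiple of a positive power of some
  root, hence an element of \<open>J\<close>.\<close>

lemma ball_exact:
  assumes y: "y \<in> carrier C" "y \<notin> J" and x: "tp m a \<otimes>\<^bsub>P\<^esub> \<iota> y \<in> ball l b"
  shows "val l b \<le> val m a"
proof (rule ccontr)
  assume "\<not> val l b \<le> val m a"
  then have lt: "a * int (p ^ l) < b * int (p ^ m)" by (simp add: val_le_iff)
  obtain c where c: "c \<in> carrier C" "tp m a \<otimes>\<^bsub>P\<^esub> \<iota> y = tp l b \<otimes>\<^bsub>P\<^esub> \<iota> c" using x by (auto simp: ball_def)
  \<comment> \<open>At the common level \<open>m + l\<close> the exponents differ by a positive
    integer, written \<open>Suc d\<close> so that one factor \<open>t (m + l)\<close> can be split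
    off from \<open>y\<close>.\<close>
  define d where "d = nat (b * int (p ^ m) - a * int (p ^ l)) - 1"
  have d: "b * int (p ^ m) = a * int (p ^ l) + int (Suc d)" using lt unfolding d_def by simp
  have "tp l b = tp (m + l) (b * int (p ^ m))" using tp_level[of l m b] by (simp add: add.commute)
  also have "\<dots> = tp (m + l) (a * int (p ^ l)) \<otimes>\<^bsub>P\<^esub> \<iota> (t (m + l) [^] Suc d)" unfolding d tp_add tp_nat ..
  also have "tp (m + l) (a * int (p ^ l)) = tp m a" by (rule tp_level)
  finally have "tp m a \<otimes>\<^bsub>P\<^esub> \<iota> y = tp m a \<otimes>\<^bsub>P\<^esub> \<iota> (t (m + l) [^] Suc d \<otimes> c)"
    using c(1) unfolding c(2) by (simp add: \<iota>_mult P.m_assoc del: nat_pow_Suc)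
  then have "\<iota> y = \<iota> (t (m + l) [^] Suc d \<otimes> c)"
    using P.Units_l_cancel[OF tp_unit] y c(1) by (simp del: nat_pow_Suc)
  then have "y = t (m + l) \<otimes> (t (m + l) [^] d \<otimes> c)"
    using y(1) c(1) by (simp add: \<iota>_inj m_ac)
  then show False using y(2) c(1) J_I[of "t (m + l) [^] d \<otimes> c" "m + l"] by simp
qed

text \<open>Separatedness bounds the power of \<open>p\<close> dividing \<open>x\<close>. After the
  largest such power is split off, \<open>leading\<close> applies, and \<open>p\<close> itself is a
  power of \<open>t m\<close>.\<close>

lemma C_leading:
  assumes x: "x \<in> carrier C" "x \<noteq> \<zero>"
  shows "\<exists>m j. \<exists>y\<in>carrier C. y \<notin> J \<and> x = t m [^] (j::nat) \<otimes> y"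
proof -
  obtain n where n: "x \<notin> p_ideal p n C" using sep x by blast
  define k where "k = (LEAST n. x \<notin> p_ideal p n C)"
  have k: "x \<notin> p_ideal p k C" unfolding k_def using n by (rule LeastI)
  have k0: "k \<noteq> 0" using k x by (cases "k = 0") auto
  then have "x \<in> p_ideal p (k - 1) C" using not_less_Least[of "k - 1" "\<lambda>n. x \<notin> p_ideal p n C"] k_def by auto
  then obtain s where s: "s \<in> carrier C" "x = p_elem p C [^] (k - 1) \<otimes> s" by (rule p_idealE)
  have "s \<notin> p_ideal p 1 C"
  proof
    assume "s \<in> p_ideal p 1 C"
    then have "x \<in> p_ideal p ((k - 1) + 1) C"
      unfolding s(2) using p_idealI[of \<one> p "k - 1"] by (intro p_ideal_mult2) auto
    then show False using k k0 by simp
  qed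
  then obtain m j y where y: "y \<in> carrier C" "y \<notin> J" "s = t m [^] (j::nat) \<otimes> y" using leading[OF s(1)] by blast
  have "p_elem p C [^] (k - 1) = t m [^] (p ^ m * (k - 1))"
    using t_pow[of 0 m] by (simp add: nat_pow_pow[symmetric] t_0)
  then have "x = t m [^] (p ^ m * (k - 1) + j) \<otimes> y"
    using y by (simp add: s(2) m_assoc nat_pow_mult[symmetric])
  then show ?thesis using y by blast
qed

lemma P_rep:
  assumes "x \<in> carrier P" obtains k c where "c \<in> carrier C" "x = tp 0 (- int k) \<otimes>\<^bsub>P\<^esub> \<iota> c"
proof -
  obtain c k where c: "c \<in> carrier C" "x = fr c k" using assms by (auto simp: P_eq loc_carrier_iff)
  have "tp 0 (int k) \<otimes>\<^bsub>P\<^esub> x = \<iota> c"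
    using c by (simp add: tp_nat t_0 \<iota>_eq) (simp add: P_eq fr_mult fr_eq_iff)
  moreover have "x = (tp 0 (- int k) \<otimes>\<^bsub>P\<^esub> tp 0 (int k)) \<otimes>\<^bsub>P\<^esub> x"
    using assms tp_inv[of 0 "- int k"] by simp
  ultimately have "x = tp 0 (- int k) \<otimes>\<^bsub>P\<^esub> \<iota> c"
    using assms by (simp add: P.m_assoc)
  then show ?thesis using that c by blast
qed

lemma P_leading:
  assumes "x \<in> carrier P" "x \<noteq> \<zero>\<^bsub>P\<^esub>"
  obtains m a y where "y \<in> carrier C" "y \<notin> J" "x = tp m a \<otimes>\<^bsub>P\<^esub> \<iota> y"
proof -
  obtain k c where c: "c \<in> carrier C" "x = tp 0 (- int k) \<otimes>\<^bsub>P\<^esub> \<iota> c" using P_rep assms(1) .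
  have "c \<noteq> \<zero>" using assms c by (auto simp: \<iota>_zero)
  then obtain m j y where y: "y \<in> carrier C" "y \<notin> J" "c = t m [^] (j::nat) \<otimes> y" using C_leading[OF c(1)] by blast
  have "x = tp 0 (- int k) \<otimes>\<^bsub>P\<^esub> tp m (int j) \<otimes>\<^bsub>P\<^esub> \<iota> y"
    using y c by (simp add: \<iota>_mult tp_nat P.m_assoc)
  then show ?thesis using that y by (simp only: tp_mult) blast
qed

text \<open>The infimum is a minimum: by \<open>ball_exact\<close> no ball of smaller radius
  contains the element.\<close>

lemma nrm_exact:
  assumes "y \<in> carrier C" "y \<notin> J"
  shows "nrm (tp m a \<otimes>\<^bsub>P\<^esub> \<iota> y) = real p powr (- val m a)"
  unfolding nrm_eq
proof (rule cInf_eq_minimum)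
  show "real p powr (- val m a) \<in> {real p powr (- val l b) |b l. tp m a \<otimes>\<^bsub>P\<^esub> \<iota> y \<in> ball l b}"
    using assms(1) by (auto simp: ball_def)
  fix v assume "v \<in> {real p powr (- val l b) |b l. tp m a \<otimes>\<^bsub>P\<^esub> \<iota> y \<in> ball l b}"
  then show "real p powr (- val m a) \<le> v" using ball_exact[OF assms] p_gt_1 by (auto intro!: powr_mono)
qed

lemma nrm_zero [simp]: "nrm \<zero>\<^bsub>P\<^esub> = 0"
proof -
  have b: "\<zero>\<^bsub>P\<^esub> \<in> ball m a" for m a
    unfolding ball_def by (auto intro!: bexI[of _ \<zero>] simp: \<iota>_zero)
  have "Inf {real p powr (- val m a) |a m. \<zero>\<^bsub>P\<^esub> \<in> ball m a} \<le> e" if "e > 0" for e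
  proof -
    obtain n where n: "(1 / real p) ^ n < e" using real_arch_pow_inv[of e "1 / real p"] \<open>e > 0\<close> p_gt_1 by auto
    have "Inf {real p powr (- val m a) |a m. \<zero>\<^bsub>P\<^esub> \<in> ball m a} \<le> real p powr (- val 0 (int n))"
      by (rule cInf_lower) (use b in \<open>blast, auto intro!: bdd_belowI[of _ 0]\<close>)
    also have "\<dots> = (1 / real p) ^ n"
      using p_gt_1 by (simp add: powr_minus powr_realpow power_one_over field_simps)
    finally show ?thesis using n by linarith
  qed
  moreover have "0 \<le> Inf {real p powr (- val m a) |a m. \<zero>\<^bsub>P\<^esub> \<in> ball m a}"
    by (rule cInf_greatest) (use b in auto)
  ultimately show ?thesis unfolding nrm_eq by (meson antisym field_le_epsilon add_increasing order_trans less_imp_le dense not_le)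
qed

lemma nrm_pos: "x \<in> carrier P \<Longrightarrow> x \<noteq> \<zero>\<^bsub>P\<^esub> \<Longrightarrow> 0 < nrm x"
  by (erule (1) P_leading) (use p_gt_1 in \<open>auto simp: nrm_exact\<close>)

lemma nrm_nonneg: "x \<in> carrier P \<Longrightarrow> 0 \<le> nrm x \<and> (nrm x = 0 \<longleftrightarrow> x = \<zero>\<^bsub>P\<^esub>)"
  using nrm_pos[of x] by (cases "x = \<zero>\<^bsub>P\<^esub>") auto

lemma nrm_le_iff:
  assumes "x \<in> carrier P" shows "nrm x \<le> real p powr (- val m a) \<longleftrightarrow> x \<in> ball m a"
proof (cases "x = \<zero>\<^bsub>P\<^esub>")
  case True
  then show ?thesis unfolding ball_def by (auto intro!: bexI[of _ \<zero>] simp: \<iota>_zero)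
next
  case False
  then obtain l b y where y: "y \<in> carrier C" "y \<notin> J" "x = tp l b \<otimes>\<^bsub>P\<^esub> \<iota> y" by (rule P_leading[OF assms])
  have "x \<in> ball l b" using y by (auto simp: ball_def)
  then have "x \<in> ball m a \<longleftrightarrow> val m a \<le> val l b" using ball_mono ball_exact[OF y(1,2)] y(3) by blast
  then show ?thesis using p_gt_1 by (simp add: y(3) nrm_exact[OF y(1,2)])
qed

lemma nrm_value: "x \<in> carrier P \<Longrightarrow> x \<noteq> \<zero>\<^bsub>P\<^esub> \<Longrightarrow> \<exists>m a. nrm x = real p powr (- val m a)"
  by (erule (1) P_leading) (auto simp: nrm_exact)

lemma ball_add: "x \<in> ball m a \<Longrightarrow> y \<in> ball m a \<Longrightarrow> x \<oplus>\<^bsub>P\<^esub> y \<in> ball m a"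
  unfolding ball_def by (auto simp: P.r_distr[symmetric] \<iota>_add[symmetric])

lemma nrm_add:
  assumes "x \<in> carrier P" "y \<in> carrier P"
  shows "nrm (x \<oplus>\<^bsub>P\<^esub> y) \<le> max (nrm x) (nrm y)"
proof (cases "x = \<zero>\<^bsub>P\<^esub> \<or> y = \<zero>\<^bsub>P\<^esub>")
  case True
  then show ?thesis using assms by auto
next
  case False
  \<comment> \<open>The larger norm is itself the radius of some ball; this ball contains both
    elements and is closed under addition.\<close>
  then have "\<exists>m a. max (nrm x) (nrm y) = real p powr (- val m a)"
    using nrm_value[OF assms(1)] nrm_value[OF assms(2)] unfolding max_def by simp
  then obtain m a where *: "max (nrm x) (nrm y) = real p powr (- val m a)" by blast
  then have "x \<in> ball m a" "y \<in> ball m a"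
    using nrm_le_iff[OF assms(1), of a m] nrm_le_iff[OF assms(2), of a m] by (auto simp: *[symmetric])
  then show ?thesis using nrm_le_iff[of "x \<oplus>\<^bsub>P\<^esub> y" a m] ball_add assms * by auto
qed

lemma val_add: "val (m + l) (a * int (p ^ l) + b * int (p ^ m)) = val m a + val l b"
  using p_gt_1 by (simp add: power_add field_simps)

lemma tp_\<iota>_mult:
  assumes "y \<in> carrier C" "z \<in> carrier C"
  shows "(tp m a \<otimes>\<^bsub>P\<^esub> \<iota> y) \<otimes>\<^bsub>P\<^esub> (tp l b \<otimes>\<^bsub>P\<^esub> \<iota> z) =
    tp (m + l) (a * int (p ^ l) + b * int (p ^ m)) \<otimes>\<^bsub>P\<^esub> \<iota> (y \<otimes> z)"
proof -
  have "(tp m a \<otimes>\<^bsub>P\<^esub> \<iota> y) \<otimes>\<^bsub>P\<^esub> (tp l b \<otimes>\<^bsub>P\<^esub> \<iota> z) = (tp m a \<otimes>\<^bsub>P\<^esub> tp l b) \<otimes>\<^bsub>P\<^esub> (\<iota> y \<otimes>\<^bsub>P\<^esub> \<iota> z)"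
    using assms by (simp add: P.m_ac)
  then show ?thesis using assms by (simp only: tp_mult \<iota>_mult)
qed

lemma nrm_mult_le:
  assumes "x \<in> carrier P" "y \<in> carrier P"
  shows "nrm (x \<otimes>\<^bsub>P\<^esub> y) \<le> nrm x * nrm y"
proof (cases "x = \<zero>\<^bsub>P\<^esub> \<or> y = \<zero>\<^bsub>P\<^esub>")
  case True
  then show ?thesis using assms by auto
next
  case False
  obtain m a x' where x: "x' \<in> carrier C" "x' \<notin> J" "x = tp m a \<otimes>\<^bsub>P\<^esub> \<iota> x'"
    by (rule P_leading[OF assms(1)]) (use False in auto)
  obtain l b y' where y: "y' \<in> carrier C" "y' \<notin> J" "y = tp l b \<otimes>\<^bsub>P\<^esub> \<iota> y'"
    by (rule P_leading[OF assms(2)]) (use False in auto)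
  have "x \<otimes>\<^bsub>P\<^esub> y \<in> ball (m + l) (a * int (p ^ l) + b * int (p ^ m))"
    unfolding x(3) y(3) tp_\<iota>_mult[OF x(1) y(1)] using x(1) y(1) by (auto simp: ball_def)
  then have "nrm (x \<otimes>\<^bsub>P\<^esub> y) \<le> real p powr (- (val m a + val l b))"
    using nrm_le_iff[OF ball_closed] val_add[where m = m and l = l and a = a and b = b] by metis
  also have "\<dots> = nrm x * nrm y"
    by (simp add: x(3) y(3) nrm_exact x y powr_add[symmetric])
  finally show ?thesis .
qed

text \<open>Submultiplicativity becomes an equality because the product of the leading parts is
  again a leading part.\<close>

lemma nrm_mult_eq:
  assumes "y \<in> carrier C" "z \<in> carrier C" "y \<otimes> z \<notin> J"
  shows "nrm ((tp m a \<otimes>\<^bsub>P\<^esub> \<iota> y) \<otimes>\<^bsub>P\<^esub> (tp l b \<otimes>\<^bsub>P\<^esub> \<iota> z)) = real p powr (- val m a) * real p powr (- val l b)"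
proof -
  have "nrm (tp (m + l) (a * int (p ^ l) + b * int (p ^ m)) \<otimes>\<^bsub>P\<^esub> \<iota> (y \<otimes> z)) = real p powr (- (val m a + val l b))"
    using nrm_exact[of "y \<otimes> z" "m + l" "a * int (p ^ l) + b * int (p ^ m)"] assms
    unfolding val_add by simp
  then show ?thesis using assms by (simp add: tp_\<iota>_mult powr_add[symmetric])
qed

lemma ball_00: "ball 0 0 = \<iota> ` carrier C"
  unfolding ball_def by auto

lemma power_bounded_eq: "power_bounded P nrm = \<iota> ` carrier C"
proof (intro equalityI subsetI)
  fix x assume "x \<in> \<iota> ` carrier C"
  then obtain c where c: "c \<in> carrier C" "x = \<iota> c" by auto
  have "nrm (x [^]\<^bsub>P\<^esub> n) \<le> 1" for n :: nat
    using nrm_le_iff[of "\<iota> (c [^] n)" 0 0] c ball_00 p_gt_1 by (simp add: \<iota>_pow[symmetric])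
  then show "x \<in> power_bounded P nrm" using c by (auto simp: power_bounded_def)
next
  fix x assume "x \<in> power_bounded P nrm"
  then obtain M where x: "x \<in> carrier P" and M: "\<And>n::nat. nrm (x [^]\<^bsub>P\<^esub> n) \<le> M" by (auto simp: power_bounded_def)
  show "x \<in> \<iota> ` carrier C"
  proof (cases "x = \<zero>\<^bsub>P\<^esub>")
    case True
    then show ?thesis using \<iota>_zero by (metis imageI zero_closed)
  next
    case False
    then obtain m a y where y: "y \<in> carrier C" "y \<notin> J" "x = tp m a \<otimes>\<^bsub>P\<^esub> \<iota> y" by (rule P_leading[OF x])
    \<comment> \<open>Each multiplication brings two exponents to a common denominator, so the level
      and the numerator change with \<open>n\<close>. Only the resulting value
      \<open>n a/p^m\<close> is controlled.\<close>
    have pw: "\<exists>l b. x [^]\<^bsub>P\<^esub> n = tp l b \<otimes>\<^bsub>P\<^esub> \<iota> (y [^] n) \<and> val l b = real n * val m a" for n :: nat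
    proof (induction n)
      case 0
      show ?case by (intro exI[of _ 0]) (simp add: \<iota>_one)
    next
      case (Suc n)
      then obtain l b where lb: "x [^]\<^bsub>P\<^esub> n = tp l b \<otimes>\<^bsub>P\<^esub> \<iota> (y [^] n)" "val l b = real n * val m a" by blast
      have "x [^]\<^bsub>P\<^esub> Suc n = tp (l + m) (b * int (p ^ m) + a * int (p ^ l)) \<otimes>\<^bsub>P\<^esub> \<iota> (y [^] Suc n)"
        using tp_\<iota>_mult[of "y [^] n" y l b m a] y lb by simp
      moreover have "val (l + m) (b * int (p ^ m) + a * int (p ^ l)) = real (Suc n) * val m a"
        unfolding val_add lb(2) by (simp add: algebra_simps add_divide_distrib)
      ultimately show ?case by blast
    qed
    have bd: "real p powr (- (real n * val m a)) \<le> M" if "n > 0" for n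
    proof -
      obtain l b where lb: "x [^]\<^bsub>P\<^esub> n = tp l b \<otimes>\<^bsub>P\<^esub> \<iota> (y [^] n)" "val l b = real n * val m a" using pw by blast
      have "y [^] n \<notin> J" using radical[OF y(1) that] y(2) by blast
      then have "nrm (x [^]\<^bsub>P\<^esub> n) = real p powr (- val l b)" using y(1) by (simp add: lb(1) nrm_exact)
      then show ?thesis using M[of n] lb(2) by simp
    qed
    have "val m a \<ge> 0"
    proof (rule ccontr)
      assume "\<not> 0 \<le> val m a"
      then have gt: "real p powr (- val m a) > 1" using p_gt_1 by simp
      then obtain n where n: "M < (real p powr (- val m a)) ^ n" using real_arch_pow by blast
      have "(real p powr (- val m a)) ^ n \<le> (real p powr (- val m a)) ^ Suc n"
        using gt by (intro power_increasing) auto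
      also have "\<dots> = real p powr (- (real (Suc n) * val m a))"
        using p_gt_1 by (subst powr_realpow[symmetric]) (auto simp: powr_powr algebra_simps)
      also have "\<dots> \<le> M" using bd[of "Suc n"] by simp
      finally show False using n by simp
    qed
    then have "x \<in> ball 0 0" using ball_mono[of x m a 0 0] y by (auto simp: ball_def)
    then show ?thesis by (simp add: ball_00)
  qed
qed

lemma nrm_\<iota>_le: "c \<in> carrier C \<Longrightarrow> nrm (\<iota> c) \<le> real p powr (- real n) \<longleftrightarrow> c \<in> p_ideal p n C"
proof -
  assume c: "c \<in> carrier C"
  have "nrm (\<iota> c) \<le> real p powr (- val 0 (int n)) \<longleftrightarrow> \<iota> c \<in> ball 0 (int n)" by (rule nrm_le_iff) (use c in simp)
  also have "\<dots> \<longleftrightarrow> c \<in> p_ideal p n C"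
    unfolding ball_def p_ideal_iff tp_nat t_0 using c by (auto simp: \<iota>_mult[symmetric] \<iota>_inj)
  finally show ?thesis by simp
qed

lemma small_pow: "e > 0 \<Longrightarrow> \<exists>n. real p powr (- real n) < e"
proof -
  assume "e > 0"
  then obtain n where "(1 / real p) ^ n < e" using real_arch_pow_inv[of e "1 / real p"] p_gt_1 by auto
  moreover have "real p powr (- real n) = (1 / real p) ^ n"
    using p_gt_1 by (simp add: powr_minus powr_realpow power_one_over field_simps)
  ultimately show ?thesis by metis
qed

text \<open>From some index on the sequence stays in one translate of the unit ball, the image of
  \<open>C\<close>. There a norm of at most \<open>p^(-n)\<close> means divisibility by
  \<open>p^n\<close>, so a thinned-out subsequence is coherent and has a limit in
  \<open>C\<close>.\<close>

lemma norm_complete: "norm_complete P nrm"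
  unfolding norm_complete_def
proof (intro allI impI)
  fix s :: "nat \<Rightarrow> ('a \<times> nat) set"
  assume s: "\<forall>i. s i \<in> carrier P"
    and cau: "\<forall>e>0. \<exists>N. \<forall>i\<ge>N. \<forall>j\<ge>N. nrm (s i \<ominus>\<^bsub>P\<^esub> s j) < e"
  have "\<forall>n. \<exists>N. \<forall>i\<ge>N. \<forall>j\<ge>N. nrm (s i \<ominus>\<^bsub>P\<^esub> s j) < real p powr (- real n)"
    using cau p_gt_1 by auto
  then obtain N where N: "\<And>n i j. i \<ge> N n \<Longrightarrow> j \<ge> N n \<Longrightarrow> nrm (s i \<ominus>\<^bsub>P\<^esub> s j) < real p powr (- real n)" by metis
  \<comment> \<open>The maximum over all \<open>k \<le> n\<close> makes \<open>M n\<close> large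
    enough for every precision up to \<open>n\<close>. The terms with indices \<open>M n\<close> and
    \<open>M (n+1)\<close> then agree modulo \<open>p^n\<close>.\<close>
  define M where "M n = Max (N ` {..n})" for n
  have M: "N k \<le> M n" if "k \<le> n" for k n unfolding M_def using that by (intro Max_ge) auto
  have inC: "s i \<ominus>\<^bsub>P\<^esub> s (M 0) \<in> \<iota> ` carrier C" if "i \<ge> N 0" for i
  proof -
    have "nrm (s i \<ominus>\<^bsub>P\<^esub> s (M 0)) \<le> real p powr (- val 0 0)" using N[OF that M[of 0 0]] p_gt_1 by simp
    then show ?thesis using nrm_le_iff[of "s i \<ominus>\<^bsub>P\<^esub> s (M 0)" 0 0] s by (simp add: ball_00)
  qed
  then have "\<forall>i. \<exists>c. i \<ge> N 0 \<longrightarrow> c \<in> carrier C \<and> s i \<ominus>\<^bsub>P\<^esub> s (M 0) = \<iota> c" by blast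
  then obtain c where c: "\<And>i. i \<ge> N 0 \<Longrightarrow> c i \<in> carrier C" "\<And>i. i \<ge> N 0 \<Longrightarrow> s i \<ominus>\<^bsub>P\<^esub> s (M 0) = \<iota> (c i)" by metis
  have diff: "\<iota> (c i \<ominus> c j) = s i \<ominus>\<^bsub>P\<^esub> s j" if "i \<ge> N 0" "j \<ge> N 0" for i j
  proof -
    have "\<iota> (c i \<ominus> c j) = (s i \<ominus>\<^bsub>P\<^esub> s (M 0)) \<ominus>\<^bsub>P\<^esub> (s j \<ominus>\<^bsub>P\<^esub> s (M 0))"
      using c that by (simp add: \<iota>_minus)
    also have "\<dots> = s i \<ominus>\<^bsub>P\<^esub> s j"
    proof -
      have "s i \<in> carrier P" "s j \<in> carrier P" "s (M 0) \<in> carrier P" using s by auto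
      then show ?thesis by algebra
    qed
    finally show ?thesis .
  qed
  have pc: "pcong p n C (c i) (c j)" if "i \<ge> N n" "j \<ge> N n" "i \<ge> N 0" "j \<ge> N 0" for n i j
    unfolding pcong_def using nrm_\<iota>_le[of "c i \<ominus> c j" n] diff[OF that(3,4)] N[OF that(1,2)] c(1)[OF that(3)] c(1)[OF that(4)]
    by simp
  have "pcoh p C (\<lambda>n. c (M n))"
    unfolding pcoh_def using c(1)[OF M] pc[OF M M M M] by simp
  then obtain l where l: "l \<in> carrier C" "\<And>n. pcong p n C l (c (M n))" using lim by blast
  show "\<exists>l\<in>carrier P. (\<lambda>i. nrm (s i \<ominus>\<^bsub>P\<^esub> l)) \<longlonglongrightarrow> 0"
  proof (intro bexI[of _ "\<iota> l \<oplus>\<^bsub>P\<^esub> s (M 0)"] LIMSEQ_I)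
    fix e :: real assume "e > 0"
    then obtain n where n: "real p powr (- real n) < e" using small_pow by blast
    have "norm (nrm (s i \<ominus>\<^bsub>P\<^esub> (\<iota> l \<oplus>\<^bsub>P\<^esub> s (M 0))) - 0) < e" if i: "i \<ge> max (N 0) (N n)" for i
    proof -
      have ci: "c i \<in> carrier C" using c i by simp
      have "s i \<ominus>\<^bsub>P\<^esub> (\<iota> l \<oplus>\<^bsub>P\<^esub> s (M 0)) = (s i \<ominus>\<^bsub>P\<^esub> s (M 0)) \<ominus>\<^bsub>P\<^esub> \<iota> l"
      proof -
        have "s i \<in> carrier P" "\<iota> l \<in> carrier P" "s (M 0) \<in> carrier P" using s l by auto
        then show ?thesis by algebra
      qed
      also have "\<dots> = \<iota> (c i \<ominus> l)" using c(2)[of i] i l ci by (simp add: \<iota>_minus)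
      finally have eq: "s i \<ominus>\<^bsub>P\<^esub> (\<iota> l \<oplus>\<^bsub>P\<^esub> s (M 0)) = \<iota> (c i \<ominus> l)" .
      have "pcong p n C (c i) (c (M n))" using i M by (intro pc) auto
      then have "pcong p n C (c i) l" using pcong_trans pcong_sym l(2) by blast
      then have "nrm (\<iota> (c i \<ominus> l)) \<le> real p powr (- real n)"
        using nrm_\<iota>_le[of "c i \<ominus> l" n] ci l by (simp add: pcong_def)
      then show ?thesis using n eq nrm_nonneg[of "\<iota> (c i \<ominus> l)"] ci l by simp
    qed
    then show "\<exists>no. \<forall>i\<ge>no. norm (nrm (s i \<ominus>\<^bsub>P\<^esub> (\<iota> l \<oplus>\<^bsub>P\<^esub> s (M 0))) - 0) < e" by blast
  qed (use l s in simp)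
qed

end

locale gauge_field = gauge_ring +
  assumes J_proper: "\<one> \<notin> J" and J_units: "y \<in> carrier C \<Longrightarrow> y \<notin> J \<Longrightarrow> y \<in> Units C"
begin

lemma Units_notin_J: "y \<in> Units C \<Longrightarrow> y \<notin> J"
  using J_proper by (metis J.I_l_closed Units_inv_closed Units_l_inv)

lemma J_maximal: "maximalideal J C"
proof (rule maximalidealI)
  show "carrier C \<noteq> J" using J_proper by blast
  fix I assume I: "ideal I C" "J \<subseteq> I" "I \<subseteq> carrier C"
  show "I = J \<or> I = carrier C"
  proof (cases "I \<subseteq> J")
    case False
    then obtain y where "y \<in> I" "y \<in> Units C" using I J_units by blast
    then have "\<one> \<in> I" using I(1) by (metis Units_inv_closed Units_l_inv ideal.I_l_closed)
    then show ?thesis using ideal.one_imp_carrier[OF I(1)] by blast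
  qed (use I in blast)
qed (rule J_ideal)

text \<open>\<open>max_ideal\<close> is a definite description, so uniqueness matters: a proper
  ideal contains no unit, hence lies in \<open>J\<close>.\<close>

lemma max_ideal_eq: "max_ideal C = J"
  unfolding max_ideal_def
proof (rule the_equality)
  show "maximalideal J C" by (rule J_maximal)
  fix I assume "maximalideal I C"
  then interpret I: maximalideal I C .
  have "I \<subseteq> J"
  proof
    fix x assume x: "x \<in> I"
    show "x \<in> J"
    proof (rule ccontr)
      assume "x \<notin> J"
      then have "x \<in> Units C" using J_units x I.Icarr by blast
      then have "\<one> \<in> I" using x by (metis Units_inv_closed Units_l_inv I.I_l_closed)
      then show False using I.one_imp_carrier I.I_notcarr by blast
    qed
  qed
  then show "I = J" using I.I_maximal[OF J_ideal] J_proper J.a_subset one_closed by blast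
qed

text \<open>The leading part of a nonzero element is a unit here. Inverting it together with the
  power of the root gives inverses, and since products of units stay outside \<open>J\<close>, the
  norm is multiplicative.\<close>

lemma nonarch: "nonarch_field P nrm"
proof -
  have one_nz: "\<one> \<noteq> \<zero>" using J_proper J.zero_closed by metis
  have lead: "\<exists>m a y. y \<in> Units C \<and> y \<in> carrier C \<and> y \<notin> J \<and> x = tp m a \<otimes>\<^bsub>P\<^esub> \<iota> y"
    if "x \<in> carrier P" "x \<noteq> \<zero>\<^bsub>P\<^esub>" for x
    using P_leading[OF that] J_units by metis
  have "field P"
  proof (rule P.cring_fieldI2)
    show "\<zero>\<^bsub>P\<^esub> \<noteq> \<one>\<^bsub>P\<^esub>" using \<iota>_inj[of \<zero> \<one>] one_nz by (simp add: \<iota>_zero \<iota>_one)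
    fix x assume "x \<in> carrier P" "x \<noteq> \<zero>\<^bsub>P\<^esub>"
    then obtain m a y where y: "y \<in> Units C" "y \<in> carrier C" "x = tp m a \<otimes>\<^bsub>P\<^esub> \<iota> y" using lead by blast
    have "x \<otimes>\<^bsub>P\<^esub> (tp m (- a) \<otimes>\<^bsub>P\<^esub> \<iota> (inv y)) = (tp m a \<otimes>\<^bsub>P\<^esub> tp m (- a)) \<otimes>\<^bsub>P\<^esub> \<iota> (y \<otimes> inv y)"
      using y by (simp add: \<iota>_mult P.m_ac del: Units_r_inv)
    also have "\<dots> = \<one>\<^bsub>P\<^esub>" using y by (simp add: tp_inv \<iota>_one)
    finally show "\<exists>b\<in>carrier P. x \<otimes>\<^bsub>P\<^esub> b = \<one>\<^bsub>P\<^esub>" using y by (intro bexI[of _ "tp m (- a) \<otimes>\<^bsub>P\<^esub> \<iota> (inv y)"]) auto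
  qed
  moreover have "nrm (x \<otimes>\<^bsub>P\<^esub> y) = nrm x * nrm y" if xy: "x \<in> carrier P" "y \<in> carrier P" for x y
  proof (cases "x = \<zero>\<^bsub>P\<^esub> \<or> y = \<zero>\<^bsub>P\<^esub>")
    case False
    then obtain m a x' l b y' where *: "x' \<in> Units C" "y' \<in> Units C" "x = tp m a \<otimes>\<^bsub>P\<^esub> \<iota> x'" "y = tp l b \<otimes>\<^bsub>P\<^esub> \<iota> y'"
      using lead xy by metis
    then have nJ: "x' \<otimes> y' \<notin> J" "x' \<notin> J" "y' \<notin> J" using Units_notin_J by blast+
    then show ?thesis unfolding *(3,4) using *(1,2)
      by (simp only: nrm_mult_eq[OF Units_closed Units_closed nJ(1)] nrm_exact[OF Units_closed nJ(2)] nrm_exact[OF Units_closed nJ(3)])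
  qed (use xy in auto)
  moreover have "\<exists>x\<in>carrier P. 0 < nrm x \<and> nrm x < 1"
  proof (intro bexI[of _ "tp 0 1 \<otimes>\<^bsub>P\<^esub> \<iota> \<one>"])
    have "nrm (tp 0 1 \<otimes>\<^bsub>P\<^esub> \<iota> \<one>) = real p powr (- val 0 1)" using J_proper by (intro nrm_exact) auto
    also have "\<dots> = 1 / real p" using p_gt_1 by (simp add: powr_minus_divide)
    finally show "0 < nrm (tp 0 1 \<otimes>\<^bsub>P\<^esub> \<iota> \<one>) \<and> nrm (tp 0 1 \<otimes>\<^bsub>P\<^esub> \<iota> \<one>) < 1"
      using p_gt_1 by (simp only:) simp
  qed simp
  ultimately show ?thesis unfolding nonarch_field_def
    using nrm_nonneg nrm_add norm_complete by blast
qed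

end

section \<open>Rings with the same operations\<close>

lemma algebra_of_simps [simp]:
  "carrier (algebra_of h B) = carrier B" "x \<otimes>\<^bsub>algebra_of h B\<^esub> y = x \<otimes>\<^bsub>B\<^esub> y"
  "x \<oplus>\<^bsub>algebra_of h B\<^esub> y = x \<oplus>\<^bsub>B\<^esub> y" "\<one>\<^bsub>algebra_of h B\<^esub> = \<one>\<^bsub>B\<^esub>" "\<zero>\<^bsub>algebra_of h B\<^esub> = \<zero>\<^bsub>B\<^esub>"
  "r \<odot>\<^bsub>algebra_of h B\<^esub> x = h r \<otimes>\<^bsub>B\<^esub> x"
  by (simp_all add: algebra_of_def)

text \<open>\<open>algebra_of\<close> only adds a scalar multiplication, so notions built from the
  ring operations are unchanged.\<close>

lemma algebra_of_derived [simp]: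
  "x [^]\<^bsub>algebra_of h B\<^esub> (n::nat) = x [^]\<^bsub>B\<^esub> n" "p_elem p (algebra_of h B) = p_elem p B"
  "p_ideal p n (algebra_of h B) = p_ideal p n B" "\<ominus>\<^bsub>algebra_of h B\<^esub> x = \<ominus>\<^bsub>B\<^esub> x"
  "x \<ominus>\<^bsub>algebra_of h B\<^esub> y = x \<ominus>\<^bsub>B\<^esub> y" "pcong p n (algebra_of h B) = pcong p n B"
  "pcoh p (algebra_of h B) = pcoh p B" "I +>\<^bsub>algebra_of h B\<^esub> x = I +>\<^bsub>B\<^esub> x"
  "ring_hom A (algebra_of h B) = ring_hom A B" "ring_hom (algebra_of h B) A = ring_hom B A"
proof -
  show pw: "y [^]\<^bsub>algebra_of h B\<^esub> (k::nat) = y [^]\<^bsub>B\<^esub> k" for y k by (simp add: nat_pow_def algebra_of_def)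
  show pe: "p_elem p (algebra_of h B) = p_elem p B"
    by (simp add: p_elem_def add_pow_def nat_pow_def algebra_of_def)
  show pid: "p_ideal p k (algebra_of h B) = p_ideal p k B" for k
    by (simp add: p_ideal_def cgenideal_def pw pe)
  show "\<ominus>\<^bsub>algebra_of h B\<^esub> x = \<ominus>\<^bsub>B\<^esub> x" for x by (simp add: a_inv_def m_inv_def)
  then show mi: "x \<ominus>\<^bsub>algebra_of h B\<^esub> y = x \<ominus>\<^bsub>B\<^esub> y" for x y by (simp add: a_minus_def)
  show pc: "pcong p n (algebra_of h B) = pcong p n B" for n by (simp add: pcong_def fun_eq_iff mi pid)
  show "pcoh p (algebra_of h B) = pcoh p B" by (simp add: pcoh_def fun_eq_iff pc)
  show "I +>\<^bsub>algebra_of h B\<^esub> x = I +>\<^bsub>B\<^esub> x" by (simp add: a_r_coset_def r_coset_def)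
  show "ring_hom A (algebra_of h B) = ring_hom A B" "ring_hom (algebra_of h B) A = ring_hom B A"
    by (simp_all add: ring_hom_def)
qed

lemma algebra_of_cring:
  assumes "cring B" shows "cring (algebra_of h B)"
proof -
  interpret B: cring B by fact
  show ?thesis
  proof (rule cringI)
    show "abelian_group (algebra_of h B)"
      by (rule abelian_groupI) (auto simp: B.a_ac intro: bexI[of _ "\<ominus>\<^bsub>B\<^esub> x" for x] B.l_neg)
    show "comm_monoid (algebra_of h B)"
      by (rule comm_monoidI) (auto simp: B.m_ac)
  qed (simp add: B.l_distr)
qed

lemma algebra_of_complete_ring:
  assumes "complete_ring B p" shows "complete_ring (algebra_of h B) p"
proof -
  interpret B: complete_ring B p by fact
  interpret cring "algebra_of h B" by (rule algebra_of_cring) (rule B.is_cring)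
  show ?thesis by unfold_locales (simp_all add: B.sep B.lim)
qed

lemma (in cring) geom_dvd:
  assumes y: "y \<in> carrier R" shows "\<exists>z\<in>carrier R. \<one> \<ominus> y [^] (n::nat) = (\<one> \<ominus> y) \<otimes> z"
proof (induction n)
  case 0
  show ?case using y by (intro bexI[of _ \<zero>]) (auto simp: a_minus_def r_neg)
next
  case (Suc n)
  then obtain z where z: "z \<in> carrier R" "\<one> \<ominus> y [^] n = (\<one> \<ominus> y) \<otimes> z" by auto
  have c: "y [^] n \<in> carrier R" using y by simp
  have "\<one> \<ominus> y [^] n \<otimes> y = (\<one> \<ominus> y [^] n) \<oplus> (\<one> \<ominus> y) \<otimes> y [^] n" using c y by algebra
  also have "\<dots> = (\<one> \<ominus> y) \<otimes> (z \<oplus> y [^] n)" unfolding z(2) using c y z(1) by (simp add: r_distr)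
  finally show ?case using c z(1) by auto
qed

section \<open>The base ring\<close>

context base_data
begin

abbreviation "Kc \<equiv> Kcirc p L R w"
abbreviation "tK \<equiv> Kcirc_root p L R w"
abbreviation "inK \<equiv> padic_in p S"

lemma Kc_complete: "complete_ring Kc p"
  unfolding Kcirc_def by (rule algebra_of_complete_ring[OF S.completion_complete])

sublocale Kc: complete_ring Kc p by (rule Kc_complete)

lemma Kc_smult: "r \<odot>\<^bsub>Kc\<^esub> c = inK r \<otimes>\<^bsub>Kc\<^esub> c"
  by (simp add: Kcirc_def)

lemma inK_hom: "inK \<in> ring_hom S Kc"
  by (simp add: Kcirc_def S.padic_in_hom)

lemma inK_closed [simp]: "s \<in> carrier S \<Longrightarrow> inK s \<in> carrier Kc"
  using inK_hom by (rule ring_hom_closed)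
lemma inK_mult: "x \<in> carrier S \<Longrightarrow> y \<in> carrier S \<Longrightarrow> inK (x \<otimes>\<^bsub>L\<^esub> y) = inK x \<otimes>\<^bsub>Kc\<^esub> inK y"
  using ring_hom_mult[OF inK_hom] by simp
lemma inK_add: "x \<in> carrier S \<Longrightarrow> y \<in> carrier S \<Longrightarrow> inK (x \<oplus>\<^bsub>L\<^esub> y) = inK x \<oplus>\<^bsub>Kc\<^esub> inK y"
  using ring_hom_add[OF inK_hom] by simp
lemma inK_one: "inK \<one>\<^bsub>L\<^esub> = \<one>\<^bsub>Kc\<^esub>"
  using ring_hom_one[OF inK_hom] by simp
lemma inK_pow: "x \<in> carrier S \<Longrightarrow> inK (x [^]\<^bsub>L\<^esub> (n::nat)) = inK x [^]\<^bsub>Kc\<^esub> n"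
  using ring_hom_pow[OF S.is_cring Kc.is_cring inK_hom] by simp

text \<open>Together with \<open>inK_dense\<close> this identifies \<open>S/p^n\<close> with
  \<open>K^o/p^n\<close>, so that questions modulo \<open>p^n\<close> are decided in the subring
  \<open>S\<close> of the field \<open>L\<close>.\<close>

lemma inK_p_ideal_iff: "s \<in> carrier S \<Longrightarrow> inK s \<in> p_ideal p n Kc \<longleftrightarrow> s \<in> p_ideal p n S"
  by (simp add: Kcirc_def S.padic_in_p_ideal_iff)

lemma inK_pcong_iff:
  assumes "s \<in> carrier S" "s' \<in> carrier S"
  shows "pcong p n Kc (inK s) (inK s') \<longleftrightarrow> pcong p n S s s'"
  using assms inK_p_ideal_iff[of "s \<ominus>\<^bsub>S\<^esub> s'" n] by (simp add: pcong_def ring_hom_minus[OF S.is_cring Kc.is_cring inK_hom])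

lemma inK_dense: "c \<in> carrier Kc \<Longrightarrow> \<exists>s\<in>carrier S. pcong p n Kc c (inK s)"
  using S.completion_dense[of c p n] by (simp add: Kcirc_def)

lemma S_p_ideal_iff: "x \<in> p_ideal p n S \<longleftrightarrow> (\<exists>y\<in>carrier S. x = \<pi> [^]\<^bsub>L\<^esub> n \<otimes>\<^bsub>L\<^esub> y)"
  by (simp add: S.p_ideal_iff)

lemma Kc_algebra: "algebra RR Kc"
proof (rule algebraI)
  have s: "\<And>r. r \<in> R \<Longrightarrow> inK r \<in> carrier Kc" using R_S by simp
  show "cring RR" "cring Kc" by (rule RR.is_cring, rule Kc.is_cring)
  show "\<And>r x. r \<in> carrier RR \<Longrightarrow> x \<in> carrier Kc \<Longrightarrow> r \<odot>\<^bsub>Kc\<^esub> x \<in> carrier Kc"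
    "\<And>r r' x. r \<in> carrier RR \<Longrightarrow> r' \<in> carrier RR \<Longrightarrow> x \<in> carrier Kc \<Longrightarrow>
      (r \<oplus>\<^bsub>RR\<^esub> r') \<odot>\<^bsub>Kc\<^esub> x = r \<odot>\<^bsub>Kc\<^esub> x \<oplus>\<^bsub>Kc\<^esub> r' \<odot>\<^bsub>Kc\<^esub> x"
    "\<And>r x y. r \<in> carrier RR \<Longrightarrow> x \<in> carrier Kc \<Longrightarrow> y \<in> carrier Kc \<Longrightarrow>
      r \<odot>\<^bsub>Kc\<^esub> (x \<oplus>\<^bsub>Kc\<^esub> y) = r \<odot>\<^bsub>Kc\<^esub> x \<oplus>\<^bsub>Kc\<^esub> r \<odot>\<^bsub>Kc\<^esub> y"
    "\<And>r r' x. r \<in> carrier RR \<Longrightarrow> r' \<in> carrier RR \<Longrightarrow> x \<in> carrier Kc \<Longrightarrow>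
      (r \<otimes>\<^bsub>RR\<^esub> r') \<odot>\<^bsub>Kc\<^esub> x = r \<odot>\<^bsub>Kc\<^esub> (r' \<odot>\<^bsub>Kc\<^esub> x)"
    "\<And>x. x \<in> carrier Kc \<Longrightarrow> \<one>\<^bsub>RR\<^esub> \<odot>\<^bsub>Kc\<^esub> x = x"
    "\<And>r x y. r \<in> carrier RR \<Longrightarrow> x \<in> carrier Kc \<Longrightarrow> y \<in> carrier Kc \<Longrightarrow>
      r \<odot>\<^bsub>Kc\<^esub> x \<otimes>\<^bsub>Kc\<^esub> y = r \<odot>\<^bsub>Kc\<^esub> (x \<otimes>\<^bsub>Kc\<^esub> y)"
    using s R_S by (simp_all add: Kc_smult inK_add inK_mult inK_one Kc.l_distr Kc.r_distr Kc.m_assoc)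
qed

lemma tK_eq: "tK m = inK (w m)"
  by (simp add: Kcirc_root_def)

sublocale Kr: root_ring Kc p tK
proof unfold_locales
  show "Factorial_Ring.prime p" by (rule prime)
  show "\<And>m. tK m \<in> carrier Kc" by (simp add: tK_eq w_S)
  show "tK 0 = p_elem p Kc"
    using ring_hom_p_elem[OF S.is_cring Kc.is_cring inK_hom, of p] by (simp add: tK_eq root_0)
  show "tK (Suc m) [^]\<^bsub>Kc\<^esub> p = tK m" for m
    using inK_pow[OF w_S, of "Suc m" p] by (simp add: tK_eq root_Suc)
qed

text \<open>Modulo \<open>p\<close> the relation can be moved into \<open>S\<close>, where it reads
  \<open>r = w l * s + \<pi> * z\<close>. Applying the \<open>R\<close>-linear functional
  \<open>e0\<close> keeps \<open>r\<close> on the left and leaves elements of \<open>pR\<close> on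
  the right.\<close>

lemma R_J:
  assumes r: "r \<in> R" "inK r \<in> tideal Kc tK" shows "r \<in> p_ideal p 1 RR"
proof -
  obtain l y where y: "y \<in> carrier Kc" "inK r = tK l \<otimes>\<^bsub>Kc\<^esub> y" using r(2) by (rule Kr.J_E)
  obtain s where s: "s \<in> carrier S" "pcong p 1 Kc y (inK s)" using inK_dense y(1) by blast
  have ws: "w l \<otimes>\<^bsub>L\<^esub> s \<in> carrier S" using S.m_closed[OF w_S s(1)] by simp
  have "pcong p 1 Kc (inK r) (tK l \<otimes>\<^bsub>Kc\<^esub> inK s)" unfolding y(2) using s by (intro Kc.pcong_mult) auto
  then have "pcong p 1 S r (w l \<otimes>\<^bsub>L\<^esub> s)"
    using inK_pcong_iff[OF R_S[OF r(1)] ws] s w_S by (simp add: tK_eq inK_mult)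
  then obtain z where z: "z \<in> carrier S" "r = w l \<otimes>\<^bsub>L\<^esub> s \<oplus>\<^bsub>L\<^esub> \<pi> \<otimes>\<^bsub>L\<^esub> z" by (auto simp: S.pcong_iff S_L)
  have "r = e0 r" using e0_R r by simp
  also have "\<dots> = e0 (w l \<otimes>\<^bsub>L\<^esub> s) \<oplus>\<^bsub>L\<^esub> \<pi> \<otimes>\<^bsub>L\<^esub> e0 z"
    unfolding z(2) using ws z(1) S.m_closed[OF R_S[OF \<pi>_R] z(1)] \<pi>_R by (simp add: e0_add e0_smult)
  also have "\<dots> \<in> p_ideal p 1 RR"
  proof -
    have "\<pi> \<otimes>\<^bsub>L\<^esub> e0 z \<in> p_ideal p 1 RR" using e0_decomp(1)[OF z(1)] unfolding sub_p_ideal_iff[OF R_subring] by auto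
    then show ?thesis using RR.p_ideal_add[OF e0_w_mult[OF s(1), of l]] by simp
  qed
  finally show ?thesis .
qed

lemma Kc_hs:
  assumes "c \<in> carrier Kc"
  shows "\<exists>M. \<forall>m\<ge>M. \<exists>u. (\<forall>i. u i \<in> R) \<and> pcong p n Kc c (hs Kc (tK m) (\<lambda>i. inK (u i)) (p ^ m))"
proof -
  obtain s where s: "s \<in> carrier S" "pcong p n Kc c (inK s)" using inK_dense assms by blast
  obtain M where M: "\<And>m. m \<ge> M \<Longrightarrow> \<exists>u. (\<forall>i. u i \<in> R) \<and> s = hs L (w m) u (p ^ m)" using S_hs[OF s(1)] by blast
  show ?thesis
  proof (intro exI[of _ M] allI impI)
    fix m assume "M \<le> m"
    then obtain u where u: "\<And>i. u i \<in> R" "s = hs L (w m) u (p ^ m)" using M by blast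
    have "inK s = hs Kc (tK m) (\<lambda>i. inK (u i)) (p ^ m)"
      using hs_hom[OF S.is_cring Kc.is_cring inK_hom, of "w m" u "p ^ m"] w_S R_S[OF u(1)] by (simp add: u(2) tK_eq)
    then show "\<exists>u. (\<forall>i. u i \<in> R) \<and> pcong p n Kc c (hs Kc (tK m) (\<lambda>i. inK (u i)) (p ^ m))" using u(1) s(2) by auto
  qed
qed

text \<open>Approximating \<open>x\<close> by some \<open>s\<close> in \<open>S\<close> modulo
  \<open>p^(n+1)\<close> turns the hypothesis into divisibility of \<open>\<pi> s\<close> by
  \<open>\<pi>^(n+1)\<close> in a domain. Cancelling costs one power, and \<open>n\<close> is
  arbitrary.\<close>

lemma Kc_ptf:
  assumes x: "x \<in> carrier Kc" "p_elem p Kc \<otimes>\<^bsub>Kc\<^esub> x = \<zero>\<^bsub>Kc\<^esub>" shows "x = \<zero>\<^bsub>Kc\<^esub>"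
proof (rule Kc.sep[OF x(1)])
  fix n
  obtain s where s: "s \<in> carrier S" "pcong p (Suc n) Kc x (inK s)" using inK_dense x(1) by blast
  have "pcong p (Suc n) Kc (p_elem p Kc \<otimes>\<^bsub>Kc\<^esub> x) (p_elem p Kc \<otimes>\<^bsub>Kc\<^esub> inK s)" using s by (intro Kc.pcong_mult) auto
  moreover have "p_elem p Kc \<otimes>\<^bsub>Kc\<^esub> inK s = inK (\<pi> \<otimes>\<^bsub>L\<^esub> s)"
    using Kr.t_0 s R_S[OF \<pi>_R] by (simp add: tK_eq root_0 inK_mult)
  ultimately have "inK (\<pi> \<otimes>\<^bsub>L\<^esub> s) \<in> p_ideal p (Suc n) Kc"
    unfolding x(2) using Kc.pcong_sym Kc.pcong_zero by metis
  then have "\<pi> \<otimes>\<^bsub>L\<^esub> s \<in> p_ideal p (Suc n) S" using inK_p_ideal_iff S.m_closed[OF R_S[OF \<pi>_R] s(1)] by simp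
  then obtain y where y: "y \<in> carrier S" "\<pi> \<otimes>\<^bsub>L\<^esub> s = \<pi> [^]\<^bsub>L\<^esub> Suc n \<otimes>\<^bsub>L\<^esub> y" unfolding S_p_ideal_iff by blast
  then have "\<pi> \<otimes>\<^bsub>L\<^esub> s = \<pi> \<otimes>\<^bsub>L\<^esub> (\<pi> [^]\<^bsub>L\<^esub> n \<otimes>\<^bsub>L\<^esub> y)" using S_L by (simp add: L.m_ac)
  then have "s = \<pi> [^]\<^bsub>L\<^esub> n \<otimes>\<^bsub>L\<^esub> y" using S_L[OF y(1)] S_L[OF s(1)] \<pi>_nz by (simp add: L.m_lcancel)
  then have "s \<in> p_ideal p n S" using y(1) S_p_ideal_iff by blast
  then have "inK s \<in> p_ideal p n Kc" using inK_p_ideal_iff s(1) by simp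
  then show "x \<in> p_ideal p n Kc" using Kc.pcong_mono[OF s(2), of n] Kc.pcong_p_ideal by auto
qed

text \<open>Of an expansion modulo \<open>p\<close> only the constant coefficient survives modulo
  the roots; hence \<open>K^o\<close> is the sum of \<open>R\<close> and the ideal of the
  roots.\<close>

lemma Kc_lift:
  assumes "x \<in> carrier Kc" shows "\<exists>r\<in>R. x \<ominus>\<^bsub>Kc\<^esub> inK r \<in> tideal Kc tK"
proof -
  obtain m u where u: "\<And>i. u i \<in> R" and x: "pcong p 1 Kc x (hs Kc (tK m) (\<lambda>i. inK (u i)) (p ^ m))"
    using Kc_hs[OF assms, of 1] by blast
  have uc: "inK (u i) \<in> carrier Kc" for i using u R_S by simp
  obtain z where z: "z \<in> carrier Kc" "hs Kc (tK m) (\<lambda>i. inK (u i)) (p ^ m) = inK (u 0) \<oplus>\<^bsub>Kc\<^esub> tK m \<otimes>\<^bsub>Kc\<^esub> z"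
    using Kc.hs_split[of "tK m" "\<lambda>i. inK (u i)" 0 "p ^ m"] uc p0 by auto
  obtain y where y: "y \<in> carrier Kc" "x = (inK (u 0) \<oplus>\<^bsub>Kc\<^esub> tK m \<otimes>\<^bsub>Kc\<^esub> z) \<oplus>\<^bsub>Kc\<^esub> p_elem p Kc \<otimes>\<^bsub>Kc\<^esub> y"
    using x unfolding Kc.pcong_iff z by auto
  have c: "tK m \<otimes>\<^bsub>Kc\<^esub> z \<in> carrier Kc" "tK 0 \<otimes>\<^bsub>Kc\<^esub> y \<in> carrier Kc" using y z by auto
  have "x \<ominus>\<^bsub>Kc\<^esub> inK (u 0) = tK m \<otimes>\<^bsub>Kc\<^esub> z \<oplus>\<^bsub>Kc\<^esub> tK 0 \<otimes>\<^bsub>Kc\<^esub> y"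
    unfolding y(2) Kr.t_0[symmetric] using c uc[of 0] by algebra
  also have "\<dots> \<in> tideal Kc tK" using y(1) z(1) Kr.J_I by (intro Kr.J.a_closed) auto
  finally show ?thesis using u by blast
qed

sublocale Kg: gauge_field Kc p tK
proof unfold_locales
  show "\<And>x. x \<in> carrier Kc \<Longrightarrow> p_elem p Kc \<otimes>\<^bsub>Kc\<^esub> x = \<zero>\<^bsub>Kc\<^esub> \<Longrightarrow> x = \<zero>\<^bsub>Kc\<^esub>" by (rule Kc_ptf)
next
  fix x assume x: "x \<in> carrier Kc" "x \<notin> p_ideal p 1 Kc"
  obtain m u where u: "\<And>i. u i \<in> R" and xu: "pcong p 1 Kc x (hs Kc (tK m) (\<lambda>i. inK (u i)) (p ^ m))"
    using Kc_hs[OF x(1), of 1] by blast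
  have uc: "inK (u i) \<in> carrier Kc" for i using u R_S by simp
  have uJ: "inK (u i) \<in> p_ideal p 1 Kc" if "inK (u i) \<in> tideal Kc tK" for i
  proof -
    have "u i \<in> p_ideal p 1 RR" using R_J[OF u that] .
    then have "u i \<in> p_ideal p 1 S" unfolding S_p_ideal_iff sub_p_ideal_iff[OF R_subring] using R_S by blast
    then show ?thesis using inK_p_ideal_iff[OF R_S[OF u]] by blast
  qed
  show "\<exists>m j. \<exists>y\<in>carrier Kc. y \<notin> tideal Kc tK \<and> x = tK m [^]\<^bsub>Kc\<^esub> (j::nat) \<otimes>\<^bsub>Kc\<^esub> y"
    using Kr.leadingI[of "\<lambda>i. inK (u i)" x m, OF uc xu uJ x(2)] by blast
next
  have one: "\<one>\<^bsub>Kc\<^esub> \<notin> tideal Kc tK"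
  proof
    assume "\<one>\<^bsub>Kc\<^esub> \<in> tideal Kc tK"
    then have "\<one>\<^bsub>L\<^esub> \<in> p_ideal p 1 RR" using R_J[OF R_closed(2)] by (simp add: inK_one)
    then obtain y where "y \<in> R" "\<one>\<^bsub>L\<^esub> = \<pi> \<otimes>\<^bsub>L\<^esub> y" by (auto simp: sub_p_ideal_iff[OF R_subring])
    then show False using p_not_unit_S[OF R_S] by metis
  qed
  then show "\<one>\<^bsub>Kc\<^esub> \<notin> tideal Kc tK" .
  show units: "y \<in> Units Kc" if y: "y \<in> carrier Kc" "y \<notin> tideal Kc tK" for y
  proof -
    obtain r where r: "r \<in> R" "y \<ominus>\<^bsub>Kc\<^esub> inK r \<in> tideal Kc tK" using Kc_lift[OF y(1)] by blast
    have rc: "inK r \<in> carrier Kc" using r R_S by simp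
    have yr: "y = (y \<ominus>\<^bsub>Kc\<^esub> inK r) \<oplus>\<^bsub>Kc\<^esub> inK r" using y rc by algebra
    have "r \<notin> p_ideal p 1 RR"
    proof
      assume "r \<in> p_ideal p 1 RR"
      then have "r \<in> p_ideal p 1 S" unfolding S_p_ideal_iff sub_p_ideal_iff[OF R_subring] using R_S by blast
      then have "inK r \<in> tideal Kc tK" using inK_p_ideal_iff[OF R_S[OF r(1)]] Kr.p_ideal_J by blast
      then have "y \<in> tideal Kc tK" using Kr.J.a_closed[OF r(2)] yr by metis
      then show False using y by simp
    qed
    then obtain u where u: "u \<in> R" "r \<otimes>\<^bsub>L\<^esub> u = \<one>\<^bsub>L\<^esub>" using R_unit r(1) by blast
    have uc: "inK u \<in> carrier Kc" using u R_S by simp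
    have ru: "inK r \<otimes>\<^bsub>Kc\<^esub> inK u = \<one>\<^bsub>Kc\<^esub>" using u r R_S by (simp add: inK_mult[symmetric] inK_one)
    \<comment> \<open>As \<open>u\<close> inverts the residue \<open>r\<close> of \<open>y\<close>,
      the product \<open>y u\<close> is \<open>1 - j\<close> with \<open>j\<close> in the ideal of
      the roots. A power \<open>j^n\<close> is divisible by \<open>p\<close>, so
      \<open>1 - j^n\<close> is a unit, and it is a multiple of \<open>1 - j\<close>.\<close>
    define j where "j = \<ominus>\<^bsub>Kc\<^esub> ((y \<ominus>\<^bsub>Kc\<^esub> inK r) \<otimes>\<^bsub>Kc\<^esub> inK u)"
    have j: "j \<in> tideal Kc tK" unfolding j_def using r(2) uc by (intro Kr.J.a_inv_closed Kr.J.I_r_closed)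
    have jc: "j \<in> carrier Kc" using Kr.J_closed[OF j] .
    have "y \<otimes>\<^bsub>Kc\<^esub> inK u = (y \<ominus>\<^bsub>Kc\<^esub> inK r) \<otimes>\<^bsub>Kc\<^esub> inK u \<oplus>\<^bsub>Kc\<^esub> inK r \<otimes>\<^bsub>Kc\<^esub> inK u"
      using y rc uc by algebra
    also have "\<dots> = \<one>\<^bsub>Kc\<^esub> \<ominus>\<^bsub>Kc\<^esub> j" unfolding ru j_def using y rc uc by (simp add: a_minus_def Kc.a_comm)
    finally have yu: "y \<otimes>\<^bsub>Kc\<^esub> inK u = \<one>\<^bsub>Kc\<^esub> \<ominus>\<^bsub>Kc\<^esub> j" .
    obtain n :: nat where n: "j [^]\<^bsub>Kc\<^esub> n \<in> p_ideal p 1 Kc" using Kr.J_nilpotent[OF j] by blast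
    obtain z where z: "z \<in> carrier Kc" "\<one>\<^bsub>Kc\<^esub> \<ominus>\<^bsub>Kc\<^esub> j [^]\<^bsub>Kc\<^esub> n = (\<one>\<^bsub>Kc\<^esub> \<ominus>\<^bsub>Kc\<^esub> j) \<otimes>\<^bsub>Kc\<^esub> z" using Kc.geom_dvd[OF jc] by blast
    have "(y \<otimes>\<^bsub>Kc\<^esub> inK u) \<otimes>\<^bsub>Kc\<^esub> z \<in> Units Kc" unfolding yu z(2)[symmetric] using n by (rule Kc.one_minus_unit)
    then show ?thesis using Kc.unit_factor[of y "inK u \<otimes>\<^bsub>Kc\<^esub> z"] y uc z by (simp add: Kc.m_assoc)
  qed
  show "x \<in> tideal Kc tK" if x: "x \<in> carrier Kc" "0 < n" "x [^]\<^bsub>Kc\<^esub> (n::nat) \<in> tideal Kc tK" for x n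
  proof (rule ccontr)
    assume "x \<notin> tideal Kc tK"
    then have "x [^]\<^bsub>Kc\<^esub> n \<in> Units Kc" using units x Kc.Units_pow_closed by blast
    then have "\<one>\<^bsub>Kc\<^esub> \<in> tideal Kc tK"
      using x(3) Kr.J.I_l_closed[OF x(3) Kc.Units_inv_closed] Kc.Units_l_inv by metis
    then show False using one by simp
  qed
qed

text \<open>The residue field is algebraically closed, hence perfect: the class \<open>c\<close> of
  \<open>r\<close> has a \<open>p\<close>-th root.\<close>

lemma R_perfect:
  assumes r: "r \<in> R" shows "\<exists>y\<in>R. pcong p 1 RR r (y [^]\<^bsub>L\<^esub> p)"
proof -
  let ?I = "p_ideal p 1 RR" let ?k = "mod_p p RR"
  interpret k: algebraically_closed ?k by (rule residue_field)
  have kq: "?k = RR Quot ?I" by (simp add: mod_p_def)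
  define c where "c = ?I +>\<^bsub>RR\<^esub> r"
  have c: "c \<in> carrier ?k" unfolding kq c_def RR.quot_carrier using r by auto
  \<comment> \<open>The coefficient list of \<open>X^p - c\<close>, highest coefficient first. It
    splits over the residue field and has positive degree \<open>p\<close>, so it has a
    root.\<close>
  define f where "f = \<one>\<^bsub>?k\<^esub> # (replicate (p - 1) \<zero>\<^bsub>?k\<^esub> @ [\<ominus>\<^bsub>?k\<^esub> c])"
  have f: "f \<in> carrier (poly_ring ?k)"
    unfolding univ_poly_def polynomial_def f_def using c by auto
  have len: "length f - 1 = p" using p0 by (simp add: f_def)
  have "size (k.roots f) = p" using k.roots_over_carrier[OF f] len by (simp add: k.splitted_def)
  then have "k.roots f \<noteq> {#}" using p0 by auto
  then obtain x where "x \<in># k.roots f" by auto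
  then have "k.is_root f x" using k.roots_mem_iff_is_root[OF f] by simp
  then have x: "x \<in> carrier ?k" "k.eval f x = \<zero>\<^bsub>?k\<^esub>" by (auto simp: k.is_root_def)
  have ev0: "k.eval (replicate n \<zero>\<^bsub>?k\<^esub> @ [d]) x = d" if "d \<in> carrier ?k" for n d
    using that x(1) by (induction n) auto
  have "x [^]\<^bsub>?k\<^esub> p \<oplus>\<^bsub>?k\<^esub> \<ominus>\<^bsub>?k\<^esub> c = \<zero>\<^bsub>?k\<^esub>"
    using x c p0 ev0[of "\<ominus>\<^bsub>?k\<^esub> c" "p - 1"] by (simp add: f_def)
  then have xp: "x [^]\<^bsub>?k\<^esub> p = c" using k.r_right_minus_eq[of "x [^]\<^bsub>?k\<^esub> p" c] x c by (simp add: a_minus_def)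
  obtain y where y: "y \<in> R" "x = ?I +>\<^bsub>RR\<^esub> y" using x(1) unfolding kq RR.quot_carrier by auto
  have yR: "y [^]\<^bsub>L\<^esub> p \<in> R" using RR.nat_pow_closed[of y p] y by (simp add: pow_sub)
  have "?I +>\<^bsub>RR\<^esub> (y [^]\<^bsub>L\<^esub> p) = c"
    using RR.quot_pow[OF RR.p_ideal_ideal, of y p 1 p] y xp by (simp add: kq pow_sub)
  then have "pcong p 1 RR r (y [^]\<^bsub>L\<^esub> p)"
    using RR.p_coset_eq_iff[of r "y [^]\<^bsub>L\<^esub> p" p 1] r yR by (simp add: c_def)
  then show ?thesis using y by blast
qed

text \<open>Each term of an expansion modulo \<open>p\<close> is a \<open>p\<close>-th power modulo
  \<open>p\<close>: its coefficient by \<open>R_perfect\<close>, and its power of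
  \<open>tK m\<close> because that root is the \<open>p\<close>-th power of the next one. Modulo
  \<open>p\<close>, sums of \<open>p\<close>-th powers are \<open>p\<close>-th powers.\<close>

lemma Kc_frob_surj:
  assumes "c \<in> carrier Kc" shows "\<exists>d\<in>carrier Kc. pcong p 1 Kc c (d [^]\<^bsub>Kc\<^esub> p)"
proof -
  obtain m u where u: "\<And>i. u i \<in> R" and cu: "pcong p 1 Kc c (hs Kc (tK m) (\<lambda>i. inK (u i)) (p ^ m))"
    using Kc_hs[OF assms, of 1] by blast
  have "\<exists>d\<in>carrier Kc. pcong p 1 Kc (hs Kc (tK m) (\<lambda>i. inK (u i)) k) (d [^]\<^bsub>Kc\<^esub> p)" for k
  proof (induction k)
    case 0
    show ?case using Kc.nat_pow_zero[of p] p0 by (intro bexI[of _ "\<zero>\<^bsub>Kc\<^esub>"]) auto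
  next
    case (Suc k)
    then obtain d where d: "d \<in> carrier Kc" "pcong p 1 Kc (hs Kc (tK m) (\<lambda>i. inK (u i)) k) (d [^]\<^bsub>Kc\<^esub> p)" by blast
    obtain y where y: "y \<in> R" "pcong p 1 RR (u k) (y [^]\<^bsub>L\<^esub> p)" using R_perfect u by blast
    have "pcong p 1 S (u k) (y [^]\<^bsub>L\<^esub> p)"
      using y(2) R_S unfolding RR.pcong_iff S.pcong_iff by (auto simp: pow_sub p_elem_sub)
    then have "pcong p 1 Kc (inK (u k)) (inK y [^]\<^bsub>Kc\<^esub> p)"
      using ring_hom_pcong[OF S.is_cring Kc.is_cring inK_hom] R_S[OF y(1)] by (metis inK_pow)
    moreover have "tK m [^]\<^bsub>Kc\<^esub> k = (tK (Suc m) [^]\<^bsub>Kc\<^esub> k) [^]\<^bsub>Kc\<^esub> p"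
      unfolding Kr.t_Suc[of m, symmetric] by (simp add: Kc.nat_pow_pow mult.commute)
    ultimately have 1: "pcong p 1 Kc (inK (u k) \<otimes>\<^bsub>Kc\<^esub> tK m [^]\<^bsub>Kc\<^esub> k) ((inK y \<otimes>\<^bsub>Kc\<^esub> tK (Suc m) [^]\<^bsub>Kc\<^esub> k) [^]\<^bsub>Kc\<^esub> p)"
      using R_S[OF y(1)] Kc.pcong_mult[of p 1 "inK (u k)" "inK y [^]\<^bsub>Kc\<^esub> p" "tK m [^]\<^bsub>Kc\<^esub> k" "tK m [^]\<^bsub>Kc\<^esub> k"]
      by (simp add: Kc.nat_pow_distrib)
    define e where "e = inK y \<otimes>\<^bsub>Kc\<^esub> tK (Suc m) [^]\<^bsub>Kc\<^esub> k"
    have e: "e \<in> carrier Kc" using R_S[OF y(1)] by (simp add: e_def)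
    have "pcong p 1 Kc (hs Kc (tK m) (\<lambda>i. inK (u i)) (Suc k)) (d [^]\<^bsub>Kc\<^esub> p \<oplus>\<^bsub>Kc\<^esub> e [^]\<^bsub>Kc\<^esub> p)"
      using Kc.pcong_add[OF d(2) 1[folded e_def]] by simp
    then have "pcong p 1 Kc (hs Kc (tK m) (\<lambda>i. inK (u i)) (Suc k)) ((d \<oplus>\<^bsub>Kc\<^esub> e) [^]\<^bsub>Kc\<^esub> p)"
      using Kc.pcong_trans Kc.pcong_sym Kc.freshman[OF prime d(1) e] by blast
    then show ?case using d(1) e by blast
  qed
  then show ?thesis using Kc.pcong_trans[OF cu] by blast
qed

lemma \<Phi>K_hom: "\<Phi>K \<in> ring_hom Kc Kc"
  using \<Phi>K_auto by (simp add: ring_iso_def)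

lemma \<phi>R_hom: "\<phi>R \<in> ring_hom RR RR"
  using \<phi>R by (simp add: frobenius_lift_def)

lemma \<phi>R_closed: "r \<in> R \<Longrightarrow> \<phi>R r \<in> R"
  using ring_hom_closed[OF \<phi>R_hom] by simp

lemma \<Phi>K_closed [simp]: "c \<in> carrier Kc \<Longrightarrow> \<Phi>K c \<in> carrier Kc"
  using \<Phi>K_hom by (rule ring_hom_closed)

lemma \<Phi>K_smult:
  assumes "r \<in> R" "c \<in> carrier Kc" shows "\<Phi>K (r \<odot>\<^bsub>Kc\<^esub> c) = \<phi>R r \<odot>\<^bsub>Kc\<^esub> \<Phi>K c"
  using assms R_S ring_hom_mult[OF \<Phi>K_hom, of "inK r" c] by (simp add: Kc_smult \<Phi>K_extends)

text \<open>Elements of \<open>R\<close> are \<open>p\<close>-th powers modulo \<open>p\<close> as its residue field is perfect, and congruences improve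
  under \<open>p\<close>-th powers.\<close>

lemma R_hom_unique:
  assumes A: "cring A" and sepA: "\<And>x. x \<in> carrier A \<Longrightarrow> (\<And>n. x \<in> p_ideal p n A) \<Longrightarrow> x = \<zero>\<^bsub>A\<^esub>"
    and f: "f \<in> ring_hom RR A" and g: "g \<in> ring_hom RR A"
    and fg: "\<And>r. r \<in> R \<Longrightarrow> pcong p 1 A (f r) (g r)" and r: "r \<in> R"
  shows "f r = g r"
proof -
  interpret A: cring A by fact
  have cl: "f r \<in> carrier A" "g r \<in> carrier A" if "r \<in> R" for r
    using ring_hom_closed[OF f] ring_hom_closed[OF g] that by auto
  have main: "\<forall>r\<in>R. pcong p (Suc n) A (f r) (g r)" for n
  proof (induction n)
    case 0
    then show ?case using fg by simp
  next
    case (Suc n)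
    show ?case
    proof
      fix r assume r: "r \<in> R"
      obtain y where y: "y \<in> R" "pcong p 1 RR r (y [^]\<^bsub>L\<^esub> p)" using R_perfect r by blast
      obtain z where z: "z \<in> R" "r = y [^]\<^bsub>L\<^esub> p \<oplus>\<^bsub>L\<^esub> \<pi> \<otimes>\<^bsub>L\<^esub> z" using y(2) R_sub by (auto simp: RR.pcong_iff pow_sub p_elem_sub)
      have yp: "y [^]\<^bsub>L\<^esub> p \<in> R" "\<pi> \<otimes>\<^bsub>L\<^esub> z \<in> R" using RR.nat_pow_closed[of y p] y \<pi>_R z R_closed(4) by (auto simp: pow_sub)
      \<comment> \<open>Every homomorphism \<open>h\<close> respects the decomposition
        \<open>r = y^p + \<pi> z\<close>. In the first summand a congruence modulo
        \<open>p^(n+1)\<close> is improved by the \<open>p\<close>-th power, in the second by the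
        factor \<open>p\<close>.\<close>
      have e: "h r = h y [^]\<^bsub>A\<^esub> p \<oplus>\<^bsub>A\<^esub> p_elem p A \<otimes>\<^bsub>A\<^esub> h z" if h: "h \<in> ring_hom RR A" for h
        using ring_hom_add[OF h, of "y [^]\<^bsub>L\<^esub> p" "\<pi> \<otimes>\<^bsub>L\<^esub> z"] ring_hom_mult[OF h, of \<pi> z] yp z y \<pi>_R
          ring_hom_pow[OF RR.is_cring A h, of y p] ring_hom_p_elem[OF RR.is_cring A h, of p]
        by (simp add: pow_sub p_elem_sub)
      have "pcong p (Suc (Suc n)) A (f y [^]\<^bsub>A\<^esub> p) (g y [^]\<^bsub>A\<^esub> p)"
        using Suc y(1) by (intro A.pcong_frob prime) blast
      moreover have "pcong p (Suc (Suc n)) A (p_elem p A \<otimes>\<^bsub>A\<^esub> f z) (p_elem p A \<otimes>\<^bsub>A\<^esub> g z)"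
      proof -
        have "f z \<ominus>\<^bsub>A\<^esub> g z \<in> p_ideal p (Suc n) A" using Suc z(1) by (auto simp: pcong_def)
        moreover have "p_elem p A \<in> p_ideal p 1 A" using A.p_idealI[of "\<one>\<^bsub>A\<^esub>" p 1] by simp
        ultimately have "p_elem p A \<otimes>\<^bsub>A\<^esub> (f z \<ominus>\<^bsub>A\<^esub> g z) \<in> p_ideal p (1 + Suc n) A" using A.p_ideal_mult2 by blast
        moreover have "p_elem p A \<otimes>\<^bsub>A\<^esub> (f z \<ominus>\<^bsub>A\<^esub> g z) = p_elem p A \<otimes>\<^bsub>A\<^esub> f z \<ominus>\<^bsub>A\<^esub> p_elem p A \<otimes>\<^bsub>A\<^esub> g z"
          using cl[OF z(1)] by (simp add: a_minus_def A.r_distr A.r_minus)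
        ultimately show ?thesis using cl[OF z(1)] by (simp add: pcong_def)
      qed
      ultimately show "pcong p (Suc (Suc n)) A (f r) (g r)"
        unfolding e[OF f] e[OF g] by (rule A.pcong_add)
    qed
  qed
  have "f r \<ominus>\<^bsub>A\<^esub> g r = \<zero>\<^bsub>A\<^esub>"
  proof (rule sepA)
    fix n
    have "pcong p n A (f r) (g r)" using main[of n] r A.pcong_mono[of p "Suc n"] by auto
    then show "f r \<ominus>\<^bsub>A\<^esub> g r \<in> p_ideal p n A" by (simp add: pcong_def)
  qed (use cl[OF r] in simp)
  then show ?thesis using cl[OF r] by simp
qed

end

section \<open>The tensor product\<close>

locale base_alg = base_data +
  fixes A :: "('a, 'e, 'n) module_scheme" and \<phi> :: "'e \<Rightarrow> 'e"
  assumes frob_alg: "frob_alg p RR A \<phi>"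
begin

lemma A_algebra: "algebra RR A"
  using frob_alg by (simp add: frob_alg_def)

sublocale A: algebra RR A by (rule A_algebra)

lemma A_cring: "cring A" by (rule A.M_cring)

lemma A_ptf:
  assumes "x \<in> carrier A" "p_elem p A \<otimes>\<^bsub>A\<^esub> x = \<zero>\<^bsub>A\<^esub>" shows "x = \<zero>\<^bsub>A\<^esub>"
proof -
  have "[p] \<cdot>\<^bsub>A\<^esub> x = \<zero>\<^bsub>A\<^esub>" using cring.p_elem_mult[OF A_cring assms(1)] assms(2) by metis
  moreover have "p_torsion_free p A" using frob_alg unfolding frob_alg_def by blast
  ultimately show ?thesis using assms(1) unfolding p_torsion_free_def by blast
qed

lemma A_sep:
  assumes "x \<in> carrier A" "\<And>n. x \<in> p_ideal p n A" shows "x = \<zero>\<^bsub>A\<^esub>"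
proof -
  have "padically_complete p A" using frob_alg unfolding frob_alg_def by blast
  from cring.padically_complete_imp_sep[OF A_cring this assms] show ?thesis .
qed

lemma \<phi>_hom: "\<phi> \<in> ring_hom A A" and \<phi>_frob: "x \<in> carrier A \<Longrightarrow> pcong p 1 A (\<phi> x) (x [^]\<^bsub>A\<^esub> p)"
proof -
  show h: "\<phi> \<in> ring_hom A A" using frob_alg by (simp add: frob_alg_def frobenius_lift_def)
  show "x \<in> carrier A \<Longrightarrow> pcong p 1 A (\<phi> x) (x [^]\<^bsub>A\<^esub> p)"
    using frob_alg ring_hom_closed[OF h] by (simp add: frob_alg_def frobenius_lift_def pcong_def)
qed

lemma A_cancel_p:
  assumes "x \<in> carrier A" "p_elem p A \<otimes>\<^bsub>A\<^esub> x \<in> p_ideal p (Suc n) A" shows "x \<in> p_ideal p n A"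
proof -
  interpret N: nzd_loc A "p_elem p A"
    using A_cring A_ptf by (simp add: nzd_loc_def nzd_loc_axioms_def cring.p_elem_closed)
  obtain y where y: "y \<in> carrier A" "p_elem p A \<otimes>\<^bsub>A\<^esub> x = p_elem p A [^]\<^bsub>A\<^esub> Suc n \<otimes>\<^bsub>A\<^esub> y"
    using assms(2) by (rule A.p_idealE)
  have c: "p_elem p A [^]\<^bsub>A\<^esub> n \<otimes>\<^bsub>A\<^esub> y \<in> carrier A" using y(1) by simp
  have "p_elem p A \<otimes>\<^bsub>A\<^esub> x = p_elem p A \<otimes>\<^bsub>A\<^esub> (p_elem p A [^]\<^bsub>A\<^esub> n \<otimes>\<^bsub>A\<^esub> y)"
    unfolding y(2) using y(1) by (simp add: A.m_ac)
  then have "p_elem p A [^]\<^bsub>A\<^esub> (1::nat) \<otimes>\<^bsub>A\<^esub> x = p_elem p A [^]\<^bsub>A\<^esub> (1::nat) \<otimes>\<^bsub>A\<^esub> (p_elem p A [^]\<^bsub>A\<^esub> n \<otimes>\<^bsub>A\<^esub> y)"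
    by simp
  from N.s_cancel[OF assms(1) c this] show ?thesis using A.p_idealI[OF y(1)] by metis
qed

lemma A_reduced:
  assumes a: "a \<in> carrier A" "a [^]\<^bsub>A\<^esub> (n::nat) \<in> p_ideal p 1 A" shows "a \<in> p_ideal p 1 A"
proof -
  have rd: "reduced_ring (A Quot p_ideal p 1 A)" using frob_alg by (simp add: frob_alg_def mod_p_def)
  have iff: "p_ideal p 1 A +>\<^bsub>A\<^esub> x = \<zero>\<^bsub>A Quot p_ideal p 1 A\<^esub> \<longleftrightarrow> x \<in> p_ideal p 1 A" if "x \<in> carrier A" for x
    unfolding A.quot_zero[OF A.p_ideal_ideal] using that by (simp add: A.p_coset_eq_iff A.pcong_zero)
  have "(p_ideal p 1 A +>\<^bsub>A\<^esub> a) [^]\<^bsub>A Quot p_ideal p 1 A\<^esub> n = \<zero>\<^bsub>A Quot p_ideal p 1 A\<^esub>"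
    unfolding A.quot_pow[OF A.p_ideal_ideal a(1)] using iff[OF A.nat_pow_closed[OF a(1)]] a(2) by blast
  moreover have "p_ideal p 1 A +>\<^bsub>A\<^esub> a \<in> carrier (A Quot p_ideal p 1 A)" unfolding A.quot_carrier using a by blast
  ultimately have "p_ideal p 1 A +>\<^bsub>A\<^esub> a = \<zero>\<^bsub>A Quot p_ideal p 1 A\<^esub>" using rd unfolding reduced_ring_def by blast
  then show ?thesis using iff a by blast
qed

section \<open>The structure map from R to A\<close>

abbreviation "emb r \<equiv> r \<odot>\<^bsub>A\<^esub> \<one>\<^bsub>A\<^esub>"

lemma smult_emb: "r \<in> R \<Longrightarrow> a \<in> carrier A \<Longrightarrow> r \<odot>\<^bsub>A\<^esub> a = emb r \<otimes>\<^bsub>A\<^esub> a"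
  using A.smult_assoc2[of r "\<one>\<^bsub>A\<^esub>" a] by simp

lemma emb_hom: "emb \<in> ring_hom RR A"
proof (rule ring_hom_memI)
  fix x y assume *: "x \<in> carrier RR" "y \<in> carrier RR"
  show "emb (x \<otimes>\<^bsub>RR\<^esub> y) = emb x \<otimes>\<^bsub>A\<^esub> emb y"
    using * A.smult_assoc1[of x y "\<one>\<^bsub>A\<^esub>"] smult_emb[of x "emb y"] by (simp del: A.smult_one)
  show "emb (x \<oplus>\<^bsub>RR\<^esub> y) = emb x \<oplus>\<^bsub>A\<^esub> emb y"
    using * by (simp add: A.smult_l_distr[simplified])
qed (use A.smult_one[of "\<one>\<^bsub>A\<^esub>"] in auto)

lemma emb_p: "emb \<pi> = p_elem p A"
  using ring_hom_p_elem[OF RR.is_cring A_cring emb_hom, of p] by (simp add: p_elem_sub)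

text \<open>Both \<open>\<phi> (emb r)\<close> and \<open>emb (\<phi>R r)\<close> define ring
  homomorphisms from \<open>R\<close> into the separated ring \<open>A\<close>, and modulo
  \<open>p\<close> both are the \<open>p\<close>-th power of \<open>emb r\<close>; so
  \<open>R_hom_unique\<close> makes them equal. This is what lets \<open>\<phi>\<close> and
  \<open>\<Phi>K\<close> be tensored over \<open>R\<close>.\<close>

lemma \<phi>_smult:
  assumes "r \<in> R" "a \<in> carrier A" shows "\<phi> (r \<odot>\<^bsub>A\<^esub> a) = \<phi>R r \<odot>\<^bsub>A\<^esub> \<phi> a"
proof -
  have ec: "r \<in> R \<Longrightarrow> emb r \<in> carrier A" for r by simp
  have "\<phi> (emb r) = emb (\<phi>R r)"
  proof (rule R_hom_unique[OF A_cring A_sep _ _ _ assms(1), of "\<lambda>r. \<phi> (emb r)" "\<lambda>r. emb (\<phi>R r)"])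
    show "(\<lambda>r. \<phi> (emb r)) \<in> ring_hom RR A" using ring_hom_trans[OF emb_hom \<phi>_hom] by (simp add: comp_def)
    show "(\<lambda>r. emb (\<phi>R r)) \<in> ring_hom RR A" using ring_hom_trans[OF \<phi>R_hom emb_hom] by (simp add: comp_def)
    fix r assume r: "r \<in> R"
    have "pcong p 1 RR (\<phi>R r) (r [^]\<^bsub>RR\<^esub> p)"
      using \<phi>R r \<phi>R_closed RR.nat_pow_closed[of r p] by (simp add: frobenius_lift_def pcong_def)
    then have "pcong p 1 A (emb (\<phi>R r)) (emb r [^]\<^bsub>A\<^esub> p)"
      using ring_hom_pcong[OF RR.is_cring A_cring emb_hom] ring_hom_pow[OF RR.is_cring A_cring emb_hom, of r p] r by force
    then show "pcong p 1 A (\<phi> (emb r)) (emb (\<phi>R r))"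
      by (rule A.pcong_trans[OF \<phi>_frob[OF ec[OF r]] A.pcong_sym])
  qed
  then show ?thesis
    unfolding smult_emb[OF assms] smult_emb[OF \<phi>R_closed[OF assms(1)] ring_hom_closed[OF \<phi>_hom assms(2)]]
      ring_hom_mult[OF \<phi>_hom ec[OF assms(1)] assms(2)] by simp
qed

section \<open>The tensor product of A with K^o and its endomorphism\<close>

sublocale TP: tensor_pair RR A Kc
  by (simp add: tensor_pair_def A_algebra Kc_algebra)

abbreviation "T \<equiv> tensor RR A Kc"
abbreviation "tin \<equiv> tensor_in RR A Kc"
abbreviation "\<Phi> \<equiv> Phi RR Kc \<Phi>K A \<phi>"

lemma \<Phi>_hom: "\<Phi> \<in> ring_hom T T"
  by (rule tensor_map_hom[where \<sigma> = \<phi>R])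
    (auto simp: TP.tensor_pair_axioms \<phi>_hom \<Phi>K_hom \<phi>R_closed \<phi>_smult \<Phi>K_smult)

lemma \<Phi>_tin: "a \<in> carrier A \<Longrightarrow> c \<in> carrier Kc \<Longrightarrow> \<Phi> (tin a c) = tin (\<phi> a) (\<Phi>K c)"
  by (rule tensor_map_in[where \<sigma> = \<phi>R])
    (auto simp: TP.tensor_pair_axioms \<phi>_hom \<Phi>K_hom \<phi>R_closed \<phi>_smult \<Phi>K_smult)

lemma \<phi>_closed [simp]: "a \<in> carrier A \<Longrightarrow> \<phi> a \<in> carrier A"
  using \<phi>_hom by (rule ring_hom_closed)

lemma \<phi>_pow_closed [simp]: "a \<in> carrier A \<Longrightarrow> (\<phi> ^^ k) a \<in> carrier A"
  by (induction k) auto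

lemma \<Phi>_unique:
  assumes \<Psi>: "\<Psi> \<in> ring_hom T T"
    and 1: "\<And>a. a \<in> carrier A \<Longrightarrow> \<Psi> (tin a \<one>\<^bsub>Kc\<^esub>) = tin (\<phi> a) \<one>\<^bsub>Kc\<^esub>"
    and 2: "\<And>c. c \<in> carrier Kc \<Longrightarrow> \<Psi> (tin \<one>\<^bsub>A\<^esub> c) = tin \<one>\<^bsub>A\<^esub> (\<Phi>K c)"
    and x: "x \<in> carrier T"
  shows "\<Psi> x = \<Phi> x"
  using x
proof (induction rule: TP.T_induct)
  case (gen a c)
  have "\<Psi> (tin a c) = tin (\<phi> a) \<one>\<^bsub>Kc\<^esub> \<otimes>\<^bsub>T\<^esub> tin \<one>\<^bsub>A\<^esub> (\<Phi>K c)"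
    using gen 1 2 by (subst TP.tin_split) (auto simp: ring_hom_mult[OF \<Psi>])
  then show ?case using gen by (simp add: \<Phi>_tin TP.tin_mult)
next
  case (add x y)
  then show ?case by (simp add: ring_hom_add[OF \<Psi>] ring_hom_add[OF \<Phi>_hom])
qed

abbreviation "tT m \<equiv> tin \<one>\<^bsub>A\<^esub> (tK m)"
abbreviation "inA a \<equiv> tin a \<one>\<^bsub>Kc\<^esub>"

lemma \<Phi>_tT: "\<Phi> (tT m) = tT m"
  using \<Phi>K_roots by (simp add: \<Phi>_tin ring_hom_one[OF \<phi>_hom])

lemma \<Phi>_inA: "a \<in> carrier A \<Longrightarrow> \<Phi> (inA a) = inA (\<phi> a)"
  by (simp add: \<Phi>_tin ring_hom_one[OF \<Phi>K_hom])

lemma tT_pow: "tT m [^]\<^bsub>T\<^esub> (k::nat) = tin \<one>\<^bsub>A\<^esub> (tK m [^]\<^bsub>Kc\<^esub> k)"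
  using ring_hom_pow[OF Kc.is_cring TP.T_cring TP.tin_hom2, of "tK m" k] by simp

lemma p_elem_T: "p_elem p T = inA (p_elem p A)" "p_elem p T = tT 0"
  using ring_hom_p_elem[OF A_cring TP.T_cring TP.tin_hom1, of p]
    ring_hom_p_elem[OF Kc.is_cring TP.T_cring TP.tin_hom2, of p] by (simp_all add: Kr.t_0)

lemma inA_p_ideal: "a \<in> p_ideal p n A \<Longrightarrow> inA a \<in> p_ideal p n T"
  by (rule ring_hom_p_ideal[OF A_cring TP.T_cring TP.tin_hom1])

lemma hs_pcong_zero:
  assumes "cring C" "t \<in> carrier C" "\<And>i. u i \<in> carrier C" "\<And>i. i < k \<Longrightarrow> u i \<in> p_ideal p n C"
  shows "hs C t u k \<in> p_ideal p n C"
proof -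
  interpret C: cring C by fact
  show ?thesis using assms(4)
    by (induction k) (use assms(2,3) in \<open>auto intro!: C.p_ideal_add simp: C.p_ideal_mult C.m_comm[of "u k" "t [^]\<^bsub>C\<^esub> k" for k]\<close>)
qed

lemma tin_pcong:
  assumes "a \<in> carrier A" "pcong p n Kc c c'" shows "pcong p n T (tin a c) (tin a c')"
proof -
  have c: "c \<in> carrier Kc" "c' \<in> carrier Kc" using assms(2) by (auto simp: pcong_def)
  have "pcong p n T (tin \<one>\<^bsub>A\<^esub> c) (tin \<one>\<^bsub>A\<^esub> c')"
    using ring_hom_pcong[OF Kc.is_cring TP.T_cring TP.tin_hom2 assms(2)] .
  then have "pcong p n T (inA a \<otimes>\<^bsub>T\<^esub> tin \<one>\<^bsub>A\<^esub> c) (inA a \<otimes>\<^bsub>T\<^esub> tin \<one>\<^bsub>A\<^esub> c')"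
    using assms(1) by (intro TP.T.pcong_mult) auto
  then show ?thesis using assms(1) c TP.tin_split[of a c] TP.tin_split[of a c'] by simp
qed

text \<open>The second factor of a pure tensor is expanded in powers of \<open>tK m\<close> with
  coefficients in \<open>R\<close>, modulo \<open>p^n\<close>, and these coefficients are moved to
  the first factor. As all large \<open>m\<close> are allowed, both summands of a sum can be
  expanded at the same level.\<close>

lemma T_hs:
  assumes "x \<in> carrier T"
  shows "\<exists>M. \<forall>m\<ge>M. \<exists>u. (\<forall>i. u i \<in> carrier A) \<and> pcong p n T x (hs T (tT m) (\<lambda>i. inA (u i)) (p ^ m))"
  using assms
proof (induction rule: TP.T_induct)
  case (gen a c)
  obtain M where M: "\<And>m. m \<ge> M \<Longrightarrow> \<exists>u. (\<forall>i. u i \<in> R) \<and> pcong p n Kc c (hs Kc (tK m) (\<lambda>i. inK (u i)) (p ^ m))"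
    using Kc_hs[OF gen(2)] by blast
  show ?case
  proof (intro exI[of _ M] allI impI)
    fix m assume "M \<le> m"
    then obtain u where u: "\<And>i. u i \<in> R" "pcong p n Kc c (hs Kc (tK m) (\<lambda>i. inK (u i)) (p ^ m))" using M by blast
    have "tin a (hs Kc (tK m) (\<lambda>i. inK (u i)) k) = hs T (tT m) (\<lambda>i. inA (u i \<odot>\<^bsub>A\<^esub> a)) k" for k
    proof (induction k)
      case 0
      have "tin a \<zero>\<^bsub>Kc\<^esub> = inA a \<otimes>\<^bsub>T\<^esub> tin \<one>\<^bsub>A\<^esub> \<zero>\<^bsub>Kc\<^esub>" using gen by (intro TP.tin_split) auto
      then show ?case using gen ring_hom_zero'[OF Kc.is_cring TP.T_cring TP.tin_hom2] by simp
    next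
      case (Suc k)
      have "tin a (inK (u k) \<otimes>\<^bsub>Kc\<^esub> tK m [^]\<^bsub>Kc\<^esub> k) = tin (u k \<odot>\<^bsub>A\<^esub> a) (tK m [^]\<^bsub>Kc\<^esub> k)"
        using TP.tin_smult[of "u k" a "tK m [^]\<^bsub>Kc\<^esub> k"] gen u(1) by (simp add: Kc_smult)
      also have "\<dots> = inA (u k \<odot>\<^bsub>A\<^esub> a) \<otimes>\<^bsub>T\<^esub> tT m [^]\<^bsub>T\<^esub> k"
        using gen u(1) by (simp add: tT_pow TP.tin_mult)
      finally show ?case using Suc gen u(1) R_S by (simp add: TP.tin_add2)
    qed
    then have "pcong p n T (tin a c) (hs T (tT m) (\<lambda>i. inA (u i \<odot>\<^bsub>A\<^esub> a)) (p ^ m))"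
      using tin_pcong[OF gen(1) u(2)] by simp
    then show "\<exists>u. (\<forall>i. u i \<in> carrier A) \<and> pcong p n T (tin a c) (hs T (tT m) (\<lambda>i. inA (u i)) (p ^ m))"
      using gen u(1) by (intro exI[of _ "\<lambda>i. u i \<odot>\<^bsub>A\<^esub> a"]) simp
  qed
next
  case (add x y)
  obtain M M' where M: "\<And>m. m \<ge> M \<Longrightarrow> \<exists>u. (\<forall>i. u i \<in> carrier A) \<and> pcong p n T x (hs T (tT m) (\<lambda>i. inA (u i)) (p ^ m))"
    and M': "\<And>m. m \<ge> M' \<Longrightarrow> \<exists>u. (\<forall>i. u i \<in> carrier A) \<and> pcong p n T y (hs T (tT m) (\<lambda>i. inA (u i)) (p ^ m))"
    using add by blast
  show ?case
  proof (intro exI[of _ "max M M'"] allI impI)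
    fix m assume "max M M' \<le> m"
    then obtain u v where u: "\<And>i. u i \<in> carrier A" "pcong p n T x (hs T (tT m) (\<lambda>i. inA (u i)) (p ^ m))"
      and v: "\<And>i. v i \<in> carrier A" "pcong p n T y (hs T (tT m) (\<lambda>i. inA (v i)) (p ^ m))"
      using M[of m] M'[of m] by auto
    have "hs T (tT m) (\<lambda>i. inA (u i \<oplus>\<^bsub>A\<^esub> v i)) (p ^ m) =
        hs T (tT m) (\<lambda>i. inA (u i)) (p ^ m) \<oplus>\<^bsub>T\<^esub> hs T (tT m) (\<lambda>i. inA (v i)) (p ^ m)"
      using u(1) v(1) TP.T.hs_add[of "tT m" "\<lambda>i. inA (u i)" "\<lambda>i. inA (v i)" "p ^ m"] by (simp add: TP.tin_add1)
    then show "\<exists>u. (\<forall>i. u i \<in> carrier A) \<and> pcong p n T (x \<oplus>\<^bsub>T\<^esub> y) (hs T (tT m) (\<lambda>i. inA (u i)) (p ^ m))"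
      using TP.T.pcong_add[OF u(2) v(2)] u(1) v(1) by (intro exI[of _ "\<lambda>i. u i \<oplus>\<^bsub>A\<^esub> v i"]) simp
  qed
qed

text \<open>Since the coefficient functional \<open>e0\<close> is \<open>R\<close>-linear, it extends to the tensor product modulo each
  power of \<open>p\<close>.\<close>

lemma T_functional:
  obtains h where "\<And>x. x \<in> carrier T \<Longrightarrow> h x \<in> carrier (A Quot p_ideal p n A)"
    "\<And>x y. x \<in> carrier T \<Longrightarrow> y \<in> carrier T \<Longrightarrow> h (x \<oplus>\<^bsub>T\<^esub> y) = h x \<oplus>\<^bsub>A Quot p_ideal p n A\<^esub> h y"
    "\<And>a c s. a \<in> carrier A \<Longrightarrow> s \<in> carrier S \<Longrightarrow> pcong p n Kc c (inK s) \<Longrightarrow>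
      h (tin a c) = p_ideal p n A +>\<^bsub>A\<^esub> (e0 s \<odot>\<^bsub>A\<^esub> a)"
proof -
  let ?I = "p_ideal p n A" let ?Q = "A Quot ?I"
  note I = A.p_ideal_ideal[of p n]
  interpret Q: cring ?Q by (rule ideal.quotient_is_cring[OF I A_cring])
  \<comment> \<open>A chosen approximation of \<open>c\<close> in \<open>S\<close> modulo
    \<open>p^n\<close>. Changing \<open>s\<close> by \<open>\<pi>^n z\<close> changes
    \<open>e0 s\<close> by \<open>\<pi>^n e0 z\<close>, so the class of
    \<open>e0 (sc c) \<odot> a\<close> is independent of the choice. This independence makes
    \<open>\<beta>\<close> additive in \<open>c\<close> and balanced.\<close>
  define sc where "sc c = (SOME s. s \<in> carrier S \<and> pcong p n Kc c (inK s))" for c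
  have sc: "sc c \<in> carrier S" "pcong p n Kc c (inK (sc c))" if "c \<in> carrier Kc" for c
    using someI_ex[of "\<lambda>s. s \<in> carrier S \<and> pcong p n Kc c (inK s)"] inK_dense[OF that, of n] unfolding sc_def by blast+
  define \<beta> where "\<beta> a c = ?I +>\<^bsub>A\<^esub> (e0 (sc c) \<odot>\<^bsub>A\<^esub> a)" for a c
  have e0c: "e0 s \<odot>\<^bsub>A\<^esub> a \<in> carrier A" if "s \<in> carrier S" "a \<in> carrier A" for s a
    using e0_decomp(1)[OF that(1)] that(2) by simp
  have \<beta>: "\<beta> a c = ?I +>\<^bsub>A\<^esub> (e0 s \<odot>\<^bsub>A\<^esub> a)"
    if a: "a \<in> carrier A" and s: "s \<in> carrier S" and cs: "pcong p n Kc c (inK s)" for a c s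
  proof -
    have c: "c \<in> carrier Kc" using cs by (simp add: pcong_def)
    have "pcong p n Kc (inK (sc c)) (inK s)" using sc[OF c] cs Kc.pcong_sym Kc.pcong_trans by blast
    then have "pcong p n S (sc c) s" using inK_pcong_iff sc(1)[OF c] s by blast
    then obtain z where z: "z \<in> carrier S" "sc c = s \<oplus>\<^bsub>L\<^esub> \<pi> [^]\<^bsub>L\<^esub> n \<otimes>\<^bsub>L\<^esub> z" by (auto simp: S.pcong_iff)
    have "\<pi> [^]\<^bsub>L\<^esub> n \<otimes>\<^bsub>L\<^esub> z \<in> carrier S" using S.m_closed[OF R_S[OF \<pi>_pow_R] z(1)] by simp
    then have "e0 (sc c) = e0 s \<oplus>\<^bsub>L\<^esub> \<pi> [^]\<^bsub>L\<^esub> n \<otimes>\<^bsub>L\<^esub> e0 z"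
      unfolding z(2) using z(1) s by (simp add: e0_add e0_smult \<pi>_pow_R)
    moreover have r: "e0 s \<in> R" "e0 z \<in> R" using e0_decomp(1) s z(1) by auto
    ultimately have "e0 (sc c) \<odot>\<^bsub>A\<^esub> a = e0 s \<odot>\<^bsub>A\<^esub> a \<oplus>\<^bsub>A\<^esub> \<pi> [^]\<^bsub>L\<^esub> n \<odot>\<^bsub>A\<^esub> (e0 z \<odot>\<^bsub>A\<^esub> a)"
      using A.smult_l_distr[of "e0 s" "\<pi> [^]\<^bsub>L\<^esub> n \<otimes>\<^bsub>L\<^esub> e0 z" a] A.smult_assoc1[of "\<pi> [^]\<^bsub>L\<^esub> n" "e0 z" a]
        a \<pi>_pow_R R_closed(4) by simp
    moreover have "\<pi> [^]\<^bsub>L\<^esub> n \<odot>\<^bsub>A\<^esub> (e0 z \<odot>\<^bsub>A\<^esub> a) = p_elem p A [^]\<^bsub>A\<^esub> n \<otimes>\<^bsub>A\<^esub> (e0 z \<odot>\<^bsub>A\<^esub> a)"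
      using smult_emb[OF \<pi>_pow_R, of "e0 z \<odot>\<^bsub>A\<^esub> a" n] ring_hom_pow[OF RR.is_cring A_cring emb_hom, of \<pi> n] r a \<pi>_R
      unfolding pow_sub emb_p by simp
    ultimately have "pcong p n A (e0 (sc c) \<odot>\<^bsub>A\<^esub> a) (e0 s \<odot>\<^bsub>A\<^esub> a)"
      unfolding A.pcong_iff using r a by auto
    then show ?thesis unfolding \<beta>_def using A.p_coset_eq_iff e0c sc(1)[OF c] s a by blast
  qed
  obtain h where h: "\<And>x. x \<in> carrier T \<Longrightarrow> h x \<in> carrier ?Q"
    "\<And>x y. x \<in> carrier T \<Longrightarrow> y \<in> carrier T \<Longrightarrow> h (x \<oplus>\<^bsub>T\<^esub> y) = h x \<oplus>\<^bsub>?Q\<^esub> h y"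
    "\<And>a c. a \<in> carrier A \<Longrightarrow> c \<in> carrier Kc \<Longrightarrow> h (tin a c) = \<beta> a c"
  proof (rule TP.T_universal[of ?Q \<beta>])
    show "abelian_group ?Q" by (rule Q.abelian_group_axioms)
    show "\<beta> a b \<in> carrier ?Q" if "a \<in> carrier A" "b \<in> carrier Kc" for a b
      unfolding \<beta>_def A.quot_carrier using e0c sc that by blast
    show "\<beta> (a \<oplus>\<^bsub>A\<^esub> a') b = \<beta> a b \<oplus>\<^bsub>?Q\<^esub> \<beta> a' b" if "a \<in> carrier A" "a' \<in> carrier A" "b \<in> carrier Kc" for a a' b
      unfolding \<beta>_def using that e0c sc e0_decomp(1)[OF sc(1)] by (simp add: A.quot_add[OF I] A.smult_r_distr)
    show "\<beta> a (b \<oplus>\<^bsub>Kc\<^esub> b') = \<beta> a b \<oplus>\<^bsub>?Q\<^esub> \<beta> a b'" if ab: "a \<in> carrier A" "b \<in> carrier Kc" "b' \<in> carrier Kc" for a b b'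
    proof -
      have s: "sc b \<in> carrier S" "sc b' \<in> carrier S" "sc b \<oplus>\<^bsub>L\<^esub> sc b' \<in> carrier S"
        using sc ab S.a_closed[of "sc b" "sc b'"] by auto
      have "pcong p n Kc (b \<oplus>\<^bsub>Kc\<^esub> b') (inK (sc b \<oplus>\<^bsub>L\<^esub> sc b'))"
        unfolding inK_add[OF s(1,2)] using sc ab by (intro Kc.pcong_add) auto
      then have "\<beta> a (b \<oplus>\<^bsub>Kc\<^esub> b') = ?I +>\<^bsub>A\<^esub> (e0 (sc b \<oplus>\<^bsub>L\<^esub> sc b') \<odot>\<^bsub>A\<^esub> a)" using \<beta> ab s by blast
      then show ?thesis unfolding \<beta>_def using ab s e0_decomp(1)
        by (simp add: e0_add A.smult_l_distr[simplified] A.quot_add[OF I] e0c)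
    qed
    show "\<beta> (r \<odot>\<^bsub>A\<^esub> a) b = \<beta> a (r \<odot>\<^bsub>Kc\<^esub> b)" if "r \<in> carrier RR" "a \<in> carrier A" "b \<in> carrier Kc" for r a b
    proof -
      have s: "r \<in> R" "sc b \<in> carrier S" "r \<otimes>\<^bsub>L\<^esub> sc b \<in> carrier S"
        using sc that S.m_closed[OF R_S, of r "sc b"] by auto
      have "pcong p n Kc (r \<odot>\<^bsub>Kc\<^esub> b) (inK (r \<otimes>\<^bsub>L\<^esub> sc b))"
        unfolding Kc_smult inK_mult[OF R_S[OF s(1)] s(2)] using sc that R_S[OF s(1)] by (intro Kc.pcong_mult) auto
      then have "\<beta> a (r \<odot>\<^bsub>Kc\<^esub> b) = ?I +>\<^bsub>A\<^esub> (e0 (r \<otimes>\<^bsub>L\<^esub> sc b) \<odot>\<^bsub>A\<^esub> a)" using \<beta> that s by blast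
      also have "e0 (r \<otimes>\<^bsub>L\<^esub> sc b) \<odot>\<^bsub>A\<^esub> a = e0 (sc b) \<odot>\<^bsub>A\<^esub> (r \<odot>\<^bsub>A\<^esub> a)"
        using s that e0_decomp(1)[OF s(2)] A.smult_assoc1[of "e0 (sc b)" r a] RR.m_comm[of r "e0 (sc b)"] by (simp add: e0_smult)
      finally show ?thesis by (simp add: \<beta>_def)
    qed
  qed blast
  show ?thesis
  proof (rule that[OF h(1,2)])
    fix a c s assume *: "a \<in> carrier A" "s \<in> carrier S" "pcong p n Kc c (inK s)"
    then have "c \<in> carrier Kc" by (simp add: pcong_def)
    then show "h (tin a c) = ?I +>\<^bsub>A\<^esub> (e0 s \<odot>\<^bsub>A\<^esub> a)" using h(3) \<beta> * by simp
  qed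
qed

end

section \<open>Completed direct limits\<close>

text \<open>Successive approximation: if \<open>x = G y + p^n z\<close> and \<open>z\<close> agrees
  with \<open>G v\<close> modulo \<open>p\<close>, then \<open>y + p^n v\<close> is correct modulo
  \<open>p^(n+1)\<close> and congruent to \<open>y\<close> modulo \<open>p^n\<close>. The resulting
  sequence is coherent, and its limit is a preimage.\<close>

lemma complete_surj:
  assumes "complete_ring C p" "complete_ring D p" and G: "G \<in> ring_hom C D"
    and mod: "\<And>x. x \<in> carrier D \<Longrightarrow> \<exists>y\<in>carrier C. pcong p 1 D x (G y)"
  shows "G ` carrier C = carrier D"
proof -
  interpret C: complete_ring C p by fact
  interpret D: complete_ring D p by fact
  note Gc = ring_hom_closed[OF G]
  have "x \<in> G ` carrier C" if x: "x \<in> carrier D" for x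
  proof -
    have step: "\<exists>y'\<in>carrier C. pcong p n C y' y \<and> pcong p (Suc n) D x (G y')"
      if y: "y \<in> carrier C" "pcong p n D x (G y)" for n y
    proof -
      obtain z where z: "z \<in> carrier D" "x = G y \<oplus>\<^bsub>D\<^esub> p_elem p D [^]\<^bsub>D\<^esub> n \<otimes>\<^bsub>D\<^esub> z" using y(2) by (auto simp: D.pcong_iff)
      obtain v where v: "v \<in> carrier C" "pcong p 1 D z (G v)" using mod[OF z(1)] by blast
      obtain e where e: "e \<in> carrier D" "z = G v \<oplus>\<^bsub>D\<^esub> p_elem p D \<otimes>\<^bsub>D\<^esub> e" using v(2) by (auto simp: D.pcong_iff)
      define y' where "y' = y \<oplus>\<^bsub>C\<^esub> p_elem p C [^]\<^bsub>C\<^esub> n \<otimes>\<^bsub>C\<^esub> v"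
      have y': "y' \<in> carrier C" "pcong p n C y' y" using y(1) v(1) by (auto simp: y'_def C.pcong_iff)
      have Gy': "G y' = G y \<oplus>\<^bsub>D\<^esub> p_elem p D [^]\<^bsub>D\<^esub> n \<otimes>\<^bsub>D\<^esub> G v"
        using y(1) v(1) by (simp add: y'_def ring_hom_add[OF G] ring_hom_mult[OF G]
          ring_hom_pow[OF C.is_cring D.is_cring G] ring_hom_p_elem[OF C.is_cring D.is_cring G])
      have "x = G y' \<oplus>\<^bsub>D\<^esub> p_elem p D [^]\<^bsub>D\<^esub> Suc n \<otimes>\<^bsub>D\<^esub> e"
        unfolding z(2) e(2) Gy' using e(1) y(1) v(1) Gc by (simp add: D.r_distr D.m_assoc D.a_assoc)
      then show ?thesis using y' e(1) Gc unfolding D.pcong_iff by blast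
    qed
    define nx where "nx n y = (SOME y'. y' \<in> carrier C \<and> pcong p n C y' y \<and> pcong p (Suc n) D x (G y'))" for n y
    define s where "s = rec_nat \<zero>\<^bsub>C\<^esub> nx"
    have nx: "nx n y \<in> carrier C \<and> pcong p n C (nx n y) y \<and> pcong p (Suc n) D x (G (nx n y))"
      if "y \<in> carrier C" "pcong p n D x (G y)" for n y
      unfolding nx_def by (rule someI_ex) (use step[OF that] in blast)
    have s: "s n \<in> carrier C \<and> pcong p n D x (G (s n))" for n
    proof (induction n)
      case 0
      then show ?case using x Gc by (simp add: s_def pcong_def)
    next
      case (Suc n)
      then show ?case using nx[of "s n" n] by (simp add: s_def)
    qed
    have "pcong p n C (s (Suc n)) (s n)" for n using nx[of "s n" n] s[of n] by (simp add: s_def)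
    then have "pcoh p C s" using s by (simp add: pcoh_def)
    then obtain l where l: "l \<in> carrier C" "\<And>n. pcong p n C l (s n)" using C.lim by blast
    have "x = G l"
    proof (rule D.sep_eq[OF x Gc[OF l(1)]])
      fix n
      have "pcong p n D (G l) (G (s n))" by (rule ring_hom_pcong[OF C.is_cring D.is_cring G l(2)])
      then show "pcong p n D x (G l)" using s[of n] D.pcong_trans D.pcong_sym by blast
    qed
    then show ?thesis using l(1) by blast
  qed
  then show ?thesis using Gc by blast
qed

text \<open>What is used of a completed limit of copies of \<open>T\<close>, detached from its
  construction: the images of the copies are together dense, and \<open>p^n\<close> divides the
  image of \<open>\<tau>\<close> exactly when it divides some iterate of \<open>\<Phi>\<close> at
  \<open>\<tau>\<close>. The right-hand side of this criterion does not mention \<open>C\<close>,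
  which makes two such rings comparable.\<close>

locale lim_ring = T: cring T + C: complete_ring C p
  for T :: "('t, 'm) ring_scheme" and C :: "('c, 'n) ring_scheme" and p +
  fixes \<Phi> :: "'t \<Rightarrow> 't" and i :: "nat \<Rightarrow> 't \<Rightarrow> 'c"
  assumes i_hom: "i m \<in> ring_hom T C"
    and i_dense: "x \<in> carrier C \<Longrightarrow> \<exists>m. \<exists>\<tau>\<in>carrier T. pcong p n C x (i m \<tau>)"
    and i_iff: "\<tau> \<in> carrier T \<Longrightarrow> i m \<tau> \<in> p_ideal p n C \<longleftrightarrow> (\<exists>k. (\<Phi> ^^ k) \<tau> \<in> p_ideal p n T)"

lemma lim_hom_surj:
  assumes "lim_ring T C p \<Phi> i" "lim_ring T' C' p \<Phi>' i'" "G \<in> ring_hom C C'"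
    and "\<And>m \<tau>. \<tau> \<in> carrier T \<Longrightarrow> G (i m \<tau>) = i' m (f \<tau>)" "f ` carrier T = carrier T'"
  shows "G ` carrier C = carrier C'"
proof -
  interpret X: lim_ring T C p \<Phi> i by fact
  interpret Y: lim_ring T' C' p \<Phi>' i' by fact
  show ?thesis
  proof (rule complete_surj[OF X.C.complete_ring_axioms Y.C.complete_ring_axioms assms(3)])
    fix x assume "x \<in> carrier C'"
    then obtain m \<tau> where \<tau>: "\<tau> \<in> carrier T'" "pcong p 1 C' x (i' m \<tau>)" using Y.i_dense by blast
    then obtain \<sigma> where \<sigma>: "\<sigma> \<in> carrier T" "\<tau> = f \<sigma>" using assms(5) by blast
    then have "pcong p 1 C' x (G (i m \<sigma>))" using \<tau> assms(4) by simp
    then show "\<exists>y\<in>carrier C. pcong p 1 C' x (G y)" using ring_hom_closed[OF X.i_hom \<sigma>(1)] by blast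
  qed
qed

text \<open>An element of the kernel is approximated modulo \<open>p^n\<close> by some
  \<open>i m \<tau>\<close>, and \<open>i' m \<tau>\<close> is then divisible by \<open>p^n\<close>.
  Both divisibilities are governed by the same condition on \<open>\<tau>\<close>, so the kernel is
  zero by separatedness.\<close>

lemma lim_hom_bij:
  assumes "lim_ring T C p \<Phi> i" "lim_ring T C' p \<Phi> i'" "G \<in> ring_hom C C'"
    and Gi: "\<And>m \<tau>. \<tau> \<in> carrier T \<Longrightarrow> G (i m \<tau>) = i' m \<tau>"
  shows "bij_betw G (carrier C) (carrier C')"
proof -
  interpret X: lim_ring T C p \<Phi> i by fact
  interpret Y: lim_ring T C' p \<Phi> i' by fact
  have zero: "x = \<zero>\<^bsub>C\<^esub>" if x: "x \<in> carrier C" "G x = \<zero>\<^bsub>C'\<^esub>" for x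
  proof (rule X.C.sep[OF x(1)])
    fix n
    obtain m \<tau> where \<tau>: "\<tau> \<in> carrier T" "pcong p n C x (i m \<tau>)" using X.i_dense x(1) by blast
    have "pcong p n C' \<zero>\<^bsub>C'\<^esub> (i' m \<tau>)"
      using ring_hom_pcong[OF X.C.is_cring Y.C.is_cring assms(3) \<tau>(2)] x(2) Gi[OF \<tau>(1)] by simp
    then have "i' m \<tau> \<in> p_ideal p n C'" using Y.C.pcong_sym Y.C.pcong_zero by blast
    then have "i m \<tau> \<in> p_ideal p n C" using X.i_iff[OF \<tau>(1)] Y.i_iff[OF \<tau>(1)] by blast
    then show "x \<in> p_ideal p n C" using X.C.pcong_p_ideal[OF \<tau>(2)] by blast
  qed
  have "inj_on G (carrier C)"
  proof (rule inj_onI)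
    fix x y assume xy: "x \<in> carrier C" "y \<in> carrier C" "G x = G y"
    then have "G (x \<ominus>\<^bsub>C\<^esub> y) = \<zero>\<^bsub>C'\<^esub>"
      using ring_hom_minus[OF X.C.is_cring Y.C.is_cring assms(3) xy(1,2)] ring_hom_closed[OF assms(3)] by simp
    then have "x \<ominus>\<^bsub>C\<^esub> y = \<zero>\<^bsub>C\<^esub>" using zero xy by simp
    then show "x = y" using xy by simp
  qed
  moreover have "G ` carrier C = carrier C'"
    by (rule lim_hom_surj[OF assms(1,2,3), where f = "\<lambda>x. x"]) (simp_all add: Gi)
  ultimately show ?thesis by (simp add: bij_betw_def)
qed

lemma lim_hom_unique:
  assumes "lim_ring T C p \<Phi> i" "complete_ring D p" "G \<in> ring_hom C D" "G' \<in> ring_hom C D"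
    and eq: "\<And>m \<tau>. \<tau> \<in> carrier T \<Longrightarrow> G (i m \<tau>) = G' (i m \<tau>)" and x: "x \<in> carrier C"
  shows "G x = G' x"
proof -
  interpret X: lim_ring T C p \<Phi> i by fact
  interpret D: complete_ring D p by fact
  show ?thesis
  proof (rule D.sep_eq)
    fix n
    obtain m \<tau> where \<tau>: "\<tau> \<in> carrier T" "pcong p n C x (i m \<tau>)" using X.i_dense x by blast
    have "pcong p n D (G x) (G (i m \<tau>))" "pcong p n D (G' x) (G (i m \<tau>))"
      using ring_hom_pcong[OF X.C.is_cring D.is_cring assms(3) \<tau>(2)]
        ring_hom_pcong[OF X.C.is_cring D.is_cring assms(4) \<tau>(2)] eq[OF \<tau>(1)] by simp_all
    then show "pcong p n D (G x) (G' x)" using D.pcong_trans D.pcong_sym by blast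
  qed (use ring_hom_closed[OF assms(3) x] ring_hom_closed[OF assms(4) x] in auto)
qed

lemma lim_ring_completion:
  assumes "ring_endo T \<Phi>"
  shows "lim_ring T (padic_completion p (dirlim T \<Phi>)) p \<Phi> (\<lambda>m \<tau>. padic_in p (dirlim T \<Phi>) (dirlim_in T \<Phi> m \<tau>))"
proof -
  interpret E: ring_endo T \<Phi> by fact
  interpret D: cring "dirlim T \<Phi>" by (rule E.dirlim_cring)
  interpret C: complete_ring "padic_completion p (dirlim T \<Phi>)" p by (rule D.completion_complete)
  show ?thesis
  proof unfold_locales
    show "(\<lambda>\<tau>. padic_in p (dirlim T \<Phi>) (E.dl m \<tau>)) \<in> ring_hom T (padic_completion p (dirlim T \<Phi>))" for m
      using ring_hom_trans[OF E.dl_hom D.padic_in_hom] by (simp add: comp_def)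
    show "\<exists>m. \<exists>\<tau>\<in>carrier T. pcong p n (padic_completion p (dirlim T \<Phi>)) x (padic_in p (dirlim T \<Phi>) (E.dl m \<tau>))"
      if x: "x \<in> carrier (padic_completion p (dirlim T \<Phi>))" for x n
    proof -
      obtain b where b: "b \<in> carrier (dirlim T \<Phi>)" "pcong p n (padic_completion p (dirlim T \<Phi>)) x (padic_in p (dirlim T \<Phi>) b)"
        using D.completion_dense[OF x, of n] by blast
      then show ?thesis using E.dirlim_carrier_iff[of b] by blast
    qed
    show "padic_in p (dirlim T \<Phi>) (E.dl m \<tau>) \<in> p_ideal p n (padic_completion p (dirlim T \<Phi>)) \<longleftrightarrow>
        (\<exists>k. (\<Phi> ^^ k) \<tau> \<in> p_ideal p n T)" if "\<tau> \<in> carrier T" for m \<tau> n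
      using that by (simp add: D.padic_in_p_ideal_iff E.dl_p_ideal_iff)
  qed
qed

lemma padic_map_endo:
  assumes "ring_endo T \<Phi>"
  shows "ring_endo (padic_completion p T) (padic_map p T \<Phi>)"
proof -
  interpret E: ring_endo T \<Phi> by fact
  show ?thesis
    using E.completion_cring padic_map_hom[OF E.is_cring E.is_cring E.endo]
    by (simp add: ring_endo_def ring_endo_axioms_def)
qed

lemma padic_map_pow_in:
  assumes "ring_endo T \<Phi>" "\<tau> \<in> carrier T"
  shows "(padic_map p T \<Phi> ^^ k) (padic_in p T \<tau>) = padic_in p T ((\<Phi> ^^ k) \<tau>)"
proof -
  interpret E: ring_endo T \<Phi> by fact
  show ?thesis
    by (induction k) (simp_all add: padic_map_in[OF E.is_cring E.is_cring E.endo] assms(2))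
qed

text \<open>Completing the copies first preserves both properties: every element of a completed copy
  is congruent to one of \<open>T\<close> modulo \<open>p^n\<close>, and \<open>padic_in\<close>
  reflects divisibility by \<open>p^n\<close>.\<close>

lemma lim_ring_completion2:
  assumes "ring_endo T \<Phi>"
  shows "lim_ring T (padic_completion p (dirlim (padic_completion p T) (padic_map p T \<Phi>))) p \<Phi>
    (\<lambda>m \<tau>. padic_in p (dirlim (padic_completion p T) (padic_map p T \<Phi>))
      (dirlim_in (padic_completion p T) (padic_map p T \<Phi>) m (padic_in p T \<tau>)))"
    (is "lim_ring T ?C p \<Phi> ?i")
proof -
  interpret E: ring_endo T \<Phi> by fact
  let ?B = "dirlim (padic_completion p T) (padic_map p T \<Phi>)"
  let ?i' = "\<lambda>m \<tau>. padic_in p ?B (dirlim_in (padic_completion p T) (padic_map p T \<Phi>) m \<tau>)"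
  interpret L: lim_ring "padic_completion p T" ?C p "padic_map p T \<Phi>" ?i'
    by (rule lim_ring_completion[OF padic_map_endo[OF assms]])
  show ?thesis
  proof unfold_locales
    show "?i m \<in> ring_hom T ?C" for m
      using ring_hom_trans[OF E.padic_in_hom[of p] L.i_hom[of m]] by (simp add: comp_def)
    show "\<exists>m. \<exists>\<tau>\<in>carrier T. pcong p n ?C x (?i m \<tau>)" if x: "x \<in> carrier ?C" for x n
    proof -
      obtain m y where y: "y \<in> carrier (padic_completion p T)" "pcong p n ?C x (?i' m y)" using L.i_dense[OF x] by blast
      obtain \<tau> where \<tau>: "\<tau> \<in> carrier T" "pcong p n (padic_completion p T) y (padic_in p T \<tau>)"
        using E.completion_dense[OF y(1)] by blast
      have "pcong p n ?C (?i' m y) (?i m \<tau>)"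
        by (rule ring_hom_pcong[OF E.completion_cring L.C.is_cring L.i_hom \<tau>(2)])
      then show ?thesis using L.C.pcong_trans[OF y(2)] \<tau>(1) by blast
    qed
    show "?i m \<tau> \<in> p_ideal p n ?C \<longleftrightarrow> (\<exists>k. (\<Phi> ^^ k) \<tau> \<in> p_ideal p n T)" if "\<tau> \<in> carrier T" for m \<tau> n
      using L.i_iff[of "padic_in p T \<tau>" m n] that ring_hom_closed[OF E.padic_in_hom that]
      by (simp add: padic_map_pow_in[OF assms] E.padic_in_p_ideal_iff)
  qed
qed

section \<open>Detection of divisibility in the tensor product\<close>

context base_alg
begin

text \<open>In \<open>p^n\<close> times a pure tensor \<open>a \<otimes> c\<close>, the factor
  \<open>p^n\<close> can be moved to \<open>c\<close>. Then \<open>p^n c\<close> is approximated by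
  \<open>0\<close> in \<open>S\<close>, where \<open>e0\<close> vanishes.\<close>

lemma functional_zero:
  assumes cl: "\<And>x. x \<in> carrier T \<Longrightarrow> h x \<in> carrier (A Quot p_ideal p n A)"
    and add: "\<And>x y. x \<in> carrier T \<Longrightarrow> y \<in> carrier T \<Longrightarrow> h (x \<oplus>\<^bsub>T\<^esub> y) = h x \<oplus>\<^bsub>A Quot p_ideal p n A\<^esub> h y"
    and h: "\<And>a c s. a \<in> carrier A \<Longrightarrow> s \<in> carrier S \<Longrightarrow> pcong p n Kc c (inK s) \<Longrightarrow>
      h (tin a c) = p_ideal p n A +>\<^bsub>A\<^esub> (e0 s \<odot>\<^bsub>A\<^esub> a)"
    and x: "x \<in> p_ideal p n T"
  shows "h x = p_ideal p n A +>\<^bsub>A\<^esub> \<zero>\<^bsub>A\<^esub>"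
proof -
  let ?q = "p_elem p T [^]\<^bsub>T\<^esub> n"
  have qe: "?q = tin \<one>\<^bsub>A\<^esub> (p_elem p Kc [^]\<^bsub>Kc\<^esub> n)" unfolding p_elem_T(2) tT_pow by (simp add: Kr.t_0)
  obtain y where y: "y \<in> carrier T" "x = ?q \<otimes>\<^bsub>T\<^esub> y" using x by (rule TP.T.p_idealE)
  have "h (?q \<otimes>\<^bsub>T\<^esub> y) = p_ideal p n A +>\<^bsub>A\<^esub> \<zero>\<^bsub>A\<^esub>" using y(1)
  proof (induction rule: TP.T_induct)
    case (gen a c)
    have "p_elem p Kc [^]\<^bsub>Kc\<^esub> n \<otimes>\<^bsub>Kc\<^esub> c \<in> p_ideal p n Kc" by (rule Kc.p_idealI[OF gen(2)])
    then have "pcong p n Kc (p_elem p Kc [^]\<^bsub>Kc\<^esub> n \<otimes>\<^bsub>Kc\<^esub> c) (inK \<zero>\<^bsub>L\<^esub>)"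
      using ring_hom_zero'[OF S.is_cring Kc.is_cring inK_hom] by (simp add: Kc.pcong_zero)
    then have "h (tin a (p_elem p Kc [^]\<^bsub>Kc\<^esub> n \<otimes>\<^bsub>Kc\<^esub> c)) = p_ideal p n A +>\<^bsub>A\<^esub> (e0 \<zero>\<^bsub>L\<^esub> \<odot>\<^bsub>A\<^esub> a)"
      using h[OF gen(1) R_S[OF R_closed(1)]] by blast
    then show ?case unfolding qe using gen e0_R[OF R_closed(1)] A.smult_l_null[OF gen(1)] by (simp add: TP.tin_mult)
  next
    case (add x y)
    have "h (?q \<otimes>\<^bsub>T\<^esub> (x \<oplus>\<^bsub>T\<^esub> y)) = h (?q \<otimes>\<^bsub>T\<^esub> x) \<oplus>\<^bsub>A Quot p_ideal p n A\<^esub> h (?q \<otimes>\<^bsub>T\<^esub> y)"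
      using add(1,2) by (simp add: TP.T.r_distr assms(2))
    then show ?case unfolding add(3,4) using A.quot_add[OF A.p_ideal_ideal, of "\<zero>\<^bsub>A\<^esub>" "\<zero>\<^bsub>A\<^esub>" p n] by simp
  qed
  then show ?thesis using y(2) by simp
qed

text \<open>The functional modulo \<open>p\<close> takes \<open>a \<otimes> 1\<close> to the class
  of \<open>a\<close>. On multiples of \<open>tT l\<close> it vanishes by \<open>e0_w_mult\<close>,
  and on multiples of \<open>p\<close> by \<open>functional_zero\<close>.\<close>

lemma T_detect:
  assumes a: "a \<in> carrier A" and z: "z \<in> carrier T" and c: "pcong p 1 T (inA a) (tT l \<otimes>\<^bsub>T\<^esub> z)"
  shows "a \<in> p_ideal p 1 A"
proof -
  let ?I = "p_ideal p 1 A"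
  note I = A.p_ideal_ideal[of p 1]
  obtain h where h1: "\<And>x. x \<in> carrier T \<Longrightarrow> h x \<in> carrier (A Quot ?I)"
    and h2: "\<And>x y. x \<in> carrier T \<Longrightarrow> y \<in> carrier T \<Longrightarrow> h (x \<oplus>\<^bsub>T\<^esub> y) = h x \<oplus>\<^bsub>A Quot ?I\<^esub> h y"
    and h3: "\<And>a c s. a \<in> carrier A \<Longrightarrow> s \<in> carrier S \<Longrightarrow> pcong p 1 Kc c (inK s) \<Longrightarrow> h (tin a c) = ?I +>\<^bsub>A\<^esub> (e0 s \<odot>\<^bsub>A\<^esub> a)"
    using T_functional[of 1] by blast
  have hz: "h (tT l \<otimes>\<^bsub>T\<^esub> z) = ?I +>\<^bsub>A\<^esub> \<zero>\<^bsub>A\<^esub>" using z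
  proof (induction rule: TP.T_induct)
    case (gen b c)
    obtain s where s: "s \<in> carrier S" "pcong p 1 Kc c (inK s)" using inK_dense gen(2) by blast
    have ws: "w l \<otimes>\<^bsub>L\<^esub> s \<in> carrier S" using S.m_closed[OF w_S s(1)] by simp
    have "pcong p 1 Kc (tK l \<otimes>\<^bsub>Kc\<^esub> c) (inK (w l \<otimes>\<^bsub>L\<^esub> s))"
      unfolding inK_mult[OF w_S s(1)] tK_eq using s w_S by (intro Kc.pcong_mult) auto
    then have e: "h (tin b (tK l \<otimes>\<^bsub>Kc\<^esub> c)) = ?I +>\<^bsub>A\<^esub> (e0 (w l \<otimes>\<^bsub>L\<^esub> s) \<odot>\<^bsub>A\<^esub> b)" using h3[OF gen(1) ws] by blast
    obtain r where r: "r \<in> R" "e0 (w l \<otimes>\<^bsub>L\<^esub> s) = \<pi> \<otimes>\<^bsub>L\<^esub> r"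
      using e0_w_mult[OF s(1), of l] unfolding sub_p_ideal_iff[OF R_subring] by auto
    have "e0 (w l \<otimes>\<^bsub>L\<^esub> s) \<odot>\<^bsub>A\<^esub> b = p_elem p A \<otimes>\<^bsub>A\<^esub> (r \<odot>\<^bsub>A\<^esub> b)"
      using A.smult_assoc1[of \<pi> r b] smult_emb[OF \<pi>_R, of "r \<odot>\<^bsub>A\<^esub> b"] r gen \<pi>_R by (simp add: emb_p)
    then have "e0 (w l \<otimes>\<^bsub>L\<^esub> s) \<odot>\<^bsub>A\<^esub> b \<in> ?I" using r gen A.p_idealI[of "r \<odot>\<^bsub>A\<^esub> b" p 1] by simp
    then have "?I +>\<^bsub>A\<^esub> (e0 (w l \<otimes>\<^bsub>L\<^esub> s) \<odot>\<^bsub>A\<^esub> b) = ?I +>\<^bsub>A\<^esub> \<zero>\<^bsub>A\<^esub>"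
      using A.p_coset_eq_iff[OF A.p_ideal_carrier A.zero_closed] A.pcong_zero by blast
    then show ?case using e gen by (simp add: TP.tin_mult)
  next
    case (add x y)
    have "h (tT l \<otimes>\<^bsub>T\<^esub> (x \<oplus>\<^bsub>T\<^esub> y)) = h (tT l \<otimes>\<^bsub>T\<^esub> x) \<oplus>\<^bsub>A Quot ?I\<^esub> h (tT l \<otimes>\<^bsub>T\<^esub> y)"
      using add(1,2) by (simp add: TP.T.r_distr h2)
    then show ?case unfolding add(3,4) using A.quot_add[OF I, of "\<zero>\<^bsub>A\<^esub>" "\<zero>\<^bsub>A\<^esub>"] by simp
  qed
  obtain y where y: "y \<in> carrier T" "inA a = tT l \<otimes>\<^bsub>T\<^esub> z \<oplus>\<^bsub>T\<^esub> p_elem p T \<otimes>\<^bsub>T\<^esub> y" using c by (auto simp: TP.T.pcong_iff)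
  have "p_elem p T \<otimes>\<^bsub>T\<^esub> y \<in> p_ideal p 1 T" using TP.T.p_idealI[OF y(1), of p 1] by simp
  from functional_zero[of h 1, OF h1 h2 h3 this] have hy: "h (p_elem p T \<otimes>\<^bsub>T\<^esub> y) = ?I +>\<^bsub>A\<^esub> \<zero>\<^bsub>A\<^esub>" .
  have "h (inA a) = (?I +>\<^bsub>A\<^esub> \<zero>\<^bsub>A\<^esub>) \<oplus>\<^bsub>A Quot ?I\<^esub> (?I +>\<^bsub>A\<^esub> \<zero>\<^bsub>A\<^esub>)"
    unfolding y(2) using y(1) z hz hy by (simp add: h2)
  also have "\<dots> = ?I +>\<^bsub>A\<^esub> \<zero>\<^bsub>A\<^esub>" using A.quot_add[OF I, of "\<zero>\<^bsub>A\<^esub>" "\<zero>\<^bsub>A\<^esub>"] by simp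
  finally have "h (inA a) = ?I +>\<^bsub>A\<^esub> \<zero>\<^bsub>A\<^esub>" .
  moreover have "h (inA a) = ?I +>\<^bsub>A\<^esub> a"
    using h3[OF a R_S[OF R_closed(2)], of "\<one>\<^bsub>Kc\<^esub>"] e0_R[OF R_closed(2)] a A.smult_one[OF a] by (simp add: inK_one)
  ultimately have "?I +>\<^bsub>A\<^esub> a = ?I +>\<^bsub>A\<^esub> \<zero>\<^bsub>A\<^esub>" by simp
  then show ?thesis using A.p_coset_eq_iff[OF a A.zero_closed] A.pcong_zero by blast
qed

text \<open>Multiplying by \<open>w\<^sup>N\<^sup>-\<^sup>j\<close> moves the coefficient of \<open>w\<^sup>j\<close> to that of \<open>w\<^sup>0\<close>, at the cost of a factor \<open>p\<close>.\<close>

lemma T_cancel: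
  assumes x: "x \<in> carrier T" and px: "p_elem p T \<otimes>\<^bsub>T\<^esub> x \<in> p_ideal p (Suc (Suc n)) T"
  shows "x \<in> p_ideal p n T"
proof -
  let ?n = "Suc (Suc n)"
  let ?I = "p_ideal p ?n A"
  note I = A.p_ideal_ideal[of p ?n]
  obtain m u where u: "\<And>i. u i \<in> carrier A" and xu: "pcong p ?n T x (hs T (tT m) (\<lambda>i. inA (u i)) (p ^ m))"
    using T_hs[OF x, of ?n] by blast
  let ?y = "hs T (tT m) (\<lambda>i. inA (u i))"
  have yc: "?y k \<in> carrier T" for k using u by (intro TP.T.hs_closed) auto
  obtain h where h1: "\<And>x. x \<in> carrier T \<Longrightarrow> h x \<in> carrier (A Quot ?I)"
    and h2: "\<And>x y. x \<in> carrier T \<Longrightarrow> y \<in> carrier T \<Longrightarrow> h (x \<oplus>\<^bsub>T\<^esub> y) = h x \<oplus>\<^bsub>A Quot ?I\<^esub> h y"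
    and h3: "\<And>a c s. a \<in> carrier A \<Longrightarrow> s \<in> carrier S \<Longrightarrow> pcong p ?n Kc c (inK s) \<Longrightarrow> h (tin a c) = ?I +>\<^bsub>A\<^esub> (e0 s \<odot>\<^bsub>A\<^esub> a)"
    using T_functional[of ?n] by blast
  have uI: "p_elem p A \<otimes>\<^bsub>A\<^esub> (p_elem p A \<otimes>\<^bsub>A\<^esub> u j) \<in> ?I" if j: "j < p ^ m" for j
  proof -
    define d where "d = p ^ m - j"
    have d: "0 < d" "d \<le> p ^ m" "\<And>k. d + k = p ^ m \<longleftrightarrow> k = j" using j by (auto simp: d_def)
    \<comment> \<open>The factor \<open>p\<close> in \<open>?q\<close> is the one supplied by the
      hypothesis on \<open>p x\<close>. A second factor \<open>p\<close> arises because the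
      exponents \<open>d\<close> and \<open>k\<close> add up to \<open>p^m\<close> for
      \<open>k = j\<close>; the other terms give zero. Hence \<open>p^2 u_j\<close> is divisible by
      \<open>p^(n+2)\<close>, and two cancellations in the torsion-free ring \<open>A\<close> leave
      \<open>p^n\<close>.\<close>
    let ?q = "inA (p_elem p A) \<otimes>\<^bsub>T\<^esub> tT m [^]\<^bsub>T\<^esub> d"
    have qc: "?q \<in> carrier T" by simp
    have qe: "?q = tin (p_elem p A) (tK m [^]\<^bsub>Kc\<^esub> d)" by (simp add: tT_pow TP.tin_mult)
    have one: "h (?q \<otimes>\<^bsub>T\<^esub> (inA (u k) \<otimes>\<^bsub>T\<^esub> tT m [^]\<^bsub>T\<^esub> k)) =
        ?I +>\<^bsub>A\<^esub> (if k = j then p_elem p A \<otimes>\<^bsub>A\<^esub> (p_elem p A \<otimes>\<^bsub>A\<^esub> u j) else \<zero>\<^bsub>A\<^esub>)" if k: "k < p ^ m" for k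
    proof -
      have "?q \<otimes>\<^bsub>T\<^esub> (inA (u k) \<otimes>\<^bsub>T\<^esub> tT m [^]\<^bsub>T\<^esub> k) = tin (p_elem p A \<otimes>\<^bsub>A\<^esub> u k) (inK (w m [^]\<^bsub>L\<^esub> d \<otimes>\<^bsub>L\<^esub> (\<one>\<^bsub>L\<^esub> \<otimes>\<^bsub>L\<^esub> w m [^]\<^bsub>L\<^esub> k)))"
      proof -
        have "tK m [^]\<^bsub>Kc\<^esub> d \<otimes>\<^bsub>Kc\<^esub> tK m [^]\<^bsub>Kc\<^esub> k = inK (w m [^]\<^bsub>L\<^esub> d \<otimes>\<^bsub>L\<^esub> (\<one>\<^bsub>L\<^esub> \<otimes>\<^bsub>L\<^esub> w m [^]\<^bsub>L\<^esub> k))"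
          using w_S w_pow_S by (simp add: tK_eq inK_mult inK_pow roots_in)
        then show ?thesis unfolding qe tT_pow using u by (simp add: TP.tin_mult)
      qed
      moreover have s: "w m [^]\<^bsub>L\<^esub> d \<otimes>\<^bsub>L\<^esub> (\<one>\<^bsub>L\<^esub> \<otimes>\<^bsub>L\<^esub> w m [^]\<^bsub>L\<^esub> k) \<in> carrier S"
        using S.m_closed[OF w_pow_S w_pow_S] by (simp add: roots_in)
      ultimately have "h (?q \<otimes>\<^bsub>T\<^esub> (inA (u k) \<otimes>\<^bsub>T\<^esub> tT m [^]\<^bsub>T\<^esub> k)) =
          ?I +>\<^bsub>A\<^esub> (e0 (w m [^]\<^bsub>L\<^esub> d \<otimes>\<^bsub>L\<^esub> (\<one>\<^bsub>L\<^esub> \<otimes>\<^bsub>L\<^esub> w m [^]\<^bsub>L\<^esub> k)) \<odot>\<^bsub>A\<^esub> (p_elem p A \<otimes>\<^bsub>A\<^esub> u k))"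
        using h3[OF _ s, of "p_elem p A \<otimes>\<^bsub>A\<^esub> u k"] u by simp
      also have "e0 (w m [^]\<^bsub>L\<^esub> d \<otimes>\<^bsub>L\<^esub> (\<one>\<^bsub>L\<^esub> \<otimes>\<^bsub>L\<^esub> w m [^]\<^bsub>L\<^esub> k)) = (if k = j then \<pi> else \<zero>\<^bsub>L\<^esub>)"
        unfolding e0_pow_pair[OF R_closed(2) d(2) k] using d(1) d(3)[of k] by simp
      also have "(if k = j then \<pi> else \<zero>\<^bsub>L\<^esub>) \<odot>\<^bsub>A\<^esub> (p_elem p A \<otimes>\<^bsub>A\<^esub> u k) =
          (if k = j then p_elem p A \<otimes>\<^bsub>A\<^esub> (p_elem p A \<otimes>\<^bsub>A\<^esub> u j) else \<zero>\<^bsub>A\<^esub>)"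
        using smult_emb[OF \<pi>_R, of "p_elem p A \<otimes>\<^bsub>A\<^esub> u j"] A.smult_l_null[of "p_elem p A \<otimes>\<^bsub>A\<^esub> u k"] u by (simp add: emb_p)
      finally show ?thesis .
    qed
    have "k \<le> p ^ m \<Longrightarrow> h (?q \<otimes>\<^bsub>T\<^esub> ?y k) =
        ?I +>\<^bsub>A\<^esub> (if j < k then p_elem p A \<otimes>\<^bsub>A\<^esub> (p_elem p A \<otimes>\<^bsub>A\<^esub> u j) else \<zero>\<^bsub>A\<^esub>)" for k
    proof (induction k)
      case 0
      then show ?case using functional_zero[of h ?n, OF h1 h2 h3 TP.T.p_ideal_zero] by simp
    next
      case (Suc k)
      have "h (?q \<otimes>\<^bsub>T\<^esub> ?y (Suc k)) = h (?q \<otimes>\<^bsub>T\<^esub> ?y k) \<oplus>\<^bsub>A Quot ?I\<^esub> h (?q \<otimes>\<^bsub>T\<^esub> (inA (u k) \<otimes>\<^bsub>T\<^esub> tT m [^]\<^bsub>T\<^esub> k))"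
        using qc yc u by (simp add: TP.T.r_distr h2)
      then show ?case using Suc one[of k] u by (simp add: A.quot_add[OF I] less_Suc_eq)
    qed
    from this[of "p ^ m"] have hq: "h (?q \<otimes>\<^bsub>T\<^esub> ?y (p ^ m)) = ?I +>\<^bsub>A\<^esub> (p_elem p A \<otimes>\<^bsub>A\<^esub> (p_elem p A \<otimes>\<^bsub>A\<^esub> u j))" using j by simp
    have "pcong p ?n T (p_elem p T \<otimes>\<^bsub>T\<^esub> x) (p_elem p T \<otimes>\<^bsub>T\<^esub> ?y (p ^ m))" using xu by (intro TP.T.pcong_mult) auto
    then have "p_elem p T \<otimes>\<^bsub>T\<^esub> ?y (p ^ m) \<in> p_ideal p ?n T" using px TP.T.pcong_p_ideal by blast
    then have "tT m [^]\<^bsub>T\<^esub> d \<otimes>\<^bsub>T\<^esub> (p_elem p T \<otimes>\<^bsub>T\<^esub> ?y (p ^ m)) \<in> p_ideal p ?n T" by (rule TP.T.p_ideal_mult) simp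
    moreover have "tT m [^]\<^bsub>T\<^esub> d \<otimes>\<^bsub>T\<^esub> (p_elem p T \<otimes>\<^bsub>T\<^esub> ?y (p ^ m)) = ?q \<otimes>\<^bsub>T\<^esub> ?y (p ^ m)"
      unfolding p_elem_T(1) using yc[of "p ^ m"] by (simp add: TP.T.m_ac)
    ultimately have "?q \<otimes>\<^bsub>T\<^esub> ?y (p ^ m) \<in> p_ideal p ?n T" by simp
    from functional_zero[of h ?n, OF h1 h2 h3 this] hq
    have "?I +>\<^bsub>A\<^esub> (p_elem p A \<otimes>\<^bsub>A\<^esub> (p_elem p A \<otimes>\<^bsub>A\<^esub> u j)) = ?I +>\<^bsub>A\<^esub> \<zero>\<^bsub>A\<^esub>" by simp
    then show ?thesis using A.p_coset_eq_iff[OF _ A.zero_closed] A.pcong_zero u by simp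
  qed
  have "u j \<in> p_ideal p n A" if "j < p ^ m" for j
    using A_cancel_p[OF _ A_cancel_p[OF _ uI[OF that]]] u by simp
  then have "?y (p ^ m) \<in> p_ideal p n T"
    using u by (intro hs_pcong_zero) (auto intro: TP.T_cring inA_p_ideal)
  then show ?thesis using TP.T.pcong_p_ideal[OF TP.T.pcong_mono[OF xu, of n]] by simp
qed

end

section \<open>The ring \<open>P\<degree>\<close>\<close>

lemma lim_ring_algebra_of:
  assumes "lim_ring T C p \<Phi> i" shows "lim_ring T (algebra_of h C) p \<Phi> i"
proof -
  interpret lim_ring T C p \<Phi> i by fact
  interpret D: complete_ring "algebra_of h C" p by (rule algebra_of_complete_ring[OF C.complete_ring_axioms])
  show ?thesis by unfold_locales (simp_all add: i_hom i_dense i_iff)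
qed

context cring
begin

lemma add_cancel_left:
  assumes "a \<in> carrier R" "b \<in> carrier R" "c \<in> carrier R"
  shows "(a \<oplus> b) \<oplus> c \<ominus> a = b \<oplus> c"
  using assms by algebra

lemma minus_add_cancel:
  assumes "a \<in> carrier R" "b \<in> carrier R"
  shows "a = (a \<ominus> b) \<oplus> b" "b = a \<oplus> \<ominus> (a \<ominus> b)"
  using assms by algebra+

lemma minus_telescope:
  assumes "a \<in> carrier R" "b \<in> carrier R" "c \<in> carrier R" "d \<in> carrier R"
  shows "a \<ominus> c = (a \<ominus> b) \<oplus> (b \<ominus> d) \<oplus> \<ominus> (c \<ominus> d)"
  using assms by algebra

end

lemma (in ideal) diff_pow:
  assumes "cring R" "x \<in> carrier R" "y \<in> carrier R" "x \<ominus> y \<in> I"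
  shows "x [^] (n::nat) \<ominus> y [^] n \<in> I"
proof -
  interpret cring R by fact
  show ?thesis
  proof (induction n)
    case 0
    show ?case by (simp add: a_minus_def r_neg)
  next
    case (Suc n)
    have c: "x [^] n \<in> carrier R" "y [^] n \<in> carrier R" using assms by auto
    have "x [^] n \<otimes> x \<ominus> y [^] n \<otimes> y = (x [^] n \<ominus> y [^] n) \<otimes> x \<oplus> y [^] n \<otimes> (x \<ominus> y)"
      using c assms(2,3) by algebra
    then show ?case using Suc assms c by (simp add: I_l_closed I_r_closed)
  qed
qed

context base_alg
begin

abbreviation "That \<equiv> Ahat p RR Kc A"
abbreviation "\<Phi>h \<equiv> Phi_hat p RR Kc \<Phi>K A \<phi>"
abbreviation "B \<equiv> Blim p RR Kc \<Phi>K A \<phi>"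
abbreviation "C \<equiv> Pcirc p RR Kc \<Phi>K A \<phi>"
abbreviation "\<rho> \<equiv> \<lambda>c. c \<odot>\<^bsub>C\<^esub> \<one>\<^bsub>C\<^esub>"
abbreviation "tC \<equiv> \<lambda>m. tK m \<odot>\<^bsub>C\<^esub> \<one>\<^bsub>C\<^esub>"

definition "i m \<tau> = padic_in p B (dirlim_in That \<Phi>h m (padic_in p T \<tau>))"

lemma Pcirc_in_eq: "Pcirc_in p RR Kc \<Phi>K A \<phi> m a c = i m (tin a c)"
  by (simp add: Pcirc_in_def i_def)

lemma T_endo: "ring_endo T \<Phi>"
  using TP.T_cring \<Phi>_hom by (simp add: ring_endo_def ring_endo_axioms_def)

sublocale TE: ring_endo T \<Phi> by (rule T_endo)

lemma C_lim: "lim_ring T C p \<Phi> i"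
  unfolding Pcirc_def Blim_def i_def[abs_def] by (rule lim_ring_algebra_of[OF lim_ring_completion2[OF T_endo]])

sublocale LC: lim_ring T C p \<Phi> i by (rule C_lim)

lemma i_closed [simp]: "\<tau> \<in> carrier T \<Longrightarrow> i m \<tau> \<in> carrier C"
  using LC.i_hom by (rule ring_hom_closed)

lemma i_Suc: assumes "\<tau> \<in> carrier T" shows "i (Suc m) (\<Phi> \<tau>) = i m \<tau>"
proof -
  interpret E: ring_endo That \<Phi>h by (rule padic_map_endo[OF T_endo])
  have c: "padic_in p T \<tau> \<in> carrier That" using ring_hom_closed[OF TP.T.padic_in_hom assms] .
  have "\<Phi>h (padic_in p T \<tau>) = padic_in p T (\<Phi> \<tau>)"
    using padic_map_pow_in[OF T_endo assms, where p = p and k = 1] by simp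
  then show ?thesis using E.dl_step[OF c, of m 1] by (simp add: i_def)
qed

lemma i_step: "\<tau> \<in> carrier T \<Longrightarrow> i (m + k) ((\<Phi> ^^ k) \<tau>) = i m \<tau>"
  by (induction k) (simp_all add: i_Suc)

lemma i_minus: "\<tau> \<in> carrier T \<Longrightarrow> \<sigma> \<in> carrier T \<Longrightarrow> i m (\<tau> \<ominus>\<^bsub>T\<^esub> \<sigma>) = i m \<tau> \<ominus>\<^bsub>C\<^esub> i m \<sigma>"
  by (rule ring_hom_minus[OF TP.T_cring LC.C.is_cring LC.i_hom])

lemma \<rho>_eq: "c \<in> carrier Kc \<Longrightarrow> \<rho> c = i 0 (tin \<one>\<^bsub>A\<^esub> c)"
  using LC.C.r_one[OF i_closed[of "tin \<one>\<^bsub>A\<^esub> c" 0]]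
  by (simp add: Pcirc_def Pcirc_in_eq[unfolded Pcirc_def])

lemma \<rho>_hom: "\<rho> \<in> ring_hom Kc C"
proof -
  have "(\<lambda>c. i 0 (tin \<one>\<^bsub>A\<^esub> c)) \<in> ring_hom Kc C"
    using ring_hom_trans[OF TP.tin_hom2 LC.i_hom[of 0]] by (simp add: comp_def)
  then show ?thesis
    using \<rho>_eq by (auto simp: ring_hom_def Pi_iff)
qed

text \<open>The roots are fixed by \<open>\<Phi>\<close>, so their image is the same from every
  copy. This lets the ideal of the roots in \<open>P^o\<close> be examined in any copy, although the
  transition maps are only semilinear.\<close>

lemma tC_eq: "tC m = i n (tT m)"
proof -
  have "(\<Phi> ^^ n) (tT m) = tT m" by (induction n) (simp_all add: \<Phi>_tT)
  then show ?thesis using i_step[of "tT m" 0 n] \<rho>_eq[of "tK m"] by simp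
qed

sublocale Cr: root_ring C p tC
proof unfold_locales
  show "Factorial_Ring.prime p" by (rule prime)
  show "\<And>m. tC m \<in> carrier C" by (simp add: tC_eq[of _ 0])
  show "tC 0 = p_elem p C"
    using ring_hom_p_elem[OF TP.T_cring LC.C.is_cring LC.i_hom[of 0], of p] unfolding tC_eq[of 0 0] p_elem_T(2) .
  show "tC (Suc m) [^]\<^bsub>C\<^esub> p = tC m" for m
    using ring_hom_pow[OF Kc.is_cring LC.C.is_cring \<rho>_hom, of "tK (Suc m)" p] by (simp add: Kr.t_Suc)
qed

lemma \<phi>_pow_refl:
  assumes "a \<in> carrier A" "(\<phi> ^^ k) a \<in> p_ideal p 1 A" shows "a \<in> p_ideal p 1 A"
  using assms
proof (induction k arbitrary: a)
  case (Suc k)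
  have "(\<phi> ^^ k) (\<phi> a) \<in> p_ideal p 1 A" using Suc.prems(2) by (simp add: funpow_swap1)
  then have "\<phi> a \<in> p_ideal p 1 A" using Suc by simp
  then have "a [^]\<^bsub>A\<^esub> p \<in> p_ideal p 1 A" using A.pcong_p_ideal[OF \<phi>_frob[OF Suc.prems(1)]] by blast
  then show ?case by (rule A_reduced[OF Suc.prems(1)])
qed simp

section \<open>The maps from A to P^o through the copies\<close>

abbreviation "iA m a \<equiv> i m (inA a)"

lemma iA_hom: "iA m \<in> ring_hom A C"
  using ring_hom_trans[OF TP.tin_hom1 LC.i_hom[of m]] by (simp add: comp_def)

lemma iA_step: "a \<in> carrier A \<Longrightarrow> iA (m + k) ((\<phi> ^^ k) a) = iA m a"
proof -
  assume a: "a \<in> carrier A"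
  have "(\<Phi> ^^ k) (inA a) = inA ((\<phi> ^^ k) a)" using a by (induction k) (simp_all add: \<Phi>_inA)
  then show ?thesis using i_step[of "inA a" m k] a by simp
qed

lemma iA_p: "a \<in> p_ideal p n A \<Longrightarrow> iA m a \<in> p_ideal p n C"
  by (rule ring_hom_p_ideal[OF A_cring LC.C.is_cring iA_hom])

text \<open>The relation with a multiple of a root is moved to a copy in which both sides live, and
  after \<open>k\<close> further steps it is a congruence modulo \<open>p\<close> in
  \<open>T\<close>, where \<open>T_detect\<close> applies. The iterates of \<open>\<phi>\<close>
  picked up on the way are removed by \<open>\<phi>_pow_refl\<close>.\<close>

lemma iA_J:
  assumes a: "a \<in> carrier A" and J: "iA n a \<in> tideal C tC" shows "a \<in> p_ideal p 1 A"
proof -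
  obtain l y where y: "y \<in> carrier C" "iA n a = tC l \<otimes>\<^bsub>C\<^esub> y" using J by (rule Cr.J_E)
  obtain m \<tau> where \<tau>: "\<tau> \<in> carrier T" "pcong p 1 C y (i m \<tau>)" using LC.i_dense[OF y(1)] by blast
  define \<sigma> where "\<sigma> = (\<Phi> ^^ n) \<tau>"
  have \<sigma>: "\<sigma> \<in> carrier T" "i m \<tau> = i (n + m) \<sigma>" using \<tau> i_step[of \<tau> m n] by (simp_all add: \<sigma>_def add.commute)
  define b where "b = (\<phi> ^^ m) a"
  have b: "b \<in> carrier A" "iA n a = iA (n + m) b" using a iA_step[of a n m] by (simp_all add: b_def)
  have "pcong p 1 C (iA (n + m) b) (i (n + m) (tT l) \<otimes>\<^bsub>C\<^esub> i (n + m) \<sigma>)"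
    unfolding b(2)[symmetric] y(2) tC_eq[of l "n + m"] \<sigma>(2)[symmetric] using \<tau> by (intro LC.C.pcong_mult) auto
  then have "iA (n + m) b \<ominus>\<^bsub>C\<^esub> i (n + m) (tT l \<otimes>\<^bsub>T\<^esub> \<sigma>) \<in> p_ideal p 1 C"
    using \<sigma>(1) by (simp add: ring_hom_mult[OF LC.i_hom] pcong_def)
  then have "i (n + m) (inA b \<ominus>\<^bsub>T\<^esub> tT l \<otimes>\<^bsub>T\<^esub> \<sigma>) \<in> p_ideal p 1 C" using b \<sigma>(1) by (simp add: i_minus)
  then obtain k where k: "(\<Phi> ^^ k) (inA b \<ominus>\<^bsub>T\<^esub> tT l \<otimes>\<^bsub>T\<^esub> \<sigma>) \<in> p_ideal p 1 T"
    using LC.i_iff[of "inA b \<ominus>\<^bsub>T\<^esub> tT l \<otimes>\<^bsub>T\<^esub> \<sigma>" "n + m" 1] b(1) \<sigma>(1) by auto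
  have "(\<Phi> ^^ k) (inA b \<ominus>\<^bsub>T\<^esub> tT l \<otimes>\<^bsub>T\<^esub> \<sigma>) = (\<Phi> ^^ k) (inA b) \<ominus>\<^bsub>T\<^esub> (\<Phi> ^^ k) (tT l) \<otimes>\<^bsub>T\<^esub> (\<Phi> ^^ k) \<sigma>"
    using b(1) \<sigma>(1) ring_hom_minus[OF TP.T_cring TP.T_cring TE.endo_pow_hom[of k]] ring_hom_mult[OF TE.endo_pow_hom[of k]] by simp
  moreover have "(\<Phi> ^^ k) (inA b) = inA ((\<phi> ^^ k) b)" using b by (induction k) (simp_all add: \<Phi>_inA)
  moreover have "(\<Phi> ^^ k) (tT l) = tT l" by (induction k) (simp_all add: \<Phi>_tT)
  ultimately have "pcong p 1 T (inA ((\<phi> ^^ k) b)) (tT l \<otimes>\<^bsub>T\<^esub> (\<Phi> ^^ k) \<sigma>)"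
    using k b(1) \<sigma>(1) by (simp add: pcong_def)
  then have "(\<phi> ^^ k) b \<in> p_ideal p 1 A" using T_detect[of "(\<phi> ^^ k) b" "(\<Phi> ^^ k) \<sigma>" l] b(1) \<sigma>(1) by simp
  then have "b \<in> p_ideal p 1 A" by (rule \<phi>_pow_refl[OF b(1)])
  then show ?thesis unfolding b_def by (rule \<phi>_pow_refl[OF a])
qed

lemma C_hs:
  assumes "x \<in> carrier C"
  obtains n m u where "\<And>j. u j \<in> carrier A" "pcong p 1 C x (hs C (tC m) (\<lambda>j. iA n (u j)) (p ^ m))"
proof -
  obtain n \<tau> where \<tau>: "\<tau> \<in> carrier T" "pcong p 1 C x (i n \<tau>)" using LC.i_dense[OF assms] by blast
  obtain m u where u: "\<And>j. u j \<in> carrier A" "pcong p 1 T \<tau> (hs T (tT m) (\<lambda>j. inA (u j)) (p ^ m))" using T_hs[OF \<tau>(1), of 1] by blast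
  have "i n (hs T (tT m) (\<lambda>j. inA (u j)) (p ^ m)) = hs C (i n (tT m)) (\<lambda>j. iA n (u j)) (p ^ m)"
    using hs_hom[OF TP.T_cring LC.C.is_cring LC.i_hom[of n], of "tT m" "\<lambda>j. inA (u j)" "p ^ m"] u(1) by simp
  moreover have "pcong p 1 C (i n \<tau>) (i n (hs T (tT m) (\<lambda>j. inA (u j)) (p ^ m)))"
    by (rule ring_hom_pcong[OF TP.T_cring LC.C.is_cring LC.i_hom u(2)])
  ultimately have "pcong p 1 C (i n \<tau>) (hs C (tC m) (\<lambda>j. iA n (u j)) (p ^ m))" unfolding tC_eq[of m n] by metis
  from LC.C.pcong_trans[OF \<tau>(2) this] that u(1) show ?thesis by blast
qed

lemma C_lift:
  assumes "x \<in> carrier C" obtains n a where "a \<in> carrier A" "x \<ominus>\<^bsub>C\<^esub> iA n a \<in> tideal C tC"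
proof -
  obtain n m u where u: "\<And>j. u j \<in> carrier A" "pcong p 1 C x (hs C (tC m) (\<lambda>j. iA n (u j)) (p ^ m))"
    by (rule C_hs[OF assms]) blast
  have uc: "iA n (u j) \<in> carrier C" for j using u(1) by simp
  obtain z where z: "z \<in> carrier C" "hs C (tC m) (\<lambda>j. iA n (u j)) (p ^ m) = iA n (u 0) \<oplus>\<^bsub>C\<^esub> tC m \<otimes>\<^bsub>C\<^esub> z"
    using LC.C.hs_split[of "tC m" "\<lambda>j. iA n (u j)" 0 "p ^ m"] uc p0 Cr.t_closed[of m] by auto
  obtain y where y: "y \<in> carrier C" "x = (iA n (u 0) \<oplus>\<^bsub>C\<^esub> tC m \<otimes>\<^bsub>C\<^esub> z) \<oplus>\<^bsub>C\<^esub> p_elem p C \<otimes>\<^bsub>C\<^esub> y"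
    using u(2) unfolding LC.C.pcong_iff z by auto
  have c: "tC m \<otimes>\<^bsub>C\<^esub> z \<in> carrier C" "tC 0 \<otimes>\<^bsub>C\<^esub> y \<in> carrier C"
    using y(1) z(1) Cr.t_closed LC.C.m_closed by blast+
  have "x \<ominus>\<^bsub>C\<^esub> iA n (u 0) = tC m \<otimes>\<^bsub>C\<^esub> z \<oplus>\<^bsub>C\<^esub> tC 0 \<otimes>\<^bsub>C\<^esub> y"
    unfolding y(2) Cr.t_0[symmetric] by (rule LC.C.add_cancel_left[OF uc c])
  also have "\<dots> \<in> tideal C tC" by (rule Cr.J.a_closed[OF Cr.J_I[OF z(1)] Cr.J_I[OF y(1)]])
  finally show ?thesis using that u(1) by blast
qed

lemma J_shift:
  assumes "x \<in> carrier C" "y \<in> carrier C" "x \<ominus>\<^bsub>C\<^esub> y \<in> tideal C tC"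
  shows "x \<in> tideal C tC \<longleftrightarrow> y \<in> tideal C tC"
proof -
  note e = LC.C.minus_add_cancel[OF assms(1,2)]
  show ?thesis using assms(3) Cr.J.a_closed Cr.J.a_inv_closed e by metis
qed

sublocale Cg: gauge_ring C p tC
proof unfold_locales
  fix x assume x: "x \<in> carrier C" "p_elem p C \<otimes>\<^bsub>C\<^esub> x = \<zero>\<^bsub>C\<^esub>"
  show "x = \<zero>\<^bsub>C\<^esub>"
  proof (rule LC.C.sep[OF x(1)])
    fix n
    \<comment> \<open>Two extra powers of \<open>p\<close>, to be spent in
      \<open>T_cancel\<close>.\<close>
    let ?n = "Suc (Suc n)"
    obtain m \<tau> where \<tau>: "\<tau> \<in> carrier T" "pcong p ?n C x (i m \<tau>)" using LC.i_dense[OF x(1)] by blast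
    have "pcong p ?n C (p_elem p C \<otimes>\<^bsub>C\<^esub> x) (p_elem p C \<otimes>\<^bsub>C\<^esub> i m \<tau>)" using \<tau> by (intro LC.C.pcong_mult) auto
    then have "p_elem p C \<otimes>\<^bsub>C\<^esub> i m \<tau> \<in> p_ideal p ?n C"
      unfolding x(2) using LC.C.pcong_sym LC.C.pcong_zero by blast
    moreover have "p_elem p C \<otimes>\<^bsub>C\<^esub> i m \<tau> = i m (p_elem p T \<otimes>\<^bsub>T\<^esub> \<tau>)"
      using \<tau>(1) ring_hom_p_elem[OF TP.T_cring LC.C.is_cring LC.i_hom[of m], of p] by (simp add: ring_hom_mult[OF LC.i_hom])
    ultimately have "i m (p_elem p T \<otimes>\<^bsub>T\<^esub> \<tau>) \<in> p_ideal p ?n C" by simp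
    then obtain k where k: "(\<Phi> ^^ k) (p_elem p T \<otimes>\<^bsub>T\<^esub> \<tau>) \<in> p_ideal p ?n T"
      using LC.i_iff[of "p_elem p T \<otimes>\<^bsub>T\<^esub> \<tau>" m ?n] \<tau>(1) by auto
    have "(\<Phi> ^^ k) (p_elem p T \<otimes>\<^bsub>T\<^esub> \<tau>) = p_elem p T \<otimes>\<^bsub>T\<^esub> (\<Phi> ^^ k) \<tau>"
      using \<tau>(1) ring_hom_mult[OF TE.endo_pow_hom[of k], of "p_elem p T" \<tau>]
        ring_hom_p_elem[OF TP.T_cring TP.T_cring TE.endo_pow_hom[of k], of p] by simp
    then have "(\<Phi> ^^ k) \<tau> \<in> p_ideal p n T" using T_cancel[of "(\<Phi> ^^ k) \<tau>" n] k \<tau>(1) by simp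
    then have "i m \<tau> \<in> p_ideal p n C" using LC.i_iff[OF \<tau>(1)] by blast
    then show "x \<in> p_ideal p n C" using LC.C.pcong_p_ideal[OF LC.C.pcong_mono[OF \<tau>(2), of n]] by simp
  qed
next
  fix x assume x: "x \<in> carrier C" "x \<notin> p_ideal p 1 C"
  obtain n m u where u: "\<And>j. u j \<in> carrier A" and xu: "pcong p 1 C x (hs C (tC m) (\<lambda>j. iA n (u j)) (p ^ m))"
    by (rule C_hs[OF x(1)]) blast
  have uc: "iA n (u j) \<in> carrier C" for j using u by simp
  have uJ: "iA n (u j) \<in> p_ideal p 1 C" if "iA n (u j) \<in> tideal C tC" for j
    using iA_p[OF iA_J[OF u that]] .
  show "\<exists>m j. \<exists>y\<in>carrier C. y \<notin> tideal C tC \<and> x = tC m [^]\<^bsub>C\<^esub> (j::nat) \<otimes>\<^bsub>C\<^esub> y"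
    using Cr.leadingI[of "\<lambda>j. iA n (u j)" x m, OF uc xu uJ x(2)] by blast
next
  fix x and n :: nat assume x: "x \<in> carrier C" "0 < n" "x [^]\<^bsub>C\<^esub> n \<in> tideal C tC"
  \<comment> \<open>Modulo \<open>J\<close> the element comes from \<open>A\<close> in some copy,
    which reduces the claim to \<open>A/pA\<close> being reduced.\<close>
  obtain m a where a: "a \<in> carrier A" "x \<ominus>\<^bsub>C\<^esub> iA m a \<in> tideal C tC" using C_lift[OF x(1)] .
  have ac: "iA m a \<in> carrier C" using a by simp
  have "x [^]\<^bsub>C\<^esub> n \<ominus>\<^bsub>C\<^esub> iA m a [^]\<^bsub>C\<^esub> n \<in> tideal C tC"
    by (rule Cr.J.diff_pow[OF LC.C.is_cring x(1) ac a(2)])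
  then have "iA m a [^]\<^bsub>C\<^esub> n \<in> tideal C tC"
    using J_shift[of "x [^]\<^bsub>C\<^esub> n" "iA m a [^]\<^bsub>C\<^esub> n"] x ac by simp
  then have "iA m (a [^]\<^bsub>A\<^esub> n) \<in> tideal C tC"
    using ring_hom_pow[OF A_cring LC.C.is_cring iA_hom a(1), of m n] by simp
  then have "a [^]\<^bsub>A\<^esub> n \<in> p_ideal p 1 A" using iA_J a(1) by simp
  then have "iA m a \<in> p_ideal p 1 C" using A_reduced[OF a(1)] iA_p by blast
  then have "iA m a \<in> tideal C tC" using Cr.p_ideal_J by blast
  then show "x \<in> tideal C tC" using J_shift[OF x(1) ac a(2)] by blast
qed

text \<open>The maximal ideal of \<open>K^o\<close> is the ideal of its roots, and the images of
  these generate \<open>J\<close>. This links the abstract ideal \<open>K^oo P^o\<close> to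
  computations with roots.\<close>

lemma max_extended_C: "max_extended Kc C = tideal C tC"
proof
  have gen: "(\<lambda>c. c \<odot>\<^bsub>C\<^esub> \<one>\<^bsub>C\<^esub>) ` max_ideal Kc \<subseteq> tideal C tC"
  proof
    fix x assume "x \<in> (\<lambda>c. c \<odot>\<^bsub>C\<^esub> \<one>\<^bsub>C\<^esub>) ` max_ideal Kc"
    then obtain c where c: "c \<in> tideal Kc tK" "x = \<rho> c" unfolding Kg.max_ideal_eq by blast
    obtain m y where y: "y \<in> carrier Kc" "c = tK m \<otimes>\<^bsub>Kc\<^esub> y" using c(1) by (rule Kr.J_E)
    have "x = tC m \<otimes>\<^bsub>C\<^esub> \<rho> y" unfolding c(2) y(2) using ring_hom_mult[OF \<rho>_hom Kr.t_closed y(1)] .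
    then show "x \<in> tideal C tC" using Cr.J_I[OF ring_hom_closed[OF \<rho>_hom y(1)]] by simp
  qed
  show "max_extended Kc C \<subseteq> tideal C tC"
    unfolding max_extended_def by (rule LC.C.genideal_minimal[OF Cr.J_ideal gen])
  have sub: "(\<lambda>c. c \<odot>\<^bsub>C\<^esub> \<one>\<^bsub>C\<^esub>) ` max_ideal Kc \<subseteq> carrier C" using gen Cr.J.a_subset by blast
  show "tideal C tC \<subseteq> max_extended Kc C"
  proof
    fix x assume "x \<in> tideal C tC"
    then obtain m y where y: "y \<in> carrier C" "x = tC m \<otimes>\<^bsub>C\<^esub> y" by (rule Cr.J_E)
    have "tK m \<in> max_ideal Kc" unfolding Kg.max_ideal_eq using Kr.J_I[OF Kc.one_closed, of m] by simp
    then have "tC m \<in> max_extended Kc C"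
      unfolding max_extended_def using LC.C.genideal_self[OF sub] by blast
    then show "x \<in> max_extended Kc C"
      unfolding y(2) using ideal.I_r_closed[OF LC.C.genideal_ideal[OF sub]] y(1) unfolding max_extended_def by blast
  qed
qed

lemma C_frob_surj:
  assumes "x \<in> carrier C" shows "\<exists>d\<in>carrier C. pcong p 1 C x (d [^]\<^bsub>C\<^esub> p)"
proof -
  obtain m \<tau> where \<tau>: "\<tau> \<in> carrier T" "pcong p 1 C x (i m \<tau>)" using LC.i_dense[OF assms] by blast
  have "\<exists>d\<in>carrier C. pcong p 1 C (i m \<tau>) (d [^]\<^bsub>C\<^esub> p)" using \<tau>(1)
  proof (induction rule: TP.T_induct)
    case (gen a c)
    obtain e where e: "e \<in> carrier Kc" "pcong p 1 Kc (\<Phi>K c) (e [^]\<^bsub>Kc\<^esub> p)" using Kc_frob_surj[of "\<Phi>K c"] gen by auto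
    have "pcong p 1 T (inA (\<phi> a) \<otimes>\<^bsub>T\<^esub> tin \<one>\<^bsub>A\<^esub> (\<Phi>K c)) (inA (a [^]\<^bsub>A\<^esub> p) \<otimes>\<^bsub>T\<^esub> tin \<one>\<^bsub>A\<^esub> (e [^]\<^bsub>Kc\<^esub> p))"
      by (rule TP.T.pcong_mult[OF ring_hom_pcong[OF A_cring TP.T_cring TP.tin_hom1 \<phi>_frob[OF gen(1)]]
        ring_hom_pcong[OF Kc.is_cring TP.T_cring TP.tin_hom2 e(2)]])
    moreover have "inA (a [^]\<^bsub>A\<^esub> p) \<otimes>\<^bsub>T\<^esub> tin \<one>\<^bsub>A\<^esub> (e [^]\<^bsub>Kc\<^esub> p) = tin a e [^]\<^bsub>T\<^esub> p"
    proof -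
      have "tin a e [^]\<^bsub>T\<^esub> p = (inA a \<otimes>\<^bsub>T\<^esub> tin \<one>\<^bsub>A\<^esub> e) [^]\<^bsub>T\<^esub> p" using gen e TP.tin_split[of a e] by simp
      then show ?thesis using gen e ring_hom_pow[OF A_cring TP.T_cring TP.tin_hom1, of a p]
        ring_hom_pow[OF Kc.is_cring TP.T_cring TP.tin_hom2, of e p] by (simp add: TP.T.nat_pow_distrib)
    qed
    moreover have "inA (\<phi> a) \<otimes>\<^bsub>T\<^esub> tin \<one>\<^bsub>A\<^esub> (\<Phi>K c) = \<Phi> (tin a c)"
      using gen by (simp add: \<Phi>_tin TP.tin_mult)
    ultimately have "pcong p 1 T (\<Phi> (tin a c)) (tin a e [^]\<^bsub>T\<^esub> p)" by simp
    then have "pcong p 1 C (i (Suc m) (\<Phi> (tin a c))) (i (Suc m) (tin a e [^]\<^bsub>T\<^esub> p))"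
      by (rule ring_hom_pcong[OF TP.T_cring LC.C.is_cring LC.i_hom])
    then have "pcong p 1 C (i m (tin a c)) (i (Suc m) (tin a e) [^]\<^bsub>C\<^esub> p)"
      using gen e i_Suc[of "tin a c" m] ring_hom_pow[OF TP.T_cring LC.C.is_cring LC.i_hom, of "tin a e" "Suc m" p] by simp
    then show ?case using gen e by (intro bexI[of _ "i (Suc m) (tin a e)"]) auto
  next
    case (add x y)
    then obtain d e where d: "d \<in> carrier C" "pcong p 1 C (i m x) (d [^]\<^bsub>C\<^esub> p)"
      and e: "e \<in> carrier C" "pcong p 1 C (i m y) (e [^]\<^bsub>C\<^esub> p)" by blast
    have "pcong p 1 C (i m (x \<oplus>\<^bsub>T\<^esub> y)) (d [^]\<^bsub>C\<^esub> p \<oplus>\<^bsub>C\<^esub> e [^]\<^bsub>C\<^esub> p)"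
      using LC.C.pcong_add[OF d(2) e(2)] add(1,2) by (simp add: ring_hom_add[OF LC.i_hom])
    then have "pcong p 1 C (i m (x \<oplus>\<^bsub>T\<^esub> y)) ((d \<oplus>\<^bsub>C\<^esub> e) [^]\<^bsub>C\<^esub> p)"
      using LC.C.pcong_trans LC.C.pcong_sym LC.C.freshman[OF prime d(1) e(1)] by blast
    then show ?case using d(1) e(1) LC.C.a_closed by blast
  qed
  then show ?thesis using LC.C.pcong_trans[OF \<tau>(2)] by blast
qed

subsection \<open>The residue ring\<close>

abbreviation "Ap \<equiv> mod_p p A"
abbreviation "frob \<equiv> \<lambda>x. x [^]\<^bsub>Ap\<^esub> p"
abbreviation "cls a \<equiv> p_ideal p 1 A +>\<^bsub>A\<^esub> a"

lemma Ap_cring: "cring Ap"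
  unfolding mod_p_def by (rule ideal.quotient_is_cring[OF A.p_ideal_ideal A_cring])

lemma cls_carrier: "x \<in> carrier Ap \<longleftrightarrow> (\<exists>a\<in>carrier A. x = cls a)"
  unfolding mod_p_def A.quot_carrier ..

lemma cls_eq_iff: "a \<in> carrier A \<Longrightarrow> b \<in> carrier A \<Longrightarrow> cls a = cls b \<longleftrightarrow> a \<ominus>\<^bsub>A\<^esub> b \<in> p_ideal p 1 A"
  by (rule A.ideal_coset_eq_iff[OF A.p_ideal_ideal])

lemma frob_cls: "a \<in> carrier A \<Longrightarrow> frob (cls a) = cls (\<phi> a)"
proof -
  assume a: "a \<in> carrier A"
  have "frob (cls a) = cls (a [^]\<^bsub>A\<^esub> p)" unfolding mod_p_def by (rule A.quot_pow[OF A.p_ideal_ideal a])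
  also have "\<dots> = cls (\<phi> a)" using A.pcong_sym[OF \<phi>_frob[OF a]] a by (simp add: cls_eq_iff pcong_def del: One_nat_def)
  finally show ?thesis .
qed

lemma cls_hom: "(+>\<^bsub>A\<^esub>) (p_ideal p 1 A) \<in> ring_hom A Ap"
  unfolding mod_p_def by (rule ideal.rcos_ring_hom[OF A.p_ideal_ideal])

text \<open>Frobenius on \<open>A/pA\<close> is the map induced by the ring endomorphism
  \<open>\<phi>\<close>, hence additive.\<close>

lemma frob_endo: "ring_endo Ap frob"
proof -
  have "frob \<in> ring_hom Ap Ap"
  proof (rule ring_hom_memI)
    fix x y assume "x \<in> carrier Ap" "y \<in> carrier Ap"
    then obtain a b where ab: "a \<in> carrier A" "b \<in> carrier A" "x = cls a" "y = cls b" by (auto simp: cls_carrier)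
    show "frob x \<in> carrier Ap" using ab frob_cls cls_carrier by auto
    show "frob (x \<otimes>\<^bsub>Ap\<^esub> y) = frob x \<otimes>\<^bsub>Ap\<^esub> frob y"
      using ab ring_hom_mult[OF cls_hom, symmetric] by (simp add: frob_cls ring_hom_mult[OF \<phi>_hom] del: One_nat_def)
    show "frob (x \<oplus>\<^bsub>Ap\<^esub> y) = frob x \<oplus>\<^bsub>Ap\<^esub> frob y"
      using ab ring_hom_add[OF cls_hom, symmetric] by (simp add: frob_cls ring_hom_add[OF \<phi>_hom] del: One_nat_def)
  next
    show "frob \<one>\<^bsub>Ap\<^esub> = \<one>\<^bsub>Ap\<^esub>" using monoid.nat_pow_one[OF ring.is_monoid[OF cring.axioms(1)[OF Ap_cring]]] by simp
  qed
  then show ?thesis using Ap_cring by (simp add: ring_endo_def ring_endo_axioms_def)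
qed

sublocale Fr: ring_endo Ap frob by (rule frob_endo)

lemma frob_pow_cls: "a \<in> carrier A \<Longrightarrow> (frob ^^ k) (cls a) = cls ((\<phi> ^^ k) a)"
  by (induction k) (simp_all add: frob_cls del: One_nat_def)

text \<open>Both elements are moved to the copy \<open>m + n\<close>, where their difference is the
  image of \<open>d\<close>. It lies in \<open>J\<close> iff \<open>d\<close> is in
  \<open>pA\<close>. Iterates of \<open>\<phi>\<close>, which induce the transition maps of the
  perfection, neither create nor destroy this membership.\<close>

lemma perf_eq_iff:
  assumes a: "a \<in> carrier A" and b: "b \<in> carrier A"
  shows "iA m a \<ominus>\<^bsub>C\<^esub> iA n b \<in> tideal C tC \<longleftrightarrow> Fr.dl m (cls a) = Fr.dl n (cls b)"
proof -
  define d where "d = (\<phi> ^^ n) a \<ominus>\<^bsub>A\<^esub> (\<phi> ^^ m) b"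
  have d: "d \<in> carrier A" using a b by (simp add: d_def)
  have "iA m a \<ominus>\<^bsub>C\<^esub> iA n b = iA (m + n) d"
    using iA_step[OF a, of m n] iA_step[OF b, of n m] a b
      ring_hom_minus[OF A_cring LC.C.is_cring iA_hom, of "(\<phi> ^^ n) a" "(\<phi> ^^ m) b" "m + n"] by (simp add: d_def add.commute)
  then have "iA m a \<ominus>\<^bsub>C\<^esub> iA n b \<in> tideal C tC \<longleftrightarrow> iA (m + n) d \<in> tideal C tC" by simp
  also have "\<dots> \<longleftrightarrow> d \<in> p_ideal p 1 A" using iA_J[OF d] iA_p Cr.p_ideal_J by blast
  also have "\<dots> \<longleftrightarrow> Fr.dl m (cls a) = Fr.dl n (cls b)"
  proof
    assume "d \<in> p_ideal p 1 A"
    then have "cls ((\<phi> ^^ (n + 0)) a) = cls ((\<phi> ^^ (m + 0)) b)" using a b by (simp add: cls_eq_iff d_def del: One_nat_def)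
    then show "Fr.dl m (cls a) = Fr.dl n (cls b)"
      using a b by (subst Fr.dl_eq_iff) (auto simp: cls_carrier frob_pow_cls simp del: One_nat_def intro!: exI[of _ 0])
  next
    assume "Fr.dl m (cls a) = Fr.dl n (cls b)"
    then obtain k where "(frob ^^ (n + k)) (cls a) = (frob ^^ (m + k)) (cls b)"
      using a b by (subst (asm) Fr.dl_eq_iff) (auto simp: cls_carrier)
    then have "(\<phi> ^^ (n + k)) a \<ominus>\<^bsub>A\<^esub> (\<phi> ^^ (m + k)) b \<in> p_ideal p 1 A"
      using a b by (simp add: frob_pow_cls cls_eq_iff del: One_nat_def)
    moreover have "(\<phi> ^^ k) d = (\<phi> ^^ (n + k)) a \<ominus>\<^bsub>A\<^esub> (\<phi> ^^ (m + k)) b"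
    proof -
      have "(\<phi> ^^ k) \<in> ring_hom A A"
      proof (induction k)
        case (Suc k) then show ?case using ring_hom_trans[OF Suc \<phi>_hom] by (simp add: comp_def)
      qed (simp add: ring_hom_def)
      from ring_hom_minus[OF A_cring A_cring this, of "(\<phi> ^^ n) a" "(\<phi> ^^ m) b"] show ?thesis
        using a b by (simp add: d_def funpow_add[unfolded comp_def, symmetric] funpow_add add.commute)
    qed
    ultimately show "d \<in> p_ideal p 1 A" using \<phi>_pow_refl[OF d] by metis
  qed
  finally show ?thesis .
qed

lemma residue_iso:
  "\<exists>h \<in> ring_iso (C Quot max_extended Kc C) (perfection p Ap).
     \<forall>m. \<forall>a\<in>carrier A. h (max_extended Kc C +>\<^bsub>C\<^esub> Pcirc_in p RR Kc \<Phi>K A \<phi> m a \<one>\<^bsub>Kc\<^esub>) = dirlim_in Ap frob m (cls a)"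
proof -
  let ?J = "tideal C tC" let ?D = "dirlim Ap frob"
  interpret D: cring ?D by (rule Fr.dirlim_cring)
  have clc: "cls a \<in> carrier Ap" if "a \<in> carrier A" for a using that cls_carrier by blast
  \<comment> \<open>Every class is that of some \<open>iA m a\<close> by \<open>C_lift\<close>. By
    \<open>perf_eq_iff\<close> the value depends on the class only, and different classes receive
    different values.\<close>
  define h where "h U = (THE y. \<exists>m. \<exists>a\<in>carrier A. U = ?J +>\<^bsub>C\<^esub> iA m a \<and> y = Fr.dl m (cls a))" for U
  have hi: "h (?J +>\<^bsub>C\<^esub> iA m a) = Fr.dl m (cls a)" if a: "a \<in> carrier A" for m a
    unfolding h_def
  proof (rule the_equality)
    show "\<exists>n. \<exists>b\<in>carrier A. ?J +>\<^bsub>C\<^esub> iA m a = ?J +>\<^bsub>C\<^esub> iA n b \<and> Fr.dl m (cls a) = Fr.dl n (cls b)" using a by blast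
    fix y assume "\<exists>n. \<exists>b\<in>carrier A. ?J +>\<^bsub>C\<^esub> iA m a = ?J +>\<^bsub>C\<^esub> iA n b \<and> y = Fr.dl n (cls b)"
    then obtain n b where b: "b \<in> carrier A" "?J +>\<^bsub>C\<^esub> iA m a = ?J +>\<^bsub>C\<^esub> iA n b" "y = Fr.dl n (cls b)" by blast
    have "iA m a \<ominus>\<^bsub>C\<^esub> iA n b \<in> ?J" using b(2) LC.C.ideal_coset_eq_iff[OF Cr.J_ideal, of "iA m a" "iA n b"] a b(1) by simp
    then show "y = Fr.dl m (cls a)" using perf_eq_iff[OF a b(1)] b(3) by simp
  qed
  have rep: "\<exists>m. \<exists>a\<in>carrier A. U = ?J +>\<^bsub>C\<^esub> iA m a" if U: "U \<in> carrier (C Quot ?J)" for U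
  proof -
    obtain x where x: "x \<in> carrier C" "U = ?J +>\<^bsub>C\<^esub> x" using iffD1[OF LC.C.quot_carrier U] by (elim bexE)
    obtain m a where a: "a \<in> carrier A" "x \<ominus>\<^bsub>C\<^esub> iA m a \<in> ?J" using C_lift[OF x(1)] .
    then show ?thesis using x LC.C.ideal_coset_eq_iff[OF Cr.J_ideal x(1), of "iA m a"] by auto
  qed
  have rep2: "\<exists>m. \<exists>a\<in>carrier A. \<exists>b\<in>carrier A. U = ?J +>\<^bsub>C\<^esub> iA m a \<and> V = ?J +>\<^bsub>C\<^esub> iA m b"
    if UV: "U \<in> carrier (C Quot ?J)" "V \<in> carrier (C Quot ?J)" for U V
  proof -
    obtain m a n b where ab: "a \<in> carrier A" "U = ?J +>\<^bsub>C\<^esub> iA m a" "b \<in> carrier A" "V = ?J +>\<^bsub>C\<^esub> iA n b"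
      using rep UV by meson
    have "U = ?J +>\<^bsub>C\<^esub> iA (m + n) ((\<phi> ^^ n) a)" "V = ?J +>\<^bsub>C\<^esub> iA (m + n) ((\<phi> ^^ m) b)"
      using ab iA_step[of a m n] iA_step[of b n m] by (simp_all add: add.commute)
    then show ?thesis using ab(1,3) \<phi>_pow_closed by blast
  qed
  have hom: "h \<in> ring_hom (C Quot ?J) ?D"
  proof (rule ring_hom_memI)
    fix U assume "U \<in> carrier (C Quot ?J)"
    then show "h U \<in> carrier ?D" using rep[of U] hi clc by auto
  next
    fix U V assume "U \<in> carrier (C Quot ?J)" "V \<in> carrier (C Quot ?J)"
    then obtain m a b where ab: "a \<in> carrier A" "b \<in> carrier A" "U = ?J +>\<^bsub>C\<^esub> iA m a" "V = ?J +>\<^bsub>C\<^esub> iA m b"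
      using rep2 by blast
    have 1: "U \<otimes>\<^bsub>C Quot ?J\<^esub> V = ?J +>\<^bsub>C\<^esub> iA m (a \<otimes>\<^bsub>A\<^esub> b)" "U \<oplus>\<^bsub>C Quot ?J\<^esub> V = ?J +>\<^bsub>C\<^esub> iA m (a \<oplus>\<^bsub>A\<^esub> b)"
      unfolding ab(3,4) ring_hom_mult[OF iA_hom ab(1,2)] ring_hom_add[OF iA_hom ab(1,2)]
      using ab(1,2) by (simp_all add: LC.C.quot_mult[OF Cr.J_ideal] LC.C.quot_add[OF Cr.J_ideal])
    have 2: "h U = Fr.dl m (cls a)" "h V = Fr.dl m (cls b)" using hi ab by auto
    show "h (U \<otimes>\<^bsub>C Quot ?J\<^esub> V) = h U \<otimes>\<^bsub>?D\<^esub> h V"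
      unfolding 1 2 hi[OF A.m_closed[OF ab(1,2)]] Fr.dl_mult[OF clc[OF ab(1)] clc[OF ab(2)]]
      using ring_hom_mult[OF cls_hom ab(1,2)] by simp
    show "h (U \<oplus>\<^bsub>C Quot ?J\<^esub> V) = h U \<oplus>\<^bsub>?D\<^esub> h V"
      unfolding 1 2 hi[OF A.a_closed[OF ab(1,2)]] Fr.dl_add[OF clc[OF ab(1)] clc[OF ab(2)]]
      using ring_hom_add[OF cls_hom ab(1,2)] by simp
  next
    have "h (?J +>\<^bsub>C\<^esub> iA 0 \<one>\<^bsub>A\<^esub>) = Fr.dl 0 (cls \<one>\<^bsub>A\<^esub>)" by (rule hi) simp
    then show "h \<one>\<^bsub>C Quot ?J\<^esub> = \<one>\<^bsub>?D\<^esub>"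
      unfolding LC.C.quot_one Fr.dl_one[of 0] ring_hom_one[OF iA_hom] ring_hom_one[OF cls_hom] .
  qed
  have "inj_on h (carrier (C Quot ?J))"
  proof (rule inj_onI)
    fix U V assume UV: "U \<in> carrier (C Quot ?J)" "V \<in> carrier (C Quot ?J)" "h U = h V"
    then obtain m a b where ab: "a \<in> carrier A" "b \<in> carrier A" "U = ?J +>\<^bsub>C\<^esub> iA m a" "V = ?J +>\<^bsub>C\<^esub> iA m b"
      using rep2 by blast
    then have "iA m a \<ominus>\<^bsub>C\<^esub> iA m b \<in> ?J" using UV(3) hi perf_eq_iff[OF ab(1,2)] by simp
    then show "U = V" using ab LC.C.ideal_coset_eq_iff[OF Cr.J_ideal, of "iA m a" "iA m b"] by simp
  qed
  moreover have "h ` carrier (C Quot ?J) = carrier ?D"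
  proof
    show "h ` carrier (C Quot ?J) \<subseteq> carrier ?D" using ring_hom_closed[OF hom] by blast
    show "carrier ?D \<subseteq> h ` carrier (C Quot ?J)"
    proof
      fix y assume "y \<in> carrier ?D"
      then obtain m a where a: "a \<in> carrier A" "y = Fr.dl m (cls a)" by (auto simp: Fr.dirlim_carrier_iff cls_carrier)
      have "?J +>\<^bsub>C\<^esub> iA m a \<in> carrier (C Quot ?J)" unfolding LC.C.quot_carrier using a(1) by auto
      moreover have "y = h (?J +>\<^bsub>C\<^esub> iA m a)" using hi[OF a(1), of m] a(2) by simp
      ultimately show "y \<in> h ` carrier (C Quot ?J)" by (rule image_eqI[rotated])
    qed
  qed
  ultimately have iso: "h \<in> ring_iso (C Quot ?J) ?D" using hom by (simp add: ring_iso_def bij_betw_def)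
  show ?thesis unfolding max_extended_C perfection_def Pcirc_in_eq
  proof (rule bexI[OF _ iso], intro allI ballI)
    show "h (?J +>\<^bsub>C\<^esub> iA m a) = Fr.dl m (cls a)" if "a \<in> carrier A" for m a using that by (rule hi)
  qed
qed

end

section \<open>The perfectoid algebra\<close>

lemma ring_hom_int_pow:
  assumes "cring A" "cring B" "h \<in> ring_hom A B" "x \<in> Units A"
  shows "h (x [^]\<^bsub>A\<^esub> (a::int)) = h x [^]\<^bsub>B\<^esub> a"
proof -
  interpret A: cring A by fact
  interpret B: cring B by fact
  have inv: "h (inv\<^bsub>A\<^esub> y) = inv\<^bsub>B\<^esub> (h y)" if "y \<in> Units A" for y
  proof -
    have c: "y \<in> carrier A" "inv\<^bsub>A\<^esub> y \<in> carrier A" using that by auto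
    have "h y \<otimes>\<^bsub>B\<^esub> h (inv\<^bsub>A\<^esub> y) = \<one>\<^bsub>B\<^esub>"
      using ring_hom_mult[OF assms(3) c, symmetric] that ring_hom_one[OF assms(3)] by simp
    then show ?thesis using B.comm_inv_char ring_hom_closed[OF assms(3)] c by metis
  qed
  have pw: "h (x [^]\<^bsub>A\<^esub> n) = h x [^]\<^bsub>B\<^esub> n" for n :: nat
    using ring_hom_pow[OF assms(1-3)] assms(4) by auto
  show ?thesis
  proof (cases "a < 0")
    case True
    show ?thesis unfolding int_pow_def2 if_P[OF True] inv[OF A.Units_pow_closed[OF assms(4), of "nat (- a)"]] pw ..
  next
    case False
    show ?thesis unfolding int_pow_def2 if_not_P[OF False] pw ..
  qed
qed

lemma algebra_algebra_of:
  assumes "cring K" "cring B" "h \<in> ring_hom K B" shows "algebra K (algebra_of h B)"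
proof -
  interpret K: cring K by fact
  interpret B: cring B by fact
  have c: "r \<in> carrier K \<Longrightarrow> h r \<in> carrier B" for r using assms(3) by (rule ring_hom_closed)
  show ?thesis
    by (rule algebraI)
      (simp_all add: assms(1) algebra_of_cring[OF assms(2)] c ring_hom_add[OF assms(3)] ring_hom_mult[OF assms(3)]
        ring_hom_one[OF assms(3)] B.l_distr B.r_distr B.m_assoc)
qed

lemma frobenius_surj_mod_p:
  assumes "cring D" "\<And>x. x \<in> carrier D \<Longrightarrow> \<exists>d\<in>carrier D. pcong p 1 D x (d [^]\<^bsub>D\<^esub> p)"
  shows "frobenius_surj (mod_p p D) p"
proof -
  interpret D: cring D by fact
  note I = D.p_ideal_ideal[of p 1]
  have c: "U \<in> carrier (mod_p p D) \<longleftrightarrow> (\<exists>x\<in>carrier D. U = p_ideal p 1 D +>\<^bsub>D\<^esub> x)" for U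
    unfolding mod_p_def D.quot_carrier ..
  have pw: "(p_ideal p 1 D +>\<^bsub>D\<^esub> x) [^]\<^bsub>mod_p p D\<^esub> p = p_ideal p 1 D +>\<^bsub>D\<^esub> x [^]\<^bsub>D\<^esub> p" if "x \<in> carrier D" for x
    unfolding mod_p_def by (rule D.quot_pow[OF I that])
  show ?thesis unfolding frobenius_surj_def
  proof (intro equalityI subsetI)
    fix U assume "U \<in> (\<lambda>x. x [^]\<^bsub>mod_p p D\<^esub> p) ` carrier (mod_p p D)"
    then obtain V where V: "V \<in> carrier (mod_p p D)" "U = V [^]\<^bsub>mod_p p D\<^esub> p" by blast
    obtain x where x: "x \<in> carrier D" "V = p_ideal p 1 D +>\<^bsub>D\<^esub> x" using iffD1[OF c V(1)] by (elim bexE)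
    show "U \<in> carrier (mod_p p D)"
      unfolding V(2) x(2) pw[OF x(1)] by (rule iffD2[OF c]) (rule bexI[OF refl D.nat_pow_closed[OF x(1)]])
  next
    fix U assume U: "U \<in> carrier (mod_p p D)"
    obtain x where x: "x \<in> carrier D" "U = p_ideal p 1 D +>\<^bsub>D\<^esub> x" using iffD1[OF c U] by (elim bexE)
    obtain d where d: "d \<in> carrier D" "pcong p 1 D x (d [^]\<^bsub>D\<^esub> p)" using assms(2)[OF x(1)] by blast
    have "U = p_ideal p 1 D +>\<^bsub>D\<^esub> d [^]\<^bsub>D\<^esub> p"
      unfolding x(2) using D.p_coset_eq_iff[OF x(1)] d by simp
    then have "U = (p_ideal p 1 D +>\<^bsub>D\<^esub> d) [^]\<^bsub>mod_p p D\<^esub> p" using pw[OF d(1)] by simp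
    moreover have "p_ideal p 1 D +>\<^bsub>D\<^esub> d \<in> carrier (mod_p p D)" by (rule iffD2[OF c]) (rule bexI[OF refl d(1)])
    ultimately show "U \<in> (\<lambda>x. x [^]\<^bsub>mod_p p D\<^esub> p) ` carrier (mod_p p D)" by (rule image_eqI)
  qed
qed

context base_alg
begin

text \<open>Both rings are instances of \<open>lim_ring\<close> for the same \<open>T\<close> and
  \<open>\<Phi>\<close>, and the canonical map is compatible with the maps from the copies.\<close>

lemma completion_iso:
  "padic_map p B (dirlim_map That \<Phi>h (padic_in p T)) \<in> ring_iso (padic_completion p (Blim' RR Kc \<Phi>K A \<phi>)) (padic_completion p B)"
proof -
  let ?B' = "dirlim T \<Phi>" and ?B = "dirlim That \<Phi>h"
  have E: "ring_endo That \<Phi>h" by (rule padic_map_endo[OF T_endo])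
  interpret E: ring_endo That \<Phi>h by (rule E)
  note B' = TE.dirlim_cring and B = E.dirlim_cring
  have comm: "padic_in p T (\<Phi> x) = \<Phi>h (padic_in p T x)" if "x \<in> carrier T" for x
    by (rule padic_map_in[OF TP.T_cring TP.T_cring \<Phi>_hom that, symmetric])
  have h: "dirlim_map That \<Phi>h (padic_in p T) \<in> ring_hom ?B' ?B"
    by (rule dirlim_map_hom[where \<Phi> = \<Phi> and \<Psi> = \<Phi>h and f = "padic_in p T", OF T_endo E TP.T.padic_in_hom comm])
  have hom: "padic_map p ?B (dirlim_map That \<Phi>h (padic_in p T)) \<in> ring_hom (padic_completion p ?B') (padic_completion p ?B)"
    by (rule padic_map_hom[OF B' B h])
  have "padic_map p ?B (dirlim_map That \<Phi>h (padic_in p T)) (padic_in p ?B' (dirlim_in T \<Phi> m \<tau>))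
      = padic_in p ?B (dirlim_in That \<Phi>h m (padic_in p T \<tau>))" if "\<tau> \<in> carrier T" for m \<tau>
    by (rule trans[OF padic_map_in[OF B' B h TE.dl_closed[OF that]] arg_cong[where f = "padic_in p ?B",
      OF dirlim_map_in[where \<Phi> = \<Phi> and \<Psi> = \<Phi>h and f = "padic_in p T", OF T_endo E TP.T.padic_in_hom comm that]]])
  note bij = lim_hom_bij[OF lim_ring_completion[OF T_endo] lim_ring_completion2[OF T_endo] hom, OF this]
  show ?thesis unfolding ring_iso_def Blim_def Blim'_def using hom bij by blast
qed

section \<open>The Banach algebra P(A, phi)\<close>

abbreviation "Q \<equiv> Palg p RR Kc \<Phi>K A \<phi>"
abbreviation "nQ \<equiv> Pnorm p RR Kc \<Phi>K tK A \<phi>"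
abbreviation "K \<equiv> invert_p p Kc"
abbreviation "nK \<equiv> gauge_norm p Kc tK"
abbreviation "\<rho>P \<equiv> invert_p_map p C \<rho>"

lemma Q_eq: "Q = algebra_of \<rho>P Cg.P"
  by (simp add: Palg_def)

lemma nQ_eq: "nQ = Cg.nrm"
  by (simp add: Pnorm_def[abs_def] fun_eq_iff)

lemma \<rho>_p: "\<rho> (p_elem p Kc) = p_elem p C"
  by (rule ring_hom_p_elem[OF Kc.is_cring LC.C.is_cring \<rho>_hom])

lemma \<rho>P_hom: "\<rho>P \<in> ring_hom K Cg.P"
  unfolding invert_p_map_def Kg.P_eq Cg.P_eq
  by (rule loc_map_hom[where f = \<rho>, OF Kg.nzd_loc_axioms Cg.nzd_loc_axioms \<rho>_hom \<rho>_p])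

lemma \<rho>P_frac: "c \<in> carrier Kc \<Longrightarrow> \<rho>P (Kg.fr c k) = Cg.fr (\<rho> c) k"
  unfolding invert_p_map_def by (rule loc_map_frac[where f = \<rho>, OF Kg.nzd_loc_axioms Cg.nzd_loc_axioms \<rho>_hom \<rho>_p])

lemma \<rho>P_\<iota>: "c \<in> carrier Kc \<Longrightarrow> \<rho>P (Kg.\<iota> c) = Cg.\<iota> (\<rho> c)"
  unfolding Kg.\<iota>_eq Cg.\<iota>_eq by (rule \<rho>P_frac)

lemma \<rho>P_tp: "\<rho>P (Kg.tp m a) = Cg.tp m a"
  unfolding Kg.tp_def Cg.tp_def
  using ring_hom_int_pow[OF Kg.P.is_cring Cg.P.is_cring \<rho>P_hom Kg.\<iota>_t_unit, of m a] by (simp add: \<rho>P_\<iota>)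

text \<open>The leading part of a nonzero scalar is a unit \<open>u\<close> of \<open>K^o\<close>.
  Multiplication by \<open>\<rho> u\<close> cannot bring an element into \<open>J\<close>, so
  leading parts multiply and the norm is exactly multiplicative.\<close>

lemma nrm_smult:
  assumes "c \<in> carrier K" "x \<in> carrier Cg.P"
  shows "Cg.nrm (\<rho>P c \<otimes>\<^bsub>Cg.P\<^esub> x) = nK c * Cg.nrm x"
proof (cases "c = \<zero>\<^bsub>K\<^esub> \<or> x = \<zero>\<^bsub>Cg.P\<^esub>")
  case True
  then show ?thesis
    using assms ring_hom_zero'[OF Kg.P.is_cring Cg.P.is_cring \<rho>P_hom] ring_hom_closed[OF \<rho>P_hom assms(1)] by auto
next
  case False
  then have False: "c \<noteq> \<zero>\<^bsub>K\<^esub> \<and> x \<noteq> \<zero>\<^bsub>Cg.P\<^esub>" by simp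
  obtain m a u where u: "u \<in> carrier Kc" "u \<notin> tideal Kc tK" "c = Kg.tp m a \<otimes>\<^bsub>K\<^esub> Kg.\<iota> u"
    using Kg.P_leading[OF assms(1) conjunct1[OF False]] .
  obtain l b y where y: "y \<in> carrier C" "y \<notin> tideal C tC" "x = Cg.tp l b \<otimes>\<^bsub>Cg.P\<^esub> Cg.\<iota> y"
    using Cg.P_leading[OF assms(2) conjunct2[OF False]] .
  have \<rho>u: "\<rho> u \<in> carrier C" using ring_hom_closed[OF \<rho>_hom u(1)] .
  have nJ: "\<rho> u \<otimes>\<^bsub>C\<^esub> y \<notin> tideal C tC"
  proof
    assume J: "\<rho> u \<otimes>\<^bsub>C\<^esub> y \<in> tideal C tC"
    obtain v where v: "v \<in> carrier Kc" "v \<otimes>\<^bsub>Kc\<^esub> u = \<one>\<^bsub>Kc\<^esub>" using Kg.J_units[OF u(1,2)] unfolding Units_def by blast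
    have \<rho>v: "\<rho> v \<in> carrier C" using ring_hom_closed[OF \<rho>_hom v(1)] .
    have "\<rho> v \<otimes>\<^bsub>C\<^esub> \<rho> u = \<one>\<^bsub>C\<^esub>" using ring_hom_mult[OF \<rho>_hom v(1) u(1)] v(2) ring_hom_one[OF \<rho>_hom] by simp
    then have "\<rho> v \<otimes>\<^bsub>C\<^esub> (\<rho> u \<otimes>\<^bsub>C\<^esub> y) = y"
      unfolding LC.C.m_assoc[OF \<rho>v \<rho>u y(1), symmetric] using y(1) by simp
    then show False using Cr.J.I_l_closed[OF J \<rho>v] y(2) by simp
  qed
  have "\<rho>P c = Cg.tp m a \<otimes>\<^bsub>Cg.P\<^esub> Cg.\<iota> (\<rho> u)"
    unfolding u(3) ring_hom_mult[OF \<rho>P_hom Kg.tp_closed Kg.\<iota>_closed[OF u(1)]] \<rho>P_tp \<rho>P_\<iota>[OF u(1)] ..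
  then show ?thesis
    unfolding u(3) y(3) using Cg.nrm_mult_eq[OF \<rho>u y(1) nJ, of m a l b] Kg.nrm_exact[OF u(1,2), of m a] Cg.nrm_exact[OF y(1,2), of l b]
    by simp
qed

lemma Q_banach: "banach_algebra K nK Q nQ"
  unfolding banach_algebra_def
proof (intro conjI)
  show "nonarch_field K nK" by (rule Kg.nonarch)
  show "algebra K Q" unfolding Q_eq by (rule algebra_algebra_of[OF Kg.P.is_cring Cg.P.is_cring \<rho>P_hom])
  show "norm_complete Q nQ" using Cg.norm_complete unfolding Q_eq nQ_eq norm_complete_def by simp
qed (simp_all add: Q_eq nQ_eq Cg.nrm_nonneg nrm_smult Cg.nrm_add Cg.nrm_mult_le)

lemma power_bounded_Q: "power_bounded Q nQ = Cg.\<iota> ` carrier C"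
  using Cg.power_bounded_eq unfolding Q_eq nQ_eq power_bounded_def by simp

section \<open>Power-bounded elements of P(A, phi)\<close>

abbreviation "Q0 \<equiv> power_bounded_ring Q nQ"

lemma \<iota>_Q0_iso: "Cg.\<iota> \<in> ring_iso C Q0"
proof -
  have "Cg.\<iota> \<in> ring_hom C Q0"
  proof (rule ring_hom_memI)
    show "Cg.\<iota> x \<in> carrier Q0" if "x \<in> carrier C" for x using that by (simp add: power_bounded_Q)
  qed (simp_all add: Cg.\<iota>_mult Cg.\<iota>_add Cg.\<iota>_one Q_eq)
  moreover have "inj_on Cg.\<iota> (carrier C)" by (rule inj_onI) (simp add: Cg.\<iota>_inj)
  ultimately show ?thesis by (simp add: ring_iso_def bij_betw_def power_bounded_Q)
qed

lemma \<iota>_Q0_hom: "Cg.\<iota> \<in> ring_hom C Q0"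
  using \<iota>_Q0_iso by (simp add: ring_iso_def)

lemma Q0_cring: "cring Q0"
proof -
  have "Cg.\<iota> \<zero>\<^bsub>C\<^esub> = \<zero>\<^bsub>Q0\<^esub>" by (simp add: Q_eq Cg.\<iota>_zero)
  then have "Q0\<lparr>ring.zero := Cg.\<iota> \<zero>\<^bsub>C\<^esub>\<rparr> = Q0" by simp
  then show ?thesis using LC.C.ring_iso_imp_img_cring[OF \<iota>_Q0_iso] by simp
qed

lemma Q_perfectoid: "perfectoid_algebra p K nK Q nQ"
  unfolding perfectoid_algebra_def
proof (intro conjI)
  show "banach_algebra K nK Q nQ" by (rule Q_banach)
  have "nQ x \<le> 1" if "x \<in> power_bounded Q nQ" for x
  proof -
    have x: "x \<in> Cg.\<iota> ` carrier C" using that unfolding power_bounded_Q .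
    then have "x \<in> carrier Cg.P" by auto
    from Cg.nrm_le_iff[OF this, of 0 0] show ?thesis using x Cg.ball_00 p0 by (simp add: nQ_eq)
  qed
  then show "\<exists>M. \<forall>x\<in>power_bounded Q nQ. nQ x \<le> M" by blast
  show "frobenius_surj (mod_p p Q0) p"
  proof (rule frobenius_surj_mod_p[OF Q0_cring])
    fix x assume "x \<in> carrier Q0"
    then obtain c where c: "c \<in> carrier C" "x = Cg.\<iota> c" using power_bounded_Q by auto
    obtain d where d: "d \<in> carrier C" "pcong p 1 C c (d [^]\<^bsub>C\<^esub> p)" using C_frob_surj[OF c(1)] by blast
    have "pcong p 1 Q0 x (Cg.\<iota> d [^]\<^bsub>Q0\<^esub> p)"
      using ring_hom_pcong[OF LC.C.is_cring Q0_cring \<iota>_Q0_hom d(2)] c(2)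
      unfolding ring_hom_pow[OF LC.C.is_cring Q0_cring \<iota>_Q0_hom d(1)] by simp
    then show "\<exists>d\<in>carrier Q0. pcong p 1 Q0 x (d [^]\<^bsub>Q0\<^esub> p)" using ring_hom_closed[OF \<iota>_Q0_hom d(1)] by blast
  qed
qed

abbreviation "QA \<equiv> power_bounded_algebra p Kc Q nQ"

lemma QA_smult: "c \<in> carrier Kc \<Longrightarrow> c \<odot>\<^bsub>QA\<^esub> \<one>\<^bsub>QA\<^esub> = Cg.\<iota> (\<rho> c)"
  using ring_hom_closed[OF \<rho>_hom, of c] by (simp add: power_bounded_algebra_def Q_eq \<rho>P_\<iota> del: One_nat_def)

lemma QA_cring: "cring QA" and \<iota>_QA_hom: "Cg.\<iota> \<in> ring_hom C QA" and QA_carrier: "carrier QA = Cg.\<iota> ` carrier C"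
  unfolding power_bounded_algebra_def using algebra_of_cring[OF Q0_cring] \<iota>_Q0_hom power_bounded_Q by simp_all

text \<open>\<open>K^o\<close> acts on the power-bounded elements through \<open>\<rho>\<close>, so
  the image of a root, and of any multiple of it, lies in the ideal generated by the maximal ideal
  of \<open>K^o\<close>.\<close>

lemma \<iota>_J_QA:
  assumes "x \<in> tideal C tC" shows "Cg.\<iota> x \<in> max_extended Kc QA"
proof -
  interpret QA: cring QA by (rule QA_cring)
  let ?G = "(\<lambda>c. c \<odot>\<^bsub>QA\<^esub> \<one>\<^bsub>QA\<^esub>) ` max_ideal Kc"
  have G: "?G \<subseteq> carrier QA"
    using Kr.J.a_subset ring_hom_closed[OF \<rho>_hom] ring_hom_closed[OF \<iota>_QA_hom] QA_smult by (auto simp: Kg.max_ideal_eq)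
  obtain m y where y: "y \<in> carrier C" "x = tC m \<otimes>\<^bsub>C\<^esub> y" using assms by (rule Cr.J_E)
  have "tK m \<in> max_ideal Kc" unfolding Kg.max_ideal_eq using Kr.J_I[OF Kc.one_closed, of m] by simp
  then have "tK m \<odot>\<^bsub>QA\<^esub> \<one>\<^bsub>QA\<^esub> \<in> Idl\<^bsub>QA\<^esub> ?G" using QA.genideal_self[OF G] by blast
  then have "Cg.\<iota> (tC m) \<in> Idl\<^bsub>QA\<^esub> ?G" using QA_smult[of "tK m"] by simp
  then have "Cg.\<iota> (tC m) \<otimes>\<^bsub>QA\<^esub> Cg.\<iota> y \<in> Idl\<^bsub>QA\<^esub> ?G"
    by (rule ideal.I_r_closed[OF QA.genideal_ideal[OF G] _ ring_hom_closed[OF \<iota>_QA_hom y(1)]])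
  then show ?thesis
    unfolding y(2) max_extended_def ring_hom_mult[OF \<iota>_QA_hom Cr.t_closed y(1)] .
qed

end

section \<open>Induced maps\<close>

lemma (in gauge_ring) nzd: "nzd_loc C (p_elem p C)" by (rule nzd_loc_axioms)

locale gauge_hom = X: gauge_ring C p t + Y: gauge_ring C' p t'
  for C :: "('c, 'm) ring_scheme" and p and t and C' :: "('d, 'n) ring_scheme" and t' +
  fixes M :: "'c \<Rightarrow> 'd"
  assumes M_hom: "M \<in> ring_hom C C'" and M_t: "M (t m) = t' m"
begin

abbreviation "MP \<equiv> invert_p_map p C' M"

lemma M_p: "M (p_elem p C) = p_elem p C'"
  by (rule ring_hom_p_elem[OF X.is_cring Y.is_cring M_hom])

lemma MP_hom: "MP \<in> ring_hom X.P Y.P"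
  unfolding invert_p_map_def X.P_eq Y.P_eq by (rule loc_map_hom[OF X.nzd_loc_axioms Y.nzd_loc_axioms M_hom M_p])

lemma MP_fr: "c \<in> carrier C \<Longrightarrow> MP (X.fr c k) = Y.fr (M c) k"
  unfolding invert_p_map_def by (rule loc_map_frac[OF X.nzd_loc_axioms Y.nzd_loc_axioms M_hom M_p])

lemma MP_\<iota>: "c \<in> carrier C \<Longrightarrow> MP (X.\<iota> c) = Y.\<iota> (M c)"
  unfolding X.\<iota>_eq Y.\<iota>_eq by (rule MP_fr)

lemma MP_tp: "MP (X.tp m a) = Y.tp m a"
  unfolding X.tp_def Y.tp_def
  using ring_hom_int_pow[OF X.P.is_cring Y.P.is_cring MP_hom X.\<iota>_t_unit, of m a] by (simp add: MP_\<iota> M_t)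

text \<open>Powers of roots go to the same powers and \<open>C\<close> goes into \<open>C'\<close>,
  hence balls go into balls of the same radius.\<close>

lemma MP_nrm_le:
  assumes "x \<in> carrier X.P" shows "Y.nrm (MP x) \<le> X.nrm x"
proof (cases "x = \<zero>\<^bsub>X.P\<^esub>")
  case True
  then show ?thesis using ring_hom_zero'[OF X.P.is_cring Y.P.is_cring MP_hom] by simp
next
  case False
  obtain m a y where y: "y \<in> carrier C" "y \<notin> tideal C t" "x = X.tp m a \<otimes>\<^bsub>X.P\<^esub> X.\<iota> y"
    using X.P_leading[OF assms False] .
  have "MP x = Y.tp m a \<otimes>\<^bsub>Y.P\<^esub> Y.\<iota> (M y)"
    unfolding y(3) ring_hom_mult[OF MP_hom X.tp_closed X.\<iota>_closed[OF y(1)]] MP_tp MP_\<iota>[OF y(1)] ..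
  then have "MP x \<in> Y.ball m a" unfolding Y.ball_def using ring_hom_closed[OF M_hom y(1)] by blast
  then show ?thesis
    unfolding y(3) X.nrm_exact[OF y(1,2)] using Y.nrm_le_iff[OF Y.ball_closed] unfolding y(3) by blast
qed

lemma MP_surj:
  assumes "M ` carrier C = carrier C'" shows "MP ` carrier X.P = carrier Y.P"
proof
  show "MP ` carrier X.P \<subseteq> carrier Y.P" using ring_hom_closed[OF MP_hom] by blast
  show "carrier Y.P \<subseteq> MP ` carrier X.P"
  proof
    fix y assume "y \<in> carrier Y.P"
    then obtain c k where c: "c \<in> carrier C'" "y = Y.fr c k" unfolding Y.P_eq by (auto simp: Y.loc_carrier_iff)
    obtain b where b: "b \<in> carrier C" "c = M b" using c(1) assms by blast
    have "X.fr b k \<in> carrier X.P" unfolding X.P_eq using b(1) by (auto simp: X.loc_carrier_iff)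
    then show "y \<in> MP ` carrier X.P" using MP_fr[OF b(1), of k] b(2) c(2) by (intro image_eqI[of _ _ "X.fr b k"]) auto
  qed
qed

end

text \<open>Completion, limit and second completion are functorial in turn. Commutation with the
  endomorphisms has to pass through the first completion, where it is checked on representing
  sequences.\<close>

lemma lim_map:
  fixes p :: nat
  assumes "ring_endo T \<Phi>" "ring_endo T' \<Phi>'" "f \<in> ring_hom T T'"
    and comm: "\<And>x. x \<in> carrier T \<Longrightarrow> f (\<Phi> x) = \<Phi>' (f x)"
  defines "D \<equiv> dirlim (padic_completion p T) (padic_map p T \<Phi>)"
    and "D' \<equiv> dirlim (padic_completion p T') (padic_map p T' \<Phi>')"
    and "M \<equiv> padic_map p (dirlim (padic_completion p T') (padic_map p T' \<Phi>'))
      (dirlim_map (padic_completion p T') (padic_map p T' \<Phi>') (padic_map p T' f))"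
  shows "M \<in> ring_hom (padic_completion p D) (padic_completion p D')"
    and "\<tau> \<in> carrier T \<Longrightarrow>
      M (padic_in p D (dirlim_in (padic_completion p T) (padic_map p T \<Phi>) m (padic_in p T \<tau>)))
      = padic_in p D' (dirlim_in (padic_completion p T') (padic_map p T' \<Phi>') m (padic_in p T' (f \<tau>)))"
proof -
  interpret X: ring_endo T \<Phi> by fact
  interpret Y: ring_endo T' \<Phi>' by fact
  let ?\<Phi>h = "padic_map p T \<Phi>" and ?\<Phi>h' = "padic_map p T' \<Phi>'" and ?f = "padic_map p T' f"
  have E: "ring_endo (padic_completion p T) ?\<Phi>h" by (rule padic_map_endo[OF assms(1)])
  have E': "ring_endo (padic_completion p T') ?\<Phi>h'" by (rule padic_map_endo[OF assms(2)])
  have T: "cring T" "cring T'" by (rule X.is_cring, rule Y.is_cring)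
  note fh = padic_map_hom[OF T assms(3), of p]
  have commh: "?f (?\<Phi>h s) = ?\<Phi>h' (?f s)" if s: "s \<in> carrier (padic_completion p T)" for s
  proof -
    obtain a where a: "pcoh p T a" "s = pseq p T a" using X.completionE[OF s] .
    note 1 = padic_map_pseq[OF T(1,1) X.endo a(1)] and 2 = padic_map_pseq[OF T assms(3) a(1)]
    have "(\<lambda>n. f (\<Phi> (a n))) = (\<lambda>n. \<Phi>' (f (a n)))" using comm X.pcoh_closed[OF a(1)] by (simp add: fun_eq_iff)
    then show ?thesis
      unfolding a(2) 1(1) 2(1) padic_map_pseq(1)[OF T assms(3) 1(2)] padic_map_pseq(1)[OF T(2,2) Y.endo 2(2)] by simp
  qed
  note dh = dirlim_map_hom[where \<Phi> = ?\<Phi>h and \<Psi> = ?\<Phi>h' and f = ?f, OF E E' fh commh]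
  note D = ring_endo.dirlim_cring[OF E] ring_endo.dirlim_cring[OF E']
  show "M \<in> ring_hom (padic_completion p D) (padic_completion p D')"
    unfolding M_def D_def D'_def by (rule padic_map_hom[OF D dh])
  assume \<tau>: "\<tau> \<in> carrier T"
  have \<tau>h: "padic_in p T \<tau> \<in> carrier (padic_completion p T)" by (rule ring_hom_closed[OF X.padic_in_hom \<tau>])
  show "M (padic_in p D (dirlim_in (padic_completion p T) ?\<Phi>h m (padic_in p T \<tau>)))
      = padic_in p D' (dirlim_in (padic_completion p T') ?\<Phi>h' m (padic_in p T' (f \<tau>)))"
    unfolding M_def D_def D'_def padic_map_in[OF T assms(3) \<tau>, symmetric]
    by (rule trans[OF padic_map_in[OF D dh ring_endo.dl_closed[OF E \<tau>h]] arg_cong[where f = "padic_in p _",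
      OF dirlim_map_in[where \<Phi> = ?\<Phi>h and \<Psi> = ?\<Phi>h' and f = ?f, OF E E' fh commh \<tau>h]]])
qed

context base_data
begin

lemma Kr_root: "root_ring Kc p tK" by (rule Kr.root_ring_axioms)

lemma Kc_gauge: "gauge_ring Kc p tK" by (rule Kg.gauge_ring_axioms)

end

context base_alg
begin

lemma T_pair: "tensor_pair RR A Kc" by (rule TP.tensor_pair_axioms)

lemma C_gauge: "gauge_ring C p tC" by (rule Cg.gauge_ring_axioms)

end

text \<open>A pair of maps on \<open>A\<close> and on \<open>K^o\<close>, semilinear over a common
  self-map \<open>\<sigma>\<close> of \<open>R\<close>, commuting with the Frobenius lifts and
  fixing the roots. The Frobenius lift of \<open>P\<close> (from \<open>\<phi>\<close>,
  \<open>\<Phi>K\<close>, \<open>\<phi>R\<close>) and the action on morphisms (with identities on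
  \<open>K^o\<close> and \<open>R\<close>) are both instances, so they share one
  construction.\<close>

locale alg_map =
  fixes p :: nat and L :: "('l, 'm) ring_scheme" and R w \<phi>R \<Phi>K
    and A :: "('l, 'a, 'n) module_scheme" and \<phi> and A' :: "('l, 'b, 'o) module_scheme" and \<phi>' f g \<sigma>
  assumes X: "base_alg p L R w \<phi>R \<Phi>K A \<phi>" and Y: "base_alg p L R w \<phi>R \<Phi>K A' \<phi>'"
    and f_hom: "f \<in> ring_hom A A'" and g_hom: "g \<in> ring_hom (Kcirc p L R w) (Kcirc p L R w)"
    and \<sigma>_closed: "r \<in> R \<Longrightarrow> \<sigma> r \<in> R"
    and f_smult: "r \<in> R \<Longrightarrow> a \<in> carrier A \<Longrightarrow> f (r \<odot>\<^bsub>A\<^esub> a) = \<sigma> r \<odot>\<^bsub>A'\<^esub> f a"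
    and g_smult: "r \<in> R \<Longrightarrow> c \<in> carrier (Kcirc p L R w) \<Longrightarrow>
      g (r \<odot>\<^bsub>Kcirc p L R w\<^esub> c) = \<sigma> r \<odot>\<^bsub>Kcirc p L R w\<^esub> g c"
    and f_\<phi>: "a \<in> carrier A \<Longrightarrow> f (\<phi> a) = \<phi>' (f a)"
    and g_\<Phi>: "c \<in> carrier (Kcirc p L R w) \<Longrightarrow> g (\<Phi>K c) = \<Phi>K (g c)"
    and g_t: "g (Kcirc_root p L R w m) = Kcirc_root p L R w m"
begin

abbreviation "RR \<equiv> L\<lparr>carrier := R\<rparr>"
abbreviation "Kc \<equiv> Kcirc p L R w"
abbreviation "tK \<equiv> Kcirc_root p L R w"
abbreviation "T \<equiv> tensor RR A Kc"
abbreviation "T' \<equiv> tensor RR A' Kc"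
abbreviation "\<Phi> \<equiv> Phi RR Kc \<Phi>K A \<phi>"
abbreviation "\<Phi>' \<equiv> Phi RR Kc \<Phi>K A' \<phi>'"
abbreviation "C \<equiv> Pcirc p RR Kc \<Phi>K A \<phi>"
abbreviation "C' \<equiv> Pcirc p RR Kc \<Phi>K A' \<phi>'"
abbreviation "i \<equiv> base_alg.i p L R w \<Phi>K A \<phi>"
abbreviation "i' \<equiv> base_alg.i p L R w \<Phi>K A' \<phi>'"
abbreviation "tm \<equiv> tensor_map RR A' Kc f g"
abbreviation "M \<equiv> padic_map p (Blim p RR Kc \<Phi>K A' \<phi>')
  (dirlim_map (Ahat p RR Kc A') (Phi_hat p RR Kc \<Phi>K A' \<phi>') (padic_map p T' tm))"

lemma tm_hom: "tm \<in> ring_hom T T'"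
  by (rule tensor_map_hom[where \<sigma> = \<sigma>, OF base_alg.T_pair[OF X] base_alg.T_pair[OF Y] f_hom g_hom])
    (simp_all add: \<sigma>_closed f_smult g_smult)

lemma tm_tin:
  "a \<in> carrier A \<Longrightarrow> c \<in> carrier Kc \<Longrightarrow> tm (tensor_in RR A Kc a c) = tensor_in RR A' Kc (f a) (g c)"
  by (rule tensor_map_in[where \<sigma> = \<sigma>, OF base_alg.T_pair[OF X] base_alg.T_pair[OF Y] f_hom g_hom])
    (simp_all add: \<sigma>_closed f_smult g_smult)

lemma tm_\<Phi>:
  assumes "x \<in> carrier T" shows "tm (\<Phi> x) = \<Phi>' (tm x)"
proof -
  note fc = ring_hom_closed[OF f_hom] and gc = ring_hom_closed[OF g_hom] and hc = ring_hom_closed[OF tm_hom]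
  note \<phi>c = ring_hom_closed[OF base_alg.\<phi>_hom[OF X]]
  note Kc = ring_hom_closed[OF base_data.\<Phi>K_hom[OF base_alg.axioms(1)[OF X]]]
  note \<Phi>c = ring_hom_closed[OF base_alg.\<Phi>_hom[OF X]]
  show ?thesis
  proof (rule tensor_pair.T_induct[OF base_alg.T_pair[OF X] assms])
    fix a c assume ac: "a \<in> carrier A" "c \<in> carrier Kc"
    show "tm (\<Phi> (tensor_in RR A Kc a c)) = \<Phi>' (tm (tensor_in RR A Kc a c))"
      unfolding base_alg.\<Phi>_tin[OF X ac] tm_tin[OF ac] tm_tin[OF \<phi>c[OF ac(1)] Kc[OF ac(2)]]
        base_alg.\<Phi>_tin[OF Y fc[OF ac(1)] gc[OF ac(2)]] f_\<phi>[OF ac(1)] g_\<Phi>[OF ac(2)] ..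
  next
    fix x y assume xy: "x \<in> carrier T" "y \<in> carrier T" "tm (\<Phi> x) = \<Phi>' (tm x)" "tm (\<Phi> y) = \<Phi>' (tm y)"
    show "tm (\<Phi> (x \<oplus>\<^bsub>T\<^esub> y)) = \<Phi>' (tm (x \<oplus>\<^bsub>T\<^esub> y))"
      unfolding ring_hom_add[OF base_alg.\<Phi>_hom[OF X] xy(1,2)] ring_hom_add[OF tm_hom xy(1,2)]
        ring_hom_add[OF tm_hom \<Phi>c[OF xy(1)] \<Phi>c[OF xy(2)]]
        ring_hom_add[OF base_alg.\<Phi>_hom[OF Y] hc[OF xy(1)] hc[OF xy(2)]] xy(3,4) ..
  qed
qed

lemma M_hom: "M \<in> ring_hom C C'"
  using lim_map(1)[where f = tm, OF base_alg.T_endo[OF X] base_alg.T_endo[OF Y] tm_hom tm_\<Phi>, where p = p]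
  by (simp add: Pcirc_def Blim_def)

lemma M_i: "\<tau> \<in> carrier T \<Longrightarrow> M (i m \<tau>) = i' m (tm \<tau>)"
  unfolding base_alg.i_def[OF X] base_alg.i_def[OF Y] Blim_def
  by (rule lim_map(2)[where f = tm, OF base_alg.T_endo[OF X] base_alg.T_endo[OF Y] tm_hom tm_\<Phi>])

lemma M_\<rho>:
  assumes "c \<in> carrier Kc" shows "M (c \<odot>\<^bsub>C\<^esub> \<one>\<^bsub>C\<^esub>) = g c \<odot>\<^bsub>C'\<^esub> \<one>\<^bsub>C'\<^esub>"
proof -
  note gc = ring_hom_closed[OF g_hom assms]
  note 1 = ring_hom_closed[OF tensor_pair.tin_hom2[OF base_alg.T_pair[OF X]] assms]
  have o: "\<one>\<^bsub>A\<^esub> \<in> carrier A" using ring_hom_one[OF base_alg.\<phi>_hom[OF X]] cring.axioms(1)[OF base_alg.A_cring[OF X]]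
    by (metis monoid.one_closed ring.is_monoid)
  show ?thesis
    unfolding base_alg.\<rho>_eq[OF X assms] base_alg.\<rho>_eq[OF Y gc] M_i[OF 1] tm_tin[OF o assms] ring_hom_one[OF f_hom] ..
qed

lemma M_gauge: "gauge_hom C p (\<lambda>m. tK m \<odot>\<^bsub>C\<^esub> \<one>\<^bsub>C\<^esub>) C' (\<lambda>m. tK m \<odot>\<^bsub>C'\<^esub> \<one>\<^bsub>C'\<^esub>) M"
proof -
  have "tK m \<in> carrier Kc" for m
    by (rule root_ring.t_closed[OF base_data.Kr_root[OF base_alg.axioms(1)[OF X]]])
  then show ?thesis
    using base_alg.C_gauge[OF X] base_alg.C_gauge[OF Y] M_hom M_\<rho> g_t by (simp add: gauge_hom_def gauge_hom_axioms_def)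
qed

abbreviation "PM \<equiv> Pinduced p RR Kc \<Phi>K A' \<phi>' f g"
abbreviation "Q \<equiv> Palg p RR Kc \<Phi>K A \<phi>"
abbreviation "Q' \<equiv> Palg p RR Kc \<Phi>K A' \<phi>'"

lemma PM_hom: "PM \<in> ring_hom Q Q'"
  unfolding Pinduced_def base_alg.Q_eq[OF X] base_alg.Q_eq[OF Y] algebra_of_derived
  by (rule gauge_hom.MP_hom[OF M_gauge])

lemma PM_nrm_le: "x \<in> carrier Q \<Longrightarrow> Pnorm p RR Kc \<Phi>K tK A' \<phi>' (PM x) \<le> Pnorm p RR Kc \<Phi>K tK A \<phi> x"
  unfolding Pinduced_def base_alg.Q_eq[OF X] algebra_of_simps base_alg.nQ_eq[OF X] base_alg.nQ_eq[OF Y]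
  by (rule gauge_hom.MP_nrm_le[OF M_gauge])

lemma PM_\<iota>: "c \<in> carrier C \<Longrightarrow> PM (invert_p_in p C c) = invert_p_in p C' (M c)"
  unfolding Pinduced_def by (rule gauge_hom.MP_\<iota>[OF M_gauge])

lemma PM_fr: "c \<in> carrier C \<Longrightarrow> PM (loc_frac C (p_elem p C) c k) = loc_frac C' (p_elem p C') (M c) k"
  unfolding Pinduced_def by (rule gauge_hom.MP_fr[OF M_gauge])

lemma Q_rep:
  assumes "x \<in> carrier Q" obtains c k where "c \<in> carrier C" "x = loc_frac C (p_elem p C) c k"
  using assms nzd_loc.loc_carrier_iff[OF gauge_ring.nzd[OF base_alg.C_gauge[OF X]]]
  unfolding base_alg.Q_eq[OF X] algebra_of_simps invert_p_def by blast

lemma PM_\<rho>P: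
  assumes g: "\<And>c. c \<in> carrier Kc \<Longrightarrow> g c = c" and c: "c \<in> carrier (invert_p p Kc)"
  shows "PM (base_alg.\<rho>P p L R w \<Phi>K A \<phi> c) = base_alg.\<rho>P p L R w \<Phi>K A' \<phi>' c"
proof -
  obtain b k where b: "b \<in> carrier Kc" "c = loc_frac Kc (p_elem p Kc) b k"
    using c nzd_loc.loc_carrier_iff[OF gauge_ring.nzd[OF base_data.Kc_gauge[OF base_alg.axioms(1)[OF X]]]]
    unfolding invert_p_def by blast
  show ?thesis
    unfolding b(2) base_alg.\<rho>P_frac[OF X b(1)] base_alg.\<rho>P_frac[OF Y b(1)]
      PM_fr[OF ring_hom_closed[OF base_alg.\<rho>_hom[OF X] b(1)]] M_\<rho>[OF b(1)] g[OF b(1)] ..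
qed

lemma PM_smult:
  assumes g: "\<And>c. c \<in> carrier Kc \<Longrightarrow> g c = c" and c: "c \<in> carrier (invert_p p Kc)" and x: "x \<in> carrier Q"
  shows "PM (c \<odot>\<^bsub>Q\<^esub> x) = c \<odot>\<^bsub>Q'\<^esub> PM x"
proof -
  have h: "PM \<in> ring_hom (invert_p p C) (invert_p p C')"
    unfolding Pinduced_def by (rule gauge_hom.MP_hom[OF M_gauge])
  have x': "x \<in> carrier (invert_p p C)" using x unfolding base_alg.Q_eq[OF X] algebra_of_simps .
  show ?thesis
    unfolding base_alg.Q_eq[OF X] base_alg.Q_eq[OF Y] algebra_of_simps
      ring_hom_mult[OF h ring_hom_closed[OF base_alg.\<rho>P_hom[OF X] c] x']
    by (rule arg_cong[where f = "\<lambda>y. y \<otimes>\<^bsub>invert_p p C'\<^esub> PM x", OF PM_\<rho>P[OF g c]])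
qed

text \<open>A tensor \<open>f a \<otimes> g c\<close> is the image of \<open>a \<otimes> c\<close>,
  so the map of tensor products is onto. \<open>lim_hom_surj\<close> passes to the completed limit,
  and fractions are lifted through their numerators.\<close>

lemma PM_surj:
  assumes f: "f ` carrier A = carrier A'" and g: "g ` carrier Kc = carrier Kc"
  shows "PM ` carrier Q = carrier Q'"
proof -
  have "carrier T' \<subseteq> tm ` carrier T"
  proof
    fix y assume "y \<in> carrier T'"
    then show "y \<in> tm ` carrier T"
    proof (rule tensor_pair.T_induct[OF base_alg.T_pair[OF Y]])
      fix b d assume "b \<in> carrier A'" "d \<in> carrier Kc"
      then obtain a c where ac: "a \<in> carrier A" "c \<in> carrier Kc" "b = f a" "d = g c" using f g by blast
      show "tensor_in RR A' Kc b d \<in> tm ` carrier T"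
        unfolding ac(3,4) tm_tin[OF ac(1,2), symmetric]
        by (rule imageI) (rule tensor_pair.tin_closed[OF base_alg.T_pair[OF X] ac(1,2)])
    next
      fix x y assume "x \<in> tm ` carrier T" "y \<in> tm ` carrier T"
      then obtain u v where uv: "u \<in> carrier T" "v \<in> carrier T" "x = tm u" "y = tm v" by blast
      have "u \<oplus>\<^bsub>T\<^esub> v \<in> carrier T"
        by (rule abelian_monoid.a_closed[OF abelian_group.axioms(1)[OF ring.is_abelian_group[OF
          cring.axioms(1)[OF tensor_pair.T_cring[OF base_alg.T_pair[OF X]]]]] uv(1,2)])
      then show "x \<oplus>\<^bsub>T'\<^esub> y \<in> tm ` carrier T"
        unfolding uv(3,4) ring_hom_add[OF tm_hom uv(1,2), symmetric] by (rule imageI)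
    qed
  qed
  then have tm: "tm ` carrier T = carrier T'" using ring_hom_closed[OF tm_hom] by blast
  have "M ` carrier C = carrier C'"
    by (rule lim_hom_surj[where f = tm and i = i and i' = i' and G = M, OF base_alg.C_lim[OF X] base_alg.C_lim[OF Y] M_hom M_i tm])
  then show ?thesis
    unfolding Pinduced_def base_alg.Q_eq[OF X] base_alg.Q_eq[OF Y] algebra_of_simps
    by (rule gauge_hom.MP_surj[OF M_gauge])
qed

end

text \<open>Both sides are determined on the tensor products, where they agree on pure tensors. The
  third pair need only agree with the composite on carriers, which accommodates extensional
  composites as well as the two sides of a commuting square.\<close>

lemma alg_map_comp:
  assumes 1: "alg_map p L R w \<phi>R \<Phi>K A1 \<phi>1 A2 \<phi>2 f1 g1 \<sigma>1" and 2: "alg_map p L R w \<phi>R \<Phi>K A2 \<phi>2 A3 \<phi>3 f2 g2 \<sigma>2"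
    and 3: "alg_map p L R w \<phi>R \<Phi>K A1 \<phi>1 A3 \<phi>3 f3 g3 \<sigma>3"
    and f: "\<And>a. a \<in> carrier A1 \<Longrightarrow> f3 a = f2 (f1 a)" and g: "\<And>c. c \<in> carrier (Kcirc p L R w) \<Longrightarrow> g3 c = g2 (g1 c)"
    and x: "x \<in> carrier (alg_map.Q p L R w \<Phi>K A1 \<phi>1)"
  shows "alg_map.PM p L R w \<Phi>K A3 \<phi>3 f3 g3 x
    = alg_map.PM p L R w \<Phi>K A3 \<phi>3 f2 g2 (alg_map.PM p L R w \<Phi>K A2 \<phi>2 f1 g1 x)"
proof -
  let ?tm1 = "tensor_map (L\<lparr>carrier := R\<rparr>) A2 (Kcirc p L R w) f1 g1"
  let ?tm2 = "tensor_map (L\<lparr>carrier := R\<rparr>) A3 (Kcirc p L R w) f2 g2"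
  let ?tm3 = "tensor_map (L\<lparr>carrier := R\<rparr>) A3 (Kcirc p L R w) f3 g3"
  let ?T = "tensor (L\<lparr>carrier := R\<rparr>) A1 (Kcirc p L R w)"
  let ?M1 = "alg_map.M p L R w \<Phi>K A2 \<phi>2 f1 g1" and ?M2 = "alg_map.M p L R w \<Phi>K A3 \<phi>3 f2 g2"
    and ?M3 = "alg_map.M p L R w \<Phi>K A3 \<phi>3 f3 g3"
  note X = alg_map.X[OF 1] and h1 = alg_map.tm_hom[OF 1] and h2 = alg_map.tm_hom[OF 2] and h3 = alg_map.tm_hom[OF 3]
  have tm: "?tm3 \<tau> = ?tm2 (?tm1 \<tau>)" if "\<tau> \<in> carrier ?T" for \<tau>
  proof (rule tensor_pair.T_induct[OF base_alg.T_pair[OF X] that])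
    fix a c assume ac: "a \<in> carrier A1" "c \<in> carrier (Kcirc p L R w)"
    note ac' = ring_hom_closed[OF alg_map.f_hom[OF 1] ac(1)] ring_hom_closed[OF alg_map.g_hom[OF 1] ac(2)]
    show "?tm3 (tensor_in (L\<lparr>carrier := R\<rparr>) A1 (Kcirc p L R w) a c) =
        ?tm2 (?tm1 (tensor_in (L\<lparr>carrier := R\<rparr>) A1 (Kcirc p L R w) a c))"
      unfolding alg_map.tm_tin[OF 3 ac] alg_map.tm_tin[OF 1 ac] alg_map.tm_tin[OF 2 ac'] f[OF ac(1)] g[OF ac(2)] ..
  next
    fix x y assume xy: "x \<in> carrier ?T" "y \<in> carrier ?T" "?tm3 x = ?tm2 (?tm1 x)" "?tm3 y = ?tm2 (?tm1 y)"
    show "?tm3 (x \<oplus>\<^bsub>?T\<^esub> y) = ?tm2 (?tm1 (x \<oplus>\<^bsub>?T\<^esub> y))"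
      unfolding ring_hom_add[OF h3 xy(1,2)] ring_hom_add[OF h1 xy(1,2)]
        ring_hom_add[OF h2 ring_hom_closed[OF h1 xy(1)] ring_hom_closed[OF h1 xy(2)]] xy(3,4) ..
  qed
  obtain c k where c: "c \<in> carrier (alg_map.C p L R w \<Phi>K A1 \<phi>1)"
    "x = loc_frac (alg_map.C p L R w \<Phi>K A1 \<phi>1) (p_elem p (alg_map.C p L R w \<Phi>K A1 \<phi>1)) c k"
    using alg_map.Q_rep[OF 1 x] .
  have "?M3 c = (?M2 \<circ> ?M1) c"
  proof (rule lim_hom_unique[where G = ?M3 and G' = "?M2 \<circ> ?M1", OF base_alg.C_lim[OF X] _ alg_map.M_hom[OF 3]
      ring_hom_trans[OF alg_map.M_hom[OF 1] alg_map.M_hom[OF 2]] _ c(1)])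
    show "complete_ring (alg_map.C p L R w \<Phi>K A3 \<phi>3) p"
      by (rule lim_ring.axioms(2)[OF base_alg.C_lim[OF alg_map.Y[OF 2]]])
    fix m \<tau> assume \<tau>: "\<tau> \<in> carrier ?T"
    show "?M3 (base_alg.i p L R w \<Phi>K A1 \<phi>1 m \<tau>) = (?M2 \<circ> ?M1) (base_alg.i p L R w \<Phi>K A1 \<phi>1 m \<tau>)"
      unfolding comp_apply alg_map.M_i[OF 3 \<tau>] alg_map.M_i[OF 1 \<tau>] alg_map.M_i[OF 2 ring_hom_closed[OF h1 \<tau>]] tm[OF \<tau>] ..
  qed
  then show ?thesis
    unfolding c(2) alg_map.PM_fr[OF 1 c(1)] alg_map.PM_fr[OF 3 c(1)]
      alg_map.PM_fr[OF 2 ring_hom_closed[OF alg_map.M_hom[OF 1] c(1)]] comp_apply by (rule arg_cong)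
qed

context base_alg
begin

lemma frob_map: "alg_map p L R w \<phi>R \<Phi>K A \<phi> A \<phi> \<phi> \<Phi>K \<phi>R"
  unfolding alg_map_def
  using base_alg_axioms by (simp add: \<phi>_hom \<Phi>K_hom \<phi>R_closed \<phi>_smult \<Phi>K_smult \<Phi>K_roots)

section \<open>The Frobenius lift of P(A, phi)\<close>

abbreviation "Fc \<equiv> padic_map p B (dirlim_map That \<Phi>h (padic_map p T \<Phi>))"
abbreviation "FP \<equiv> Pfrob p RR Kc \<Phi>K A \<phi>"

lemma Fc_hom: "Fc \<in> ring_hom C C"
  by (rule alg_map.M_hom[OF frob_map])

lemma Fc_i: "\<tau> \<in> carrier T \<Longrightarrow> Fc (i m \<tau>) = i m (\<Phi> \<tau>)"
  by (rule alg_map.M_i[OF frob_map])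

lemma Fc_\<rho>: "c \<in> carrier Kc \<Longrightarrow> Fc (\<rho> c) = \<rho> (\<Phi>K c)"
  by (rule alg_map.M_\<rho>[OF frob_map])

lemma Fc_J:
  assumes "x \<in> tideal C tC" shows "Fc x \<in> tideal C tC"
proof -
  obtain m y where y: "y \<in> carrier C" "x = tC m \<otimes>\<^bsub>C\<^esub> y" using assms by (rule Cr.J_E)
  have "Fc x = tC m \<otimes>\<^bsub>C\<^esub> Fc y"
    unfolding y(2) ring_hom_mult[OF Fc_hom Cr.t_closed y(1)] Fc_\<rho>[OF Kr.t_closed] \<Phi>K_roots ..
  then show ?thesis using Cr.J_I[OF ring_hom_closed[OF Fc_hom y(1)]] by simp
qed

text \<open>Modulo \<open>J\<close> both \<open>Fc x\<close> and \<open>x^p\<close> depend on the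
  class of \<open>x\<close> only, so \<open>x\<close> may be replaced by some \<open>iA n a\<close>;
  there the claim is the Frobenius property of \<open>\<phi>\<close>.\<close>

lemma Fc_frob:
  assumes x: "x \<in> carrier C" shows "Fc x \<ominus>\<^bsub>C\<^esub> x [^]\<^bsub>C\<^esub> p \<in> tideal C tC"
proof -
  obtain n a where a: "a \<in> carrier A" "x \<ominus>\<^bsub>C\<^esub> iA n a \<in> tideal C tC" using C_lift[OF x] .
  have ac: "iA n a \<in> carrier C" using a(1) by simp
  note Fx = ring_hom_closed[OF Fc_hom x] and Fa = ring_hom_closed[OF Fc_hom ac]
  have 1: "Fc x \<ominus>\<^bsub>C\<^esub> Fc (iA n a) \<in> tideal C tC"
    using Fc_J[OF a(2)] unfolding ring_hom_minus[OF LC.C.is_cring LC.C.is_cring Fc_hom x ac] .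
  have 2: "x [^]\<^bsub>C\<^esub> p \<ominus>\<^bsub>C\<^esub> iA n a [^]\<^bsub>C\<^esub> p \<in> tideal C tC"
    by (rule Cr.J.diff_pow[OF LC.C.is_cring x ac a(2)])
  have "Fc (iA n a) = iA n (\<phi> a)" using Fc_i[of "inA a" n] a(1) by (simp add: \<Phi>_inA)
  moreover have "pcong p 1 C (iA n (\<phi> a)) (iA n a [^]\<^bsub>C\<^esub> p)"
    using ring_hom_pcong[OF A_cring LC.C.is_cring iA_hom \<phi>_frob[OF a(1)], of n]
    unfolding ring_hom_pow[OF A_cring LC.C.is_cring iA_hom a(1)] .
  ultimately have 3: "Fc (iA n a) \<ominus>\<^bsub>C\<^esub> iA n a [^]\<^bsub>C\<^esub> p \<in> tideal C tC"
    by (intro Cr.p_ideal_J) (simp add: pcong_def)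
  have "Fc x \<ominus>\<^bsub>C\<^esub> x [^]\<^bsub>C\<^esub> p = (Fc x \<ominus>\<^bsub>C\<^esub> Fc (iA n a)) \<oplus>\<^bsub>C\<^esub> (Fc (iA n a) \<ominus>\<^bsub>C\<^esub> iA n a [^]\<^bsub>C\<^esub> p)
      \<oplus>\<^bsub>C\<^esub> \<ominus>\<^bsub>C\<^esub> (x [^]\<^bsub>C\<^esub> p \<ominus>\<^bsub>C\<^esub> iA n a [^]\<^bsub>C\<^esub> p)"
    by (rule LC.C.minus_telescope[OF Fx Fa LC.C.nat_pow_closed[OF x] LC.C.nat_pow_closed[OF ac]])
  also have "\<dots> \<in> tideal C tC"
    by (rule Cr.J.a_closed[OF Cr.J.a_closed[OF 1 3] Cr.J.a_inv_closed[OF 2]])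
  finally show ?thesis .
qed

text \<open>The maps taking \<open>\<tau>\<close> to \<open>i m (\<Phi> \<tau>)\<close> describe
  \<open>C\<close> as a completed limit just as well: density holds as \<open>i m \<tau>\<close> is
  \<open>i (m+1) (\<Phi> \<tau>)\<close>, and one more iterate does not affect divisibility at a
  finite stage. As \<open>Fc\<close> takes \<open>i m \<tau>\<close> to
  \<open>i m (\<Phi> \<tau>)\<close>, it compares two such descriptions, and
  \<open>lim_hom_bij\<close> applies.\<close>

lemma Fc_bij: "bij_betw Fc (carrier C) (carrier C)"
proof (rule lim_hom_bij[where G = Fc and i' = "\<lambda>m \<tau>. i m (\<Phi> \<tau>)", OF C_lim _ Fc_hom Fc_i])
  show "lim_ring T C p \<Phi> (\<lambda>m \<tau>. i m (\<Phi> \<tau>))"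
  proof unfold_locales
    show "(\<lambda>\<tau>. i m (\<Phi> \<tau>)) \<in> ring_hom T C" for m
      using ring_hom_trans[OF \<Phi>_hom LC.i_hom[of m]] by (simp add: comp_def)
    show "\<exists>m. \<exists>\<tau>\<in>carrier T. pcong p n C x (i m (\<Phi> \<tau>))" if x: "x \<in> carrier C" for x n
    proof -
      obtain m \<tau> where \<tau>: "\<tau> \<in> carrier T" "pcong p n C x (i m \<tau>)" using LC.i_dense[OF x] by blast
      then show ?thesis using i_Suc[OF \<tau>(1), of m] by metis
    qed
    show "i m (\<Phi> \<tau>) \<in> p_ideal p n C \<longleftrightarrow> (\<exists>k. (\<Phi> ^^ k) \<tau> \<in> p_ideal p n T)" if \<tau>: "\<tau> \<in> carrier T" for m \<tau> n
    proof -
      have "i m (\<Phi> \<tau>) \<in> p_ideal p n C \<longleftrightarrow> (\<exists>k. (\<Phi> ^^ k) (\<Phi> \<tau>) \<in> p_ideal p n T)"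
        by (rule LC.i_iff[OF ring_hom_closed[OF \<Phi>_hom \<tau>]])
      moreover have "(\<Phi> ^^ k) (\<Phi> \<tau>) \<in> p_ideal p n T" if "(\<Phi> ^^ k) \<tau> \<in> p_ideal p n T" for k
        using ring_hom_p_ideal[OF TP.T_cring TP.T_cring \<Phi>_hom that] by (simp add: funpow_swap1)
      moreover have "(\<Phi> ^^ k) (\<Phi> \<tau>) = (\<Phi> ^^ Suc k) \<tau>" for k by (simp add: funpow_swap1)
      ultimately show ?thesis by metis
    qed
  qed
qed

lemma FP_\<iota>: "c \<in> carrier C \<Longrightarrow> FP (Cg.\<iota> c) = Cg.\<iota> (Fc c)"
  unfolding Pfrob_def by (rule alg_map.PM_\<iota>[OF frob_map])

lemma FP_hom: "FP \<in> ring_hom Q Q"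
  unfolding Pfrob_def by (rule alg_map.PM_hom[OF frob_map])

text \<open>All properties are carried over from \<open>Fc\<close> along the isomorphism of
  \<open>C\<close> with the power-bounded elements.\<close>

lemma FP_lift: "invertible_perfectoid_frobenius_lift p Kc \<Phi>K Q nQ FP"
proof -
  note Fcc = ring_hom_closed[OF Fc_hom] and \<rho>c = ring_hom_closed[OF \<rho>_hom]
  have im: "FP ` (Cg.\<iota> ` carrier C) \<subseteq> Cg.\<iota> ` carrier C" using FP_\<iota> Fcc by auto
  have bij: "bij_betw FP (Cg.\<iota> ` carrier C) (Cg.\<iota> ` carrier C)"
    unfolding bij_betw_def
  proof
    show "inj_on FP (Cg.\<iota> ` carrier C)"
    proof (rule inj_onI)
      fix x y assume "x \<in> Cg.\<iota> ` carrier C" "y \<in> Cg.\<iota> ` carrier C" and eq: "FP x = FP y"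
      then obtain c d where cd: "c \<in> carrier C" "d \<in> carrier C" "x = Cg.\<iota> c" "y = Cg.\<iota> d" by blast
      have "Fc c = Fc d" using eq unfolding cd(3,4) FP_\<iota>[OF cd(1)] FP_\<iota>[OF cd(2)] Cg.\<iota>_inj[OF Fcc[OF cd(1)] Fcc[OF cd(2)]] .
      then show "x = y" unfolding cd(3,4) using inj_onD[OF bij_betw_imp_inj_on[OF Fc_bij] _ cd(1,2)] by blast
    qed
    show "FP ` (Cg.\<iota> ` carrier C) = Cg.\<iota> ` carrier C"
    proof (rule equalityI[OF im], rule subsetI)
      fix y assume "y \<in> Cg.\<iota> ` carrier C"
      then obtain c where c: "c \<in> carrier C" "y = Cg.\<iota> c" by blast
      obtain d where d: "d \<in> carrier C" "c = Fc d" using bij_betw_imp_surj_on[OF Fc_bij] c(1) by blast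
      show "y \<in> FP ` (Cg.\<iota> ` carrier C)" unfolding c(2) d(2) FP_\<iota>[OF d(1), symmetric] using d(1) by blast
    qed
  qed
  have "rel_frobenius_lift p Kc \<Phi>K QA FP"
    unfolding rel_frobenius_lift_def
  proof (intro conjI ballI)
    show "FP \<in> ring_hom QA QA"
    proof -
      have "FP \<in> ring_hom Q0 Q0"
      proof (rule ring_hom_memI)
        show "FP x \<in> carrier Q0" if "x \<in> carrier Q0" for x using that im by (auto simp: power_bounded_Q)
        have sub: "x \<in> carrier Q" if "x \<in> carrier Q0" for x using that by (simp add: power_bounded_def)
        show "FP (x \<otimes>\<^bsub>Q0\<^esub> y) = FP x \<otimes>\<^bsub>Q0\<^esub> FP y" "FP (x \<oplus>\<^bsub>Q0\<^esub> y) = FP x \<oplus>\<^bsub>Q0\<^esub> FP y"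
          if "x \<in> carrier Q0" "y \<in> carrier Q0" for x y
          using ring_hom_mult[OF FP_hom sub[OF that(1)] sub[OF that(2)]] ring_hom_add[OF FP_hom sub[OF that(1)] sub[OF that(2)]]
          by simp_all
        show "FP \<one>\<^bsub>Q0\<^esub> = \<one>\<^bsub>Q0\<^esub>" using ring_hom_one[OF FP_hom] by simp
      qed
      then show ?thesis by (simp add: power_bounded_algebra_def)
    qed
    show "FP (c \<odot>\<^bsub>QA\<^esub> \<one>\<^bsub>QA\<^esub>) = \<Phi>K c \<odot>\<^bsub>QA\<^esub> \<one>\<^bsub>QA\<^esub>" if c: "c \<in> carrier Kc" for c
      unfolding QA_smult[OF c] QA_smult[OF \<Phi>K_closed[OF c]] FP_\<iota>[OF \<rho>c[OF c]] Fc_\<rho>[OF c] ..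
    fix x assume "x \<in> carrier QA"
    then obtain c where c: "c \<in> carrier C" "x = Cg.\<iota> c" unfolding QA_carrier by blast
    have "FP x \<ominus>\<^bsub>QA\<^esub> x [^]\<^bsub>QA\<^esub> p = Cg.\<iota> (Fc c \<ominus>\<^bsub>C\<^esub> c [^]\<^bsub>C\<^esub> p)"
      unfolding c(2) FP_\<iota>[OF c(1)] ring_hom_minus[OF LC.C.is_cring QA_cring \<iota>_QA_hom Fcc[OF c(1)] LC.C.nat_pow_closed[OF c(1)]]
        ring_hom_pow[OF LC.C.is_cring QA_cring \<iota>_QA_hom c(1)] ..
    then show "FP x \<ominus>\<^bsub>QA\<^esub> x [^]\<^bsub>QA\<^esub> p \<in> max_extended Kc QA" using \<iota>_J_QA[OF Fc_frob[OF c(1)]] by simp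
  qed
  then show ?thesis
    unfolding invertible_perfectoid_frobenius_lift_def perfectoid_frobenius_lift_def power_bounded_Q
    using FP_hom im bij by blast
qed

end

section \<open>Functoriality\<close>

lemma base_algI:
  "base_data p L R w \<phi>R \<Phi>K \<Longrightarrow> frob_alg p (L\<lparr>carrier := R\<rparr>) A \<phi> \<Longrightarrow> base_alg p L R w \<phi>R \<Phi>K A \<phi>"
  by (simp add: base_alg_def base_alg_axioms_def)

lemma restrict_ring_hom:
  assumes "cring A" "f \<in> ring_hom A B" shows "restrict f (carrier A) \<in> ring_hom A B"
proof -
  interpret A: cring A by fact
  show ?thesis
    by (rule ring_hom_memI)
      (simp_all add: ring_hom_closed[OF assms(2)] ring_hom_mult[OF assms(2)] ring_hom_add[OF assms(2)] ring_hom_one[OF assms(2)])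
qed

context alg_map
begin

lemma frob_comp: "alg_map p L R w \<phi>R \<Phi>K A \<phi> A' \<phi>' (\<lambda>a. f (\<phi> a)) (\<lambda>c. g (\<Phi>K c)) (\<lambda>r. \<sigma> (\<phi>R r))"
proof -
  note D = base_alg.axioms(1)[OF X]
  note \<phi>c = base_alg.\<phi>_closed[OF X] and Kc = base_data.\<Phi>K_closed[OF D] and Rc = base_data.\<phi>R_closed[OF D]
  show ?thesis
  proof (rule alg_map.intro)
    show "(\<lambda>a. f (\<phi> a)) \<in> ring_hom A A'"
      using ring_hom_trans[OF base_alg.\<phi>_hom[OF X] f_hom] by (simp add: comp_def)
    show "(\<lambda>c. g (\<Phi>K c)) \<in> ring_hom Kc Kc"
      using ring_hom_trans[OF base_data.\<Phi>K_hom[OF D] g_hom] by (simp add: comp_def)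
    show "g (\<Phi>K (tK m)) = tK m" for m using base_data.\<Phi>K_roots[OF D] g_t by simp
  qed (simp_all add: X Y \<sigma>_closed Rc base_alg.\<phi>_smult[OF X] base_data.\<Phi>K_smult[OF D] f_smult g_smult \<phi>c Kc f_\<phi> g_\<Phi>)
qed

text \<open>Both composites are induced by the same pair of maps: \<open>f\<close> after
  \<open>\<phi>\<close> and \<open>g\<close> after \<open>\<Phi>K\<close> agree on the carriers with
  \<open>\<phi>'\<close> after \<open>f\<close> and \<open>\<Phi>K\<close> after
  \<open>g\<close>.\<close>

lemma PM_frob: "x \<in> carrier Q \<Longrightarrow> PM (Pfrob p RR Kc \<Phi>K A \<phi> x) = Pfrob p RR Kc \<Phi>K A' \<phi>' (PM x)"
  using alg_map_comp[OF base_alg.frob_map[OF X] alg_map_axioms frob_comp refl refl]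
    alg_map_comp[OF alg_map_axioms base_alg.frob_map[OF Y] frob_comp f_\<phi> g_\<Phi>]
  unfolding Pfrob_def by metis

end

lemma Pmap_hom:
  assumes m: "alg_map p L R w \<phi>R \<Phi>K A \<phi> A' \<phi>' f id id"
  shows "Pmap p (L\<lparr>carrier := R\<rparr>) (Kcirc p L R w) \<Phi>K A \<phi> A' \<phi>' f \<in> perf_alg_hom (invert_p p (Kcirc p L R w))
    (alg_map.Q p L R w \<Phi>K A \<phi>) (base_alg.nQ p L R w \<Phi>K A \<phi>) (base_alg.FP p L R w \<Phi>K A \<phi>)
    (alg_map.Q p L R w \<Phi>K A' \<phi>') (base_alg.nQ p L R w \<Phi>K A' \<phi>') (base_alg.FP p L R w \<Phi>K A' \<phi>')"
proof -
  let ?Q = "alg_map.Q p L R w \<Phi>K A \<phi>" and ?K = "invert_p p (Kcirc p L R w)"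
  note X = alg_map.X[OF m]
  have alg: "algebra ?K ?Q" using base_alg.Q_banach[OF X] unfolding banach_algebra_def by blast
  interpret Q: algebra ?K ?Q by (rule alg)
  note FPc = ring_hom_closed[OF base_alg.FP_hom[OF X]]
  \<comment> \<open>The bound \<open>1\<close> works, since induced maps do not increase the
    norm.\<close>
  have "\<exists>N. \<forall>x\<in>carrier ?Q. base_alg.nQ p L R w \<Phi>K A' \<phi>' (alg_map.PM p L R w \<Phi>K A' \<phi>' f id x) \<le> N * base_alg.nQ p L R w \<Phi>K A \<phi> x"
    using alg_map.PM_nrm_le[OF m] by (intro exI[of _ 1]) simp
  then show ?thesis
    unfolding perf_alg_hom_def Pmap_def
    using restrict_ring_hom[OF Q.M_cring alg_map.PM_hom[OF m]] alg_map.PM_smult[OF m]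
      Q.smult_closed alg_map.PM_frob[OF m] FPc
    by simp
qed

text \<open>The identity morphism is extensional, so \<open>f\<close> is only assumed to be the
  identity on the carrier. It induces the identity on pure tensors, and uniqueness of maps out of
  the completed limit does the rest.\<close>

lemma Pmap_id:
  assumes m: "alg_map p L R w \<phi>R \<Phi>K A \<phi> A \<phi> f id id" and f: "\<And>a. a \<in> carrier A \<Longrightarrow> f a = a"
  shows "Pmap p (L\<lparr>carrier := R\<rparr>) (Kcirc p L R w) \<Phi>K A \<phi> A \<phi> f = (\<lambda>x\<in>carrier (alg_map.Q p L R w \<Phi>K A \<phi>). x)"
proof -
  let ?T = "alg_map.T p L R w A" and ?tm = "alg_map.tm p L R w A f id" and ?M = "alg_map.M p L R w \<Phi>K A \<phi> f id"
  let ?i = "base_alg.i p L R w \<Phi>K A \<phi>"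
  note X = alg_map.X[OF m] and h = alg_map.tm_hom[OF m]
  have tm: "?tm \<tau> = \<tau>" if "\<tau> \<in> carrier ?T" for \<tau>
  proof (rule tensor_pair.T_induct[OF base_alg.T_pair[OF X] that])
    fix a c assume ac: "a \<in> carrier A" "c \<in> carrier (Kcirc p L R w)"
    show "?tm (tensor_in (L\<lparr>carrier := R\<rparr>) A (Kcirc p L R w) a c) = tensor_in (L\<lparr>carrier := R\<rparr>) A (Kcirc p L R w) a c"
      unfolding alg_map.tm_tin[OF m ac] f[OF ac(1)] id_apply ..
  next
    fix x y assume xy: "x \<in> carrier ?T" "y \<in> carrier ?T" "?tm x = x" "?tm y = y"
    show "?tm (x \<oplus>\<^bsub>?T\<^esub> y) = x \<oplus>\<^bsub>?T\<^esub> y" unfolding ring_hom_add[OF h xy(1,2)] xy(3,4) ..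
  qed
  have M: "?M c = c" if c: "c \<in> carrier (alg_map.C p L R w \<Phi>K A \<phi>)" for c
  proof -
    have "?M c = id c"
    proof (rule lim_hom_unique[where G = ?M and G' = id, OF base_alg.C_lim[OF X] _ alg_map.M_hom[OF m] id_ring_hom _ c])
      show "complete_ring (alg_map.C p L R w \<Phi>K A \<phi>) p" by (rule lim_ring.axioms(2)[OF base_alg.C_lim[OF X]])
      fix m' \<tau> assume \<tau>: "\<tau> \<in> carrier ?T"
      show "?M (?i m' \<tau>) = id (?i m' \<tau>)" unfolding alg_map.M_i[OF m \<tau>] tm[OF \<tau>] id_apply ..
    qed
    then show ?thesis by simp
  qed
  have "alg_map.PM p L R w \<Phi>K A \<phi> f id x = x" if "x \<in> carrier (alg_map.Q p L R w \<Phi>K A \<phi>)" for x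
  proof (rule alg_map.Q_rep[OF m that])
    fix c k assume c: "c \<in> carrier (alg_map.C p L R w \<Phi>K A \<phi>)"
      "x = loc_frac (alg_map.C p L R w \<Phi>K A \<phi>) (p_elem p (alg_map.C p L R w \<Phi>K A \<phi>)) c k"
    show ?thesis unfolding c(2) alg_map.PM_fr[OF m c(1)] M[OF c(1)] ..
  qed
  then show ?thesis unfolding Pmap_def by (intro ext) (simp add: restrict_def)
qed

lemma Pmap_compose:
  assumes 1: "alg_map p L R w \<phi>R \<Phi>K A1 \<phi>1 A2 \<phi>2 f1 id id" and 2: "alg_map p L R w \<phi>R \<Phi>K A2 \<phi>2 A3 \<phi>3 f2 id id"
    and 3: "alg_map p L R w \<phi>R \<Phi>K A1 \<phi>1 A3 \<phi>3 (compose (carrier A1) f2 f1) id id"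
  shows "Pmap p (L\<lparr>carrier := R\<rparr>) (Kcirc p L R w) \<Phi>K A1 \<phi>1 A3 \<phi>3 (compose (carrier A1) f2 f1) =
    compose (carrier (alg_map.Q p L R w \<Phi>K A1 \<phi>1)) (Pmap p (L\<lparr>carrier := R\<rparr>) (Kcirc p L R w) \<Phi>K A2 \<phi>2 A3 \<phi>3 f2)
      (Pmap p (L\<lparr>carrier := R\<rparr>) (Kcirc p L R w) \<Phi>K A1 \<phi>1 A2 \<phi>2 f1)"
proof -
  have "alg_map.PM p L R w \<Phi>K A3 \<phi>3 (compose (carrier A1) f2 f1) id x =
      alg_map.PM p L R w \<Phi>K A3 \<phi>3 f2 id (alg_map.PM p L R w \<Phi>K A2 \<phi>2 f1 id x)"
    if x: "x \<in> carrier (alg_map.Q p L R w \<Phi>K A1 \<phi>1)" for x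
    by (rule alg_map_comp[OF 1 2 3 _ _ x]) (simp_all add: compose_def)
  then show ?thesis
    unfolding Pmap_def using ring_hom_closed[OF alg_map.PM_hom[OF 1]] by (intro ext) (simp add: compose_def restrict_def)
qed

section \<open>Morphisms of algebras with Frobenius lift\<close>

lemma frob_alg_hom_map:
  assumes "base_alg p L R w \<phi>R \<Phi>K A \<phi>" "base_alg p L R w \<phi>R \<Phi>K A' \<phi>'"
    and "f \<in> frob_alg_hom (L\<lparr>carrier := R\<rparr>) A \<phi> A' \<phi>'"
  shows "alg_map p L R w \<phi>R \<Phi>K A \<phi> A' \<phi>' f id id"
  using assms by (simp add: alg_map_def frob_alg_hom_def)

lemma frob_alg_hom_id:
  assumes "base_alg p L R w \<phi>R \<Phi>K A \<phi>"
  shows "(\<lambda>a\<in>carrier A. a) \<in> frob_alg_hom (L\<lparr>carrier := R\<rparr>) A \<phi> A \<phi>"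
proof -
  have "algebra (L\<lparr>carrier := R\<rparr>) A" by (rule base_alg.A_algebra[OF assms])
  then interpret algebra "L\<lparr>carrier := R\<rparr>" A .
  have "(\<lambda>a\<in>carrier A. a) \<in> ring_hom A A"
    using restrict_ring_hom[OF M_cring id_ring_hom] by (simp add: id_def)
  then show ?thesis
    using smult_closed base_alg.\<phi>_closed[OF assms] by (simp add: frob_alg_hom_def)
qed

lemma frob_alg_hom_compose:
  assumes "cring A" "\<And>r a. r \<in> carrier R \<Longrightarrow> a \<in> carrier A \<Longrightarrow> r \<odot>\<^bsub>A\<^esub> a \<in> carrier A" "\<And>a. a \<in> carrier A \<Longrightarrow> \<phi> a \<in> carrier A"
    and f: "f \<in> frob_alg_hom R A \<phi> B \<psi>" and g: "g \<in> frob_alg_hom R B \<psi> C \<chi>"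
  shows "compose (carrier A) g f \<in> frob_alg_hom R A \<phi> C \<chi>"
proof -
  have f': "f \<in> ring_hom A B" and g': "g \<in> ring_hom B C" using f g by (simp_all add: frob_alg_hom_def)
  have "compose (carrier A) g f = restrict (g \<circ> f) (carrier A)" by (simp add: compose_def comp_def)
  then have "compose (carrier A) g f \<in> ring_hom A C"
    using restrict_ring_hom[OF assms(1) ring_hom_trans[OF f' g']] by simp
  then show ?thesis
    using f g assms(2,3) ring_hom_closed[OF f'] by (simp add: frob_alg_hom_def compose_def)
qed

theorem theorem3p8:
  fixes p :: nat and L :: "'l ring" and R\<^sub>0 :: "'l set" and w :: "nat \<Rightarrow> 'l"
    and \<phi>R :: "'l \<Rightarrow> 'l" and \<Phi>K :: "(nat \<Rightarrow> 'l set) \<Rightarrow> (nat \<Rightarrow> 'l set)"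
    and A :: "('l, 'a) module" and \<phi> :: "'a \<Rightarrow> 'a"
  defines "R \<equiv> L\<lparr>carrier := R\<^sub>0\<rparr>"
    and "Kc \<equiv> Kcirc p L R\<^sub>0 w"
    and "t \<equiv> Kcirc_root p L R\<^sub>0 w"
    and "K \<equiv> invert_p p (Kcirc p L R\<^sub>0 w)"
    and "nK \<equiv> gauge_norm p (Kcirc p L R\<^sub>0 w) (Kcirc_root p L R\<^sub>0 w)"
  assumes base: "base_data p L R\<^sub>0 w \<phi>R \<Phi>K"
    and A: "frob_alg p R A \<phi>"
  shows
    "\<comment> \<open>\<open>\<Phi>\<close> is the unique endomorphism of the tensor product compatible with \<open>\<phi>\<close> and \<open>\<Phi>K\<close>\<close>
     Phi R Kc \<Phi>K A \<phi> \<in> ring_hom (tensor R A Kc) (tensor R A Kc) \<and>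
     (\<forall>a\<in>carrier A. Phi R Kc \<Phi>K A \<phi> (tensor_in R A Kc a \<one>\<^bsub>Kc\<^esub>) = tensor_in R A Kc (\<phi> a) \<one>\<^bsub>Kc\<^esub>) \<and>
     (\<forall>c\<in>carrier Kc. Phi R Kc \<Phi>K A \<phi> (tensor_in R A Kc \<one>\<^bsub>A\<^esub> c) = tensor_in R A Kc \<one>\<^bsub>A\<^esub> (\<Phi>K c)) \<and>
     (\<forall>\<Psi>\<in>ring_hom (tensor R A Kc) (tensor R A Kc).
       (\<forall>a\<in>carrier A. \<Psi> (tensor_in R A Kc a \<one>\<^bsub>Kc\<^esub>) = tensor_in R A Kc (\<phi> a) \<one>\<^bsub>Kc\<^esub>) \<longrightarrow>
       (\<forall>c\<in>carrier Kc. \<Psi> (tensor_in R A Kc \<one>\<^bsub>A\<^esub> c) = tensor_in R A Kc \<one>\<^bsub>A\<^esub> (\<Phi>K c)) \<longrightarrow>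
       (\<forall>x\<in>carrier (tensor R A Kc). \<Psi> x = Phi R Kc \<Phi>K A \<phi> x)) \<and>
     \<comment> \<open>the canonical map between the completions of the two direct limits is an isomorphism\<close>
     padic_map p (Blim p R Kc \<Phi>K A \<phi>)
       (dirlim_map (Ahat p R Kc A) (Phi_hat p R Kc \<Phi>K A \<phi>) (padic_in p (tensor R A Kc)))
     \<in> ring_iso (padic_completion p (Blim' R Kc \<Phi>K A \<phi>)) (padic_completion p (Blim p R Kc \<Phi>K A \<phi>)) \<and>
     \<comment> \<open>(1)\<close>
     perfectoid_algebra p K nK (Palg p R Kc \<Phi>K A \<phi>) (Pnorm p R Kc \<Phi>K t A \<phi>) \<and>
     \<comment> \<open>(2)\<close>
     invert_p_in p (Pcirc p R Kc \<Phi>K A \<phi>) \<in> ring_iso (Pcirc p R Kc \<Phi>K A \<phi>)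
       (power_bounded_ring (Palg p R Kc \<Phi>K A \<phi>) (Pnorm p R Kc \<Phi>K t A \<phi>)) \<and>
     \<comment> \<open>(3)\<close>
     invertible_perfectoid_frobenius_lift p Kc \<Phi>K (Palg p R Kc \<Phi>K A \<phi>) (Pnorm p R Kc \<Phi>K t A \<phi>)
       (Pfrob p R Kc \<Phi>K A \<phi>) \<and>
     \<comment> \<open>(4), with the isomorphism being the canonical one on the image of \<open>A\<close> in each stage\<close>
     (\<exists>h \<in> ring_iso (Pcirc p R Kc \<Phi>K A \<phi> Quot max_extended Kc (Pcirc p R Kc \<Phi>K A \<phi>))
                   (perfection p (mod_p p A)).
       \<forall>m. \<forall>a\<in>carrier A.
         h (max_extended Kc (Pcirc p R Kc \<Phi>K A \<phi>) +>\<^bsub>Pcirc p R Kc \<Phi>K A \<phi>\<^esub>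
              Pcirc_in p R Kc \<Phi>K A \<phi> m a \<one>\<^bsub>Kc\<^esub>) =
         dirlim_in (mod_p p A) (\<lambda>x. x [^]\<^bsub>mod_p p A\<^esub> p) m (p_ideal p 1 A +>\<^bsub>A\<^esub> a)) \<and>
     \<comment> \<open>(5); objects go to objects by (1) and (3)\<close>
     (\<forall>(B :: ('l, 'b) module) \<psi> f. frob_alg p R B \<psi> \<longrightarrow> f \<in> frob_alg_hom R A \<phi> B \<psi> \<longrightarrow>
       Pmap p R Kc \<Phi>K A \<phi> B \<psi> f \<in> perf_alg_hom K
         (Palg p R Kc \<Phi>K A \<phi>) (Pnorm p R Kc \<Phi>K t A \<phi>) (Pfrob p R Kc \<Phi>K A \<phi>)
         (Palg p R Kc \<Phi>K B \<psi>) (Pnorm p R Kc \<Phi>K t B \<psi>) (Pfrob p R Kc \<Phi>K B \<psi>)) \<and>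
     Pmap p R Kc \<Phi>K A \<phi> A \<phi> (\<lambda>a\<in>carrier A. a) = (\<lambda>x\<in>carrier (Palg p R Kc \<Phi>K A \<phi>). x) \<and>
     (\<forall>(B :: ('l, 'b) module) \<psi> (C :: ('l, 'c) module) \<chi> f g.
       frob_alg p R B \<psi> \<longrightarrow> frob_alg p R C \<chi> \<longrightarrow>
       f \<in> frob_alg_hom R A \<phi> B \<psi> \<longrightarrow> g \<in> frob_alg_hom R B \<psi> C \<chi> \<longrightarrow>
       Pmap p R Kc \<Phi>K A \<phi> C \<chi> (compose (carrier A) g f) =
       compose (carrier (Palg p R Kc \<Phi>K A \<phi>)) (Pmap p R Kc \<Phi>K B \<psi> C \<chi> g) (Pmap p R Kc \<Phi>K A \<phi> B \<psi> f)) \<and>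
     \<comment> \<open>(6)\<close>
     (\<forall>(B :: ('l, 'b) module) \<psi> f. frob_alg p R B \<psi> \<longrightarrow> f \<in> frob_alg_hom R A \<phi> B \<psi> \<longrightarrow>
       f ` carrier A = carrier B \<longrightarrow>
       Pmap p R Kc \<Phi>K A \<phi> B \<psi> f ` carrier (Palg p R Kc \<Phi>K A \<phi>) = carrier (Palg p R Kc \<Phi>K B \<psi>))"
proof -
  note alg = base_algI[OF base, folded R_def]
  note X = alg[OF A]
  note m = frob_alg_hom_map[OF X, folded R_def]
  have mid: "alg_map p L R\<^sub>0 w \<phi>R \<Phi>K A \<phi> A \<phi> (\<lambda>a\<in>carrier A. a) id id"
    by (rule frob_alg_hom_map[OF X X frob_alg_hom_id[OF X]])
  have surj: "Pmap p R Kc \<Phi>K A \<phi> B \<psi> f ` carrier (Palg p R Kc \<Phi>K A \<phi>) = carrier (Palg p R Kc \<Phi>K B \<psi>)"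
    if B: "frob_alg p R B \<psi>" "f \<in> frob_alg_hom R A \<phi> B \<psi>" "f ` carrier A = carrier B" for B :: "('l, 'b) module" and \<psi> f
    using alg_map.PM_surj[OF m[OF alg[OF B(1)] B(2)] B(3)]
    unfolding Pmap_def R_def Kc_def by simp
  have comp: "Pmap p R Kc \<Phi>K A \<phi> C \<chi> (compose (carrier A) g f) =
      compose (carrier (Palg p R Kc \<Phi>K A \<phi>)) (Pmap p R Kc \<Phi>K B \<psi> C \<chi> g) (Pmap p R Kc \<Phi>K A \<phi> B \<psi> f)"
    if B: "frob_alg p R B \<psi>" "frob_alg p R C \<chi>" and f: "f \<in> frob_alg_hom R A \<phi> B \<psi>" and g: "g \<in> frob_alg_hom R B \<psi> C \<chi>"
    for B :: "('l, 'b) module" and \<psi> f and C :: "('l, 'c) module" and \<chi> g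
  proof -
    interpret A: algebra "L\<lparr>carrier := R\<^sub>0\<rparr>" A by (rule base_alg.A_algebra[OF X])
    have "compose (carrier A) g f \<in> frob_alg_hom R A \<phi> C \<chi>"
      by (rule frob_alg_hom_compose[OF A.M_cring _ base_alg.\<phi>_closed[OF X] f g]) (simp add: R_def A.smult_closed)
    from Pmap_compose[OF m[OF alg[OF B(1)] f] frob_alg_hom_map[OF alg[OF B(1)] alg[OF B(2)] g[unfolded R_def]] m[OF alg[OF B(2)] this]]
    show ?thesis unfolding R_def Kc_def .
  qed
  have hom: "Pmap p R Kc \<Phi>K A \<phi> B \<psi> f \<in> perf_alg_hom K
         (Palg p R Kc \<Phi>K A \<phi>) (Pnorm p R Kc \<Phi>K t A \<phi>) (Pfrob p R Kc \<Phi>K A \<phi>)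
         (Palg p R Kc \<Phi>K B \<psi>) (Pnorm p R Kc \<Phi>K t B \<psi>) (Pfrob p R Kc \<Phi>K B \<psi>)"
    if B: "frob_alg p R B \<psi>" "f \<in> frob_alg_hom R A \<phi> B \<psi>" for B :: "('l, 'b) module" and \<psi> f
    unfolding R_def Kc_def K_def t_def by (rule Pmap_hom[OF m[OF alg[OF B(1)] B(2)]])
  have id: "Pmap p R Kc \<Phi>K A \<phi> A \<phi> (\<lambda>a\<in>carrier A. a) = (\<lambda>x\<in>carrier (Palg p R Kc \<Phi>K A \<phi>). x)"
    unfolding R_def Kc_def by (rule Pmap_id[OF mid]) simp
  have unique: "\<forall>\<Psi>\<in>ring_hom (tensor R A Kc) (tensor R A Kc).
       (\<forall>a\<in>carrier A. \<Psi> (tensor_in R A Kc a \<one>\<^bsub>Kc\<^esub>) = tensor_in R A Kc (\<phi> a) \<one>\<^bsub>Kc\<^esub>) \<longrightarrow>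
       (\<forall>c\<in>carrier Kc. \<Psi> (tensor_in R A Kc \<one>\<^bsub>A\<^esub> c) = tensor_in R A Kc \<one>\<^bsub>A\<^esub> (\<Phi>K c)) \<longrightarrow>
       (\<forall>x\<in>carrier (tensor R A Kc). \<Psi> x = Phi R Kc \<Phi>K A \<phi> x)"
    unfolding R_def Kc_def using base_alg.\<Phi>_unique[OF X] by blast
  have inA: "\<forall>a\<in>carrier A. Phi R Kc \<Phi>K A \<phi> (tensor_in R A Kc a \<one>\<^bsub>Kc\<^esub>) = tensor_in R A Kc (\<phi> a) \<one>\<^bsub>Kc\<^esub>"
    unfolding R_def Kc_def using base_alg.\<Phi>_inA[OF X] by blast
  have inK: "\<forall>c\<in>carrier Kc. Phi R Kc \<Phi>K A \<phi> (tensor_in R A Kc \<one>\<^bsub>A\<^esub> c) = tensor_in R A Kc \<one>\<^bsub>A\<^esub> (\<Phi>K c)"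
  proof -
    have "\<one>\<^bsub>A\<^esub> \<in> carrier A"
      using monoid.one_closed[OF ring.is_monoid[OF cring.axioms(1)[OF base_alg.A_cring[OF X]]]] .
    then show ?thesis
      unfolding R_def Kc_def using base_alg.\<Phi>_tin[OF X] ring_hom_one[OF base_alg.\<phi>_hom[OF X]] by simp
  qed
  show ?thesis
    using hom id comp surj unique inA inK
      base_alg.\<Phi>_hom[OF X, folded R_def Kc_def] base_alg.completion_iso[OF X, folded R_def Kc_def]
      base_alg.Q_perfectoid[OF X, folded R_def K_def nK_def, folded Kc_def t_def]
      base_alg.\<iota>_Q0_iso[OF X, folded R_def, folded Kc_def t_def]
      base_alg.FP_lift[OF X, folded R_def, folded Kc_def t_def]
      base_alg.residue_iso[OF X, folded R_def, folded Kc_def]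
    by blast
qed

end
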